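(* Let $F(z)=D+C(zI-A)^{-1}B$ be a minimal realization $\Sigma=(A,B,C,D)$, and let $\Pi_k,\Pi_f,H_k,H_f,\Lambda_k,\Lambda_{kf},\Lambda_f,\alpha_k,R_0,\sigma,\beta_k,L_0,L_\beta$ and $\Pi'_k,H'_k,\Lambda'_k,\alpha'_k,R'_0,\sigma',\beta'_k,L'_0,L'_{\beta'}$ be the matrices and functions constructed from this realization as described in the context. Put $F_{\rm r}=FL_\beta$ and $F_{\rm rl}=L'_{\beta'}FL_\beta$. Then: (i) $F=(L'_{\beta'})^{*}F_{\rm rl}L_\beta^{*}$ (where ${}^*$ on rational functions is the para-hermitian conjugate), and $F_{\rm rl}$ has the realization $$\Sigma_{\rm rl}=\bigl(A,\ (B+\Pi_k\sigma^{-1}H_k^{*})L_0,\ L'_0(C+H_k'^{*}\sigma'^{-1}\Pi'_k),\ L'_0DL_0\bigr),$$ i.e. $F_{\rm rl}(z)=L'_0DL_0+L'_0(C+H_k'^{*}\sigma'^{-1}\Pi'_k)(zI-A)^{-1}(B+\Pi_k\sigma^{-1}H_k^{*})L_0$. (ii) The realization $\Sigma_{\rm rl}$ of $F_{\rm rl}$ is minimal if at least one of the following holds: (a) all eigenvalues of $A$ have non-positive real part; or (b) $A$ and $-A^*$ have no common eigenvalues, the pair $(A,\overline C^{*})$ is stabilizable (in the continuous-time sense), and the pair $(\overline B^{*},A)$ is detectable (in the continuous-time sense), where $\overline C=CP+DB^*$ with $P$ the solution of $AP+PA^*+BB^*=0$, and $\overline B=QB+C^*D$ with $Q$ the solution of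 $QA+A^*Q+C^*C=0$. (iii) If the realization $\Sigma_{\rm rl}$ is minimal, then $$\mathcal C^*(\Sigma_{\rm rl})\cap\mathcal V^*(\Sigma_{\rm rl})=\{0\},\qquad \mathcal C^*(\Sigma_{\rm rl})\vee\mathcal V^*(\Sigma_{\rm rl})=\mathbb C^n,\qquad \mathcal C^*(\Sigma_{\rm rl})=\mathcal C^*(\Sigma_{\rm r}),$$ $$(\mathcal C^*(\Sigma)\cap\mathcal V^*(\Sigma))\vee\mathcal C^*(\Sigma_{\rm rl})=\mathcal C^*(\Sigma),\qquad \mathcal V^*(\Sigma_{\rm rl})\cap(\mathcal C^*(\Sigma)\vee\mathcal V^*(\Sigma))=\mathcal V^*(\Sigma),$$ where $\Sigma_{\rm r}=(A,(B+\Pi_k\sigma^{-1}H_k^* )L_0,C,DL_0)$ is the realization of $F_{\rm r}$; moreover $\mathcal W(\ker F_{\rm rl})=\{0\}$, $\mathcal W(\operatorname{Im}F_{\rm rl})=\{0\}$, and the function $F_{\rm rl}$ is invertible. (iv) If the realization $\Sigma_{\rm rl}$ is minimal, then the finite zero matrix of $F_{\rm rl}$ is given by $$\begin{bmatrix}-\sigma^{-1}(\Lambda_k+\alpha_k\beta_k)^{*}\sigma&\Lambda_{kf}+\sigma^{-1}(H_k+R_0\beta_k)^{*}H_f&\sigma^{-1}(H_k+R_0\beta_k)^{*}Z'_k\\0&\Lambda_f&\Delta\\0&0&-(\Lambda'_k+\beta'_k\alpha'_k)^{*}\end{bmatrix}$$ for some matrices $Z'_k$ and $\Delta$.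
   Context: Notation. $A\in\mathbb C^{n\times n}$, $B\in\mathbb C^{n\times q}$, $C\in\mathbb C^{p\times n}$, $D\in\mathbb C^{p\times q}$; a realization is a quadruple $\Sigma=(A,B,C,D)$. $\langle A\mid B\rangle=\operatorname{Im}[B,AB,A^2B,\dots]$. $\vee$ denotes the sum of subspaces. For a constant matrix, $M^*$ is the adjoint; for a rational matrix function, $G^*(z)=(G(-\bar z))^*$ (para-hermitian conjugate). $\mathcal V^*(\Sigma)$ is the largest subspace $\mathcal V\subset\mathbb C^n$ for which there is $K$ with $(A+BK)\mathcal V\subset\mathcal V\subset\ker(C+DK)$. $\mathcal C^*(\Sigma)$ is the set of $x\in\mathbb C^n$ for which there are $k\ge0$ and inputs $u(-k),\dots,u(0)$ such that the system $x(j+1)=Ax(j)+Bu(j)$, $y(j)=Cx(j)+Du(j)$ started at $x(-k)=0$ satisfies $y(j)=0$ for $-k\le j\le0$ and $x(1)=x$. $\pi_-$ maps a vector of rational functions to its strictly proper part. For a rational matrix $G$, $\ker G$ and $\operatorname{Im}G$ are the kernel and image over the field $\mathbb C(z)$; $\mathcal W(\ker G)=\pi_-(\ker G)/\{\text{strictly proper elements of }\ker G\}$, $\mathcal W(\operatorname{Im}G)=\pi_-(\operatorname{Im}G)/\{\text{strictly proper elements of }\operatorname{Im}G\}$. Right construction (for a realization with $(C,A)$ observable). Let $(\Pi_{fzk},H_{fzk},\Lambda_{fzk})$ satisfy $\begin{bmatrix}A&B\\C&D\end{bmatrix}\begin{bmatrix}\Pi_{fzk}\\H_{fzk}\end{bmatrix}=\begin{bmatrix}\Pi_{fzk}\Lambda_{fzk}\\0\end{bmatrix}$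 with $\ker\Pi_{fzk}=\{0\}$ and $\operatorname{Im}\Pi_{fzk}=\mathcal V^*(\Sigma)\cap\langle A\mid B\rangle$ (for minimal $\Sigma$ this is a maximal solution). Let $(R_0,\alpha_0)$ be a solution of $BR_0=\Pi_{fzk}\alpha_0$, $DR_0=0$ with $\operatorname{Im}R_0$ maximal, $R_0$ having orthonormal columns. Choose the basis so that $\Lambda_{fzk}=\begin{bmatrix}\Lambda_k&\Lambda_{kf}\\0&\Lambda_f\end{bmatrix}$, $\alpha_0=\begin{bmatrix}\alpha_k\\0\end{bmatrix}$ with $(\Lambda_k,\alpha_k)$ controllable, and accordingly $\Pi_{fzk}=[\Pi_k,\Pi_f]$, $H_{fzk}=[H_k,H_f]$. The matrix $\Lambda_f$ is called the finite zero matrix of the function (it is determined up to similarity). Let $\sigma$ be the positive definite solution of $$\sigma(\Lambda_k-\alpha_kR_0^*H_k)+(\Lambda_k-\alpha_kR_0^*H_k)^*\sigma-\sigma\alpha_k\alpha_k^*\sigma+H_k^*(I-R_0R_0^* )H_k=0,$$ $\beta_k=-\alpha_k^*\sigma-R_0^*H_k$, $L_0$ a matrix such that $[R_0,L_0]$ is unitary, and $$L_\beta(z)=L_0-(H_k+R_0\beta_k)\bigl(zI-(\Lambda_k+\alpha_k\beta_k)\bigr)^{-1}\sigma^{-1}(H_k+R_0\beta_k)^*L_0 .$$ Left construction (for the minimal realization $\Sigma$). Let $(\Pi'_{fzk},H'_{fzk},\Lambda'_{fzk})$ satisfy $[\Pi'_{fzk},H'_{fzk}]\begin{bmatrix}A&B\\C&D\end{bmatrix}=[\Lambda'_{fzk}\Pi'_{fzk},0]$,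 with linearly independent rows of $\Pi'_{fzk}$ and with the row space of $\Pi'_{fzk}$ maximal among all solutions. Let $(R'_0,\alpha'_0)$ solve $R'_0C=\alpha'_0\Pi'_{fzk}$, $R'_0D=0$ with maximal row space of $R'_0$, $R'_0$ having orthonormal rows. Choose the basis so that $\Lambda'_{fzk}=\begin{bmatrix}\Lambda'_k&0\\\Lambda'_{kf}&\Lambda'_f\end{bmatrix}$, $\alpha'_0=[\alpha'_k,0]$ with $(\alpha'_k,\Lambda'_k)$ observable, and accordingly $\Pi'_{fzk}=\begin{bmatrix}\Pi'_k\\\Pi'_f\end{bmatrix}$, $H'_{fzk}=\begin{bmatrix}H'_k\\H'_f\end{bmatrix}$. Let $\sigma'$ be the positive definite solution of $$(\Lambda'_k-H'_kR_0'^{*}\alpha'_k)\sigma'+\sigma'(\Lambda'_k-H'_kR_0'^{*}\alpha'_k)^*-\sigma'\alpha_k'^{*}\alpha'_k\sigma'+H'_k(I-R_0'^{*}R'_0)H_k'^{*}=0,$$ $\beta'_k=-\sigma'\alpha_k'^{*}-H'_kR_0'^{*}$, $L'_0$ a matrix such that $\begin{bmatrix}R'_0\\L'_0\end{bmatrix}$ is unitary, and $$L'_{\beta'}(z)=L'_0-L'_0(H'_k+\beta'_kR'_0)^*\sigma'^{-1}\bigl(zI-(\Lambda'_k+\beta'_k\alpha'_k)\bigr)^{-1}(H'_k+\beta'_kR'_0).$$ *)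

theory Defs
  imports
    "Jordan_Normal_Form.Schur_Decomposition"
    "Jordan_Normal_Form.Matrix_Kernel"
    "Jordan_Normal_Form.Gauss_Jordan_Elimination"
    "HOL-Computational_Algebra.Polynomial_Factorial"
begin

text \<open>
  Matrices are those of \<^theory>\<open>Jordan_Normal_Form.Matrix\<close>: the dimensions are part of the value and
  may be zero, as happens for the blocks below (e.g. when the kernel of the function is trivial).
  Rational functions are elements of \<^typ>\<open>complex poly fract\<close>, the field of fractions of
  the complex polynomials.
\<close>


section \<open>Matrices\<close>

notation mat_adjoint (\<open>_\<^sup>\<dagger>\<close> [1000] 999)

abbreviation mat_inv :: "'a :: field mat \<Rightarrow> 'a mat" where
  "mat_inv M \<equiv> the (mat_inverse M)"

definition append_cols :: "'a :: zero mat \<Rightarrow> 'a mat \<Rightarrow> 'a mat" (infixr \<open>@\<^sub>c\<close> 65) where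
  "M @\<^sub>c N = four_block_mat M N (0\<^sub>m 0 (dim_col M)) (0\<^sub>m 0 (dim_col N))"

definition mat_range :: "'a :: comm_ring_1 mat \<Rightarrow> 'a vec set" where
  "mat_range M = (\<lambda>v. M *\<^sub>v v) ` carrier_vec (dim_col M)"

definition unitary_mat :: "complex mat \<Rightarrow> bool" where
  "unitary_mat U \<longleftrightarrow> square_mat U \<and> U\<^sup>\<dagger> * U = 1\<^sub>m (dim_row U) \<and> U * U\<^sup>\<dagger> = 1\<^sub>m (dim_row U)"

definition pos_def_mat :: "nat \<Rightarrow> complex mat \<Rightarrow> bool" where
  "pos_def_mat m S \<longleftrightarrow> S \<in> carrier_mat m m \<and> S\<^sup>\<dagger> = S \<and>
     (\<forall>v \<in> carrier_vec m. v \<noteq> 0\<^sub>v m \<longrightarrow> 0 < Re ((S *\<^sub>v v) \<bullet>c v))"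

text \<open>The sum \<open>U \<or> V\<close> of two subspaces of \<open>\<complex>\<^sup>n\<close>.\<close>

abbreviation join_subspaces :: "nat \<Rightarrow> complex vec set \<Rightarrow> complex vec set \<Rightarrow> complex vec set" where
  "join_subspaces n U V \<equiv>
     LinearCombinations.module.submodule_sum (module_vec TYPE(complex) n) U V"


section \<open>Rational functions\<close>

definition const_mat :: "complex mat \<Rightarrow> complex poly fract mat" where
  "const_mat M = map_mat (\<lambda>c. to_fract [:c:]) M"

text \<open>\<open>resolvent M\<close> is \<open>(zI - M)\<^sup>-\<^sup>1\<close>; the variable \<open>z\<close> is the polynomial \<open>[:0, 1:]\<close>.\<close>

definition resolvent :: "complex mat \<Rightarrow> complex poly fract mat" where
  "resolvent M = mat_inv (to_fract [:0, 1:] \<cdot>\<^sub>m 1\<^sub>m (dim_row M) - const_mat M)"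

definition para_conj_poly :: "complex poly \<Rightarrow> complex poly" where
  "para_conj_poly p = map_poly cnj p \<circ>\<^sub>p [:0, -1:]"

lemma poly_para_conj_poly: "poly (para_conj_poly p) z = cnj (poly p (- cnj z))"
proof -
  have "poly (map_poly cnj p) w = cnj (poly p (cnj w))" for w
    by (induction p) (auto simp: map_poly_pCons)
  from this[of "- z"] show ?thesis
    by (simp add: para_conj_poly_def poly_pcompose)
qed

text \<open>\<open>para_conj r\<close> is the rational function whose value at \<open>z\<close> is the conjugate of \<open>r (- cnj z)\<close>.\<close>

definition para_conj :: "complex poly fract \<Rightarrow> complex poly fract" where
  "para_conj r = (THE s. \<exists>a b. b \<noteq> 0 \<and> r = Fract a b \<and>
     s = Fract (para_conj_poly a) (para_conj_poly b))"

lemma para_conj_poly_0_iff: "para_conj_poly p = 0 \<longleftrightarrow> p = 0"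
proof
  assume "para_conj_poly p = 0"
  then have "cnj (poly p (- cnj (- cnj z))) = 0" for z
    using poly_para_conj_poly[of p "- cnj z"] by simp
  then have "poly p z = 0" for z
    by simp
  then show "p = 0"
    by (simp add: poly_eq_poly_eq_iff[symmetric] fun_eq_iff)
qed (simp add: para_conj_poly_def)

lemma para_conj_poly_mult: "para_conj_poly (p * r) = para_conj_poly p * para_conj_poly r"
  by (simp add: poly_eq_poly_eq_iff[symmetric] fun_eq_iff poly_para_conj_poly)

lemma para_conj_Fract:
  assumes "b \<noteq> 0"
  shows "para_conj (Fract a b) = Fract (para_conj_poly a) (para_conj_poly b)"
  unfolding para_conj_def
proof (rule the_equality)
  fix s
  assume "\<exists>a' b'. b' \<noteq> 0 \<and> Fract a b = Fract a' b' \<and>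
    s = Fract (para_conj_poly a') (para_conj_poly b')"
  then obtain a' b' where *: "b' \<noteq> 0" "Fract a b = Fract a' b'"
    "s = Fract (para_conj_poly a') (para_conj_poly b')"
    by blast
  from *(1,2) assms have "a * b' = a' * b"
    by (simp add: eq_fract)
  then have "para_conj_poly a * para_conj_poly b' = para_conj_poly a' * para_conj_poly b"
    by (simp flip: para_conj_poly_mult)
  with *(1,3) assms show "s = Fract (para_conj_poly a) (para_conj_poly b)"
    by (simp add: eq_fract para_conj_poly_0_iff)
qed (use assms in blast)

definition para_adjoint :: "complex poly fract mat \<Rightarrow> complex poly fract mat" where
  "para_adjoint G = (map_mat para_conj G)\<^sup>T"

definition strictly_proper :: "complex poly fract \<Rightarrow> bool" where
  "strictly_proper r \<longleftrightarrow>
     (\<exists>a b. b \<noteq> 0 \<and> r = Fract a b \<and> (a = 0 \<or> degree a < degree b))"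

definition strictly_proper_part :: "complex poly fract \<Rightarrow> complex poly fract" where
  "strictly_proper_part r = (THE s. strictly_proper s \<and> (\<exists>p. r = to_fract p + s))"

definition strictly_proper_elems :: "complex poly fract vec set \<Rightarrow> complex poly fract vec set" where
  "strictly_proper_elems U = {v \<in> U. \<forall>i < dim_vec v. strictly_proper (v $ i)}"

text \<open>
  The quotient \<open>\<pi>\<^sub>-(U) / strictly_proper_elems U\<close>, as the set of its cosets. Its zero element is the coset
  \<open>strictly_proper_elems U\<close> of the zero vector.
\<close>

definition W_space :: "complex poly fract vec set \<Rightarrow> complex poly fract vec set set" where
  "W_space U = (\<lambda>x. {x + s | s. s \<in> strictly_proper_elems U}) ` map_vec strictly_proper_part ` U"


section \<open>Realizations\<close>

definition transfer_function ::
  "complex mat \<Rightarrow> complex mat \<Rightarrow> complex mat \<Rightarrow> complex mat \<Rightarrow> complex poly fract mat" where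
  "transfer_function A B C D = const_mat D + const_mat C * resolvent A * const_mat B"

definition realization ::
  "complex poly fract mat \<Rightarrow> complex mat \<Rightarrow> complex mat \<Rightarrow> complex mat \<Rightarrow> complex mat \<Rightarrow> bool" where
  "realization G A B C D \<longleftrightarrow>
     (\<exists>n q p. A \<in> carrier_mat n n \<and> B \<in> carrier_mat n q \<and> C \<in> carrier_mat p n \<and> D \<in> carrier_mat p q) \<and>
     G = transfer_function A B C D"

definition minimal_realization ::
  "complex poly fract mat \<Rightarrow> complex mat \<Rightarrow> complex mat \<Rightarrow> complex mat \<Rightarrow> complex mat \<Rightarrow> bool" where
  "minimal_realization G A B C D \<longleftrightarrow> realization G A B C D \<and>
     (\<forall>A' B' C' D'. realization G A' B' C' D' \<longrightarrow> dim_row A \<le> dim_row A')"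

text \<open>\<open>\<langle>A | B\<rangle>\<close>\<close>

definition reachable_subspace :: "complex mat \<Rightarrow> complex mat \<Rightarrow> complex vec set" where
  "reachable_subspace A B = LinearCombinations.module.span class_ring
     (module_vec TYPE(complex) (dim_row A)) (\<Union>i. mat_range (A ^\<^sub>m i * B))"

definition controllable :: "complex mat \<Rightarrow> complex mat \<Rightarrow> bool" where
  "controllable A B \<longleftrightarrow> reachable_subspace A B = carrier_vec (dim_row A)"

definition observable :: "complex mat \<Rightarrow> complex mat \<Rightarrow> bool" where
  "observable C A \<longleftrightarrow> (\<Inter>i. mat_kernel (C * A ^\<^sub>m i)) = {0\<^sub>v (dim_row A)}"

definition hurwitz :: "complex mat \<Rightarrow> bool" where
  "hurwitz A \<longleftrightarrow> (\<forall>\<mu>. eigenvalue A \<mu> \<longrightarrow> Re \<mu> < 0)"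

definition stabilizable :: "complex mat \<Rightarrow> complex mat \<Rightarrow> bool" where
  "stabilizable A B \<longleftrightarrow> (\<exists>K \<in> carrier_mat (dim_col B) (dim_row A). hurwitz (A + B * K))"

definition detectable :: "complex mat \<Rightarrow> complex mat \<Rightarrow> bool" where
  "detectable C A \<longleftrightarrow> (\<exists>K \<in> carrier_mat (dim_row A) (dim_row C). hurwitz (A + K * C))"

definition output_nulling ::
  "complex mat \<Rightarrow> complex mat \<Rightarrow> complex mat \<Rightarrow> complex mat \<Rightarrow> complex vec set \<Rightarrow> bool" where
  "output_nulling A B C D V \<longleftrightarrow>
     VectorSpace.subspace class_ring V (module_vec TYPE(complex) (dim_row A)) \<and>
     (\<exists>K \<in> carrier_mat (dim_col B) (dim_row A).
        (\<lambda>v. (A + B * K) *\<^sub>v v) ` V \<subseteq> V \<and> V \<subseteq> mat_kernel (C + D * K))"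

definition Vstar ::
  "complex mat \<Rightarrow> complex mat \<Rightarrow> complex mat \<Rightarrow> complex mat \<Rightarrow> complex vec set" where
  "Vstar A B C D = (GREATEST V. output_nulling A B C D V)"

definition Cstar ::
  "complex mat \<Rightarrow> complex mat \<Rightarrow> complex mat \<Rightarrow> complex mat \<Rightarrow> complex vec set" where
  "Cstar A B C D = {x. \<exists>(k :: nat) (u :: int \<Rightarrow> complex vec) (s :: int \<Rightarrow> complex vec).
     s (- int k) = 0\<^sub>v (dim_row A) \<and>
     (\<forall>j \<in> {- int k..0}. u j \<in> carrier_vec (dim_col B) \<and>
        s (j + 1) = A *\<^sub>v s j + B *\<^sub>v u j \<and>
        C *\<^sub>v s j + D *\<^sub>v u j = 0\<^sub>v (dim_row C)) \<and>
     s 1 = x}"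


section \<open>Right construction\<close>

text \<open>\<open>R\<close> and \<open>\<alpha>\<close> have \<open>r\<close> columns, \<open>\<Pi>z\<close> has \<open>m\<close> columns.\<close>

definition R_solution ::
  "complex mat \<Rightarrow> complex mat \<Rightarrow> complex mat \<Rightarrow> nat \<Rightarrow> nat \<Rightarrow> complex mat \<Rightarrow> complex mat \<Rightarrow> bool" where
  "R_solution B D \<Pi>z m r R \<alpha> \<longleftrightarrow>
     R \<in> carrier_mat (dim_col B) r \<and> \<alpha> \<in> carrier_mat m r \<and>
     B * R = \<Pi>z * \<alpha> \<and> D * R = 0\<^sub>m (dim_row D) r"

definition right_construction ::
  "complex mat \<Rightarrow> complex mat \<Rightarrow> complex mat \<Rightarrow> complex mat \<Rightarrow> nat \<Rightarrow> nat \<Rightarrow> nat \<Rightarrow>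
   complex mat \<Rightarrow> complex mat \<Rightarrow> complex mat \<Rightarrow> complex mat \<Rightarrow>
   complex mat \<Rightarrow> complex mat \<Rightarrow> complex mat \<Rightarrow> complex mat \<Rightarrow> complex mat \<Rightarrow> bool" where
  "right_construction A B C D k f r \<Pi>k \<Pi>f Hk Hf \<Lambda>k \<Lambda>kf \<Lambda>f \<alpha>k R0 \<longleftrightarrow>
     (let n = dim_row A; q = dim_col B; p = dim_row C;
          \<Pi>z = \<Pi>k @\<^sub>c \<Pi>f; H = Hk @\<^sub>c Hf;
          \<Lambda> = four_block_mat \<Lambda>k \<Lambda>kf (0\<^sub>m f k) \<Lambda>f; \<alpha>0 = \<alpha>k @\<^sub>r 0\<^sub>m f r
      in \<Pi>k \<in> carrier_mat n k \<and> \<Pi>f \<in> carrier_mat n f \<and>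
         Hk \<in> carrier_mat q k \<and> Hf \<in> carrier_mat q f \<and>
         \<Lambda>k \<in> carrier_mat k k \<and> \<Lambda>kf \<in> carrier_mat k f \<and> \<Lambda>f \<in> carrier_mat f f \<and>
         \<alpha>k \<in> carrier_mat k r \<and>
         four_block_mat A B C D * (\<Pi>z @\<^sub>r H) = (\<Pi>z * \<Lambda>) @\<^sub>r 0\<^sub>m p (k + f) \<and>
         mat_kernel \<Pi>z = {0\<^sub>v (k + f)} \<and>
         mat_range \<Pi>z = Vstar A B C D \<inter> reachable_subspace A B \<and>
         R_solution B D \<Pi>z (k + f) r R0 \<alpha>0 \<and>
         (\<forall>r' R \<alpha>. R_solution B D \<Pi>z (k + f) r' R \<alpha> \<and> mat_range R0 \<subseteq> mat_range R
            \<longrightarrow> mat_range R = mat_range R0) \<and>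
         R0\<^sup>\<dagger> * R0 = 1\<^sub>m r \<and>
         controllable \<Lambda>k \<alpha>k)"

text \<open>
  \<open>M\<close> is a finite zero matrix of the function realized by \<open>(A, B, C, D)\<close>: it is the block \<open>\<Lambda>\<^sub>f\<close> of
  some right construction. The choice of bases leaves it determined only up to similarity.
\<close>

definition finite_zero_matrix ::
  "complex mat \<Rightarrow> complex mat \<Rightarrow> complex mat \<Rightarrow> complex mat \<Rightarrow> complex mat \<Rightarrow> bool" where
  "finite_zero_matrix A B C D M \<longleftrightarrow> observable C A \<and>
     (\<exists>k f r \<Pi>k \<Pi>f Hk Hf \<Lambda>k \<Lambda>kf \<alpha>k R0.
        right_construction A B C D k f r \<Pi>k \<Pi>f Hk Hf \<Lambda>k \<Lambda>kf M \<alpha>k R0)"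


section \<open>Left construction\<close>

definition left_zero_solution ::
  "complex mat \<Rightarrow> complex mat \<Rightarrow> complex mat \<Rightarrow> complex mat \<Rightarrow> nat \<Rightarrow>
   complex mat \<Rightarrow> complex mat \<Rightarrow> complex mat \<Rightarrow> bool" where
  "left_zero_solution A B C D m \<Pi>z H \<Lambda> \<longleftrightarrow>
     \<Pi>z \<in> carrier_mat m (dim_row A) \<and> H \<in> carrier_mat m (dim_row C) \<and> \<Lambda> \<in> carrier_mat m m \<and>
     (\<Pi>z @\<^sub>c H) * four_block_mat A B C D = (\<Lambda> * \<Pi>z) @\<^sub>c 0\<^sub>m m (dim_col B)"

definition left_R_solution ::
  "complex mat \<Rightarrow> complex mat \<Rightarrow> complex mat \<Rightarrow> nat \<Rightarrow> nat \<Rightarrow> complex mat \<Rightarrow> complex mat \<Rightarrow> bool" where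
  "left_R_solution C D \<Pi>z m r R \<alpha> \<longleftrightarrow>
     R \<in> carrier_mat r (dim_row C) \<and> \<alpha> \<in> carrier_mat r m \<and>
     R * C = \<alpha> * \<Pi>z \<and> R * D = 0\<^sub>m r (dim_col D)"

definition left_construction ::
  "complex mat \<Rightarrow> complex mat \<Rightarrow> complex mat \<Rightarrow> complex mat \<Rightarrow> nat \<Rightarrow> nat \<Rightarrow> nat \<Rightarrow>
   complex mat \<Rightarrow> complex mat \<Rightarrow> complex mat \<Rightarrow> complex mat \<Rightarrow>
   complex mat \<Rightarrow> complex mat \<Rightarrow> complex mat \<Rightarrow> complex mat \<Rightarrow> complex mat \<Rightarrow> bool" where
  "left_construction A B C D k f r \<Pi>k \<Pi>f Hk Hf \<Lambda>k \<Lambda>kf \<Lambda>f \<alpha>k R0 \<longleftrightarrow>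
     (let n = dim_row A; p = dim_row C;
          \<Pi>z = \<Pi>k @\<^sub>r \<Pi>f; H = Hk @\<^sub>r Hf;
          \<Lambda> = four_block_mat \<Lambda>k (0\<^sub>m k f) \<Lambda>kf \<Lambda>f; \<alpha>0 = \<alpha>k @\<^sub>c 0\<^sub>m r f
      in \<Pi>k \<in> carrier_mat k n \<and> \<Pi>f \<in> carrier_mat f n \<and>
         Hk \<in> carrier_mat k p \<and> Hf \<in> carrier_mat f p \<and>
         \<Lambda>k \<in> carrier_mat k k \<and> \<Lambda>kf \<in> carrier_mat f k \<and> \<Lambda>f \<in> carrier_mat f f \<and>
         \<alpha>k \<in> carrier_mat r k \<and>
         left_zero_solution A B C D (k + f) \<Pi>z H \<Lambda> \<and>
         mat_kernel \<Pi>z\<^sup>T = {0\<^sub>v (k + f)} \<and>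
         (\<forall>m' \<Pi>z' H' \<Lambda>'. left_zero_solution A B C D m' \<Pi>z' H' \<Lambda>' \<and> mat_range \<Pi>z\<^sup>T \<subseteq> mat_range \<Pi>z'\<^sup>T
            \<longrightarrow> mat_range \<Pi>z'\<^sup>T = mat_range \<Pi>z\<^sup>T) \<and>
         left_R_solution C D \<Pi>z (k + f) r R0 \<alpha>0 \<and>
         (\<forall>r' R \<alpha>. left_R_solution C D \<Pi>z (k + f) r' R \<alpha> \<and> mat_range R0\<^sup>T \<subseteq> mat_range R\<^sup>T
            \<longrightarrow> mat_range R\<^sup>T = mat_range R0\<^sup>T) \<and>
         R0 * R0\<^sup>\<dagger> = 1\<^sub>m r \<and>
         observable \<alpha>k \<Lambda>k)"

end

theory Submission
  imports Defs
begin

text \<open>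
  Two subspaces carry the whole proof. \<open>Vtraj\<close> consists of the states from which some infinite
  trajectory has zero output, \<open>Cstar\<close> of the states that are reached from the zero state with zero
  output. Both are governed by one-step transitions with zero output (\<open>null_step\<close>), and \<open>Vtraj\<close> is
  \<open>Vstar\<close> (\<open>Vstar_eq_Vtraj\<close>). Passing to the transposed system exchanges them up to annihilators
  (\<open>Vtraj_transpose\<close>, \<open>Cstar_transpose\<close>). Hence the left construction for a system is the right
  construction for its transpose (\<open>right_construction_of_left\<close>), and only right factors need to be
  studied.

  The matrix \<open>\<Pi>k\<close> spans \<open>Cstar \<inter> Vtraj\<close>, and with \<open>Hb = Hk + R0 * \<beta>k\<close>, \<open>Lb = \<Lambda>k + \<alpha>k * \<beta>k\<close>
  this subspace is controlled invariant: \<open>A * \<Pi>k + B * Hb = \<Pi>k * Lb\<close> with zero output. Put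
  \<open>G = \<sigma>\<inverse> * Hb\<^sup>\<dagger>\<close> and \<open>U(z) = 1 - Hb * (z - Lb)\<inverse> * G\<close>, so that \<open>L\<beta> = U * L0\<close>. The Riccati equation
  is a Lyapunov equation for \<open>Lb\<close> (\<open>lyapunov\<close>), and this makes \<open>U\<close> para-unitary. Multiplication of
  \<open>F\<close> by \<open>U\<close> keeps the state space and replaces \<open>B\<close> by \<open>B + \<Pi>k * G\<close>
  (\<open>transfer_function_mult_cascade\<close>). The replaced input matrix and \<open>D\<close> vanish on the range of
  \<open>R0\<close>, so that \<open>L0 * L0\<^sup>\<dagger>\<close> acts as the identity on inputs. The factorization of \<open>F\<close> and the
  realization of \<open>Frl\<close> follow.

  Adding \<open>\<Pi>k * G\<close> changes the states along a trajectory only by elements of the range of \<open>\<Pi>k\<close>.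
  Therefore \<open>Vtraj\<close> stays the same and \<open>Cstar\<close> changes only modulo that range
  (locale \<open>input_perturbation\<close>). Since \<open>G * R0 = - \<alpha>k\<close>, an input that leads from the zero state
  into \<open>Vtraj\<close> with zero output has no effect any more, and the new \<open>Cstar\<close> meets \<open>Vtraj\<close> only in zero
  (locale \<open>input_factor\<close>). The dual perturbation of \<open>C\<close>, applied afterwards, leaves this new \<open>Cstar\<close>
  alone and enlarges \<open>Vtraj\<close> to a complement of it (locale \<open>two_sided\<close>).

  A rational function in the kernel of \<open>Frl\<close>, multiplied by a common denominator, generates the
  inputs of a finite trajectory from zero to zero with zero output (\<open>kernel_trajectory\<close>). Its states
  lie in \<open>Cstar \<inter> Vtraj = {0}\<close>, so it is trivial. The same argument for the transpose shows that
  \<open>Frl\<close> is invertible, and then both spaces \<open>W_space\<close> are zero.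

  Minimality means controllability and observability (\<open>minimal_realizationI\<close>,
  \<open>minimal_realization_controllable\<close>, \<open>minimal_realization_observable\<close>). By the Hautus test, loss of
  controllability comes from an eigenvector of \<open>A\<^sup>T\<close> whose eigenvalue \<open>\<mu>\<close> is the reflection
  of an eigenvalue of \<open>Lb\<close>, and the Lyapunov equation forces \<open>Re \<mu> > 0\<close> (\<open>uncontrollable_mode\<close>).
  The first sufficient condition excludes this at once. Under the second one the same eigenvector is
  an unstable mode that the pair \<open>(A, (C * P + D * B\<^sup>\<dagger>)\<^sup>\<dagger>)\<close> cannot move.

  For the finite zero matrix, the columns of \<open>\<Pi>k\<close> and \<open>\<Pi>f\<close> are extended to a basis of the
  enlarged \<open>Vtraj\<close> by a block \<open>X\<close> (\<open>complement_exists\<close>). Multiplication by \<open>\<Pi>k'\<close> determines its own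
  diagonal block (\<open>complement_multiplier\<close>), and a Sylvester equation, solvable because
  \<open>(\<Lambda>k, \<alpha>k)\<close> is controllable, brings the remaining block into the required form
  (\<open>decoupled_complement\<close>).
\<close>

section \<open>Matrix algebra with dimensions as side conditions\<close>

text \<open>The laws of matrix algebra with equations between dimensions as premises. In this form the simplifier
  discharges the premises from the dimensions of the atoms, whereas the library versions mention
  dimensions that do not occur in the conclusion.\<close>

lemma mat_mult_assoc:
  "dim_col A = dim_row B \<Longrightarrow> dim_col B = dim_row C \<Longrightarrow>
   (A * B) * (C :: 'a :: comm_ring_1 mat) = A * (B * C)"
  by (rule assoc_mult_mat[of A "dim_row A" "dim_row B" B "dim_row C" C "dim_col C"]) auto

lemma mat_mult_add:
  "dim_col A = dim_row C \<Longrightarrow> dim_row B = dim_row C \<Longrightarrow> dim_col B = dim_col C \<Longrightarrow>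
   A * (B + C) = A * B + A * (C :: 'a :: comm_ring_1 mat)"
  by (rule mult_add_distrib_mat[of A "dim_row A" "dim_col A" _ "dim_col C"]) auto

lemma mat_add_mult:
  "dim_col B = dim_row C \<Longrightarrow> dim_row A = dim_row B \<Longrightarrow> dim_col A = dim_col B \<Longrightarrow>
   (A + B) * C = A * C + B * (C :: 'a :: comm_ring_1 mat)"
  by (rule add_mult_distrib_mat[of A "dim_row A" "dim_col A" _ _ "dim_col C"]) auto

lemma mat_mult_minus:
  "dim_col A = dim_row C \<Longrightarrow> dim_row B = dim_row C \<Longrightarrow> dim_col B = dim_col C \<Longrightarrow>
   A * (B - C) = A * B - A * (C :: 'a :: comm_ring_1 mat)"
  by (rule mult_minus_distrib_mat[of A "dim_row A" "dim_col A" _ "dim_col C"]) auto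

lemma mat_minus_mult:
  "dim_col B = dim_row C \<Longrightarrow> dim_row A = dim_row B \<Longrightarrow> dim_col A = dim_col B \<Longrightarrow>
   (A - B) * C = A * C - B * (C :: 'a :: comm_ring_1 mat)"
  by (rule minus_mult_distrib_mat[of A "dim_row A" "dim_col A" _ _ "dim_col C"]) auto

lemma mat_uminus_mult:
  "dim_col A = dim_row B \<Longrightarrow> (- A) * B = - (A * (B :: 'a :: comm_ring_1 mat))"
  by (rule eq_matI) (auto simp: scalar_prod_def sum_negf)

lemma mat_mult_uminus:
  "dim_col A = dim_row B \<Longrightarrow> A * (- B) = - (A * (B :: 'a :: comm_ring_1 mat))"
  by (rule eq_matI) (auto simp: scalar_prod_def sum_negf)

lemma mat_mult_vec:
  "dim_col A = dim_row B \<Longrightarrow> dim_vec x = dim_col B \<Longrightarrow>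
   (A * B) *\<^sub>v x = A *\<^sub>v (B *\<^sub>v (x :: 'a :: comm_ring_1 vec))"
  by (rule assoc_mult_mat_vec[of A "dim_row A" "dim_row B" B "dim_col B"])
    (auto intro: carrier_vecI)

lemma mat_add_mult_vec:
  "dim_row A = dim_row B \<Longrightarrow> dim_col A = dim_col B \<Longrightarrow> dim_vec x = dim_col B \<Longrightarrow>
   (A + B) *\<^sub>v x = A *\<^sub>v x + B *\<^sub>v (x :: 'a :: comm_ring_1 vec)"
  by (rule add_mult_distrib_mat_vec[of A "dim_row A" "dim_col B"]) (auto intro: carrier_vecI)

lemma mat_minus_mult_vec:
  "dim_row A = dim_row B \<Longrightarrow> dim_col A = dim_col B \<Longrightarrow> dim_vec x = dim_col B \<Longrightarrow>
   (A - B) *\<^sub>v x = A *\<^sub>v x - B *\<^sub>v (x :: 'a :: comm_ring_1 vec)"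
  by (rule minus_mult_distrib_mat_vec[of A "dim_row A" "dim_col B"]) (auto intro: carrier_vecI)

lemma mat_uminus_mult_vec:
  "dim_vec x = dim_col A \<Longrightarrow> (- A) *\<^sub>v x = - (A *\<^sub>v (x :: 'a :: comm_ring_1 vec))"
  by (rule eq_vecI) (auto simp: scalar_prod_def sum_negf)

lemma mat_mult_vec_add:
  "dim_vec x = dim_col A \<Longrightarrow> dim_vec y = dim_col A \<Longrightarrow>
   A *\<^sub>v (x + y) = A *\<^sub>v x + A *\<^sub>v (y :: 'a :: comm_ring_1 vec)"
  by (rule mult_add_distrib_mat_vec[of A "dim_row A" "dim_col A"]) (auto intro: carrier_vecI)

lemma mat_mult_vec_minus:
  "dim_vec x = dim_col A \<Longrightarrow> dim_vec y = dim_col A \<Longrightarrow>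
   A *\<^sub>v (x - y) = A *\<^sub>v x - A *\<^sub>v (y :: 'a :: comm_ring_1 vec)"
  by (rule mult_minus_distrib_mat_vec[of A "dim_row A" "dim_col A"]) (auto intro: carrier_vecI)

lemma mat_mult_vec_uminus:
  "dim_vec x = dim_col A \<Longrightarrow> A *\<^sub>v (- x) = - (A *\<^sub>v (x :: 'a :: comm_ring_1 vec))"
  by (rule eq_vecI) (auto simp: scalar_prod_def sum_negf)

lemma mat_mult_vec_smult:
  "dim_vec x = dim_col A \<Longrightarrow> A *\<^sub>v (c \<cdot>\<^sub>v x) = c \<cdot>\<^sub>v (A *\<^sub>v (x :: 'a :: comm_ring_1 vec))"
  by (rule eq_vecI) (auto simp: scalar_prod_def sum_distrib_left mult_ac)

lemma mat_mult_vec_zero: "dim_col A = n \<Longrightarrow> A *\<^sub>v 0\<^sub>v n = (0\<^sub>v (dim_row A) :: 'a :: comm_ring_1 vec)"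
  by (rule eq_vecI) auto

lemma zero_mat_mult_vec: "dim_vec x = m \<Longrightarrow> 0\<^sub>m n m *\<^sub>v x = (0\<^sub>v n :: 'a :: comm_ring_1 vec)"
  by (rule eq_vecI) (auto simp: scalar_prod_def)

lemma mat_mult_zero: "dim_col A = n \<Longrightarrow> A * 0\<^sub>m n m = (0\<^sub>m (dim_row A) m :: 'a :: comm_ring_1 mat)"
  by (rule eq_matI) (auto simp: scalar_prod_def)

lemma zero_mult_mat: "dim_row A = m \<Longrightarrow> 0\<^sub>m n m * A = (0\<^sub>m n (dim_col A) :: 'a :: comm_ring_1 mat)"
  by (rule eq_matI) (auto simp: scalar_prod_def)

lemma mat_mult_one: "dim_col A = n \<Longrightarrow> A * 1\<^sub>m n = (A :: 'a :: comm_ring_1 mat)"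
  by (rule right_mult_one_mat') auto

lemma one_mult_mat: "dim_row A = n \<Longrightarrow> 1\<^sub>m n * A = (A :: 'a :: comm_ring_1 mat)"
  by (rule left_mult_one_mat') auto

lemmas mat_distrib = mat_mult_assoc mat_mult_add mat_add_mult mat_mult_minus mat_minus_mult
  mat_uminus_mult mat_mult_uminus mat_mult_zero zero_mult_mat mat_mult_one one_mult_mat

lemmas vec_distrib = mat_mult_vec mat_add_mult_vec mat_minus_mult_vec mat_uminus_mult_vec
  mat_mult_vec_add mat_mult_vec_minus mat_mult_vec_uminus mat_mult_vec_smult mat_mult_vec_zero
  zero_mat_mult_vec

lemma mat_transpose_mult:
  "dim_col A = dim_row B \<Longrightarrow> (A * B)\<^sup>T = B\<^sup>T * (A :: 'a :: comm_ring_1 mat)\<^sup>T"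
  by (rule transpose_mult[of A "dim_row A" "dim_col A" B "dim_col B"]) auto

lemma mat_transpose_add:
  "dim_row A = dim_row B \<Longrightarrow> dim_col A = dim_col B \<Longrightarrow> (A + B)\<^sup>T = A\<^sup>T + (B :: 'a :: comm_ring_1 mat)\<^sup>T"
  by (rule eq_matI) auto

lemma mat_transpose_minus:
  "dim_row A = dim_row B \<Longrightarrow> dim_col A = dim_col B \<Longrightarrow> (A - B)\<^sup>T = A\<^sup>T - (B :: 'a :: comm_ring_1 mat)\<^sup>T"
  by (rule eq_matI) auto

lemma mat_transpose_uminus: "(- A)\<^sup>T = - (A :: 'a :: comm_ring_1 mat)\<^sup>T"
  by (rule eq_matI) auto

lemma mat_transpose_one: "(1\<^sub>m n)\<^sup>T = (1\<^sub>m n :: 'a :: comm_ring_1 mat)"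
  by (rule eq_matI) auto

lemma mat_transpose_zero: "(0\<^sub>m n m)\<^sup>T = (0\<^sub>m m n :: 'a :: comm_ring_1 mat)"
  by (rule eq_matI) auto

lemmas mat_transpose = mat_transpose_mult mat_transpose_add mat_transpose_minus
  mat_transpose_uminus mat_transpose_one mat_transpose_zero

lemma mat_adjoint_eq: "A\<^sup>\<dagger> = mat (dim_col A) (dim_row A) (\<lambda>(i, j). conjugate (A $$ (j, i)))"
  by (rule eq_matI) (auto simp: mat_adjoint_def mat_of_rows_def)

lemma adjoint_dim [simp]: "dim_row (A\<^sup>\<dagger>) = dim_col A" "dim_col (A\<^sup>\<dagger>) = dim_row A"
  by (auto simp: mat_adjoint_eq)

lemma adjoint_index [simp]:
  "i < dim_col A \<Longrightarrow> j < dim_row A \<Longrightarrow> A\<^sup>\<dagger> $$ (i, j) = conjugate (A $$ (j, i))"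
  by (auto simp: mat_adjoint_eq)

lemma adjoint_carrier [simp]: "A \<in> carrier_mat n m \<Longrightarrow> A\<^sup>\<dagger> \<in> carrier_mat m n"
  by (auto simp: mat_adjoint_eq)

lemma adjoint_adjoint [simp]: "(A\<^sup>\<dagger>)\<^sup>\<dagger> = A"
  by (rule eq_matI) auto

lemma adjoint_mult:
  "dim_col A = dim_row B \<Longrightarrow> (A * B)\<^sup>\<dagger> = B\<^sup>\<dagger> * (A :: complex mat)\<^sup>\<dagger>"
  by (rule eq_matI) (auto simp: scalar_prod_def mult.commute intro!: sum.cong)

lemma adjoint_add:
  "dim_row A = dim_row B \<Longrightarrow> dim_col A = dim_col B \<Longrightarrow> (A + B)\<^sup>\<dagger> = A\<^sup>\<dagger> + (B :: complex mat)\<^sup>\<dagger>"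
  by (rule eq_matI) auto

lemma adjoint_minus:
  "dim_row A = dim_row B \<Longrightarrow> dim_col A = dim_col B \<Longrightarrow> (A - B)\<^sup>\<dagger> = A\<^sup>\<dagger> - (B :: complex mat)\<^sup>\<dagger>"
  by (rule eq_matI) auto

lemma adjoint_uminus: "(- A)\<^sup>\<dagger> = - (A :: complex mat)\<^sup>\<dagger>"
  by (rule eq_matI) auto

lemma adjoint_one [simp]: "(1\<^sub>m n)\<^sup>\<dagger> = (1\<^sub>m n :: complex mat)"
  by (rule eq_matI) auto

lemma adjoint_zero [simp]: "(0\<^sub>m n m)\<^sup>\<dagger> = (0\<^sub>m m n :: complex mat)"
  by (rule eq_matI) auto

lemmas adjoint_simps = adjoint_mult adjoint_add adjoint_minus adjoint_uminus

lemma adjoint_transpose: "(A\<^sup>T)\<^sup>\<dagger> = (A\<^sup>\<dagger>)\<^sup>T"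
  by (rule eq_matI) auto

lemma adjoint_scalar_prod:
  assumes "dim_vec x = dim_col A" "dim_vec y = dim_row A"
  shows "(A *\<^sub>v x) \<bullet>c y = x \<bullet>c ((A :: complex mat)\<^sup>\<dagger> *\<^sub>v y)"
proof -
  have "(A *\<^sub>v x) \<bullet>c y = (\<Sum>i<dim_row A. \<Sum>j<dim_col A. A $$ (i, j) * x $ j * cnj (y $ i))"
    using assms by (simp add: scalar_prod_def sum_distrib_right atLeast0LessThan)
  also have "\<dots> = (\<Sum>j<dim_col A. \<Sum>i<dim_row A. A $$ (i, j) * x $ j * cnj (y $ i))"
    by (rule sum.swap)
  also have "\<dots> = x \<bullet>c (A\<^sup>\<dagger> *\<^sub>v y)"
    using assms by (simp add: scalar_prod_def sum_distrib_left atLeast0LessThan mult_ac)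
  finally show ?thesis .
qed

lemma transpose_scalar_prod:
  assumes "dim_vec x = dim_col A" "dim_vec y = dim_row A"
  shows "(A\<^sup>T *\<^sub>v y) \<bullet> x = y \<bullet> ((A :: 'a :: comm_ring_1 mat) *\<^sub>v x)"
proof -
  have "(A\<^sup>T *\<^sub>v y) \<bullet> x = (\<Sum>j<dim_col A. \<Sum>i<dim_row A. A $$ (i, j) * y $ i * x $ j)"
    using assms by (simp add: scalar_prod_def sum_distrib_right atLeast0LessThan)
  also have "\<dots> = (\<Sum>i<dim_row A. \<Sum>j<dim_col A. A $$ (i, j) * y $ i * x $ j)"
    by (rule sum.swap)
  also have "\<dots> = y \<bullet> (A *\<^sub>v x)"
    using assms by (simp add: scalar_prod_def sum_distrib_left atLeast0LessThan mult_ac)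
  finally show ?thesis .
qed

lemma mat_eq_vecI:
  assumes "A \<in> carrier_mat n m" "B \<in> carrier_mat n m"
    and "\<And>x. x \<in> carrier_vec m \<Longrightarrow> A *\<^sub>v x = B *\<^sub>v (x :: 'a :: comm_ring_1 vec)"
  shows "A = B"
proof (rule eq_matI)
  fix i j assume ij: "i < dim_row B" "j < dim_col B"
  then have "(A *\<^sub>v unit_vec m j) $ i = (B *\<^sub>v unit_vec m j) $ i"
    using assms(3) by simp
  then show "A $$ (i, j) = B $$ (i, j)"
    using ij assms(1,2) by simp
qed (use assms in auto)


section \<open>Inverses, subspaces and annihilators\<close>

text \<open>If there were more columns than rows, the matrix could be padded with zero rows to a singular
  square matrix, whose kernel contains a nonzero vector.\<close>

lemma injective_mat_dim_le:
  fixes M :: "'a :: field mat"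
  assumes M: "M \<in> carrier_mat n m"
    and inj: "\<And>v. v \<in> carrier_vec m \<Longrightarrow> M *\<^sub>v v = 0\<^sub>v n \<Longrightarrow> v = 0\<^sub>v m"
  shows "m \<le> n"
proof (rule ccontr)
  assume "\<not> m \<le> n"
  then have less: "n < m" by simp
  define N where "N = mat m m (\<lambda>(i, j). if i < n then M $$ (i, j) else 0)"
  have N: "N \<in> carrier_mat m m" by (simp add: N_def)
  have "N\<^sup>T *\<^sub>v unit_vec m (m - 1) = 0\<^sub>v m"
    by (rule eq_vecI) (use less N in \<open>auto simp: N_def\<close>)
  moreover have "unit_vec m (m - 1) \<noteq> (0\<^sub>v m :: 'a vec)"
    using less by (intro unit_vec_nonzero) auto
  ultimately have "det (N\<^sup>T) = 0"
    using N by (subst det_0_iff_vec_prod_zero_field[of _ m]) (auto intro!: exI[of _ "unit_vec m (m - 1)"])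
  then have "det N = 0"
    using det_transpose[OF N] by simp
  then obtain v where v: "v \<in> carrier_vec m" "v \<noteq> 0\<^sub>v m" "N *\<^sub>v v = 0\<^sub>v m"
    using det_0_iff_vec_prod_zero_field[OF N] by auto
  have "M *\<^sub>v v = 0\<^sub>v n"
  proof (rule eq_vecI)
    fix i assume i: "i < dim_vec (0\<^sub>v n)"
    then have "row M i = row N i"
      using M N less by (intro eq_vecI) (auto simp: N_def)
    moreover have "(N *\<^sub>v v) $ i = 0"
      using v(3) i less by simp
    ultimately show "(M *\<^sub>v v) $ i = 0\<^sub>v n $ i"
      using i M N less by simp
  qed (use M in auto)
  with inj v show False by blast
qed

lemma mat_inv_of_injective:
  fixes M :: "'a :: field mat"
  assumes M: "M \<in> carrier_mat n n"
    and inj: "\<And>v. v \<in> carrier_vec n \<Longrightarrow> M *\<^sub>v v = 0\<^sub>v n \<Longrightarrow> v = 0\<^sub>v n"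
  shows "mat_inv M \<in> carrier_mat n n" "M * mat_inv M = 1\<^sub>m n" "mat_inv M * M = 1\<^sub>m n"
proof -
  have "det M \<noteq> 0"
    using det_0_iff_vec_prod_zero_field[OF M] inj by blast
  then have "M \<in> Units (ring_mat TYPE('a) n undefined)"
    by (rule det_non_zero_imp_unit[OF M])
  then obtain N where "mat_inverse M = Some N"
    using mat_inverse(1)[OF M, of undefined] by (cases "mat_inverse M") auto
  from this mat_inverse(2)[OF M this]
  show "mat_inv M \<in> carrier_mat n n" "M * mat_inv M = 1\<^sub>m n" "mat_inv M * M = 1\<^sub>m n"
    by auto
qed

lemma left_inverse_imp_injective:
  fixes M :: "'a :: comm_ring_1 mat"
  assumes "M \<in> carrier_mat n m" "N \<in> carrier_mat m n" "N * M = 1\<^sub>m m"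
    and "v \<in> carrier_vec m" "M *\<^sub>v v = 0\<^sub>v n"
  shows "v = 0\<^sub>v m"
proof -
  have "v = (N * M) *\<^sub>v v" using assms by simp
  also have "\<dots> = N *\<^sub>v (M *\<^sub>v v)" using assms(1,2,4) by (simp add: vec_distrib)
  finally show ?thesis using assms by (simp add: vec_distrib)
qed

lemma mat_inv_unique:
  fixes M :: "'a :: field mat"
  assumes M: "M \<in> carrier_mat n n" and N: "N \<in> carrier_mat n n" and "N * M = 1\<^sub>m n"
  shows "mat_inv M = N" "M * N = 1\<^sub>m n"
proof -
  note inv = mat_inv_of_injective[OF M left_inverse_imp_injective[OF M N assms(3)]]
  have "mat_inv M = (N * M) * mat_inv M" using inv assms by simp
  also have "\<dots> = N * (M * mat_inv M)" using inv(1) assms(1,2) by (intro mat_mult_assoc) auto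
  also have "\<dots> = N" using inv(2) N by simp
  finally show "mat_inv M = N" .
  with inv show "M * N = 1\<^sub>m n" by simp
qed

lemma vec_norm_zero: "v \<bullet>c v = 0 \<Longrightarrow> v = 0\<^sub>v (dim_vec (v :: complex vec))"
  using conjugate_square_eq_0_vec[of v "dim_vec v"] carrier_vec_dim_vec by blast

text \<open>The Gram matrix \<open>M\<^sup>\<dagger> * M\<close> of independent columns is invertible, and \<open>(M\<^sup>\<dagger> * M)\<inverse> * M\<^sup>\<dagger>\<close> is a left inverse.\<close>

lemma injective_left_inverse:
  fixes M :: "complex mat"
  assumes M: "M \<in> carrier_mat n m"
    and inj: "\<And>v. v \<in> carrier_vec m \<Longrightarrow> M *\<^sub>v v = 0\<^sub>v n \<Longrightarrow> v = 0\<^sub>v m"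
  obtains N where "N \<in> carrier_mat m n" "N * M = 1\<^sub>m m"
proof -
  have G: "M\<^sup>\<dagger> * M \<in> carrier_mat m m" using M by auto
  have "v = 0\<^sub>v m" if v: "v \<in> carrier_vec m" "(M\<^sup>\<dagger> * M) *\<^sub>v v = 0\<^sub>v m" for v
  proof -
    have "(M *\<^sub>v v) \<bullet>c (M *\<^sub>v v) = v \<bullet>c ((M\<^sup>\<dagger> * M) *\<^sub>v v)"
      using M v(1) by (simp add: adjoint_scalar_prod vec_distrib)
    also have "\<dots> = 0" using v by simp
    finally have "M *\<^sub>v v = 0\<^sub>v n" using M vec_norm_zero by fastforce
    with inj v show ?thesis by blast
  qed
  note inv = mat_inv_of_injective[OF G this]
  show thesis
  proof (rule that)
    show "mat_inv (M\<^sup>\<dagger> * M) * M\<^sup>\<dagger> \<in> carrier_mat m n" using inv M by auto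
    show "mat_inv (M\<^sup>\<dagger> * M) * M\<^sup>\<dagger> * M = 1\<^sub>m m"
      using inv M by (subst mat_mult_assoc) auto
  qed
qed

text \<open>The closure conditions spelled out, so that subspaces can be handled without entering the
  locales of modules and vector spaces; the two notions agree by \<open>subspace_iff_vec_subspace\<close>.\<close>

definition vec_subspace :: "nat \<Rightarrow> complex vec set \<Rightarrow> bool" where
  "vec_subspace n V \<longleftrightarrow> V \<subseteq> carrier_vec n \<and> 0\<^sub>v n \<in> V \<and> (\<forall>x\<in>V. \<forall>y\<in>V. x + y \<in> V) \<and>
     (\<forall>c. \<forall>x\<in>V. c \<cdot>\<^sub>v x \<in> V)"

lemma vec_subspaceI [intro?]:
  assumes "V \<subseteq> carrier_vec n" "0\<^sub>v n \<in> V" "\<And>x y. x \<in> V \<Longrightarrow> y \<in> V \<Longrightarrow> x + y \<in> V"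
    "\<And>c x. x \<in> V \<Longrightarrow> c \<cdot>\<^sub>v x \<in> V"
  shows "vec_subspace n V"
  using assms by (auto simp: vec_subspace_def)

lemma vec_subspaceD:
  assumes "vec_subspace n V"
  shows "V \<subseteq> carrier_vec n" "0\<^sub>v n \<in> V" "x \<in> V \<Longrightarrow> y \<in> V \<Longrightarrow> x + y \<in> V" "x \<in> V \<Longrightarrow> c \<cdot>\<^sub>v x \<in> V"
    "x \<in> V \<Longrightarrow> x \<in> carrier_vec n"
  using assms by (auto simp: vec_subspace_def)

lemma vec_subspace_minus:
  assumes "vec_subspace n V" "x \<in> V" "y \<in> V"
  shows "x - y \<in> V"
proof -
  have "x - y = x + (-1) \<cdot>\<^sub>v y"
    using assms(1)[THEN vec_subspaceD(5)] assms(2,3) by (intro eq_vecI) auto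
  then show ?thesis
    using assms vec_subspaceD[OF assms(1)] by auto
qed

lemma subspace_iff_vec_subspace:
  "VectorSpace.subspace class_ring V (module_vec TYPE(complex) n) \<longleftrightarrow> vec_subspace n V"
proof -
  interpret vec_space "TYPE(complex)" n .
  have "VectorSpace.subspace class_ring V (module_vec TYPE(complex) n) \<longleftrightarrow>
    submodule class_ring V (module_vec TYPE(complex) n)"
    by (metis VectorSpace.subspace_def vectorspace_axioms)
  also have "\<dots> \<longleftrightarrow> vec_subspace n V"
    using module_axioms
    by (auto simp: submodule_def vec_subspace_def module_vec_def)
  finally show ?thesis .
qed

lemma mem_mat_range:
  "M \<in> carrier_mat n m \<Longrightarrow> x \<in> mat_range M \<longleftrightarrow> (\<exists>v\<in>carrier_vec m. x = M *\<^sub>v v)"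
  by (auto simp: mat_range_def)

lemma vec_subspace_mat_range:
  assumes M: "M \<in> carrier_mat n m"
  shows "vec_subspace n (mat_range M)"
proof
  show "mat_range M \<subseteq> carrier_vec n" using M by (auto simp: mat_range_def)
  show "0\<^sub>v n \<in> mat_range M"
    using M by (auto simp: mem_mat_range intro!: bexI[of _ "0\<^sub>v m"])
  show "x + y \<in> mat_range M" if "x \<in> mat_range M" "y \<in> mat_range M" for x y
  proof -
    from that M obtain v w where "v \<in> carrier_vec m" "x = M *\<^sub>v v" "w \<in> carrier_vec m" "y = M *\<^sub>v w"
      by (auto simp: mem_mat_range)
    then show ?thesis using M
      by (auto simp: mem_mat_range vec_distrib intro!: bexI[of _ "v + w"])
  qed
  show "c \<cdot>\<^sub>v x \<in> mat_range M" if "x \<in> mat_range M" for c x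
  proof -
    from that M obtain v where "v \<in> carrier_vec m" "x = M *\<^sub>v v"
      by (auto simp: mem_mat_range)
    then show ?thesis using M
      by (auto simp: mem_mat_range vec_distrib intro!: bexI[of _ "c \<cdot>\<^sub>v v"])
  qed
qed

lemma append_cols_carrier [simp]:
  "M \<in> carrier_mat n m \<Longrightarrow> N \<in> carrier_mat n k \<Longrightarrow> M @\<^sub>c N \<in> carrier_mat n (m + k)"
  by (auto simp: append_cols_def)

lemma append_cols_index:
  "M \<in> carrier_mat n m \<Longrightarrow> N \<in> carrier_mat n k \<Longrightarrow> i < n \<Longrightarrow> j < m + k \<Longrightarrow>
   (M @\<^sub>c N) $$ (i, j) = (if j < m then M $$ (i, j) else N $$ (i, j - m))"
  by (auto simp: append_cols_def)

lemma append_cols_dim [simp]: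
  "dim_row (M @\<^sub>c N) = dim_row M" "dim_col (M @\<^sub>c N) = dim_col M + dim_col N"
  by (auto simp: append_cols_def)

lemma append_rows_dim [simp]:
  "dim_row (M @\<^sub>r N) = dim_row M + dim_row N" "dim_col (M @\<^sub>r N) = dim_col M"
  by (auto simp: append_rows_def)

lemma append_rows_carrier [simp]:
  "M \<in> carrier_mat m n \<Longrightarrow> N \<in> carrier_mat k n \<Longrightarrow> M @\<^sub>r N \<in> carrier_mat (m + k) n"
  by (auto simp: append_rows_def)

lemma append_rows_index:
  "M \<in> carrier_mat m n \<Longrightarrow> N \<in> carrier_mat k n \<Longrightarrow> i < m + k \<Longrightarrow> j < n \<Longrightarrow>
   (M @\<^sub>r N) $$ (i, j) = (if i < m then M $$ (i, j) else N $$ (i - m, j))"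
  by (auto simp: append_rows_def)

lemma append_cols_transpose:
  "M \<in> carrier_mat n m \<Longrightarrow> N \<in> carrier_mat n k \<Longrightarrow> (M @\<^sub>c N)\<^sup>T = M\<^sup>T @\<^sub>r N\<^sup>T"
  by (rule eq_matI) (auto simp: append_cols_def append_rows_def)

lemma append_rows_transpose:
  "M \<in> carrier_mat m n \<Longrightarrow> N \<in> carrier_mat k n \<Longrightarrow> (M @\<^sub>r N)\<^sup>T = M\<^sup>T @\<^sub>c N\<^sup>T"
  by (rule eq_matI) (auto simp: append_cols_def append_rows_def)

lemma scalar_prod_append':
  assumes "dim_vec u = dim_vec x" "dim_vec v = dim_vec y"
  shows "(u @\<^sub>v v) \<bullet> (x @\<^sub>v y) = u \<bullet> x + v \<bullet> (y :: 'a :: comm_ring_1 vec)"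
  using assms by (intro scalar_prod_append[of _ "dim_vec x" _ "dim_vec y"]) (auto intro: carrier_vecI)

lemma append_cols_mult_vec:
  assumes "M \<in> carrier_mat n m" "N \<in> carrier_mat n k" "x \<in> carrier_vec m" "y \<in> carrier_vec k"
  shows "(M @\<^sub>c N) *\<^sub>v (x @\<^sub>v y) = M *\<^sub>v x + N *\<^sub>v (y :: 'a :: comm_ring_1 vec)"
proof (rule eq_vecI)
  fix i assume "i < dim_vec (M *\<^sub>v x + N *\<^sub>v y)"
  then have i: "i < n" using assms by auto
  have "row (M @\<^sub>c N) i = row M i @\<^sub>v row N i"
    by (rule eq_vecI) (use assms i in \<open>auto simp: append_cols_def\<close>)
  then show "((M @\<^sub>c N) *\<^sub>v (x @\<^sub>v y)) $ i = (M *\<^sub>v x + N *\<^sub>v y) $ i"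
    using i assms by (simp add: scalar_prod_append')
qed (use assms in auto)

lemma append_rows_mult_vec:
  assumes "M \<in> carrier_mat m n" "N \<in> carrier_mat k n" "x \<in> carrier_vec n"
  shows "(M @\<^sub>r N) *\<^sub>v x = (M *\<^sub>v x) @\<^sub>v (N *\<^sub>v (x :: 'a :: comm_ring_1 vec))"
proof (rule eq_vecI)
  fix i assume "i < dim_vec ((M *\<^sub>v x) @\<^sub>v (N *\<^sub>v x))"
  then have i: "i < m + k" using assms by auto
  have "row (M @\<^sub>r N) i = (if i < m then row M i else row N (i - m))"
    by (rule eq_vecI) (use assms i in \<open>auto simp: append_rows_def\<close>)
  then show "((M @\<^sub>r N) *\<^sub>v x) $ i = ((M *\<^sub>v x) @\<^sub>v (N *\<^sub>v x)) $ i"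
    using i assms by simp
qed (use assms in auto)

lemma vec_split:
  assumes "v \<in> carrier_vec (m + k)"
  obtains x y where "x \<in> carrier_vec m" "y \<in> carrier_vec k" "v = x @\<^sub>v y"
  using assms that[of "vec_first v m" "vec_last v k"] vec_first_last_append[of v m k] by auto

lemma append_vec_zero_iff:
  "x \<in> carrier_vec m \<Longrightarrow> y \<in> carrier_vec k \<Longrightarrow> x @\<^sub>v y = 0\<^sub>v (m + k) \<longleftrightarrow> x = 0\<^sub>v m \<and> y = 0\<^sub>v k"
proof -
  assume *: "x \<in> carrier_vec m" "y \<in> carrier_vec k"
  have "0\<^sub>v (m + k) = 0\<^sub>v m @\<^sub>v (0\<^sub>v k :: 'a vec)" by (rule eq_vecI) auto
  with * show ?thesis by (metis append_vec_eq zero_carrier_vec)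
qed

lemma append_rows_eq_iff:
  assumes "M \<in> carrier_mat m n" "M' \<in> carrier_mat m n" "N \<in> carrier_mat k n" "N' \<in> carrier_mat k n"
  shows "M @\<^sub>r N = M' @\<^sub>r N' \<longleftrightarrow> M = M' \<and> N = N'"
proof
  assume eq: "M @\<^sub>r N = M' @\<^sub>r N'"
  have "M $$ (i, j) = M' $$ (i, j)" if "i < m" "j < n" for i j
    using arg_cong[OF eq, of "\<lambda>X. X $$ (i, j)"] that assms by (simp add: append_rows_index)
  moreover have "N $$ (i, j) = N' $$ (i, j)" if "i < k" "j < n" for i j
    using arg_cong[OF eq, of "\<lambda>X. X $$ (m + i, j)"] that assms by (simp add: append_rows_index)
  ultimately show "M = M' \<and> N = N'"
    using assms by (auto intro!: eq_matI)
qed auto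

lemma append_cols_eq_iff:
  assumes "M \<in> carrier_mat n m" "M' \<in> carrier_mat n m" "N \<in> carrier_mat n k" "N' \<in> carrier_mat n k"
  shows "M @\<^sub>c N = M' @\<^sub>c N' \<longleftrightarrow> M = M' \<and> N = N'"
proof -
  have "M @\<^sub>c N = M' @\<^sub>c N' \<longleftrightarrow> (M @\<^sub>c N)\<^sup>T = (M' @\<^sub>c N')\<^sup>T"
    by (metis transpose_transpose)
  also have "\<dots> \<longleftrightarrow> M\<^sup>T = M'\<^sup>T \<and> N\<^sup>T = N'\<^sup>T"
    using assms by (simp add: append_cols_transpose append_rows_eq_iff[of _ m n])
  also have "\<dots> \<longleftrightarrow> M = M' \<and> N = N'"
    by (metis transpose_transpose)
  finally show ?thesis .
qed

text \<open>Columns are added as long as the range stays inside the subspace; by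
  \<open>injective_mat_dim_le\<close> this stops.\<close>

lemma vec_subspace_basis:
  assumes V: "vec_subspace n V"
  obtains m M where "M \<in> carrier_mat n m" "mat_range M = V"
    "\<And>v. v \<in> carrier_vec m \<Longrightarrow> M *\<^sub>v v = 0\<^sub>v n \<Longrightarrow> v = 0\<^sub>v m"
proof -
  define P where "P m \<longleftrightarrow> (\<exists>M\<in>carrier_mat n m. mat_range M \<subseteq> V \<and>
     (\<forall>v \<in> carrier_vec m. M *\<^sub>v v = 0\<^sub>v n \<longrightarrow> v = 0\<^sub>v m))" for m
  have bound: "m \<le> n" if "P m" for m
    using that injective_mat_dim_le unfolding P_def by blast
  have "P 0"
    unfolding P_def
  proof (intro bexI[of _ "0\<^sub>m n 0"] conjI ballI impI)
    show "mat_range (0\<^sub>m n 0) \<subseteq> V"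
      using V by (auto simp: mat_range_def zero_mat_mult_vec vec_subspaceD)
  qed auto
  with bound have "P (GREATEST m. P m)" and greatest: "\<And>m. P m \<Longrightarrow> m \<le> (GREATEST m. P m)"
    by (blast intro: GreatestI_nat Greatest_le_nat)+
  then obtain M where M: "M \<in> carrier_mat n (GREATEST m. P m)" "mat_range M \<subseteq> V"
    and inj: "\<And>v. v \<in> carrier_vec (GREATEST m. P m) \<Longrightarrow> M *\<^sub>v v = 0\<^sub>v n \<Longrightarrow> v = 0\<^sub>v (GREATEST m. P m)"
    unfolding P_def by auto
  define m where "m = (GREATEST m. P m)"
  note M = M[folded m_def] and inj = inj[folded m_def]
  have "x \<in> mat_range M" if x: "x \<in> V" for x
  proof (rule ccontr)
    assume nx: "x \<notin> mat_range M"
    have xc: "x \<in> carrier_vec n" using V x vec_subspaceD by blast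
    define X where "X = mat n 1 (\<lambda>(i, j). x $ i)"
    have X: "X \<in> carrier_mat n 1" by (simp add: X_def)
    have Xv: "X *\<^sub>v c = c $ 0 \<cdot>\<^sub>v x" if "c \<in> carrier_vec 1" for c
      by (rule eq_vecI) (use that xc in \<open>auto simp: X_def scalar_prod_def\<close>)
    have "P (m + 1)"
      unfolding P_def
    proof (intro bexI[of _ "M @\<^sub>c X"] conjI ballI impI subsetI)
      show MX: "M @\<^sub>c X \<in> carrier_mat n (m + 1)" using append_cols_carrier[OF M(1) X] .
      show "y \<in> V" if "y \<in> mat_range (M @\<^sub>c X)" for y
      proof -
        from that MX obtain v where v: "v \<in> carrier_vec (m + 1)" and y: "y = (M @\<^sub>c X) *\<^sub>v v"
          by (auto simp: mem_mat_range)
        from v obtain a c where ac: "a \<in> carrier_vec m" "c \<in> carrier_vec 1" "v = a @\<^sub>v c"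
          by (rule vec_split)
        then have "y = M *\<^sub>v a + c $ 0 \<cdot>\<^sub>v x"
          using y append_cols_mult_vec[OF M(1) X] Xv by simp
        moreover have "M *\<^sub>v a \<in> V" using M ac by (auto simp: mat_range_def)
        ultimately show "y \<in> V" using V x by (auto simp: vec_subspaceD)
      qed
      show "v = 0\<^sub>v (m + 1)" if "v \<in> carrier_vec (m + 1)" "(M @\<^sub>c X) *\<^sub>v v = 0\<^sub>v n" for v
      proof -
        from that(1) obtain a c where ac: "a \<in> carrier_vec m" "c \<in> carrier_vec 1" "v = a @\<^sub>v c"
          by (rule vec_split)
        have eq: "M *\<^sub>v a + c $ 0 \<cdot>\<^sub>v x = 0\<^sub>v n"
          using that(2) ac append_cols_mult_vec[OF M(1) X] Xv by simp
        have c0: "c $ 0 = 0"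
        proof (rule ccontr)
          assume c: "c $ 0 \<noteq> 0"
          have "x = M *\<^sub>v ((- 1 / c $ 0) \<cdot>\<^sub>v a)"
          proof (rule eq_vecI)
            fix i assume "i < dim_vec (M *\<^sub>v ((- 1 / c $ 0) \<cdot>\<^sub>v a))"
            then have i: "i < n" using M by simp
            have "(M *\<^sub>v a) $ i + c $ 0 * x $ i = 0"
              using arg_cong[OF eq, of "\<lambda>v. v $ i"] i M xc by (simp del: index_mult_mat_vec)
            then have "x $ i = (- 1 / c $ 0) * (M *\<^sub>v a) $ i"
              using c by (simp add: field_simps add_eq_0_iff)
            then show "x $ i = (M *\<^sub>v ((- 1 / c $ 0) \<cdot>\<^sub>v a)) $ i"
              using i M ac by (simp add: vec_distrib del: index_mult_mat_vec)
          qed (use xc M in auto)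
          then have "x \<in> mat_range M"
            using M ac by (auto simp: mem_mat_range)
          with nx show False ..
        qed
        have "0 \<cdot>\<^sub>v x = 0\<^sub>v n" using xc by auto
        then have "M *\<^sub>v a = 0\<^sub>v n"
          using eq M(1) ac unfolding c0 by simp
        then have "a = 0\<^sub>v m" using inj ac by blast
        moreover have "c = 0\<^sub>v 1" using c0 ac by (auto intro!: eq_vecI)
        ultimately show "v = 0\<^sub>v (m + 1)" using ac by auto
      qed
    qed
    then have "m + 1 \<le> m" using greatest unfolding m_def by blast
    then show False by simp
  qed
  with M have "mat_range M = V" by blast
  with M(1) inj show thesis by (intro that) auto
qed

text \<open>With a left inverse \<open>N\<close> of a basis matrix \<open>M\<close> of \<open>V\<close>, the matrix \<open>1 - M * N\<close> annihilates \<open>V\<close> but not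
  \<open>c\<close>, and a multiple of one of its rows separates.\<close>

lemma vec_subspace_separation:
  assumes V: "vec_subspace n V" and c: "c \<in> carrier_vec n" "c \<notin> V"
  obtains y where "y \<in> carrier_vec n" "\<And>x. x \<in> V \<Longrightarrow> y \<bullet> x = 0" "y \<bullet> c = 1"
proof -
  obtain m M where M: "M \<in> carrier_mat n m" "mat_range M = V"
    and inj: "\<And>v. v \<in> carrier_vec m \<Longrightarrow> M *\<^sub>v v = 0\<^sub>v n \<Longrightarrow> v = 0\<^sub>v m"
    using vec_subspace_basis[OF V] by blast
  from injective_left_inverse[OF M(1) inj]
  obtain N where N: "N \<in> carrier_mat m n" "N * M = 1\<^sub>m m" by auto
  define d where "d = c - M *\<^sub>v (N *\<^sub>v c)"
  define P where "P = 1\<^sub>m n - M * N"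
  have P: "P \<in> carrier_mat n n" using M N by (auto simp: P_def)
  have d: "d = P *\<^sub>v c" using M N c by (simp add: P_def d_def vec_distrib)
  have PM: "P * M = 0\<^sub>m n m"
    using M N by (simp add: P_def mat_distrib)
  have "d \<noteq> 0\<^sub>v n"
  proof
    assume d0: "d = 0\<^sub>v n"
    have "c = M *\<^sub>v (N *\<^sub>v c)"
    proof (rule eq_vecI)
      fix i assume "i < dim_vec (M *\<^sub>v (N *\<^sub>v c))"
      then show "c $ i = (M *\<^sub>v (N *\<^sub>v c)) $ i"
        using arg_cong[OF d0, of "\<lambda>v. v $ i"] M c by (simp add: d_def del: index_mult_mat_vec)
    qed (use M c in auto)
    with M N c show False by (auto simp: mat_range_def)
  qed
  then obtain i where i: "i < n" "d $ i \<noteq> 0" using d P by (metis eq_vecI dim_mult_mat_vec carrier_matD(1) index_zero_vec)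
  define y where "y = (1 / d $ i) \<cdot>\<^sub>v row P i"
  show thesis
  proof (rule that)
    show "y \<in> carrier_vec n" using P i by (auto simp: y_def)
    show "y \<bullet> c = 1"
      using P i c d by (auto simp: y_def)
    show "y \<bullet> x = 0" if "x \<in> V" for x
    proof -
      from that M obtain v where v: "v \<in> carrier_vec m" "x = M *\<^sub>v v" by (auto simp: mem_mat_range)
      have "P *\<^sub>v x = 0\<^sub>v n"
        using PM P M v by (simp add: vec_distrib zero_mat_mult_vec flip: mat_mult_vec)
      then have "(P *\<^sub>v x) $ i = 0" using i by simp
      then show ?thesis using P i v M by (auto simp: y_def)
    qed
  qed
qed

text \<open>The bilinear product is used here instead of the hermitian one: annihilators then match
  transposes, and the left construction involves no conjugation of the system matrices.\<close>

definition annihilator :: "nat \<Rightarrow> complex vec set \<Rightarrow> complex vec set" where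
  "annihilator n S = {y \<in> carrier_vec n. \<forall>x\<in>S. y \<bullet> x = 0}"

lemma vec_subspace_annihilator: "S \<subseteq> carrier_vec n \<Longrightarrow> vec_subspace n (annihilator n S)"
  by (rule vec_subspaceI)
    (auto simp: annihilator_def add_scalar_prod_distrib[of _ n] subset_iff)

lemma annihilator_annihilator:
  assumes V: "vec_subspace n V"
  shows "annihilator n (annihilator n V) = V"
proof
  show "V \<subseteq> annihilator n (annihilator n V)"
    using vec_subspaceD[OF V] by (auto simp: annihilator_def intro: comm_scalar_prod[THEN trans])
  show "annihilator n (annihilator n V) \<subseteq> V"
  proof
    fix c assume c: "c \<in> annihilator n (annihilator n V)"
    show "c \<in> V"
    proof (rule ccontr)
      assume "c \<notin> V"
      moreover have cc: "c \<in> carrier_vec n" using c by (auto simp: annihilator_def)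
      ultimately obtain y where y: "y \<in> carrier_vec n" "\<And>x. x \<in> V \<Longrightarrow> y \<bullet> x = 0" "y \<bullet> c = 1"
        using vec_subspace_separation[OF V] by metis
      then have "c \<bullet> y = 0" using c by (auto simp: annihilator_def)
      with y cc show False using comm_scalar_prod[of c n y] by simp
    qed
  qed
qed

text \<open>The Fredholm alternative: otherwise a vector that separates \<open>c\<close> from the range of
  \<open>M\<^sup>T\<close> lies in the kernel of \<open>M\<close> without being orthogonal to \<open>c\<close>.\<close>

lemma transpose_solvable:
  assumes M: "M \<in> carrier_mat p s" and c: "c \<in> carrier_vec s"
    and orth: "\<And>x. x \<in> carrier_vec s \<Longrightarrow> M *\<^sub>v x = 0\<^sub>v p \<Longrightarrow> x \<bullet> c = 0"
  obtains w where "w \<in> carrier_vec p" "M\<^sup>T *\<^sub>v w = (c :: complex vec)"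
proof -
  have "c \<in> mat_range (M\<^sup>T)"
  proof (rule ccontr)
    assume "c \<notin> mat_range (M\<^sup>T)"
    moreover have "vec_subspace s (mat_range (M\<^sup>T))"
      using M by (intro vec_subspace_mat_range) auto
    ultimately obtain y where y: "y \<in> carrier_vec s" "\<And>x. x \<in> mat_range (M\<^sup>T) \<Longrightarrow> y \<bullet> x = 0" "y \<bullet> c = 1"
      using vec_subspace_separation c by metis
    have "M *\<^sub>v y = 0\<^sub>v p"
    proof (rule eq_vecI)
      fix i assume "i < dim_vec (0\<^sub>v p)"
      then have i: "i < p" by simp
      have "M\<^sup>T *\<^sub>v unit_vec p i \<in> mat_range (M\<^sup>T)" using M by (auto simp: mat_range_def)
      then have "y \<bullet> (M\<^sup>T *\<^sub>v unit_vec p i) = 0" using y by blast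
      also have "y \<bullet> (M\<^sup>T *\<^sub>v unit_vec p i) = (M\<^sup>T *\<^sub>v unit_vec p i) \<bullet> y"
        using M y by (intro comm_scalar_prod) auto
      also have "\<dots> = unit_vec p i \<bullet> (M *\<^sub>v y)"
        using M y by (intro transpose_scalar_prod) auto
      finally show "(M *\<^sub>v y) $ i = 0\<^sub>v p $ i" using i M y by simp
    qed (use M in auto)
    with orth y show False by auto
  qed
  with M that show thesis by (auto simp: mat_range_def)
qed

text \<open>In the coordinates of a basis of \<open>V\<close>, the matrix acts as a square matrix, which has an eigenvalue over
  the complex numbers.\<close>

lemma invariant_subspace_eigenvector:
  assumes A: "(A :: complex mat) \<in> carrier_mat n n" and V: "vec_subspace n V"
    and inv: "\<And>x. x \<in> V \<Longrightarrow> A *\<^sub>v x \<in> V" and nz: "V \<noteq> {0\<^sub>v n}"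
  obtains x \<mu> where "x \<in> V" "x \<noteq> 0\<^sub>v n" "A *\<^sub>v x = \<mu> \<cdot>\<^sub>v x"
proof -
  obtain m M where M: "M \<in> carrier_mat n m" "mat_range M = V"
    and inj: "\<And>v. v \<in> carrier_vec m \<Longrightarrow> M *\<^sub>v v = 0\<^sub>v n \<Longrightarrow> v = 0\<^sub>v m"
    using vec_subspace_basis[OF V] by blast
  from injective_left_inverse[OF M(1) inj]
  obtain N where N: "N \<in> carrier_mat m n" "N * M = 1\<^sub>m m" by auto
  define T where "T = N * (A * M)"
  have T: "T \<in> carrier_mat m m" using M N A by (auto simp: T_def)
  have AM: "A *\<^sub>v (M *\<^sub>v v) = M *\<^sub>v (T *\<^sub>v v)" if v: "v \<in> carrier_vec m" for v
  proof -
    have "A *\<^sub>v (M *\<^sub>v v) \<in> mat_range M"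
      unfolding M(2) using M v by (intro inv) (auto simp: mat_range_def)
    then obtain w where w: "w \<in> carrier_vec m" "A *\<^sub>v (M *\<^sub>v v) = M *\<^sub>v w"
      using M by (auto simp: mem_mat_range)
    have "T *\<^sub>v v = N *\<^sub>v (A *\<^sub>v (M *\<^sub>v v))"
      using A M N v by (simp add: T_def vec_distrib)
    also have "\<dots> = (N * M) *\<^sub>v w"
      using w(1) M(1) N(1) by (simp add: w(2) vec_distrib)
    finally show ?thesis using w N by simp
  qed
  have "m \<noteq> 0"
  proof
    assume "m = 0"
    then have "mat_range M = {0\<^sub>v n}"
      using M(1) by (auto simp: mat_range_def image_def scalar_prod_def intro!: bexI[of _ "0\<^sub>v 0"] eq_vecI)
    with M nz show False by simp
  qed
  then have "degree (char_poly T) \<noteq> 0"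
    using degree_monic_char_poly[OF T] by simp
  then have "\<not> constant (poly (char_poly T))"
    by (simp add: constant_degree)
  then obtain \<mu> where "poly (char_poly T) \<mu> = 0"
    using fundamental_theorem_of_algebra by blast
  then have "eigenvalue T \<mu>" using eigenvalue_root_char_poly[OF T] by simp
  then obtain v where v: "v \<in> carrier_vec m" "v \<noteq> 0\<^sub>v m" "T *\<^sub>v v = \<mu> \<cdot>\<^sub>v v"
    using T by (auto simp: eigenvalue_def eigenvector_def)
  show thesis
  proof (rule that)
    show "M *\<^sub>v v \<in> V" using M v by (auto simp: mat_range_def)
    show "M *\<^sub>v v \<noteq> 0\<^sub>v n" using inj v by blast
    show "A *\<^sub>v (M *\<^sub>v v) = \<mu> \<cdot>\<^sub>v (M *\<^sub>v v)" using AM v M by (simp add: vec_distrib)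
  qed
qed

lemma smult_zero_vec' [simp]: "c \<cdot>\<^sub>v 0\<^sub>v n = (0\<^sub>v n :: 'a :: comm_ring_1 vec)"
  by (rule eq_vecI) auto

lemma mult_mat_vec_carrier_iff [simp]: "M *\<^sub>v v \<in> carrier_vec n \<longleftrightarrow> dim_row M = n"
  by (auto simp: carrier_dim_vec)

lemma mult_carrier_mat_iff [simp]: "M * N \<in> carrier_mat n m \<longleftrightarrow> dim_row M = n \<and> dim_col N = m"
  by auto

lemma pow_mat_Suc_left: "A \<in> carrier_mat n n \<Longrightarrow> A ^\<^sub>m Suc i = A * (A :: 'a :: comm_ring_1 mat) ^\<^sub>m i"
proof (induction i)
  case (Suc i)
  then have "A ^\<^sub>m Suc (Suc i) = A * A ^\<^sub>m i * A" by simp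
  also have "\<dots> = A * (A ^\<^sub>m i * A)"
    using Suc.prems by (intro mat_mult_assoc) auto
  finally show ?case by simp
qed auto

lemma transpose_pow_mat:
  "A \<in> carrier_mat n n \<Longrightarrow> (A ^\<^sub>m i)\<^sup>T = (A :: 'a :: comm_ring_1 mat)\<^sup>T ^\<^sub>m i"
proof (induction i)
  case (Suc i)
  then have "(A ^\<^sub>m Suc i)\<^sup>T = A\<^sup>T * (A\<^sup>T) ^\<^sub>m i"
    by (simp add: mat_transpose_mult)
  then show ?case using Suc.prems pow_mat_Suc_left[of "A\<^sup>T" n i] by simp
qed (auto simp: mat_transpose_one)

lemma pow_mat_dims:
  assumes "A \<in> carrier_mat n n"
  shows "dim_row (A ^\<^sub>m i) = n" "dim_col (A ^\<^sub>m i) = n"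
  using pow_carrier_mat[OF assms, of i] by (auto simp del: pow_carrier_mat)

lemma annihilator_zero: "annihilator n {0\<^sub>v n} = carrier_vec n"
  by (auto simp: annihilator_def)

lemma annihilator_carrier: "annihilator n (carrier_vec n) = {0\<^sub>v n}"
proof -
  have "vec_subspace n {0\<^sub>v n}" by (rule vec_subspaceI) auto
  from annihilator_annihilator[OF this] show ?thesis by (simp add: annihilator_zero)
qed

lemma invertible_of_injective:
  fixes M :: "'a :: field mat"
  assumes M: "M \<in> carrier_mat a b"
    and inj: "\<And>v. v \<in> carrier_vec b \<Longrightarrow> M *\<^sub>v v = 0\<^sub>v a \<Longrightarrow> v = 0\<^sub>v b"
    and injT: "\<And>v. v \<in> carrier_vec a \<Longrightarrow> M\<^sup>T *\<^sub>v v = 0\<^sub>v b \<Longrightarrow> v = 0\<^sub>v a"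
  shows "invertible_mat M" "mat_range M = carrier_vec a" "mat_kernel M = {0\<^sub>v b}"
proof -
  have "b \<le> a" by (rule injective_mat_dim_le[OF M inj])
  moreover have "a \<le> b" by (rule injective_mat_dim_le[of "M\<^sup>T" b a, OF _ injT]) (use M in simp)
  ultimately have ab: "a = b" by simp
  note M' = M[folded ab] and inj' = inj[folded ab]
  note inv = mat_inv_of_injective[OF M' inj']
  show "invertible_mat M"
    unfolding invertible_mat_def square_mat.simps inverts_mat_def using M' inv by auto
  have "v \<in> mat_range M" if v: "v \<in> carrier_vec a" for v
  proof -
    have "(M * mat_inv M) *\<^sub>v v = M *\<^sub>v (mat_inv M *\<^sub>v v)"
      using M' inv(1) v by (intro assoc_mult_mat_vec) auto
    moreover have "(M * mat_inv M) *\<^sub>v v = 1\<^sub>m a *\<^sub>v v" by (rule arg_cong[OF inv(2)])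
    moreover have "1\<^sub>m a *\<^sub>v v = v" using v by simp
    ultimately have "v = M *\<^sub>v (mat_inv M *\<^sub>v v)" by simp
    moreover have "mat_inv M *\<^sub>v v \<in> carrier_vec a" using inv(1) v by simp
    ultimately show ?thesis using mem_mat_range[OF M'] by blast
  qed
  moreover have "mat_range M \<subseteq> carrier_vec a" using M by (auto simp: mat_range_def)
  ultimately show "mat_range M = carrier_vec a" by blast
  show "mat_kernel M = {0\<^sub>v b}"
    using inj M by (auto simp: mat_kernel_def vec_distrib)
qed

section \<open>Controllability and observability\<close>

context
  fixes A B :: "complex mat" and n q :: nat
  assumes A: "A \<in> carrier_mat n n" and B: "B \<in> carrier_mat n q"
begin

lemmas pow_dims [simp] = pow_mat_dims[OF A]

lemma reachable_generators: "(\<Union>i. mat_range (A ^\<^sub>m i * B)) \<subseteq> carrier_vec n"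
  using mult_carrier_mat[OF pow_carrier_mat[OF A] B] B
  by (auto simp: mat_range_def intro: mult_mat_vec_carrier)

lemma vec_subspace_reachable: "vec_subspace n (reachable_subspace A B)"
proof -
  interpret vec_space "TYPE(complex)" n .
  show ?thesis
    using span_is_subspace[OF reachable_generators] A
    by (simp add: reachable_subspace_def subspace_iff_vec_subspace)
qed

lemma reachable_generator: "mat_range (A ^\<^sub>m i * B) \<subseteq> reachable_subspace A B"
proof -
  interpret vec_space "TYPE(complex)" n .
  show ?thesis
    using in_own_span[OF reachable_generators] A by (auto simp: reachable_subspace_def)
qed

lemma reachable_least_powers:
  assumes V: "vec_subspace n V" and gen: "\<And>i. mat_range (A ^\<^sub>m i * B) \<subseteq> V"
  shows "reachable_subspace A B \<subseteq> V"
proof -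
  interpret vec_space "TYPE(complex)" n .
  have "submodule class_ring V (module_vec TYPE(complex) n)"
    using V unfolding subspace_iff_vec_subspace[symmetric] by (auto simp: VectorSpace.subspace_def)
  then show ?thesis
    using span_is_subset[of "\<Union>i. mat_range (A ^\<^sub>m i * B)" V] gen A
    by (auto simp: reachable_subspace_def)
qed

lemma reachable_least:
  assumes V: "vec_subspace n V" and gen: "mat_range B \<subseteq> V"
    and inv: "\<And>x. x \<in> V \<Longrightarrow> A *\<^sub>v x \<in> V"
  shows "reachable_subspace A B \<subseteq> V"
proof (rule reachable_least_powers[OF V])
  fix i
  show "mat_range (A ^\<^sub>m i * B) \<subseteq> V"
  proof (induction i)
    case 0
    then show ?case using gen A B by simp
  next
    case (Suc i)
    have "A ^\<^sub>m Suc i * B = A * (A ^\<^sub>m i * B)"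
      using A B pow_mat_Suc_left[OF A] by (simp del: pow_mat.simps add: mat_mult_assoc)
    moreover have "(A * (A ^\<^sub>m i * B)) *\<^sub>v v \<in> V" if "v \<in> carrier_vec q" for v
    proof -
      have "(A ^\<^sub>m i * B) *\<^sub>v v \<in> V" using Suc that B by (auto simp: mat_range_def)
      then have "A *\<^sub>v ((A ^\<^sub>m i * B) *\<^sub>v v) \<in> V" by (rule inv)
      then show ?thesis using A B that by (simp add: mat_mult_vec)
    qed
    ultimately show ?case using B by (auto simp: mat_range_def)
  qed
qed

text \<open>The vectors that \<open>A\<close> maps into the reachable subspace form a subspace containing all generators.\<close>

lemma reachable_invariant:
  assumes "x \<in> reachable_subspace A B"
  shows "A *\<^sub>v x \<in> reachable_subspace A B"
proof -
  let ?R = "reachable_subspace A B"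
  note R = vec_subspaceD[OF vec_subspace_reachable]
  define V where "V = {x \<in> ?R. A *\<^sub>v x \<in> ?R}"
  have "?R \<subseteq> V"
  proof (rule reachable_least_powers)
    show "vec_subspace n V"
    proof
      show "V \<subseteq> carrier_vec n" using R(1) by (auto simp: V_def)
      show "0\<^sub>v n \<in> V" using R(2) A by (auto simp: V_def vec_distrib)
    next
      fix x y assume "x \<in> V" "y \<in> V"
      then show "x + y \<in> V"
        using R(3) R(5)[of x] R(5)[of y] A by (auto simp: V_def vec_distrib)
    next
      fix c x assume "x \<in> V"
      then show "c \<cdot>\<^sub>v x \<in> V"
        using R(4) R(5)[of x] A by (auto simp: V_def vec_distrib)
    qed
    fix i
    have "A *\<^sub>v ((A ^\<^sub>m i * B) *\<^sub>v v) \<in> ?R" if "v \<in> carrier_vec q" for v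
    proof -
      have "A *\<^sub>v ((A ^\<^sub>m i * B) *\<^sub>v v) = (A ^\<^sub>m Suc i * B) *\<^sub>v v"
        using A B that pow_mat_Suc_left[OF A] by (simp del: pow_mat.simps add: mat_mult_vec)
      also have "\<dots> \<in> ?R" using reachable_generator[of "Suc i"] that B by (auto simp: mat_range_def)
      finally show ?thesis .
    qed
    then show "mat_range (A ^\<^sub>m i * B) \<subseteq> V"
      using reachable_generator[of i] B by (auto simp: V_def mat_range_def)
  qed
  with assms show ?thesis by (auto simp: V_def)
qed

lemma annihilator_reachable:
  "annihilator n (reachable_subspace A B) =
    {y \<in> carrier_vec n. \<forall>i. (A ^\<^sub>m i * B)\<^sup>T *\<^sub>v y = 0\<^sub>v q}"
proof (rule equalityI; rule subsetI)
  fix y assume y: "y \<in> annihilator n (reachable_subspace A B)"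
  then have yc: "y \<in> carrier_vec n" by (simp add: annihilator_def)
  have "(A ^\<^sub>m i * B)\<^sup>T *\<^sub>v y = 0\<^sub>v q" for i
  proof (rule eq_vecI)
    fix j assume "j < dim_vec (0\<^sub>v q)"
    then have j: "j < q" by simp
    have "(A ^\<^sub>m i * B) *\<^sub>v unit_vec q j \<in> reachable_subspace A B"
      using reachable_generator[of i] B by (auto simp: mat_range_def)
    then have "y \<bullet> ((A ^\<^sub>m i * B) *\<^sub>v unit_vec q j) = 0" using y by (auto simp: annihilator_def)
    then have "((A ^\<^sub>m i * B)\<^sup>T *\<^sub>v y) \<bullet> unit_vec q j = 0"
      using A B yc by (subst transpose_scalar_prod) auto
    then show "((A ^\<^sub>m i * B)\<^sup>T *\<^sub>v y) $ j = 0\<^sub>v q $ j"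
      using j by (simp add: scalar_prod_right_unit)
  qed (use B in auto)
  with yc show "y \<in> {y \<in> carrier_vec n. \<forall>i. (A ^\<^sub>m i * B)\<^sup>T *\<^sub>v y = 0\<^sub>v q}" by simp
next
  fix y assume "y \<in> {y \<in> carrier_vec n. \<forall>i. (A ^\<^sub>m i * B)\<^sup>T *\<^sub>v y = 0\<^sub>v q}"
  then have y: "y \<in> carrier_vec n" "\<forall>i. (A ^\<^sub>m i * B)\<^sup>T *\<^sub>v y = 0\<^sub>v q" by auto
  have sub: "vec_subspace n (annihilator n {y})"
    using y by (intro vec_subspace_annihilator) auto
  have "reachable_subspace A B \<subseteq> annihilator n {y}"
  proof (rule reachable_least_powers[OF sub])
    fix i
    have "((A ^\<^sub>m i * B) *\<^sub>v v) \<bullet> y = 0" if "v \<in> carrier_vec q" for v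
    proof -
      have "((A ^\<^sub>m i * B) *\<^sub>v v) \<bullet> y = y \<bullet> ((A ^\<^sub>m i * B) *\<^sub>v v)"
        using A B y that by (intro comm_scalar_prod[of _ n]) auto
      also have "\<dots> = ((A ^\<^sub>m i * B)\<^sup>T *\<^sub>v y) \<bullet> v"
        using A B y that by (intro transpose_scalar_prod[symmetric]) auto
      finally show ?thesis using y that by simp
    qed
    then show "mat_range (A ^\<^sub>m i * B) \<subseteq> annihilator n {y}"
      using A B by (auto simp: mat_range_def annihilator_def)
  qed
  then show "y \<in> annihilator n (reachable_subspace A B)"
    using y(1) by (auto simp: annihilator_def subset_iff) (metis comm_scalar_prod)
qed

lemma controllable_iff_annihilator:
  "controllable A B \<longleftrightarrow> annihilator n (reachable_subspace A B) = {0\<^sub>v n}"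
  using annihilator_annihilator[OF vec_subspace_reachable] annihilator_zero annihilator_carrier A
  by (auto simp: controllable_def)

text \<open>The Hautus test: the annihilator of the reachable subspace is invariant under the
  transpose, so that it contains an eigenvector if it is not zero.\<close>

lemma hautus_controllable:
  assumes "\<And>x \<mu>. x \<in> carrier_vec n \<Longrightarrow> A\<^sup>T *\<^sub>v x = \<mu> \<cdot>\<^sub>v x \<Longrightarrow> B\<^sup>T *\<^sub>v x = 0\<^sub>v q \<Longrightarrow> x = 0\<^sub>v n"
  shows "controllable A B"
proof (rule ccontr)
  let ?N = "annihilator n (reachable_subspace A B)"
  assume "\<not> controllable A B"
  then have nz: "?N \<noteq> {0\<^sub>v n}" by (simp add: controllable_iff_annihilator)
  have sub: "vec_subspace n ?N"
    using vec_subspaceD(1)[OF vec_subspace_reachable] by (rule vec_subspace_annihilator)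
  have inv: "A\<^sup>T *\<^sub>v x \<in> ?N" if "x \<in> ?N" for x
  proof -
    have "(A\<^sup>T *\<^sub>v x) \<bullet> y = 0" if "y \<in> reachable_subspace A B" for y
    proof -
      have "(A\<^sup>T *\<^sub>v x) \<bullet> y = x \<bullet> (A *\<^sub>v y)"
        using A \<open>x \<in> ?N\<close> that vec_subspaceD(5)[OF vec_subspace_reachable that]
        by (intro transpose_scalar_prod) (auto simp: annihilator_def)
      then show ?thesis using reachable_invariant[OF that] \<open>x \<in> ?N\<close> by (auto simp: annihilator_def)
    qed
    then show ?thesis using A that by (auto simp: annihilator_def)
  qed
  obtain x \<mu> where x: "x \<in> ?N" "x \<noteq> 0\<^sub>v n" "A\<^sup>T *\<^sub>v x = \<mu> \<cdot>\<^sub>v x"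
    using invariant_subspace_eigenvector[of "A\<^sup>T" n ?N] A sub inv nz by auto
  have "(A ^\<^sub>m 0 * B)\<^sup>T *\<^sub>v x = 0\<^sub>v q" using x(1) unfolding annihilator_reachable by blast
  then have "B\<^sup>T *\<^sub>v x = 0\<^sub>v q" using A B by simp
  with assms[of x \<mu>] x show False by (auto simp: annihilator_def)
qed

text \<open>Such an eigenvector is orthogonal to every \<open>A ^\<^sub>m i * B\<close>, hence to the reachable subspace.\<close>

lemma controllable_hautus:
  assumes "controllable A B" "x \<in> carrier_vec n" "A\<^sup>T *\<^sub>v x = \<mu> \<cdot>\<^sub>v x" "B\<^sup>T *\<^sub>v x = 0\<^sub>v q"
  shows "x = 0\<^sub>v n"
proof -
  have "(A ^\<^sub>m i * B)\<^sup>T *\<^sub>v x = 0\<^sub>v q" for i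
  proof -
    have "(A\<^sup>T) ^\<^sub>m i *\<^sub>v x = \<mu> ^ i \<cdot>\<^sub>v x"
    proof (induction i)
      case 0
      then show ?case using A assms(2) by simp
    next
      case (Suc i)
      have "A\<^sup>T ^\<^sub>m Suc i *\<^sub>v x = A\<^sup>T *\<^sub>v (A\<^sup>T ^\<^sub>m i *\<^sub>v x)"
        using A assms(2) pow_mat_Suc_left[of "A\<^sup>T" n] by (simp add: mat_mult_vec del: pow_mat.simps)
      then show ?case using Suc A assms(2,3) by (simp add: vec_distrib smult_smult_assoc mult_ac)
    qed
    then show ?thesis
      using A B assms(2,4) by (simp add: mat_transpose_mult transpose_pow_mat[OF A] vec_distrib)
  qed
  then have "x \<in> annihilator n (reachable_subspace A B)"
    using assms(2) by (simp add: annihilator_reachable)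
  with assms(1) show ?thesis by (simp add: controllable_iff_annihilator)
qed

lemma observable_transpose: "observable (B\<^sup>T) (A\<^sup>T) \<longleftrightarrow> controllable A B"
proof -
  have "B\<^sup>T * (A\<^sup>T) ^\<^sub>m i = (A ^\<^sub>m i * B)\<^sup>T" for i
    using A B by (simp add: mat_transpose_mult transpose_pow_mat)
  then have "(\<Inter>i. mat_kernel (B\<^sup>T * (A\<^sup>T) ^\<^sub>m i)) = annihilator n (reachable_subspace A B)"
    using A B by (auto simp: annihilator_reachable mat_kernel_def)
  then show ?thesis using A by (simp add: observable_def controllable_iff_annihilator)
qed

end

lemma controllable_transpose:
  assumes "A \<in> carrier_mat n n" "C \<in> carrier_mat p n"
  shows "controllable (A\<^sup>T) (C\<^sup>T) \<longleftrightarrow> observable C A"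
  using observable_transpose[of "A\<^sup>T" n "C\<^sup>T" p] assms by simp

lemma observable_hautus:
  assumes "A \<in> carrier_mat n n" "C \<in> carrier_mat p n" "observable C A"
    and "x \<in> carrier_vec n" "A *\<^sub>v x = \<mu> \<cdot>\<^sub>v x" "C *\<^sub>v x = 0\<^sub>v p"
  shows "x = 0\<^sub>v n"
  using controllable_hautus[of "A\<^sup>T" n "C\<^sup>T" p x \<mu>] assms by (simp add: controllable_transpose)


section \<open>Trajectories, output-nulling subspaces and their duality\<close>

text \<open>With the input of a transition hidden in the quantifier, \<open>Cstar\<close> and \<open>Vtraj\<close> become the forward closure of the zero state and the largest
  set of states from which one can step forever, and their properties are proved by induction and
  coinduction.\<close>

definition null_step ::
  "complex mat \<Rightarrow> complex mat \<Rightarrow> complex mat \<Rightarrow> complex mat \<Rightarrow> complex vec \<Rightarrow> complex vec \<Rightarrow> bool" where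
  "null_step A B C D x y \<longleftrightarrow> (\<exists>u \<in> carrier_vec (dim_col B).
     y = A *\<^sub>v x + B *\<^sub>v u \<and> C *\<^sub>v x + D *\<^sub>v u = 0\<^sub>v (dim_row C))"

definition Vtraj :: "complex mat \<Rightarrow> complex mat \<Rightarrow> complex mat \<Rightarrow> complex mat \<Rightarrow> complex vec set" where
  "Vtraj A B C D = {x \<in> carrier_vec (dim_row A). \<exists>s :: nat \<Rightarrow> complex vec. s 0 = x \<and>
     (\<forall>j. s j \<in> carrier_vec (dim_row A) \<and> null_step A B C D (s j) (s (Suc j)))}"

locale system =
  fixes A B C D :: "complex mat" and n q p :: nat
  assumes A [simp]: "A \<in> carrier_mat n n" and B [simp]: "B \<in> carrier_mat n q"
    and C [simp]: "C \<in> carrier_mat p n" and D [simp]: "D \<in> carrier_mat p q"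
begin

lemma sys_dims [simp]: "dim_row A = n" "dim_col A = n" "dim_row B = n" "dim_col B = q"
  "dim_row C = p" "dim_col C = n" "dim_row D = p" "dim_col D = q"
  using carrier_matD[OF A] carrier_matD[OF B] carrier_matD[OF C] carrier_matD[OF D] by auto

abbreviation step :: "complex vec \<Rightarrow> complex vec \<Rightarrow> bool" where "step \<equiv> null_step A B C D"

lemma stepI: "u \<in> carrier_vec q \<Longrightarrow> y = A *\<^sub>v x + B *\<^sub>v u \<Longrightarrow> C *\<^sub>v x + D *\<^sub>v u = 0\<^sub>v p \<Longrightarrow> step x y"
  by (auto simp: null_step_def)

lemma stepE:
  assumes "step x y"
  obtains u where "u \<in> carrier_vec q" "y = A *\<^sub>v x + B *\<^sub>v u" "C *\<^sub>v x + D *\<^sub>v u = 0\<^sub>v p"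
  using assms by (auto simp: null_step_def)

lemma step_carrier: "step x y \<Longrightarrow> y \<in> carrier_vec n"
  by (auto simp: null_step_def intro!: carrier_vecI)

lemma step_add:
  assumes "step x y" "step x' y'" "x \<in> carrier_vec n" "x' \<in> carrier_vec n"
  shows "step (x + x') (y + y')"
proof -
  from assms(1) obtain u where u: "u \<in> carrier_vec q" "y = A *\<^sub>v x + B *\<^sub>v u" "C *\<^sub>v x + D *\<^sub>v u = 0\<^sub>v p"
    by (rule stepE)
  from assms(2) obtain u' where u': "u' \<in> carrier_vec q" "y' = A *\<^sub>v x' + B *\<^sub>v u'" "C *\<^sub>v x' + D *\<^sub>v u' = 0\<^sub>v p"
    by (rule stepE)
  show ?thesis
  proof (rule stepI[of "u + u'"])
    show "y + y' = A *\<^sub>v (x + x') + B *\<^sub>v (u + u')"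
      by (rule eq_vecI) (use u u' assms(3,4) in \<open>auto simp: vec_distrib simp del: index_mult_mat_vec\<close>)
    have "C *\<^sub>v (x + x') + D *\<^sub>v (u + u') = (C *\<^sub>v x + D *\<^sub>v u) + (C *\<^sub>v x' + D *\<^sub>v u')"
      by (rule eq_vecI) (use u(1) u'(1) assms(3,4) in \<open>auto simp: vec_distrib simp del: index_mult_mat_vec\<close>)
    then show "C *\<^sub>v (x + x') + D *\<^sub>v (u + u') = 0\<^sub>v p" by (simp add: u u')
  qed (use u u' in auto)
qed

lemma step_smult:
  assumes "step x y" "x \<in> carrier_vec n"
  shows "step (c \<cdot>\<^sub>v x) (c \<cdot>\<^sub>v y)"
proof -
  from assms(1) obtain u where u: "u \<in> carrier_vec q" "y = A *\<^sub>v x + B *\<^sub>v u" "C *\<^sub>v x + D *\<^sub>v u = 0\<^sub>v p"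
    by (rule stepE)
  show ?thesis
  proof (rule stepI[of "c \<cdot>\<^sub>v u"])
    show "c \<cdot>\<^sub>v y = A *\<^sub>v (c \<cdot>\<^sub>v x) + B *\<^sub>v (c \<cdot>\<^sub>v u)"
      by (rule eq_vecI) (use u assms(2) in \<open>auto simp: vec_distrib algebra_simps simp del: index_mult_mat_vec\<close>)
    have "C *\<^sub>v (c \<cdot>\<^sub>v x) + D *\<^sub>v (c \<cdot>\<^sub>v u) = c \<cdot>\<^sub>v (C *\<^sub>v x + D *\<^sub>v u)"
      by (rule eq_vecI) (use u(1) assms(2) in \<open>auto simp: vec_distrib algebra_simps simp del: index_mult_mat_vec\<close>)
    then show "C *\<^sub>v (c \<cdot>\<^sub>v x) + D *\<^sub>v (c \<cdot>\<^sub>v u) = 0\<^sub>v p" by (simp add: u)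
  qed (use u in auto)
qed

lemma step_zero: "step (0\<^sub>v n) (0\<^sub>v n)"
  by (rule stepI[of "0\<^sub>v q"]) (auto simp: vec_distrib)

lemma zero_Cstar: "0\<^sub>v n \<in> Cstar A B C D"
proof -
  have "\<exists>(k :: nat) (u :: int \<Rightarrow> complex vec) (s :: int \<Rightarrow> complex vec).
     s (- int k) = 0\<^sub>v n \<and>
     (\<forall>j \<in> {- int k..0}. u j \<in> carrier_vec q \<and> s (j + 1) = A *\<^sub>v s j + B *\<^sub>v u j \<and>
        C *\<^sub>v s j + D *\<^sub>v u j = 0\<^sub>v p) \<and> s 1 = 0\<^sub>v n"
    by (intro exI[of _ 0] exI[of _ "\<lambda>_. 0\<^sub>v q"] exI[of _ "\<lambda>_. 0\<^sub>v n"]) (auto simp: vec_distrib)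
  then show ?thesis by (simp add: Cstar_def)
qed

text \<open>The trajectory that ends in \<open>x\<close> is shifted one step into the past and prolonged by \<open>y\<close>.\<close>

lemma Cstar_step:
  assumes x: "x \<in> Cstar A B C D" and st: "step x y"
  shows "y \<in> Cstar A B C D"
proof -
  from x obtain k :: nat and u s :: "int \<Rightarrow> complex vec" where s: "s (- int k) = 0\<^sub>v n" "s 1 = x"
    and step: "\<forall>j \<in> {- int k..0}. u j \<in> carrier_vec q \<and> s (j + 1) = A *\<^sub>v s j + B *\<^sub>v u j \<and>
        C *\<^sub>v s j + D *\<^sub>v u j = 0\<^sub>v p"
    unfolding Cstar_def sys_dims by blast
  from st obtain w where w: "w \<in> carrier_vec q" "y = A *\<^sub>v x + B *\<^sub>v w" "C *\<^sub>v x + D *\<^sub>v w = 0\<^sub>v p"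
    by (rule stepE)
  define u' where "u' j = (if j = 0 then w else u (j + 1))" for j :: int
  define s' where "s' j = (if j = 1 then y else s (j + 1))" for j :: int
  have "u' j \<in> carrier_vec q \<and> s' (j + 1) = A *\<^sub>v s' j + B *\<^sub>v u' j \<and>
        C *\<^sub>v s' j + D *\<^sub>v u' j = 0\<^sub>v p" if j: "j \<in> {- int (Suc k)..0}" for j
  proof (cases "j = 0")
    case True
    then show ?thesis using w s by (simp add: u'_def s'_def)
  next
    case False
    then have "j + 1 \<in> {- int k..0}" using j by auto
    from step[rule_format, OF this] False j show ?thesis by (auto simp: u'_def s'_def)
  qed
  moreover have "s' (- int (Suc k)) = 0\<^sub>v n" "s' 1 = y" using s by (auto simp: s'_def)
  ultimately show ?thesis
    unfolding Cstar_def mem_Collect_eq sys_dims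
    by (intro exI[of _ "Suc k"] exI[of _ u'] exI[of _ s']) auto
qed

lemma Cstar_induct [consumes 1, case_names zero step]:
  assumes x: "x \<in> Cstar A B C D" and zero: "P (0\<^sub>v n)"
    and step: "\<And>x y. x \<in> Cstar A B C D \<Longrightarrow> x \<in> carrier_vec n \<Longrightarrow> P x \<Longrightarrow> null_step A B C D x y \<Longrightarrow> P y"
  shows "P x"
proof -
  from x obtain k :: nat and u s :: "int \<Rightarrow> complex vec" where s: "s (- int k) = 0\<^sub>v n" "s 1 = x"
    and st: "\<forall>j \<in> {- int k..0}. u j \<in> carrier_vec q \<and> s (j + 1) = A *\<^sub>v s j + B *\<^sub>v u j \<and>
        C *\<^sub>v s j + D *\<^sub>v u j = 0\<^sub>v p"
    unfolding Cstar_def sys_dims by blast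
  have "s (- int k + int i) \<in> Cstar A B C D \<and> s (- int k + int i) \<in> carrier_vec n \<and>
      P (s (- int k + int i))" if "i \<le> Suc k" for i
    using that
  proof (induction i)
    case 0
    then show ?case using s zero zero_Cstar by simp
  next
    case (Suc i)
    define j where "j = - int k + int i"
    have "j \<in> {- int k..0}" using Suc.prems by (auto simp: j_def)
    from st[rule_format, OF this] have "null_step A B C D (s j) (s (j + 1))"
      by (intro stepI[of "u j"]) auto
    with Suc j_def have "s (j + 1) \<in> Cstar A B C D \<and> s (j + 1) \<in> carrier_vec n \<and> P (s (j + 1))"
      using Cstar_step step step_carrier by auto
    then show ?case by (simp add: j_def add_ac)
  qed
  from this[of "Suc k"] s show "P x" by simp
qed

lemma Cstar_subset: "Cstar A B C D \<subseteq> carrier_vec n"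
proof
  fix x assume "x \<in> Cstar A B C D"
  then show "x \<in> carrier_vec n" by (induction rule: Cstar_induct) (auto dest: step_carrier)
qed

lemma vec_subspace_Cstar: "vec_subspace n (Cstar A B C D)"
proof -
  \<comment> \<open>Trajectories of different lengths are added after padding the shorter one with zeros.\<close>
  define R where "R k = {x. (step ^^ k) (0\<^sub>v n) x}" for k
  have R0: "R 0 = {0\<^sub>v n}" by (auto simp: R_def)
  have RSuc: "y \<in> R (Suc k) \<longleftrightarrow> (\<exists>x\<in>R k. step x y)" for k y
    by (auto simp: R_def)
  have R_carrier: "R k \<subseteq> carrier_vec n" for k
    by (cases k) (auto simp: R0 RSuc dest: step_carrier)
  have mono: "R k \<subseteq> R (Suc k)" for k
  proof (induction k)
    case 0
    then show ?case using step_zero by (auto simp: R0 RSuc)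
  next
    case (Suc k)
    show ?case
    proof
      fix y assume "y \<in> R (Suc k)"
      then obtain x where "x \<in> R k" "step x y" by (auto simp: RSuc)
      with Suc show "y \<in> R (Suc (Suc k))" by (subst RSuc) auto
    qed
  qed
  have Cstar: "Cstar A B C D = (\<Union>k. R k)"
  proof
    show "Cstar A B C D \<subseteq> (\<Union>k. R k)"
    proof
      fix x assume "x \<in> Cstar A B C D"
      then show "x \<in> (\<Union>k. R k)"
        by (induction rule: Cstar_induct) (use R0 RSuc in blast)+
    qed
    have "R k \<subseteq> Cstar A B C D" for k
    proof (induction k)
      case (Suc k)
      then show ?case using Cstar_step unfolding RSuc subset_iff by blast
    qed (simp add: R0 zero_Cstar)
    then show "(\<Union>k. R k) \<subseteq> Cstar A B C D" by blast
  qed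
  have mono': "R k \<subseteq> R l" if "k \<le> l" for k l
    using lift_Suc_mono_le[of R, OF mono that] .
  have add: "x + y \<in> R k" if "x \<in> R k" "y \<in> R k" for x y k
    using that
  proof (induction k arbitrary: x y)
    case (Suc k)
    then show ?case using step_add R_carrier unfolding RSuc by blast
  qed (auto simp: R0)
  have smult: "c \<cdot>\<^sub>v x \<in> R k" if "x \<in> R k" for c x k
    using that
  proof (induction k arbitrary: x)
    case (Suc k)
    then show ?case using step_smult R_carrier unfolding RSuc by blast
  qed (auto simp: R0)
  show ?thesis
  proof
    fix x y assume "x \<in> Cstar A B C D" "y \<in> Cstar A B C D"
    then obtain k l where "x \<in> R k" "y \<in> R l" by (auto simp: Cstar)
    then have "x \<in> R (max k l)" "y \<in> R (max k l)" using mono' by (meson max.cobounded1 max.cobounded2 subsetD)+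
    then show "x + y \<in> Cstar A B C D" using add by (auto simp: Cstar)
  next
    fix c x assume "x \<in> Cstar A B C D"
    then show "c \<cdot>\<^sub>v x \<in> Cstar A B C D" using smult unfolding Cstar by blast
  qed (use Cstar_subset zero_Cstar in auto)
qed


lemma Vtraj_carrier: "Vtraj A B C D \<subseteq> carrier_vec n"
  by (auto simp: Vtraj_def)

lemma Vtraj_step:
  assumes "x \<in> Vtraj A B C D"
  obtains y where "y \<in> Vtraj A B C D" "step x y"
proof -
  from assms obtain s :: "nat \<Rightarrow> complex vec" where s: "s 0 = x"
    "\<And>j. s j \<in> carrier_vec n \<and> step (s j) (s (Suc j))"
    by (auto simp: Vtraj_def)
  have "s 1 \<in> Vtraj A B C D"
    unfolding Vtraj_def by (auto simp: s intro!: exI[of _ "\<lambda>j. s (Suc j)"])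
  with that[of "s 1"] s(2)[of 0] s(1) show thesis by simp
qed

lemma Vtraj_coinduct:
  assumes x: "x \<in> W" and W: "W \<subseteq> carrier_vec n" and st: "\<And>x. x \<in> W \<Longrightarrow> \<exists>y\<in>W. step x y"
  shows "x \<in> Vtraj A B C D"
proof -
  have "\<exists>s. \<forall>j. (s j \<in> W \<and> (j = 0 \<longrightarrow> s j = x)) \<and> step (s j) (s (Suc j))"
    by (rule dependent_nat_choice[where P = "\<lambda>j y. y \<in> W \<and> (j = 0 \<longrightarrow> y = x)" and Q = "\<lambda>j y z. step y z"])
      (use x st in auto)
  then show ?thesis using W by (auto simp: Vtraj_def subset_iff)
qed

lemma Vtraj_back:
  assumes "step x y" "y \<in> Vtraj A B C D" "x \<in> carrier_vec n"
  shows "x \<in> Vtraj A B C D"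
proof (rule Vtraj_coinduct[of _ "insert x (Vtraj A B C D)"])
  fix z assume "z \<in> insert x (Vtraj A B C D)"
  then show "\<exists>y\<in>insert x (Vtraj A B C D). step z y"
    using assms(1,2) by (auto elim: Vtraj_step)
qed (use assms Vtraj_carrier in auto)

lemma vec_subspace_Vtraj: "vec_subspace n (Vtraj A B C D)"
proof
  show "0\<^sub>v n \<in> Vtraj A B C D"
    by (rule Vtraj_coinduct[of _ "{0\<^sub>v n}"]) (auto intro: step_zero)
next
  fix x y assume xy: "x \<in> Vtraj A B C D" "y \<in> Vtraj A B C D"
  show "x + y \<in> Vtraj A B C D"
  proof (rule Vtraj_coinduct[of _ "{x + y | x y. x \<in> Vtraj A B C D \<and> y \<in> Vtraj A B C D}"])
    fix z assume "z \<in> {x + y | x y. x \<in> Vtraj A B C D \<and> y \<in> Vtraj A B C D}"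
    then obtain x y where z: "z = x + y" "x \<in> Vtraj A B C D" "y \<in> Vtraj A B C D" by auto
    obtain x' where x': "x' \<in> Vtraj A B C D" "step x x'" using z(2) by (rule Vtraj_step)
    obtain y' where y': "y' \<in> Vtraj A B C D" "step y y'" using z(3) by (rule Vtraj_step)
    have "step z (x' + y')" unfolding z(1)
      by (rule step_add) (use x' y' z Vtraj_carrier in auto)
    then show "\<exists>y\<in>{x + y | x y. x \<in> Vtraj A B C D \<and> y \<in> Vtraj A B C D}. step z y"
      using x' y' by blast
  next
    show "{x + y | x y. x \<in> Vtraj A B C D \<and> y \<in> Vtraj A B C D} \<subseteq> carrier_vec n"
      using Vtraj_carrier by (auto intro!: add_carrier_vec)
  qed (use xy in auto)
next
  fix c x assume x: "x \<in> Vtraj A B C D"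
  show "c \<cdot>\<^sub>v x \<in> Vtraj A B C D"
  proof (rule Vtraj_coinduct[of _ "{c \<cdot>\<^sub>v x | x. x \<in> Vtraj A B C D}"])
    fix z assume "z \<in> {c \<cdot>\<^sub>v x | x. x \<in> Vtraj A B C D}"
    then obtain x where z: "z = c \<cdot>\<^sub>v x" "x \<in> Vtraj A B C D" by auto
    obtain x' where x': "x' \<in> Vtraj A B C D" "step x x'" using z(2) by (rule Vtraj_step)
    have "step z (c \<cdot>\<^sub>v x')" unfolding z(1)
      by (rule step_smult) (use x' z Vtraj_carrier in auto)
    then show "\<exists>y\<in>{c \<cdot>\<^sub>v x | x. x \<in> Vtraj A B C D}. step z y" using x' by blast
  qed (use x Vtraj_carrier in auto)
qed (rule Vtraj_carrier)

text \<open>Choosing an input for each column of \<open>M\<close> turns pointwise steps into the matrix equations that appear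
  in the right and left constructions; \<open>matrix_steps\<close> is the converse.\<close>

lemma steps_matrix:
  assumes M: "M \<in> carrier_mat n m" and M': "M' \<in> carrier_mat n m'"
    and st: "\<And>x. x \<in> mat_range M \<Longrightarrow> \<exists>y\<in>mat_range M'. step x y"
  obtains H L where "H \<in> carrier_mat q m" "L \<in> carrier_mat m' m"
    "A * M + B * H = M' * L" "C * M + D * H = 0\<^sub>m p m"
proof -
  have "\<exists>u l. u \<in> carrier_vec q \<and> l \<in> carrier_vec m' \<and> A *\<^sub>v col M j + B *\<^sub>v u = M' *\<^sub>v l \<and>
      C *\<^sub>v col M j + D *\<^sub>v u = 0\<^sub>v p" if j: "j < m" for j
  proof -
    have "col M j = M *\<^sub>v unit_vec m j" using M j by (auto intro!: eq_vecI)
    then have "col M j \<in> mat_range M" using M by (auto simp: mat_range_def)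
    from st[OF this] obtain y where y: "y \<in> mat_range M'" "step (col M j) y" by auto
    from y(2) show ?thesis
      by (rule stepE) (use y(1) M' in \<open>auto simp: mem_mat_range\<close>)
  qed
  then obtain u l where ul: "\<And>j. j < m \<Longrightarrow> u j \<in> carrier_vec q \<and> l j \<in> carrier_vec m' \<and>
      A *\<^sub>v col M j + B *\<^sub>v u j = M' *\<^sub>v l j \<and> C *\<^sub>v col M j + D *\<^sub>v u j = 0\<^sub>v p"
    by metis
  define H where "H = mat q m (\<lambda>(i, j). u j $ i)"
  define L where "L = mat m' m (\<lambda>(i, j). l j $ i)"
  have H: "H \<in> carrier_mat q m" and L: "L \<in> carrier_mat m' m" by (auto simp: H_def L_def)
  have cols: "col H j = u j" "col L j = l j" if "j < m" for j
    using ul[OF that] that by (auto simp: H_def L_def intro!: eq_vecI)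
  show thesis
  proof (rule that[OF H L])
    show "A * M + B * H = M' * L"
    proof (rule eq_matI)
      fix i j assume "i < dim_row (M' * L)" "j < dim_col (M' * L)"
      then have ij: "i < n" "j < m" using M' L by auto
      have "(A *\<^sub>v col M j + B *\<^sub>v u j) $ i = (M' *\<^sub>v l j) $ i" using ul[OF ij(2)] by simp
      then show "(A * M + B * H) $$ (i, j) = (M' * L) $$ (i, j)"
        using ij M M' H L cols[OF ij(2)] by simp
    qed (use M M' H L in auto)
    show "C * M + D * H = 0\<^sub>m p m"
    proof (rule eq_matI)
      fix i j assume "i < dim_row (0\<^sub>m p m :: complex mat)" "j < dim_col (0\<^sub>m p m :: complex mat)"
      then have ij: "i < p" "j < m" by auto
      have "(C *\<^sub>v col M j + D *\<^sub>v u j) $ i = 0\<^sub>v p $ i" using ul[OF ij(2)] by simp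
      then show "(C * M + D * H) $$ (i, j) = 0\<^sub>m p m $$ (i, j)"
        using ij M H cols[OF ij(2)] by simp
    qed (use M H in auto)
  qed
qed

lemma matrix_steps:
  assumes "M \<in> carrier_mat n m" "M' \<in> carrier_mat n m'" "H \<in> carrier_mat q m" "L \<in> carrier_mat m' m"
    and eqs: "A * M + B * H = M' * L" "C * M + D * H = 0\<^sub>m p m" and v: "v \<in> carrier_vec m"
  shows "step (M *\<^sub>v v) (M' *\<^sub>v (L *\<^sub>v v))"
proof (rule stepI[of "H *\<^sub>v v"])
  have "(A * M + B * H) *\<^sub>v v = (M' * L) *\<^sub>v v" by (simp add: eqs)
  then show "M' *\<^sub>v (L *\<^sub>v v) = A *\<^sub>v (M *\<^sub>v v) + B *\<^sub>v (H *\<^sub>v v)"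
    using assms(1-4) v by (simp add: vec_distrib)
  have "(C * M + D * H) *\<^sub>v v = 0\<^sub>v p" using v by (simp add: eqs zero_mat_mult_vec)
  then show "C *\<^sub>v (M *\<^sub>v v) + D *\<^sub>v (H *\<^sub>v v) = 0\<^sub>v p"
    using assms(1-4) v by (simp add: vec_distrib)
qed (use assms in auto)

lemma Vtraj_of_matrix:
  assumes "M \<in> carrier_mat n m" "H \<in> carrier_mat q m" "L \<in> carrier_mat m m"
    and "A * M + B * H = M * L" "C * M + D * H = 0\<^sub>m p m"
  shows "mat_range M \<subseteq> Vtraj A B C D"
proof
  fix x assume x: "x \<in> mat_range M"
  show "x \<in> Vtraj A B C D"
  proof (rule Vtraj_coinduct[OF x])
    show "mat_range M \<subseteq> carrier_vec n" using vec_subspace_mat_range[OF assms(1)] vec_subspaceD by blast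
    fix y assume "y \<in> mat_range M"
    then obtain v where v: "v \<in> carrier_vec m" "y = M *\<^sub>v v" using assms by (auto simp: mem_mat_range)
    show "\<exists>z\<in>mat_range M. step y z"
      using matrix_steps[OF assms(1,1,2,3,4,5) v(1)] v assms(1,3)
      by (intro bexI[of _ "M *\<^sub>v (L *\<^sub>v v)"]) (auto simp: mem_mat_range intro!: bexI[of _ "L *\<^sub>v v"])
  qed
qed

text \<open>For a basis matrix \<open>M\<close> of \<open>Vtraj\<close> with left inverse \<open>N\<close>, inputs \<open>H\<close> that keep the columns of \<open>M\<close>
  inside \<open>Vtraj\<close> give the feedback \<open>H * N\<close>. Conversely, an output-nulling subspace is closed under
  the steps defined by its feedback.\<close>

lemma Vstar_eq_Vtraj: "Vstar A B C D = Vtraj A B C D"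
  unfolding Vstar_def
proof (rule Greatest_equality[where P = "output_nulling A B C D"])
  let ?V = "Vtraj A B C D"
  obtain m M where M: "M \<in> carrier_mat n m" "mat_range M = ?V"
    and inj: "\<And>v. v \<in> carrier_vec m \<Longrightarrow> M *\<^sub>v v = 0\<^sub>v n \<Longrightarrow> v = 0\<^sub>v m"
    by (rule vec_subspace_basis[OF vec_subspace_Vtraj]) (rule that)
  obtain N where N: "N \<in> carrier_mat m n" "N * M = 1\<^sub>m m"
    by (rule injective_left_inverse[OF M(1) inj])
  obtain H L where HL: "H \<in> carrier_mat q m" "L \<in> carrier_mat m m"
    "A * M + B * H = M * L" "C * M + D * H = 0\<^sub>m p m"
  proof (rule steps_matrix[OF M(1) M(1)])
    fix x assume "x \<in> mat_range M"
    then show "\<exists>y\<in>mat_range M. step x y" unfolding M(2) using Vtraj_step by blast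
  qed
  show "output_nulling A B C D ?V"
    unfolding output_nulling_def subspace_iff_vec_subspace sys_dims
  proof (intro conjI bexI[of _ "H * N"] subsetI)
    show "H * N \<in> carrier_mat q n" using HL N by simp
    have AK: "(A + B * (H * N)) * M = M * L"
      using HL M N by (simp add: mat_distrib)
    have CK: "(C + D * (H * N)) * M = 0\<^sub>m p m"
      using HL M N by (simp add: mat_distrib)
    fix x
    {
      assume "x \<in> (\<lambda>v. (A + B * (H * N)) *\<^sub>v v) ` ?V"
      then obtain v where v: "v \<in> carrier_vec m" "x = (A + B * (H * N)) *\<^sub>v (M *\<^sub>v v)"
        unfolding M(2)[symmetric] using M(1) by (auto simp: mat_range_def)
      have "x = ((A + B * (H * N)) * M) *\<^sub>v v"
        using v(1) M(1) HL(1) N(1) unfolding v(2) by (subst mat_mult_vec) auto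
      then have "x = M *\<^sub>v (L *\<^sub>v v)" unfolding AK using v(1) M(1) HL by (simp add: mat_mult_vec)
      then show "x \<in> ?V" unfolding M(2)[symmetric] using M(1) HL v(1) by (auto simp: mat_range_def)
    }
    assume "x \<in> ?V"
    then obtain v where v: "v \<in> carrier_vec m" "x = M *\<^sub>v v"
      unfolding M(2)[symmetric] using M(1) by (auto simp: mat_range_def)
    have "(C + D * (H * N)) *\<^sub>v x = ((C + D * (H * N)) * M) *\<^sub>v v"
      using v(1) M(1) HL(1) N(1) unfolding v(2) by (subst mat_mult_vec) auto
    then have "(C + D * (H * N)) *\<^sub>v x = 0\<^sub>v p" unfolding CK using v(1) by (simp add: zero_mat_mult_vec)
    then show "x \<in> mat_kernel (C + D * (H * N))"
      using v M N HL by (auto simp: mat_kernel_def)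
  qed (rule vec_subspace_Vtraj)
next
  fix V assume "output_nulling A B C D V"
  then obtain K where V: "vec_subspace n V" and K: "K \<in> carrier_mat q n"
    and inv: "(\<lambda>v. (A + B * K) *\<^sub>v v) ` V \<subseteq> V" and ker: "V \<subseteq> mat_kernel (C + D * K)"
    unfolding output_nulling_def subspace_iff_vec_subspace sys_dims by blast
  show "V \<le> Vtraj A B C D"
  proof
    fix x assume x: "x \<in> V"
    show "x \<in> Vtraj A B C D"
    proof (rule Vtraj_coinduct[OF x])
      show "V \<subseteq> carrier_vec n" using V by (rule vec_subspaceD)
      fix y assume y: "y \<in> V"
      then have yc: "y \<in> carrier_vec n" using V vec_subspaceD by blast
      have "step y ((A + B * K) *\<^sub>v y)"
      proof (rule stepI[of "K *\<^sub>v y"])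
        show "C *\<^sub>v y + D *\<^sub>v (K *\<^sub>v y) = 0\<^sub>v p"
          using ker y yc K by (auto simp: mat_kernel_def vec_distrib subset_iff)
      qed (use yc K in \<open>auto simp: vec_distrib\<close>)
      with inv y show "\<exists>z\<in>V. step y z" by blast
    qed
  qed
qed

lemma system_transpose: "system (A\<^sup>T) (C\<^sup>T) (B\<^sup>T) (D\<^sup>T) n p q"
  by unfold_locales auto

text \<open>Along a step from \<open>x\<close> to \<open>x'\<close> of the system and a step from \<open>y\<close> to \<open>y'\<close> of the transposed system, both with
  zero output, one has \<open>y \<bullet> x' = y' \<bullet> x\<close>; induction gives one inclusion. For the other one, the input that
  keeps a state of the transposed system orthogonal to \<open>Cstar\<close> solves a linear equation, which is solvable
  because its right hand side is orthogonal to the kernel of the transpose.\<close>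

lemma Vtraj_transpose: "Vtraj (A\<^sup>T) (C\<^sup>T) (B\<^sup>T) (D\<^sup>T) = annihilator n (Cstar A B C D)"
proof -
  interpret T: system "A\<^sup>T" "C\<^sup>T" "B\<^sup>T" "D\<^sup>T" n p q by (rule system_transpose)
  show ?thesis
  proof
    have "\<forall>y \<in> Vtraj (A\<^sup>T) (C\<^sup>T) (B\<^sup>T) (D\<^sup>T). y \<bullet> x = 0" if "x \<in> Cstar A B C D" for x
      using that
    proof (induction rule: Cstar_induct)
      case zero
      then show ?case using T.Vtraj_carrier by auto
    next
      case (step x x')
      show ?case
      proof
        fix y assume y: "y \<in> Vtraj (A\<^sup>T) (C\<^sup>T) (B\<^sup>T) (D\<^sup>T)"
        then have yc: "y \<in> carrier_vec n" using T.Vtraj_carrier by auto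
        obtain y' where y': "y' \<in> Vtraj (A\<^sup>T) (C\<^sup>T) (B\<^sup>T) (D\<^sup>T)" "T.step y y'"
          using y by (rule T.Vtraj_step)
        obtain w where w: "w \<in> carrier_vec p" "y' = A\<^sup>T *\<^sub>v y + C\<^sup>T *\<^sub>v w" "B\<^sup>T *\<^sub>v y + D\<^sup>T *\<^sub>v w = 0\<^sub>v q"
          using y'(2) by (rule T.stepE)
        obtain u where u: "u \<in> carrier_vec q" "x' = A *\<^sub>v x + B *\<^sub>v u" "C *\<^sub>v x + D *\<^sub>v u = 0\<^sub>v p"
          using \<open>null_step A B C D x x'\<close> by (rule stepE)
        have xc: "x \<in> carrier_vec n" using step by simp
        have 1: "y' \<bullet> x = y \<bullet> (A *\<^sub>v x) + w \<bullet> (C *\<^sub>v x)"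
          unfolding w(2) using xc yc w(1)
          by (subst add_scalar_prod_distrib[of _ n]) (auto simp: transpose_scalar_prod)
        have 2: "0 = y \<bullet> (B *\<^sub>v u) + w \<bullet> (D *\<^sub>v u)"
        proof -
          have "(B\<^sup>T *\<^sub>v y + D\<^sup>T *\<^sub>v w) \<bullet> u = y \<bullet> (B *\<^sub>v u) + w \<bullet> (D *\<^sub>v u)"
            using u(1) yc w(1)
            by (subst add_scalar_prod_distrib[of _ q]) (auto simp: transpose_scalar_prod)
          then show ?thesis using u(1) by (simp add: w(3))
        qed
        have 3: "w \<bullet> (C *\<^sub>v x) + w \<bullet> (D *\<^sub>v u) = 0"
        proof -
          have "w \<bullet> (C *\<^sub>v x + D *\<^sub>v u) = w \<bullet> (C *\<^sub>v x) + w \<bullet> (D *\<^sub>v u)"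
            using u(1) xc w(1) by (intro scalar_prod_add_distrib[of _ p]) auto
          then show ?thesis using w(1) by (simp add: u(3))
        qed
        have "y \<bullet> x' = y \<bullet> (A *\<^sub>v x) + y \<bullet> (B *\<^sub>v u)"
          unfolding u(2) using u(1) xc yc by (intro scalar_prod_add_distrib[of _ n]) auto
        moreover have "y' \<bullet> x = 0" using step y'(1) by blast
        then have "y \<bullet> (A *\<^sub>v x) = - (w \<bullet> (C *\<^sub>v x))" using 1 by (simp add: eq_neg_iff_add_eq_0)
        moreover have "y \<bullet> (B *\<^sub>v u) = - (w \<bullet> (D *\<^sub>v u))" using 2 by (simp add: eq_neg_iff_add_eq_0)
        ultimately show "y \<bullet> x' = 0" using 3 by (simp add: neg_eq_iff_add_eq_0 add_eq_0_iff)
      qed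
    qed
    then show "Vtraj (A\<^sup>T) (C\<^sup>T) (B\<^sup>T) (D\<^sup>T) \<subseteq> annihilator n (Cstar A B C D)"
      using T.Vtraj_carrier by (auto simp: annihilator_def)
  next
    obtain m M where M: "M \<in> carrier_mat n m" "mat_range M = Cstar A B C D"
      and "\<And>v. v \<in> carrier_vec m \<Longrightarrow> M *\<^sub>v v = 0\<^sub>v n \<Longrightarrow> v = 0\<^sub>v m"
      by (rule vec_subspace_basis[OF vec_subspace_Cstar]) (rule that)
    show "annihilator n (Cstar A B C D) \<subseteq> Vtraj (A\<^sup>T) (C\<^sup>T) (B\<^sup>T) (D\<^sup>T)"
    proof (rule subsetI, rule T.Vtraj_coinduct)
      fix y assume y: "y \<in> annihilator n (Cstar A B C D)"
      then have yc: "y \<in> carrier_vec n" by (simp add: annihilator_def)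
      \<comment> \<open>The input \<open>w\<close> of the transposed system has to solve \<open>E\<^sup>T *\<^sub>v w = - (G\<^sup>T *\<^sub>v y)\<close>: the first block keeps
        the next state orthogonal to \<open>Cstar\<close>, the second one makes the output zero.\<close>
      define E where "E = (C * M) @\<^sub>c D"
      define G where "G = (A * M) @\<^sub>c B"
      have E: "E \<in> carrier_mat p (m + q)" and G: "G \<in> carrier_mat n (m + q)"
        using M unfolding E_def G_def by (auto intro!: append_cols_carrier)
      define c where "c = - (G\<^sup>T *\<^sub>v y)"
      have c: "c \<in> carrier_vec (m + q)" using G by (auto simp: c_def)
      have orth: "x \<bullet> c = 0" if x: "x \<in> carrier_vec (m + q)" "E *\<^sub>v x = 0\<^sub>v p" for x
      proof -
        obtain a u where au: "a \<in> carrier_vec m" "u \<in> carrier_vec q" "x = a @\<^sub>v u"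
          using x(1) by (rule vec_split)
        have "C *\<^sub>v (M *\<^sub>v a) + D *\<^sub>v u = 0\<^sub>v p"
          using x(2) M(1) au append_cols_mult_vec[of "C * M" p m D q a u]
          by (simp add: E_def mat_mult_vec)
        then have "step (M *\<^sub>v a) (A *\<^sub>v (M *\<^sub>v a) + B *\<^sub>v u)"
          using au by (intro stepI[of u]) auto
        moreover have "M *\<^sub>v a \<in> Cstar A B C D" unfolding M(2)[symmetric] using M(1) au by (auto simp: mat_range_def)
        ultimately have "A *\<^sub>v (M *\<^sub>v a) + B *\<^sub>v u \<in> Cstar A B C D" using Cstar_step by blast
        moreover have "G *\<^sub>v x = A *\<^sub>v (M *\<^sub>v a) + B *\<^sub>v u"
          using M au append_cols_mult_vec[of "A * M" n m B q a u]
          by (simp add: G_def mat_mult_vec)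
        ultimately have "y \<bullet> (G *\<^sub>v x) = 0" using y by (auto simp: annihilator_def)
        then have "(G\<^sup>T *\<^sub>v y) \<bullet> x = 0" using G x yc by (subst transpose_scalar_prod) auto
        then have "x \<bullet> (G\<^sup>T *\<^sub>v y) = 0" using G x yc comm_scalar_prod[of x "m + q" "G\<^sup>T *\<^sub>v y"] by auto
        then show ?thesis using x G yc by (simp add: c_def)
      qed
      obtain w where w: "w \<in> carrier_vec p" "E\<^sup>T *\<^sub>v w = c"
        by (rule transpose_solvable[OF E c orth])
      have ET: "E\<^sup>T *\<^sub>v w = (M\<^sup>T *\<^sub>v (C\<^sup>T *\<^sub>v w)) @\<^sub>v (D\<^sup>T *\<^sub>v w)"
        using M w append_rows_mult_vec[of "(C * M)\<^sup>T" m p "D\<^sup>T" q w]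
        by (simp add: E_def append_cols_transpose[of _ p m _ q] mat_transpose_mult mat_mult_vec)
      have GT: "G\<^sup>T *\<^sub>v y = (M\<^sup>T *\<^sub>v (A\<^sup>T *\<^sub>v y)) @\<^sub>v (B\<^sup>T *\<^sub>v y)"
        using M yc append_rows_mult_vec[of "(A * M)\<^sup>T" m n "B\<^sup>T" q y]
        by (simp add: G_def append_cols_transpose[of _ n m _ q] mat_transpose_mult mat_mult_vec)
      have "E\<^sup>T *\<^sub>v w + G\<^sup>T *\<^sub>v y = 0\<^sub>v (m + q)"
        unfolding w(2) c_def using G by (intro eq_vecI) auto
      then have "(M\<^sup>T *\<^sub>v (C\<^sup>T *\<^sub>v w) + M\<^sup>T *\<^sub>v (A\<^sup>T *\<^sub>v y)) @\<^sub>v (D\<^sup>T *\<^sub>v w + B\<^sup>T *\<^sub>v y) = 0\<^sub>v (m + q)"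
        unfolding ET GT using M w(1) yc
        by (subst append_vec_add[symmetric, of _ m _ _ q]) auto
      then have zero: "M\<^sup>T *\<^sub>v (C\<^sup>T *\<^sub>v w) + M\<^sup>T *\<^sub>v (A\<^sup>T *\<^sub>v y) = 0\<^sub>v m" "D\<^sup>T *\<^sub>v w + B\<^sup>T *\<^sub>v y = 0\<^sub>v q"
        using M w(1) yc by (auto simp: append_vec_zero_iff[of _ m _ q])
      define z where "z = A\<^sup>T *\<^sub>v y + C\<^sup>T *\<^sub>v w"
      have zc: "z \<in> carrier_vec n" by (auto simp: z_def)
      have "T.step y z"
      proof (rule T.stepI[OF w(1)])
        have "B\<^sup>T *\<^sub>v y + D\<^sup>T *\<^sub>v w = D\<^sup>T *\<^sub>v w + B\<^sup>T *\<^sub>v y" by (rule comm_add_vec[of _ q]) auto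
        with zero show "B\<^sup>T *\<^sub>v y + D\<^sup>T *\<^sub>v w = 0\<^sub>v q" by simp
      qed (simp add: z_def)
      moreover have "z \<in> annihilator n (Cstar A B C D)"
      proof -
        have "z \<bullet> (M *\<^sub>v v) = 0" if v: "v \<in> carrier_vec m" for v
        proof -
          have "M\<^sup>T *\<^sub>v z = M\<^sup>T *\<^sub>v (C\<^sup>T *\<^sub>v w) + M\<^sup>T *\<^sub>v (A\<^sup>T *\<^sub>v y)"
            unfolding z_def using M by (subst comm_add_vec[of _ n]) (auto simp: mat_mult_vec_add)
          then have "(M\<^sup>T *\<^sub>v z) \<bullet> v = 0" using zero v by simp
          then show ?thesis using M zc v by (subst transpose_scalar_prod[symmetric]) auto
        qed
        then show ?thesis using zc unfolding M(2)[symmetric] using M(1) by (auto simp: annihilator_def mat_range_def)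
      qed
      ultimately show "\<exists>z \<in> annihilator n (Cstar A B C D). T.step y z" by blast
    qed (auto simp: annihilator_def)
  qed
qed

lemma Cstar_transpose: "Cstar (A\<^sup>T) (C\<^sup>T) (B\<^sup>T) (D\<^sup>T) = annihilator n (Vtraj A B C D)"
proof -
  interpret T: system "A\<^sup>T" "C\<^sup>T" "B\<^sup>T" "D\<^sup>T" n p q by (rule system_transpose)
  show ?thesis
    using T.Vtraj_transpose annihilator_annihilator[OF T.vec_subspace_Cstar] by simp
qed

end

section \<open>Block matrices\<close>

lemma mult_append_cols:
  "A \<in> carrier_mat p n \<Longrightarrow> M \<in> carrier_mat n m \<Longrightarrow> N \<in> carrier_mat n k \<Longrightarrow>
   (A :: 'a :: comm_ring_1 mat) * (M @\<^sub>c N) = (A * M) @\<^sub>c (A * N)"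
  by (rule eq_matI)
    (auto simp: append_cols_index[of _ n m _ k] append_cols_index[of _ p m _ k] scalar_prod_def
      intro!: sum.cong)

lemma append_cols_mult:
  "M \<in> carrier_mat n m \<Longrightarrow> N \<in> carrier_mat n k \<Longrightarrow> X \<in> carrier_mat m l \<Longrightarrow> Y \<in> carrier_mat k l \<Longrightarrow>
   (M @\<^sub>c N) * (X @\<^sub>r Y) = M * X + N * (Y :: 'a :: comm_ring_1 mat)"
  unfolding append_cols_def append_rows_def
  by (subst mult_four_block_mat[of _ n m _ k _ 0 _ _ l _ 0])
    (auto intro!: eq_matI simp: four_block_mat_def)

lemma four_block_mult_append_rows:
  assumes "A \<in> carrier_mat n n'" "B \<in> carrier_mat n q" "C \<in> carrier_mat p n'" "D \<in> carrier_mat p q"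
    "X \<in> carrier_mat n' l" "Y \<in> carrier_mat q l"
  shows "four_block_mat A B C D * (X @\<^sub>r Y) = (A * X + B * Y) @\<^sub>r (C * X + D * (Y :: 'a :: comm_ring_1 mat))"
  unfolding append_rows_def
  using assms by (subst mult_four_block_mat[of _ n n' _ q _ p _ _ l _ 0])
    (auto intro!: cong_four_block_mat eq_matI)

lemma append_cols_four_block:
  assumes "M \<in> carrier_mat n m" "N \<in> carrier_mat n k"
    "W \<in> carrier_mat m i" "X \<in> carrier_mat m j" "Y \<in> carrier_mat k i" "Z \<in> carrier_mat k j"
  shows "(M @\<^sub>c N) * four_block_mat W X Y Z = (M * W + N * Y) @\<^sub>c (M * X + N * (Z :: 'a :: comm_ring_1 mat))"
  unfolding append_cols_def
  using assms by (subst mult_four_block_mat[of _ n m _ k _ 0 _ _ i _ j])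
    (auto intro!: cong_four_block_mat eq_matI)

lemma append_cols_add:
  "M \<in> carrier_mat n m \<Longrightarrow> N \<in> carrier_mat n k \<Longrightarrow> M' \<in> carrier_mat n m \<Longrightarrow> N' \<in> carrier_mat n k \<Longrightarrow>
   (M @\<^sub>c N) + (M' @\<^sub>c N') = (M + M') @\<^sub>c (N + (N' :: 'a :: comm_ring_1 mat))"
  by (rule eq_matI) (auto simp: append_cols_index[of _ n m _ k])

lemma zero_append_cols: "0\<^sub>m n (m + k) = 0\<^sub>m n m @\<^sub>c 0\<^sub>m n k"
  by (rule eq_matI) (auto simp: append_cols_index[of _ n m _ k])


lemma append_rows_split:
  assumes M: "M \<in> carrier_mat (a + b) m"
  obtains M1 M2 where "M1 \<in> carrier_mat a m" "M2 \<in> carrier_mat b m" "M = M1 @\<^sub>r (M2 :: complex mat)"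
proof (rule that)
  show "M = mat a m (\<lambda>(i, j). M $$ (i, j)) @\<^sub>r mat b m (\<lambda>(i, j). M $$ (i + a, j))"
    by (rule eq_matI) (use M in \<open>auto simp: append_rows_index[of _ a m _ b]\<close>)
qed auto


section \<open>Perturbing the input along a controlled invariant subspace\<close>

context system
begin

text \<open>All predecessors of an element of \<open>Vtraj\<close> along a trajectory with zero output lie in \<open>Vtraj\<close> again, so
  that a trajectory from the zero state to an element of the intersection never leaves \<open>Vtraj\<close>.\<close>

lemma Cstar_inter_Vtraj_subset:
  assumes zero: "0\<^sub>v n \<in> W"
    and closed: "\<And>x u. x \<in> W \<Longrightarrow> u \<in> carrier_vec q \<Longrightarrow> C *\<^sub>v x + D *\<^sub>v u = 0\<^sub>v p \<Longrightarrow>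
      A *\<^sub>v x + B *\<^sub>v u \<in> Vtraj A B C D \<Longrightarrow> A *\<^sub>v x + B *\<^sub>v u \<in> W"
  shows "Cstar A B C D \<inter> Vtraj A B C D \<subseteq> W"
proof -
  have "x \<in> Vtraj A B C D \<longrightarrow> x \<in> W" if "x \<in> Cstar A B C D" for x
    using that
  proof (induction rule: Cstar_induct)
    case (step x y)
    show ?case
    proof
      assume y: "y \<in> Vtraj A B C D"
      have st: "null_step A B C D x y" using step by simp
      have "x \<in> carrier_vec n" using step by simp
      with st y have "x \<in> Vtraj A B C D" by (rule Vtraj_back)
      then have "x \<in> W" using step by blast
      obtain u where "u \<in> carrier_vec q" "y = A *\<^sub>v x + B *\<^sub>v u" "C *\<^sub>v x + D *\<^sub>v u = 0\<^sub>v p"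
        using st by (rule stepE)
      then show "y \<in> W" using closed \<open>x \<in> W\<close> y by blast
    qed
  qed (use zero in auto)
  then show ?thesis by blast
qed

end

text \<open>The columns of \<open>P\<close> span a controlled invariant subspace with feedback \<open>H\<close> and zero output. Adding
  \<open>P * G\<close> to the input matrix pushes the state by elements of the range of \<open>P\<close>, and such a push can
  be compensated by the feedback at later times.\<close>

locale input_perturbation = system +
  fixes k :: nat and P H L G :: "complex mat"
  assumes P [simp]: "P \<in> carrier_mat n k" and H [simp]: "H \<in> carrier_mat q k"
    and L [simp]: "L \<in> carrier_mat k k" and G [simp]: "G \<in> carrier_mat k q"
    and inv: "A * P + B * H = P * L" and out: "C * P + D * H = 0\<^sub>m p k"
begin

lemma pert_dims [simp]: "dim_row P = n" "dim_col P = k" "dim_row H = q" "dim_col H = k"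
  "dim_row L = k" "dim_col L = k" "dim_row G = k" "dim_col G = q"
  using carrier_matD[OF P] carrier_matD[OF H] carrier_matD[OF L] carrier_matD[OF G] by auto

definition Bp :: "complex mat" where "Bp = B + P * G"

lemma Bp [simp]: "Bp \<in> carrier_mat n q"
  by (auto simp: Bp_def)

sublocale pert: system A Bp C D n q p
  by unfold_locales auto

lemma invD: "v \<in> carrier_vec k \<Longrightarrow> A *\<^sub>v (P *\<^sub>v v) + B *\<^sub>v (H *\<^sub>v v) = P *\<^sub>v (L *\<^sub>v v)"
  using arg_cong[OF inv, of "\<lambda>M. M *\<^sub>v v"] by (simp add: vec_distrib)

lemma outD: "v \<in> carrier_vec k \<Longrightarrow> C *\<^sub>v (P *\<^sub>v v) + D *\<^sub>v (H *\<^sub>v v) = 0\<^sub>v p"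
  using arg_cong[OF out, of "\<lambda>M. M *\<^sub>v v"] by (simp add: vec_distrib)

text \<open>The deviation \<open>P *\<^sub>v w\<close> between a trajectory of the perturbed system and one of the original system evolves
  by \<open>w' = L *\<^sub>v w - G *\<^sub>v u\<close>, and it is realized by the additional input \<open>H *\<^sub>v w\<close>.\<close>

lemma pert_step_imp_step:
  assumes st: "pert.step x x'" and x: "x \<in> carrier_vec n" and w: "w \<in> carrier_vec k"
  shows "\<exists>w'\<in>carrier_vec k. step (x + P *\<^sub>v w) (x' + P *\<^sub>v w')"
proof -
  obtain u where u: "u \<in> carrier_vec q" "x' = A *\<^sub>v x + Bp *\<^sub>v u" "C *\<^sub>v x + D *\<^sub>v u = 0\<^sub>v p"
    using st by (rule pert.stepE)
  define w' where "w' = L *\<^sub>v w - G *\<^sub>v u"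
  have "step (x + P *\<^sub>v w) (x' + P *\<^sub>v w')"
  proof (rule stepI[of "u + H *\<^sub>v w"])
    show "u + H *\<^sub>v w \<in> carrier_vec q" using u by (auto intro!: add_carrier_vec)
    show "x' + P *\<^sub>v w' = A *\<^sub>v (x + P *\<^sub>v w) + B *\<^sub>v (u + H *\<^sub>v w)"
    proof (rule eq_vecI)
      fix i assume "i < dim_vec (A *\<^sub>v (x + P *\<^sub>v w) + B *\<^sub>v (u + H *\<^sub>v w))"
      then have i: "i < n" by simp
      have "(A *\<^sub>v (P *\<^sub>v w) + B *\<^sub>v (H *\<^sub>v w)) $ i = (P *\<^sub>v (L *\<^sub>v w)) $ i" using invD[OF w] by simp
      then have "(A *\<^sub>v (P *\<^sub>v w)) $ i + (B *\<^sub>v (H *\<^sub>v w)) $ i = (P *\<^sub>v (L *\<^sub>v w)) $ i"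
        using i by (simp del: index_mult_mat_vec)
      then show "(x' + P *\<^sub>v w') $ i = (A *\<^sub>v (x + P *\<^sub>v w) + B *\<^sub>v (u + H *\<^sub>v w)) $ i"
        using i u(1) x w by (simp add: u(2) w'_def Bp_def vec_distrib algebra_simps del: index_mult_mat_vec)
    qed (simp add: u(2))
    have "C *\<^sub>v (x + P *\<^sub>v w) + D *\<^sub>v (u + H *\<^sub>v w) =
      (C *\<^sub>v x + D *\<^sub>v u) + (C *\<^sub>v (P *\<^sub>v w) + D *\<^sub>v (H *\<^sub>v w))"
      by (rule eq_vecI) (use u(1) x w in \<open>auto simp: vec_distrib simp del: index_mult_mat_vec\<close>)
    then show "C *\<^sub>v (x + P *\<^sub>v w) + D *\<^sub>v (u + H *\<^sub>v w) = 0\<^sub>v p" by (simp add: u outD[OF w])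
  qed
  moreover have "w' \<in> carrier_vec k" by (auto simp: w'_def intro!: carrier_vecI)
  ultimately show ?thesis by blast
qed

lemma Vtraj_pert_subset: "Vtraj A Bp C D \<subseteq> Vtraj A B C D"
proof
  let ?W = "{x + P *\<^sub>v w | x w. x \<in> Vtraj A Bp C D \<and> w \<in> carrier_vec k}"
  fix x assume x: "x \<in> Vtraj A Bp C D"
  show "x \<in> Vtraj A B C D"
  proof (rule Vtraj_coinduct[of _ ?W])
    have xc: "x \<in> carrier_vec n" using x pert.Vtraj_carrier by auto
    then have "x = x + P *\<^sub>v 0\<^sub>v k" by (simp add: vec_distrib)
    then show "x \<in> ?W" using x zero_carrier_vec by blast
    show "?W \<subseteq> carrier_vec n" using pert.Vtraj_carrier by (auto intro!: add_carrier_vec)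
    fix z assume "z \<in> ?W"
    then obtain y w where z: "z = y + P *\<^sub>v w" "y \<in> Vtraj A Bp C D" "w \<in> carrier_vec k" by blast
    then obtain y' where y': "y' \<in> Vtraj A Bp C D" "pert.step y y'" by (auto elim: pert.Vtraj_step)
    have "y \<in> carrier_vec n" using z pert.Vtraj_carrier by auto
    from pert_step_imp_step[OF y'(2) this z(3)] y'(1)
    show "\<exists>z'\<in>?W. step z z'" unfolding z(1) by blast
  qed
qed

lemma Cstar_pert_subset: "\<exists>y\<in>Cstar A B C D. \<exists>w\<in>carrier_vec k. x = y + P *\<^sub>v w"
  if x: "x \<in> Cstar A Bp C D"
proof -
  have "x \<in> carrier_vec n \<and> (\<exists>w\<in>carrier_vec k. x + P *\<^sub>v w \<in> Cstar A B C D)"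
    using x
  proof (induction rule: pert.Cstar_induct)
    case zero
    then show ?case using zero_Cstar by (auto intro!: bexI[of _ "0\<^sub>v k"] simp: vec_distrib)
  next
    case (step x y)
    then obtain w where w: "w \<in> carrier_vec k" "x + P *\<^sub>v w \<in> Cstar A B C D" by blast
    have st: "null_step A Bp C D x y" using step by simp
    obtain w' where "w' \<in> carrier_vec k" "step (x + P *\<^sub>v w) (y + P *\<^sub>v w')"
      using pert_step_imp_step[OF st _ w(1)] step by blast
    then show ?case using Cstar_step[OF w(2)] pert.step_carrier[OF st] by blast
  qed
  then obtain w where w: "x \<in> carrier_vec n" "w \<in> carrier_vec k" "x + P *\<^sub>v w \<in> Cstar A B C D" by blast
  have "x = (x + P *\<^sub>v w) + P *\<^sub>v (- w)"
    by (rule eq_vecI) (use w in \<open>auto simp: vec_distrib simp del: index_mult_mat_vec\<close>)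
  with w show ?thesis by (metis uminus_carrier_vec)
qed

text \<open>The original system is a perturbation of the perturbed one, so that both inclusions can be
  reversed.\<close>

lemma reverse: "input_perturbation A Bp C D n q p k P H (L + G * H) (- G)"
proof unfold_locales
  show "A * P + Bp * H = P * (L + G * H)"
  proof (rule eq_matI)
    fix i j assume "i < dim_row (P * (L + G * H))" "j < dim_col (P * (L + G * H))"
    then have ij: "i < n" "j < k" by auto
    have "(A * P + B * H) $$ (i, j) = (P * L) $$ (i, j)" using inv by simp
    then show "(A * P + Bp * H) $$ (i, j) = (P * (L + G * H)) $$ (i, j)"
      using ij by (simp add: Bp_def mat_distrib del: index_mult_mat(1))
  qed auto
  show "C * P + D * H = 0\<^sub>m p k" by (rule out)
qed auto

lemma Bp_reverse: "Bp + P * (- G) = B"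
  by (rule eq_matI) (auto simp: Bp_def mat_distrib simp del: index_mult_mat(1))

lemma Vtraj_pert: "Vtraj A Bp C D = Vtraj A B C D"
proof -
  interpret rev: input_perturbation A Bp C D n q p k P H "L + G * H" "- G" by (rule reverse)
  show ?thesis
    using Vtraj_pert_subset rev.Vtraj_pert_subset unfolding rev.Bp_def Bp_reverse by blast
qed

lemma Cstar_pert_superset: "\<exists>y\<in>Cstar A Bp C D. \<exists>w\<in>carrier_vec k. x = y + P *\<^sub>v w"
  if "x \<in> Cstar A B C D"
proof -
  interpret rev: input_perturbation A Bp C D n q p k P H "L + G * H" "- G" by (rule reverse)
  show ?thesis using rev.Cstar_pert_subset that unfolding rev.Bp_def Bp_reverse by blast
qed

lemma range_Vtraj: "mat_range P \<subseteq> Vtraj A B C D"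
  by (rule Vtraj_of_matrix[OF P H L inv out])

end

text \<open>Now the perturbation is along \<open>Cstar \<inter> Vtraj\<close> and is chosen such that inputs that
  move the zero state inside \<open>Vtraj\<close> without being visible in the output have no effect any more.\<close>

locale input_factor = input_perturbation +
  assumes range_Cstar: "mat_range P \<subseteq> Cstar A B C D"
    and Cstar_Vtraj: "Cstar A B C D \<inter> Vtraj A B C D \<subseteq> mat_range P"
    and blocked: "\<And>u. u \<in> carrier_vec q \<Longrightarrow> D *\<^sub>v u = 0\<^sub>v p \<Longrightarrow> B *\<^sub>v u \<in> Vtraj A B C D \<Longrightarrow>
      (B + P * G) *\<^sub>v u = 0\<^sub>v n"
begin

lemma Cstar_Vtraj_eq: "Cstar A B C D \<inter> Vtraj A B C D = mat_range P"
  using range_Cstar range_Vtraj Cstar_Vtraj by blast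

lemma Cstar_eq: "Cstar A B C D = {y + P *\<^sub>v w | y w. y \<in> Cstar A Bp C D \<and> w \<in> carrier_vec k}"
proof
  show "Cstar A B C D \<subseteq> {y + P *\<^sub>v w | y w. y \<in> Cstar A Bp C D \<and> w \<in> carrier_vec k}"
    using Cstar_pert_superset by blast
  have "y + P *\<^sub>v w \<in> Cstar A B C D" if y: "y \<in> Cstar A Bp C D" and w: "w \<in> carrier_vec k" for y w
  proof -
    note S = vec_subspaceD[OF vec_subspace_Cstar]
    have rng: "P *\<^sub>v v \<in> Cstar A B C D" if "v \<in> carrier_vec k" for v
      using range_Cstar that mem_mat_range[OF P] by blast
    obtain z v where "z \<in> Cstar A B C D" "v \<in> carrier_vec k" "y = z + P *\<^sub>v v"
      using Cstar_pert_subset[OF y] by blast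
    then show ?thesis using rng[OF w] rng[of v] S(3) by blast
  qed
  then show "{y + P *\<^sub>v w | y w. y \<in> Cstar A Bp C D \<and> w \<in> carrier_vec k} \<subseteq> Cstar A B C D" by blast
qed

text \<open>A trajectory inside \<open>Vtraj\<close> that starts at zero stays there, because the first input that would leave zero
  is blocked.\<close>

lemma Cstar_Vtraj_pert: "Cstar A Bp C D \<inter> Vtraj A Bp C D = {0\<^sub>v n}"
proof
  show "Cstar A Bp C D \<inter> Vtraj A Bp C D \<subseteq> {0\<^sub>v n}"
  proof (rule pert.Cstar_inter_Vtraj_subset)
    note S = vec_subspaceD[OF vec_subspace_Vtraj]
    fix x u assume "x \<in> {0\<^sub>v n}" and u: "u \<in> carrier_vec q" and eq: "C *\<^sub>v x + D *\<^sub>v u = 0\<^sub>v p"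
      and V: "A *\<^sub>v x + Bp *\<^sub>v u \<in> Vtraj A Bp C D"
    then have x: "x = 0\<^sub>v n" by simp
    have Du: "D *\<^sub>v u = 0\<^sub>v p" using eq x by (simp add: vec_distrib)
    have "Bp *\<^sub>v u \<in> Vtraj A B C D" using V x by (simp add: vec_distrib Vtraj_pert)
    moreover have "P *\<^sub>v (G *\<^sub>v u) \<in> Vtraj A B C D"
    proof -
      have "G *\<^sub>v u \<in> carrier_vec k" by simp
      then show ?thesis using range_Vtraj mem_mat_range[OF P] by blast
    qed
    moreover have "B *\<^sub>v u = Bp *\<^sub>v u - P *\<^sub>v (G *\<^sub>v u)"
      by (rule eq_vecI) (use u in \<open>auto simp: Bp_def vec_distrib simp del: index_mult_mat_vec\<close>)
    ultimately have "B *\<^sub>v u \<in> Vtraj A B C D" using vec_subspace_minus[OF vec_subspace_Vtraj] by simp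
    from blocked[OF u Du this] show "A *\<^sub>v x + Bp *\<^sub>v u \<in> {0\<^sub>v n}"
      using x by (simp add: vec_distrib Bp_def)
  qed simp
  show "{0\<^sub>v n} \<subseteq> Cstar A Bp C D \<inter> Vtraj A Bp C D"
    using pert.zero_Cstar vec_subspaceD(2)[OF pert.vec_subspace_Vtraj] by auto
qed

end


section \<open>The matrices of the right construction\<close>

text \<open>The data of one right construction for a controllable and observable system. The left construction
  instantiates the same locale with the transposed system.\<close>

locale right_data = system +
  fixes k f r l :: nat
    and \<Pi>k \<Pi>f Hk Hf \<Lambda>k \<Lambda>kf \<Lambda>f \<alpha>k R0 \<sigma> \<beta>k L0 :: "complex mat"
  assumes right: "right_construction A B C D k f r \<Pi>k \<Pi>f Hk Hf \<Lambda>k \<Lambda>kf \<Lambda>f \<alpha>k R0"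
    and reach: "controllable A B" and obs: "observable C A"
    and \<sigma>: "pos_def_mat k \<sigma>"
    and riccati: "\<sigma> * (\<Lambda>k - \<alpha>k * R0\<^sup>\<dagger> * Hk) + (\<Lambda>k - \<alpha>k * R0\<^sup>\<dagger> * Hk)\<^sup>\<dagger> * \<sigma>
          - \<sigma> * \<alpha>k * \<alpha>k\<^sup>\<dagger> * \<sigma> + Hk\<^sup>\<dagger> * (1\<^sub>m q - R0 * R0\<^sup>\<dagger>) * Hk = 0\<^sub>m k k"
    and \<beta>k: "\<beta>k = - (\<alpha>k\<^sup>\<dagger> * \<sigma>) - R0\<^sup>\<dagger> * Hk"
    and L0: "L0 \<in> carrier_mat q l" and unitary: "unitary_mat (R0 @\<^sub>c L0)"
begin

lemmas right_unfolded = right[unfolded right_construction_def Let_def R_solution_def sys_dims]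

lemma carriers [simp]:
  "\<Pi>k \<in> carrier_mat n k" "\<Pi>f \<in> carrier_mat n f" "Hk \<in> carrier_mat q k" "Hf \<in> carrier_mat q f"
  "\<Lambda>k \<in> carrier_mat k k" "\<Lambda>kf \<in> carrier_mat k f" "\<Lambda>f \<in> carrier_mat f f" "\<alpha>k \<in> carrier_mat k r"
proof -
  show "\<Pi>k \<in> carrier_mat n k" using right_unfolded by (elim conjE)
  show "\<Pi>f \<in> carrier_mat n f" using right_unfolded by (elim conjE)
  show "Hk \<in> carrier_mat q k" using right_unfolded by (elim conjE)
  show "Hf \<in> carrier_mat q f" using right_unfolded by (elim conjE)
  show "\<Lambda>k \<in> carrier_mat k k" using right_unfolded by (elim conjE)
  show "\<Lambda>kf \<in> carrier_mat k f" using right_unfolded by (elim conjE)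
  show "\<Lambda>f \<in> carrier_mat f f" using right_unfolded by (elim conjE)
  show "\<alpha>k \<in> carrier_mat k r" using right_unfolded by (elim conjE)
qed

lemma R0 [simp]: "R0 \<in> carrier_mat q r"
  using right_unfolded by (elim conjE)

lemma \<sigma>_carrier [simp]: "\<sigma> \<in> carrier_mat k k" and \<sigma>_adjoint: "\<sigma>\<^sup>\<dagger> = \<sigma>"
  and \<sigma>_pos: "v \<in> carrier_vec k \<Longrightarrow> v \<noteq> 0\<^sub>v k \<Longrightarrow> 0 < Re ((\<sigma> *\<^sub>v v) \<bullet>c v)"
  using \<sigma> unfolding pos_def_mat_def by auto

lemma dims [simp]:
  "dim_row \<Pi>k = n" "dim_col \<Pi>k = k" "dim_row \<Pi>f = n" "dim_col \<Pi>f = f"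
  "dim_row Hk = q" "dim_col Hk = k" "dim_row Hf = q" "dim_col Hf = f"
  "dim_row \<Lambda>k = k" "dim_col \<Lambda>k = k" "dim_row \<Lambda>kf = k" "dim_col \<Lambda>kf = f"
  "dim_row \<Lambda>f = f" "dim_col \<Lambda>f = f" "dim_row \<alpha>k = k" "dim_col \<alpha>k = r"
  "dim_row R0 = q" "dim_col R0 = r" "dim_row \<sigma> = k" "dim_col \<sigma> = k"
  "dim_row L0 = q" "dim_col L0 = l"
  using carriers R0 \<sigma>_carrier L0 by (auto simp del: carriers R0 \<sigma>_carrier)

text \<open>The letter \<open>b\<close> marks the closed loop: \<open>Hb\<close> and \<open>Lb\<close> result from \<open>Hk\<close> and \<open>\<Lambda>k\<close> by the feedback
  \<open>\<beta>k\<close> through the inputs \<open>R0\<close>.\<close>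

definition S :: "complex mat" where "S = mat_inv \<sigma>"
definition Hb :: "complex mat" where "Hb = Hk + R0 * \<beta>k"
definition Lb :: "complex mat" where "Lb = \<Lambda>k + \<alpha>k * \<beta>k"
definition G :: "complex mat" where "G = S * Hb\<^sup>\<dagger>"

lemma \<beta>_dims [simp]: "dim_row \<beta>k = r" "dim_col \<beta>k = k"
  by (auto simp: \<beta>k)

lemma \<sigma>_injective: "v \<in> carrier_vec k \<Longrightarrow> \<sigma> *\<^sub>v v = 0\<^sub>v k \<Longrightarrow> v = 0\<^sub>v k"
  using \<sigma>_pos[of v] by (cases "v = 0\<^sub>v k") auto

lemma S [simp]: "S \<in> carrier_mat k k" and \<sigma>S: "\<sigma> * S = 1\<^sub>m k" and S\<sigma>: "S * \<sigma> = 1\<^sub>m k"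
  unfolding S_def using mat_inv_of_injective[OF \<sigma>_carrier \<sigma>_injective] by auto

lemma S_dims [simp]: "dim_row S = k" "dim_col S = k"
  using S by (auto simp del: S)

lemma S_adjoint: "S\<^sup>\<dagger> = S"
proof -
  have "S\<^sup>\<dagger> * \<sigma> = 1\<^sub>m k"
    using arg_cong[OF \<sigma>S, of mat_adjoint] by (simp add: adjoint_mult \<sigma>_adjoint)
  then have "mat_inv \<sigma> = S\<^sup>\<dagger>" by (rule mat_inv_unique(1)[OF \<sigma>_carrier adjoint_carrier[OF S]])
  then show ?thesis by (simp add: S_def)
qed

lemma Hb [simp]: "Hb \<in> carrier_mat q k" "dim_row Hb = q" "dim_col Hb = k"
  and Lb [simp]: "Lb \<in> carrier_mat k k" "dim_row Lb = k" "dim_col Lb = k"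
  and G [simp]: "G \<in> carrier_mat k q" "dim_row G = k" "dim_col G = q"
  by (auto simp: Hb_def Lb_def G_def)

lemma unitary_eqs:
  "R0\<^sup>\<dagger> * R0 = 1\<^sub>m r" "R0\<^sup>\<dagger> * L0 = 0\<^sub>m r l" "L0\<^sup>\<dagger> * R0 = 0\<^sub>m l r" "L0\<^sup>\<dagger> * L0 = 1\<^sub>m l"
  "R0 * R0\<^sup>\<dagger> + L0 * L0\<^sup>\<dagger> = 1\<^sub>m q"
proof -
  let ?U = "R0 @\<^sub>c L0"
  have U: "?U\<^sup>\<dagger> * ?U = 1\<^sub>m q" "?U * ?U\<^sup>\<dagger> = 1\<^sub>m q" and rl: "r + l = q"
    using unitary by (auto simp: unitary_mat_def)
  have adj: "?U\<^sup>\<dagger> = R0\<^sup>\<dagger> @\<^sub>r L0\<^sup>\<dagger>"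
    by (rule eq_matI) (auto simp: append_cols_index[OF R0 L0] append_rows_index[OF adjoint_carrier[OF R0] adjoint_carrier[OF L0]])
  show "R0 * R0\<^sup>\<dagger> + L0 * L0\<^sup>\<dagger> = 1\<^sub>m q"
    using U(2) unfolding adj by (subst (asm) append_cols_mult[of _ q r _ l _ q]) (use L0 in auto)
  have entry: "(?U\<^sup>\<dagger> * ?U) $$ (i, j) = (1\<^sub>m q :: complex mat) $$ (i, j)" for i j by (simp add: U)
  have colR: "col ?U j = col R0 j" if "j < r" for j
    using that L0 by (auto intro!: eq_vecI simp: append_cols_index[OF R0 L0])
  have colL: "col ?U (r + j) = col L0 j" if "j < l" for j
    using that L0 by (auto intro!: eq_vecI simp: append_cols_index[OF R0 L0])
  have rowR: "row (?U\<^sup>\<dagger>) i = row (R0\<^sup>\<dagger>) i" if "i < r" for i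
    using that L0 by (auto intro!: eq_vecI simp: append_cols_index[OF R0 L0])
  have rowL: "row (?U\<^sup>\<dagger>) (r + i) = row (L0\<^sup>\<dagger>) i" if "i < l" for i
    using that L0 by (auto intro!: eq_vecI simp: append_cols_index[OF R0 L0])
  show "R0\<^sup>\<dagger> * R0 = 1\<^sub>m r"
  proof (rule eq_matI)
    fix i j assume "i < dim_row (1\<^sub>m r :: complex mat)" "j < dim_col (1\<^sub>m r :: complex mat)"
    then show "(R0\<^sup>\<dagger> * R0) $$ (i, j) = 1\<^sub>m r $$ (i, j)"
      using entry[of i j] rl colR[of j] rowR[of i] by auto
  qed auto
  show "R0\<^sup>\<dagger> * L0 = 0\<^sub>m r l"
  proof (rule eq_matI)
    fix i j assume "i < dim_row (0\<^sub>m r l :: complex mat)" "j < dim_col (0\<^sub>m r l :: complex mat)"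
    then show "(R0\<^sup>\<dagger> * L0) $$ (i, j) = 0\<^sub>m r l $$ (i, j)"
      using entry[of i "r + j"] rl colL[of j] rowR[of i] by auto
  qed auto
  show "L0\<^sup>\<dagger> * R0 = 0\<^sub>m l r"
  proof (rule eq_matI)
    fix i j assume "i < dim_row (0\<^sub>m l r :: complex mat)" "j < dim_col (0\<^sub>m l r :: complex mat)"
    then show "(L0\<^sup>\<dagger> * R0) $$ (i, j) = 0\<^sub>m l r $$ (i, j)"
      using entry[of "r + i" j] rl colR[of j] rowL[of i] by auto
  qed auto
  show "L0\<^sup>\<dagger> * L0 = 1\<^sub>m l"
  proof (rule eq_matI)
    fix i j assume "i < dim_row (1\<^sub>m l :: complex mat)" "j < dim_col (1\<^sub>m l :: complex mat)"
    then show "(L0\<^sup>\<dagger> * L0) $$ (i, j) = 1\<^sub>m l $$ (i, j)"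
      using entry[of "r + i" "r + j"] rl colL[of j] rowL[of i] by auto
  qed auto
qed

lemma zero_equations:
  "A * \<Pi>k + B * Hk = \<Pi>k * \<Lambda>k" "C * \<Pi>k + D * Hk = 0\<^sub>m p k"
  "A * \<Pi>f + B * Hf = \<Pi>k * \<Lambda>kf + \<Pi>f * \<Lambda>f" "C * \<Pi>f + D * Hf = 0\<^sub>m p f"
proof -
  let ?P = "\<Pi>k @\<^sub>c \<Pi>f" and ?H = "Hk @\<^sub>c Hf" and ?L = "four_block_mat \<Lambda>k \<Lambda>kf (0\<^sub>m f k) \<Lambda>f"
  have P: "?P \<in> carrier_mat n (k + f)" "?H \<in> carrier_mat q (k + f)" "?L \<in> carrier_mat (k + f) (k + f)"
    by (auto intro!: append_cols_carrier four_block_carrier_mat)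
  have "four_block_mat A B C D * (?P @\<^sub>r ?H) = (?P * ?L) @\<^sub>r 0\<^sub>m p (k + f)"
    using right_unfolded by (elim conjE)
  then have "(A * ?P + B * ?H) @\<^sub>r (C * ?P + D * ?H) = (?P * ?L) @\<^sub>r 0\<^sub>m p (k + f)"
    using P by (simp add: four_block_mult_append_rows[of _ n n _ q _ p _ _ "k + f"])
  then have eqs: "A * ?P + B * ?H = ?P * ?L" "C * ?P + D * ?H = 0\<^sub>m p (k + f)"
    using P by (auto simp: append_rows_eq_iff[of _ n "k + f" _ _ p])
  have "(A * \<Pi>k + B * Hk) @\<^sub>c (A * \<Pi>f + B * Hf) = (\<Pi>k * \<Lambda>k) @\<^sub>c (\<Pi>k * \<Lambda>kf + \<Pi>f * \<Lambda>f)"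
  proof -
    have "?P * ?L = (\<Pi>k * \<Lambda>k + \<Pi>f * 0\<^sub>m f k) @\<^sub>c (\<Pi>k * \<Lambda>kf + \<Pi>f * \<Lambda>f)"
      by (rule append_cols_four_block) auto
    also have "\<Pi>k * \<Lambda>k + \<Pi>f * 0\<^sub>m f k = \<Pi>k * \<Lambda>k" by (simp add: mat_mult_zero)
    finally show ?thesis
      using eqs(1) by (simp add: mult_append_cols[of _ n n _ k _ f] mult_append_cols[of _ n q _ k _ f]
          append_cols_add[of _ n k _ f])
  qed
  then show "A * \<Pi>k + B * Hk = \<Pi>k * \<Lambda>k" "A * \<Pi>f + B * Hf = \<Pi>k * \<Lambda>kf + \<Pi>f * \<Lambda>f"
    by (auto simp: append_cols_eq_iff[of _ n k _ _ f])
  have "(C * \<Pi>k + D * Hk) @\<^sub>c (C * \<Pi>f + D * Hf) = 0\<^sub>m p k @\<^sub>c 0\<^sub>m p f"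
    using eqs(2) by (simp add: mult_append_cols[of _ p n _ k _ f] mult_append_cols[of _ p q _ k _ f]
          append_cols_add[of _ p k _ f] zero_append_cols)
  then show "C * \<Pi>k + D * Hk = 0\<^sub>m p k" "C * \<Pi>f + D * Hf = 0\<^sub>m p f"
    by (auto simp: append_cols_eq_iff[of _ p k _ _ f])
qed

lemma BR0: "B * R0 = \<Pi>k * \<alpha>k" and DR0: "D * R0 = 0\<^sub>m p r"
proof -
  have "B * R0 = (\<Pi>k @\<^sub>c \<Pi>f) * (\<alpha>k @\<^sub>r 0\<^sub>m f r)"
    using right_unfolded by (elim conjE)
  moreover have "D * R0 = 0\<^sub>m p r"
    using right_unfolded by (elim conjE)
  ultimately show "B * R0 = \<Pi>k * \<alpha>k" "D * R0 = 0\<^sub>m p r"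
    by (auto simp: append_cols_mult[of _ n k _ f _ r] mat_mult_zero)
qed

lemma controlled_invariance: "A * \<Pi>k + B * Hb = \<Pi>k * Lb" "C * \<Pi>k + D * Hb = 0\<^sub>m p k"
proof -
  have "A * \<Pi>k + B * Hb = (A * \<Pi>k + B * Hk) + (B * R0) * \<beta>k"
    by (rule eq_matI) (auto simp: Hb_def mat_distrib simp del: index_mult_mat(1))
  also have "\<dots> = \<Pi>k * Lb"
    unfolding zero_equations(1) BR0 by (simp add: Lb_def mat_distrib)
  finally show "A * \<Pi>k + B * Hb = \<Pi>k * Lb" .
  have "C * \<Pi>k + D * Hb = (C * \<Pi>k + D * Hk) + (D * R0) * \<beta>k"
    by (rule eq_matI) (auto simp: Hb_def mat_distrib simp del: index_mult_mat(1))
  also have "\<dots> = 0\<^sub>m p k"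
    unfolding zero_equations(2) DR0 by (simp add: mat_distrib)
  finally show "C * \<Pi>k + D * Hb = 0\<^sub>m p k" .
qed

lemma R0_Hb: "R0\<^sup>\<dagger> * Hb = - (\<alpha>k\<^sup>\<dagger> * \<sigma>)"
proof -
  have "R0\<^sup>\<dagger> * Hb = R0\<^sup>\<dagger> * Hk + (R0\<^sup>\<dagger> * R0) * \<beta>k"
    by (simp add: Hb_def mat_distrib)
  also have "\<dots> = - (\<alpha>k\<^sup>\<dagger> * \<sigma>)"
    unfolding unitary_eqs by (rule eq_matI) (auto simp: \<beta>k mat_distrib simp del: index_mult_mat(1))
  finally show ?thesis .
qed

lemma G_R0: "G * R0 = - \<alpha>k"
proof -
  have "(R0\<^sup>\<dagger> * Hb)\<^sup>\<dagger> = (- (\<alpha>k\<^sup>\<dagger> * \<sigma>))\<^sup>\<dagger>" by (simp add: R0_Hb)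
  then have "Hb\<^sup>\<dagger> * R0 = - (\<sigma> * \<alpha>k)" by (simp add: adjoint_simps \<sigma>_adjoint)
  then have "G * R0 = - ((S * \<sigma>) * \<alpha>k)" by (simp add: G_def mat_distrib)
  then show ?thesis by (simp add: S\<sigma> mat_distrib)
qed

text \<open>Completing the square turns the Riccati equation for \<open>\<sigma>\<close> into a Lyapunov equation for the closed
  loop matrix: with \<open>K = (1 - R0 * R0\<^sup>\<dagger>) * Hk\<close> one has \<open>Hb = K - R0 * \<alpha>k\<^sup>\<dagger> * \<sigma>\<close>, and the two
  terms are orthogonal.\<close>

lemma lyapunov: "\<sigma> * Lb + Lb\<^sup>\<dagger> * \<sigma> + Hb\<^sup>\<dagger> * Hb = 0\<^sub>m k k"
proof -
  define X where "X = \<Lambda>k - \<alpha>k * R0\<^sup>\<dagger> * Hk"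
  define Y where "Y = \<sigma> * \<alpha>k * \<alpha>k\<^sup>\<dagger> * \<sigma>"
  define Z where "Z = Hk\<^sup>\<dagger> * (1\<^sub>m q - R0 * R0\<^sup>\<dagger>) * Hk"
  have c: "X \<in> carrier_mat k k" "Y \<in> carrier_mat k k" "Z \<in> carrier_mat k k"
    by (auto simp: X_def Y_def Z_def)
  have Lb': "Lb = X - \<alpha>k * (\<alpha>k\<^sup>\<dagger> * \<sigma>)"
    unfolding Lb_def unfolding \<beta>k
    by (rule eq_matI) (auto simp: X_def mat_distrib simp del: index_mult_mat(1))
  have 1: "\<sigma> * Lb = \<sigma> * X - Y"
    using c by (simp add: Lb' Y_def mat_distrib)
  then have "(\<sigma> * Lb)\<^sup>\<dagger> = (\<sigma> * X - Y)\<^sup>\<dagger>" by simp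
  moreover have "Y\<^sup>\<dagger> = Y"
    by (simp add: Y_def adjoint_simps \<sigma>_adjoint mat_distrib)
  ultimately have 2: "Lb\<^sup>\<dagger> * \<sigma> = X\<^sup>\<dagger> * \<sigma> - Y"
    using c by (simp add: adjoint_simps \<sigma>_adjoint)
  define K where "K = Hk - R0 * (R0\<^sup>\<dagger> * Hk)"
  have K: "K \<in> carrier_mat q k" by (auto simp: K_def)
  have Hb': "Hb = K - R0 * (\<alpha>k\<^sup>\<dagger> * \<sigma>)"
    unfolding Hb_def unfolding \<beta>k
    by (rule eq_matI) (auto simp: K_def mat_distrib simp del: index_mult_mat(1))
  have "R0\<^sup>\<dagger> * K = R0\<^sup>\<dagger> * Hk - (R0\<^sup>\<dagger> * R0) * (R0\<^sup>\<dagger> * Hk)"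
    by (simp add: K_def mat_distrib)
  then have RK: "R0\<^sup>\<dagger> * K = 0\<^sub>m r k"
    unfolding unitary_eqs by (simp add: mat_distrib)
  then have "(R0\<^sup>\<dagger> * K)\<^sup>\<dagger> = (0\<^sub>m r k)\<^sup>\<dagger>" by simp
  then have KR: "K\<^sup>\<dagger> * R0 = 0\<^sub>m k r" using K by (simp add: adjoint_mult)
  have KK: "K\<^sup>\<dagger> * K = Z"
  proof -
    have "K\<^sup>\<dagger> * K = K\<^sup>\<dagger> * Hk - (K\<^sup>\<dagger> * R0) * (R0\<^sup>\<dagger> * Hk)"
      using K by (subst (2) K_def) (simp add: mat_distrib)
    also have "\<dots> = K\<^sup>\<dagger> * Hk" unfolding KR
      by (rule eq_matI) (use K in \<open>auto simp: mat_distrib simp del: index_mult_mat(1)\<close>)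
    also have "\<dots> = Z" by (simp add: K_def Z_def adjoint_simps mat_distrib)
    finally show ?thesis .
  qed
  have "Hb\<^sup>\<dagger> = K\<^sup>\<dagger> - \<sigma> * \<alpha>k * R0\<^sup>\<dagger>"
    unfolding Hb' using K by (simp add: adjoint_simps \<sigma>_adjoint mat_distrib)
  then have "Hb\<^sup>\<dagger> * Hb = (K\<^sup>\<dagger> - \<sigma> * \<alpha>k * R0\<^sup>\<dagger>) * (K - R0 * (\<alpha>k\<^sup>\<dagger> * \<sigma>))"
    by (simp add: Hb')
  also have "\<dots> = K\<^sup>\<dagger> * K - (K\<^sup>\<dagger> * R0) * (\<alpha>k\<^sup>\<dagger> * \<sigma>) - \<sigma> * \<alpha>k * (R0\<^sup>\<dagger> * K)
      + \<sigma> * \<alpha>k * ((R0\<^sup>\<dagger> * R0) * (\<alpha>k\<^sup>\<dagger> * \<sigma>))"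
    by (rule eq_matI) (use K in \<open>auto simp: mat_distrib simp del: index_mult_mat(1)\<close>)
  also have "\<dots> = Z + Y"
    unfolding KK KR RK unitary_eqs
    by (rule eq_matI) (use c in \<open>auto simp: Y_def mat_distrib simp del: index_mult_mat(1)\<close>)
  finally have 3: "Hb\<^sup>\<dagger> * Hb = Z + Y" .
  have ric: "\<sigma> * X + X\<^sup>\<dagger> * \<sigma> - Y + Z = 0\<^sub>m k k"
    using riccati unfolding X_def Y_def Z_def .
  show ?thesis
  proof (rule eq_matI)
    fix i j assume "i < dim_row (0\<^sub>m k k :: complex mat)" "j < dim_col (0\<^sub>m k k :: complex mat)"
    then have ij: "i < k" "j < k" by auto
    have "(\<sigma> * X + X\<^sup>\<dagger> * \<sigma> - Y + Z) $$ (i, j) = 0" using ij by (simp add: ric)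
    then show "(\<sigma> * Lb + Lb\<^sup>\<dagger> * \<sigma> + Hb\<^sup>\<dagger> * Hb) $$ (i, j) = 0\<^sub>m k k $$ (i, j)"
      unfolding 1 2 3 using ij c by (simp add: algebra_simps del: index_mult_mat(1))
  qed auto
qed

lemma G_Hb: "G * Hb = - Lb - S * Lb\<^sup>\<dagger> * \<sigma>"
proof -
  have "S * (\<sigma> * Lb + Lb\<^sup>\<dagger> * \<sigma> + Hb\<^sup>\<dagger> * Hb) = 0\<^sub>m k k" by (simp add: lyapunov mat_mult_zero)
  then have eq: "(S * \<sigma>) * Lb + S * Lb\<^sup>\<dagger> * \<sigma> + G * Hb = 0\<^sub>m k k"
    by (simp add: mat_distrib G_def)
  show ?thesis
  proof (rule eq_matI)
    fix i j assume "i < dim_row (- Lb - S * Lb\<^sup>\<dagger> * \<sigma>)" "j < dim_col (- Lb - S * Lb\<^sup>\<dagger> * \<sigma>)"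
    then have ij: "i < k" "j < k" by auto
    have "((S * \<sigma>) * Lb + S * Lb\<^sup>\<dagger> * \<sigma> + G * Hb) $$ (i, j) = 0" using ij by (simp add: eq)
    then show "(G * Hb) $$ (i, j) = (- Lb - S * Lb\<^sup>\<dagger> * \<sigma>) $$ (i, j)"
      unfolding S\<sigma> using ij by (simp add: mat_distrib eq_neg_iff_add_eq_0 algebra_simps del: index_mult_mat(1))
  qed auto
qed

lemma range_Vtraj: "mat_range (\<Pi>k @\<^sub>c \<Pi>f) = Vtraj A B C D"
proof -
  have "mat_range (\<Pi>k @\<^sub>c \<Pi>f) = Vstar A B C D \<inter> reachable_subspace A B"
    using right_unfolded by (elim conjE)
  moreover have "reachable_subspace A B = carrier_vec n" using reach by (simp add: controllable_def)
  ultimately show ?thesis using Vtraj_carrier by (auto simp: Vstar_eq_Vtraj)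
qed

lemma \<Pi>z_injective:
  assumes "a \<in> carrier_vec k" "b \<in> carrier_vec f" "\<Pi>k *\<^sub>v a + \<Pi>f *\<^sub>v b = 0\<^sub>v n"
  shows "a = 0\<^sub>v k" "b = 0\<^sub>v f"
proof -
  have "mat_kernel (\<Pi>k @\<^sub>c \<Pi>f) = {0\<^sub>v (k + f)}"
    using right_unfolded by (elim conjE)
  moreover have "a @\<^sub>v b \<in> mat_kernel (\<Pi>k @\<^sub>c \<Pi>f)"
    using assms append_cols_mult_vec[OF carriers(1,2) assms(1,2)] by (simp add: mat_kernel_def)
  ultimately have "a @\<^sub>v b = 0\<^sub>v (k + f)" by simp
  then show "a = 0\<^sub>v k" "b = 0\<^sub>v f" using append_vec_zero_iff[OF assms(1,2)] by auto
qed

lemma range_Vtraj_iff: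
  "x \<in> Vtraj A B C D \<longleftrightarrow> (\<exists>a\<in>carrier_vec k. \<exists>b\<in>carrier_vec f. x = \<Pi>k *\<^sub>v a + \<Pi>f *\<^sub>v b)"
proof -
  have c: "\<Pi>k @\<^sub>c \<Pi>f \<in> carrier_mat n (k + f)" by (rule append_cols_carrier) auto
  show ?thesis
    unfolding range_Vtraj[symmetric] mem_mat_range[OF c]
  proof
    assume "\<exists>v\<in>carrier_vec (k + f). x = (\<Pi>k @\<^sub>c \<Pi>f) *\<^sub>v v"
    then obtain v where v: "v \<in> carrier_vec (k + f)" "x = (\<Pi>k @\<^sub>c \<Pi>f) *\<^sub>v v" by blast
    obtain a b where "a \<in> carrier_vec k" "b \<in> carrier_vec f" "v = a @\<^sub>v b"
      using v(1) by (rule vec_split)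
    with v(2) show "\<exists>a\<in>carrier_vec k. \<exists>b\<in>carrier_vec f. x = \<Pi>k *\<^sub>v a + \<Pi>f *\<^sub>v b"
      using append_cols_mult_vec[OF carriers(1,2)] by blast
  next
    assume "\<exists>a\<in>carrier_vec k. \<exists>b\<in>carrier_vec f. x = \<Pi>k *\<^sub>v a + \<Pi>f *\<^sub>v b"
    then obtain a b where ab: "a \<in> carrier_vec k" "b \<in> carrier_vec f" "x = \<Pi>k *\<^sub>v a + \<Pi>f *\<^sub>v b" by blast
    then have "x = (\<Pi>k @\<^sub>c \<Pi>f) *\<^sub>v (a @\<^sub>v b)" using append_cols_mult_vec[OF carriers(1,2)] by simp
    then show "\<exists>v\<in>carrier_vec (k + f). x = (\<Pi>k @\<^sub>c \<Pi>f) *\<^sub>v v"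
      using ab(1,2) append_carrier_vec by blast
  qed
qed

text \<open>Otherwise appending \<open>u\<close> as a column to \<open>R0\<close> would enlarge its range, against maximality.\<close>

lemma range_R0:
  assumes u: "u \<in> carrier_vec q" and Du: "D *\<^sub>v u = 0\<^sub>v p" and Bu: "B *\<^sub>v u \<in> Vtraj A B C D"
  shows "u \<in> mat_range R0"
proof -
  let ?P = "\<Pi>k @\<^sub>c \<Pi>f" and ?al = "\<alpha>k @\<^sub>r 0\<^sub>m f r"
  have P: "?P \<in> carrier_mat n (k + f)" by (rule append_cols_carrier) auto
  have al: "?al \<in> carrier_mat (k + f) r" by (rule append_rows_carrier) auto
  obtain c where c: "c \<in> carrier_vec (k + f)" "B *\<^sub>v u = ?P *\<^sub>v c"
    using Bu unfolding range_Vtraj[symmetric] mem_mat_range[OF P] by blast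
  define X where "X = mat q 1 (\<lambda>(i, j). u $ i)"
  define Y where "Y = mat (k + f) 1 (\<lambda>(i, j). c $ i)"
  have X: "X \<in> carrier_mat q 1" and Y: "Y \<in> carrier_mat (k + f) 1" by (auto simp: X_def Y_def)
  have colX: "col X 0 = u" and colY: "col Y 0 = c"
    using u c by (auto simp: X_def Y_def intro!: eq_vecI)
  have BX: "B * X = ?P * Y"
  proof (rule eq_matI)
    fix i j assume "i < dim_row (?P * Y)" "j < dim_col (?P * Y)"
    then have ij: "i < n" "j = 0" using Y by auto
    have "(B *\<^sub>v u) $ i = (?P *\<^sub>v c) $ i" by (simp add: c)
    then show "(B * X) $$ (i, j) = (?P * Y) $$ (i, j)"
      using ij X Y P by (simp add: colX colY)
  qed (use X Y in auto)
  have DX: "D * X = 0\<^sub>m p 1"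
  proof (rule eq_matI)
    fix i j assume "i < dim_row (0\<^sub>m p 1 :: complex mat)" "j < dim_col (0\<^sub>m p 1 :: complex mat)"
    then have ij: "i < p" "j = 0" by auto
    have "(D *\<^sub>v u) $ i = 0" using Du ij by simp
    then show "(D * X) $$ (i, j) = 0\<^sub>m p 1 $$ (i, j)" using ij X by (simp add: colX)
  qed (use X in auto)
  have BR: "B * R0 = ?P * ?al" using right_unfolded by (elim conjE)
  have R: "R0 @\<^sub>c X \<in> carrier_mat q (r + 1)" by (rule append_cols_carrier[OF R0 X])
  have "R_solution B D ?P (k + f) (r + 1) (R0 @\<^sub>c X) (?al @\<^sub>c Y)"
    unfolding R_solution_def sys_dims
  proof (intro conjI)
    show "?al @\<^sub>c Y \<in> carrier_mat (k + f) (r + 1)" by (rule append_cols_carrier[OF al Y])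
    show "B * (R0 @\<^sub>c X) = ?P * (?al @\<^sub>c Y)"
      unfolding mult_append_cols[OF B R0 X] mult_append_cols[OF P al Y] BX BR ..
    show "D * (R0 @\<^sub>c X) = 0\<^sub>m p (r + 1)"
      unfolding mult_append_cols[OF D R0 X] DX DR0 zero_append_cols ..
  qed (rule R)
  moreover have range: "mat_range R0 \<subseteq> mat_range (R0 @\<^sub>c X)"
  proof
    fix x assume "x \<in> mat_range R0"
    then obtain v where v: "v \<in> carrier_vec r" "x = R0 *\<^sub>v v" using mem_mat_range[OF R0] by blast
    have "(R0 @\<^sub>c X) *\<^sub>v (v @\<^sub>v 0\<^sub>v 1) = R0 *\<^sub>v v + X *\<^sub>v 0\<^sub>v 1"
      by (rule append_cols_mult_vec[OF R0 X v(1)]) auto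
    also have "\<dots> = x" using X v by (simp add: vec_distrib)
    finally show "x \<in> mat_range (R0 @\<^sub>c X)"
      unfolding mem_mat_range[OF R] using v(1) append_carrier_vec[OF v(1), of "0\<^sub>v 1" 1] by force
  qed
  moreover have "\<forall>r' R \<alpha>. R_solution B D ?P (k + f) r' R \<alpha> \<and> mat_range R0 \<subseteq> mat_range R \<longrightarrow>
      mat_range R = mat_range R0"
    using right unfolding right_construction_def Let_def by (elim conjE)
  ultimately have "mat_range (R0 @\<^sub>c X) = mat_range R0" by blast
  moreover have "u \<in> mat_range (R0 @\<^sub>c X)"
  proof -
    have "(R0 @\<^sub>c X) *\<^sub>v (0\<^sub>v r @\<^sub>v unit_vec 1 0) = R0 *\<^sub>v 0\<^sub>v r + X *\<^sub>v unit_vec 1 0"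
      by (rule append_cols_mult_vec[OF R0 X]) auto
    also have "\<dots> = u"
      by (rule eq_vecI) (use u in \<open>auto simp: X_def scalar_prod_def\<close>)
    finally show ?thesis
      unfolding mem_mat_range[OF R] using append_carrier_vec[of "0\<^sub>v r" r "unit_vec 1 0" 1] by force
  qed
  ultimately show ?thesis by simp
qed

sublocale pert: input_perturbation A B C D n q p k \<Pi>k Hb Lb G
  by unfold_locales (use controlled_invariance in auto)

text \<open>The inputs \<open>R0\<close> lead from zero to the columns of \<open>\<Pi>k * \<alpha>k\<close>, the inputs \<open>Hk\<close> move \<open>\<Pi>k *\<^sub>v w\<close> to
  \<open>\<Pi>k *\<^sub>v (\<Lambda>k *\<^sub>v w)\<close>, and both have zero output; controllability of \<open>(\<Lambda>k, \<alpha>k)\<close> then reaches every \<open>w\<close>.\<close>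

lemma range_\<Pi>k_Cstar: "mat_range \<Pi>k \<subseteq> Cstar A B C D"
proof -
  note S = vec_subspaceD[OF vec_subspace_Cstar]
  define W where "W = {w \<in> carrier_vec k. \<Pi>k *\<^sub>v w \<in> Cstar A B C D}"
  have "reachable_subspace \<Lambda>k \<alpha>k \<subseteq> W"
  proof (rule reachable_least[OF carriers(5,8)])
    show "vec_subspace k W"
      by (rule vec_subspaceI) (use S in \<open>auto simp: W_def vec_distrib\<close>)
    show "mat_range \<alpha>k \<subseteq> W"
    proof
      fix w assume "w \<in> mat_range \<alpha>k"
      then obtain c where c: "c \<in> carrier_vec r" "w = \<alpha>k *\<^sub>v c" using mem_mat_range[OF carriers(8)] by blast
      have "B *\<^sub>v (R0 *\<^sub>v c) = \<Pi>k *\<^sub>v w"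
        using arg_cong[OF BR0, of "\<lambda>M. M *\<^sub>v c"] c by (simp add: vec_distrib)
      moreover have "D *\<^sub>v (R0 *\<^sub>v c) = 0\<^sub>v p"
        using arg_cong[OF DR0, of "\<lambda>M. M *\<^sub>v c"] c by (simp add: vec_distrib)
      ultimately have "step (0\<^sub>v n) (\<Pi>k *\<^sub>v w)"
        by (intro stepI[of "R0 *\<^sub>v c"]) (auto simp: vec_distrib)
      then show "w \<in> W" using Cstar_step[OF zero_Cstar] c by (auto simp: W_def)
    qed
    fix w assume w: "w \<in> W"
    then have "step (\<Pi>k *\<^sub>v w) (\<Pi>k *\<^sub>v (\<Lambda>k *\<^sub>v w))"
      by (intro matrix_steps[OF _ _ _ _ zero_equations(1,2)]) (auto simp: W_def)
    with w show "\<Lambda>k *\<^sub>v w \<in> W" using Cstar_step by (auto simp: W_def)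
  qed
  moreover have "controllable \<Lambda>k \<alpha>k" using right_unfolded by (elim conjE)
  then have "reachable_subspace \<Lambda>k \<alpha>k = carrier_vec k" by (simp add: controllable_def)
  ultimately show ?thesis by (auto simp: W_def mat_range_def)
qed

lemma blocked: "u \<in> mat_range R0 \<Longrightarrow> pert.Bp *\<^sub>v u = 0\<^sub>v n"
proof -
  assume "u \<in> mat_range R0"
  then obtain c where c: "c \<in> carrier_vec r" "u = R0 *\<^sub>v c" using mem_mat_range[OF R0] by blast
  have "pert.Bp * R0 = B * R0 + \<Pi>k * (G * R0)" by (simp add: pert.Bp_def mat_distrib)
  also have "\<dots> = 0\<^sub>m n r"
    unfolding BR0 G_R0 by (rule eq_matI) (auto simp: mat_distrib simp del: index_mult_mat(1))
  finally have "(pert.Bp * R0) *\<^sub>v c = 0\<^sub>v n" using c by (simp add: vec_distrib)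
  then show ?thesis using c by (simp add: mat_mult_vec)
qed

text \<open>A step inside \<open>Vtraj\<close> from an element \<open>\<Pi>k *\<^sub>v w\<close> differs from the feedback step by an input
  that leads from zero into \<open>Vtraj\<close> with zero output. By \<open>range_R0\<close> it is a combination of the columns of
  \<open>R0\<close>, whose effect \<open>B * R0 = \<Pi>k * \<alpha>k\<close> stays in the range of \<open>\<Pi>k\<close>. Hence this range exhausts
  \<open>Cstar \<inter> Vtraj\<close>.\<close>

sublocale factor: input_factor A B C D n q p k \<Pi>k Hb Lb G
proof
  show "mat_range \<Pi>k \<subseteq> Cstar A B C D" by (rule range_\<Pi>k_Cstar)
  show "Cstar A B C D \<inter> Vtraj A B C D \<subseteq> mat_range \<Pi>k"
  proof (rule Cstar_inter_Vtraj_subset)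
    show "0\<^sub>v n \<in> mat_range \<Pi>k" by (rule vec_subspaceD[OF vec_subspace_mat_range]) auto
  next
    fix x u assume x: "x \<in> mat_range \<Pi>k" and u: "u \<in> carrier_vec q"
      and Cx: "C *\<^sub>v x + D *\<^sub>v u = 0\<^sub>v p" and V: "A *\<^sub>v x + B *\<^sub>v u \<in> Vtraj A B C D"
    obtain w where w: "w \<in> carrier_vec k" "x = \<Pi>k *\<^sub>v w" using x mem_mat_range[OF carriers(1)] by blast
    define u' where "u' = u - Hb *\<^sub>v w"
    have u': "u' \<in> carrier_vec q" using u by (auto simp: u'_def intro!: carrier_vecI)
    have Ax: "A *\<^sub>v x + B *\<^sub>v u = \<Pi>k *\<^sub>v (Lb *\<^sub>v w) + B *\<^sub>v u'"
    proof (rule eq_vecI)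
      fix i assume "i < dim_vec (\<Pi>k *\<^sub>v (Lb *\<^sub>v w) + B *\<^sub>v u')"
      then have i: "i < n" by simp
      have "(A *\<^sub>v (\<Pi>k *\<^sub>v w) + B *\<^sub>v (Hb *\<^sub>v w)) $ i = (\<Pi>k *\<^sub>v (Lb *\<^sub>v w)) $ i"
        using pert.invD[OF w(1)] by simp
      then have "(A *\<^sub>v (\<Pi>k *\<^sub>v w)) $ i + (B *\<^sub>v (Hb *\<^sub>v w)) $ i = (\<Pi>k *\<^sub>v (Lb *\<^sub>v w)) $ i"
        using i by (simp del: index_mult_mat_vec)
      then show "(A *\<^sub>v x + B *\<^sub>v u) $ i = (\<Pi>k *\<^sub>v (Lb *\<^sub>v w) + B *\<^sub>v u') $ i"
        using i u w by (simp add: u'_def vec_distrib algebra_simps del: index_mult_mat_vec)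
    qed simp
    have "D *\<^sub>v u' = 0\<^sub>v p"
    proof (rule eq_vecI)
      fix i assume "i < dim_vec (0\<^sub>v p)"
      then have i: "i < p" by simp
      have "(C *\<^sub>v (\<Pi>k *\<^sub>v w) + D *\<^sub>v (Hb *\<^sub>v w)) $ i = 0" "(C *\<^sub>v (\<Pi>k *\<^sub>v w) + D *\<^sub>v u) $ i = 0"
        using pert.outD[OF w(1)] Cx w i by auto
      then have "(C *\<^sub>v (\<Pi>k *\<^sub>v w)) $ i + (D *\<^sub>v (Hb *\<^sub>v w)) $ i = 0"
        "(C *\<^sub>v (\<Pi>k *\<^sub>v w)) $ i + (D *\<^sub>v u) $ i = 0"
        using i by (auto simp del: index_mult_mat_vec)
      then have "(D *\<^sub>v u) $ i = (D *\<^sub>v (Hb *\<^sub>v w)) $ i" by (metis add_left_cancel)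
      then show "(D *\<^sub>v u') $ i = 0\<^sub>v p $ i"
        using i u w by (simp add: u'_def vec_distrib del: index_mult_mat_vec)
    qed simp
    moreover have "B *\<^sub>v u' \<in> Vtraj A B C D"
    proof -
      have "Lb *\<^sub>v w \<in> carrier_vec k" by simp
      then have "\<Pi>k *\<^sub>v (Lb *\<^sub>v w) \<in> Vtraj A B C D"
        using pert.range_Vtraj mem_mat_range[OF carriers(1)] by blast
      moreover have "B *\<^sub>v u' = (A *\<^sub>v x + B *\<^sub>v u) - \<Pi>k *\<^sub>v (Lb *\<^sub>v w)"
        unfolding Ax by (rule eq_vecI) (simp_all del: index_mult_mat_vec add: index_minus_vec)
      ultimately show ?thesis using V vec_subspace_minus[OF vec_subspace_Vtraj] by simp
    qed
    ultimately have "u' \<in> mat_range R0" by (rule range_R0[OF u'])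
    then obtain c where c: "c \<in> carrier_vec r" "u' = R0 *\<^sub>v c" using mem_mat_range[OF R0] by blast
    have "B *\<^sub>v u' = \<Pi>k *\<^sub>v (\<alpha>k *\<^sub>v c)"
      using arg_cong[OF BR0, of "\<lambda>M. M *\<^sub>v c"] c by (simp add: vec_distrib)
    then have "A *\<^sub>v x + B *\<^sub>v u = \<Pi>k *\<^sub>v (Lb *\<^sub>v w + \<alpha>k *\<^sub>v c)"
      unfolding Ax by (simp add: vec_distrib)
    moreover have "Lb *\<^sub>v w + \<alpha>k *\<^sub>v c \<in> carrier_vec k" by (auto intro!: carrier_vecI)
    ultimately show "A *\<^sub>v x + B *\<^sub>v u \<in> mat_range \<Pi>k" using mem_mat_range[OF carriers(1)] by blast
  qed
next
  fix u assume "u \<in> carrier_vec q" "D *\<^sub>v u = 0\<^sub>v p" "B *\<^sub>v u \<in> Vtraj A B C D"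
  then show "(B + \<Pi>k * G) *\<^sub>v u = 0\<^sub>v n"
    using range_R0 blocked unfolding pert.Bp_def by blast
qed

text \<open>The perturbation replaces the multiplier \<open>Lb\<close> by \<open>Lb + G * Hb\<close>, which by the Lyapunov equation is
  similar to \<open>- Lb\<^sup>\<dagger>\<close>: the modes on the range of \<open>\<Pi>k\<close> are reflected at the imaginary axis.\<close>

lemma zero_equations_pert:
  "A * \<Pi>k + pert.Bp * Hb = \<Pi>k * (- (S * Lb\<^sup>\<dagger> * \<sigma>))"
  "A * \<Pi>f + pert.Bp * Hf = \<Pi>k * (\<Lambda>kf + G * Hf) + \<Pi>f * \<Lambda>f"
proof -
  have "A * \<Pi>k + pert.Bp * Hb = (A * \<Pi>k + B * Hb) + \<Pi>k * (G * Hb)"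
    by (rule eq_matI) (auto simp: pert.Bp_def mat_distrib simp del: index_mult_mat(1))
  also have "\<dots> = \<Pi>k * (- (S * Lb\<^sup>\<dagger> * \<sigma>))"
    unfolding controlled_invariance(1) G_Hb
    by (rule eq_matI) (auto simp: mat_distrib simp del: index_mult_mat(1))
  finally show "A * \<Pi>k + pert.Bp * Hb = \<Pi>k * (- (S * Lb\<^sup>\<dagger> * \<sigma>))" .
  have "A * \<Pi>f + pert.Bp * Hf = (A * \<Pi>f + B * Hf) + \<Pi>k * (G * Hf)"
    by (rule eq_matI) (auto simp: pert.Bp_def mat_distrib simp del: index_mult_mat(1))
  also have "\<dots> = \<Pi>k * (\<Lambda>kf + G * Hf) + \<Pi>f * \<Lambda>f"
    unfolding zero_equations(3)
    by (rule eq_matI) (auto simp: mat_distrib simp del: index_mult_mat(1))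
  finally show "A * \<Pi>f + pert.Bp * Hf = \<Pi>k * (\<Lambda>kf + G * Hf) + \<Pi>f * \<Lambda>f" .
qed

lemma Hb_L0: "Hb\<^sup>\<dagger> * L0 = Hk\<^sup>\<dagger> * L0"
proof -
  have "Hb\<^sup>\<dagger> * L0 = Hk\<^sup>\<dagger> * L0 + \<beta>k\<^sup>\<dagger> * (R0\<^sup>\<dagger> * L0)"
    by (simp add: Hb_def adjoint_simps mat_distrib)
  also have "\<dots> = Hk\<^sup>\<dagger> * L0"
    unfolding unitary_eqs by (rule eq_matI) (auto simp: mat_distrib simp del: index_mult_mat(1))
  finally show ?thesis .
qed

lemma Bp_L0: "pert.Bp * L0 = (B + \<Pi>k * S * Hk\<^sup>\<dagger>) * L0"
proof -
  have "pert.Bp * L0 = B * L0 + \<Pi>k * (S * (Hb\<^sup>\<dagger> * L0))"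
    unfolding pert.Bp_def by (simp add: G_def mat_distrib)
  then show ?thesis unfolding Hb_L0 by (simp add: mat_distrib)
qed

lemma Bp_R0: "pert.Bp * R0 = 0\<^sub>m n r"
proof -
  have "pert.Bp * R0 = B * R0 + \<Pi>k * (G * R0)" by (simp add: pert.Bp_def mat_distrib)
  also have "\<dots> = 0\<^sub>m n r"
    unfolding BR0 G_R0 by (rule eq_matI) (auto simp: mat_distrib simp del: index_mult_mat(1))
  finally show ?thesis .
qed

text \<open>Since \<open>R0 * R0\<^sup>\<dagger> + L0 * L0\<^sup>\<dagger>\<close> is the identity, the projection \<open>L0 * L0\<^sup>\<dagger>\<close> loses nothing of a matrix
  that vanishes on the range of \<open>R0\<close>.\<close>

lemma project_input:
  assumes "M \<in> carrier_mat m q" "M * R0 = 0\<^sub>m m r"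
  shows "M * L0 * L0\<^sup>\<dagger> = M"
proof -
  have "M = M * (R0 * R0\<^sup>\<dagger> + L0 * L0\<^sup>\<dagger>)" unfolding unitary_eqs using assms by simp
  also have "\<dots> = (M * R0) * R0\<^sup>\<dagger> + M * L0 * L0\<^sup>\<dagger>" using assms(1) by (simp add: mat_distrib)
  also have "\<dots> = M * L0 * L0\<^sup>\<dagger>"
    unfolding assms(2) by (rule eq_matI) (use assms(1) in \<open>auto simp: mat_distrib simp del: index_mult_mat(1)\<close>)
  finally show ?thesis by simp
qed

end

section \<open>Transfer functions\<close>


abbreviation zvar :: "complex poly fract" where "zvar \<equiv> to_fract [:0, 1:]"
abbreviation cst :: "complex \<Rightarrow> complex poly fract" where "cst c \<equiv> to_fract [:c:]"

lemma cst_hom: "cst (a + b) = cst a + cst b" "cst (a * b) = cst a * cst b" "cst (a - b) = cst a - cst b"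
  "cst (- a) = - cst a"
  by (simp_all add: flip: to_fract_add to_fract_mult to_fract_diff to_fract_uminus)

lemma cst_1: "cst 1 = 1"
  by (simp add: one_pCons[symmetric])

lemma cst_sum: "cst (sum f S) = (\<Sum>x\<in>S. cst (f x))"
  by (induction S rule: infinite_finite_induct) (auto simp: cst_hom)

lemma const_mat_dims [simp]: "dim_row (const_mat M) = dim_row M" "dim_col (const_mat M) = dim_col M"
  by (auto simp: const_mat_def)

lemma const_mat_carrier [simp]: "const_mat M \<in> carrier_mat n m \<longleftrightarrow> M \<in> carrier_mat n m"
  by (auto simp: const_mat_def)

lemma const_mat_index: "i < dim_row M \<Longrightarrow> j < dim_col M \<Longrightarrow> const_mat M $$ (i, j) = cst (M $$ (i, j))"
  by (auto simp: const_mat_def)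

lemma const_mat_mult: "dim_col M = dim_row N \<Longrightarrow> const_mat (M * N) = const_mat M * const_mat N"
  by (rule eq_matI) (auto simp: const_mat_def scalar_prod_def cst_hom cst_sum)

lemma const_mat_add:
  "dim_row M = dim_row N \<Longrightarrow> dim_col M = dim_col N \<Longrightarrow> const_mat (M + N) = const_mat M + const_mat N"
  by (rule eq_matI) (auto simp: const_mat_def cst_hom)

lemma const_mat_minus:
  "dim_row M = dim_row N \<Longrightarrow> dim_col M = dim_col N \<Longrightarrow> const_mat (M - N) = const_mat M - const_mat N"
  by (rule eq_matI) (auto simp: const_mat_def cst_hom)

lemma const_mat_uminus: "const_mat (- M) = - const_mat M"
  by (rule eq_matI) (auto simp: const_mat_def cst_hom)

lemma const_mat_one: "const_mat (1\<^sub>m n) = 1\<^sub>m n"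
  by (rule eq_matI) (auto simp: const_mat_def cst_1)

lemma const_mat_zero: "const_mat (0\<^sub>m n m) = 0\<^sub>m n m"
  by (rule eq_matI) (auto simp: const_mat_def)

lemma const_mat_transpose: "const_mat (M\<^sup>T) = (const_mat M)\<^sup>T"
  by (rule eq_matI) (auto simp: const_mat_def)

lemmas const_mat_hom = const_mat_mult const_mat_add const_mat_minus const_mat_uminus
  const_mat_one const_mat_zero

definition pencil :: "complex mat \<Rightarrow> complex poly fract mat" where
  "pencil M = zvar \<cdot>\<^sub>m 1\<^sub>m (dim_row M) - const_mat M"

lemma pencil_dims [simp]: "dim_row (pencil M) = dim_row M" "dim_col (pencil M) = dim_col M"
  by (auto simp: pencil_def)

lemma pencil_carrier: "M \<in> carrier_mat n n \<Longrightarrow> pencil M \<in> carrier_mat n n"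
  by (auto simp: pencil_def)

lemma pencil_index:
  "i < dim_row M \<Longrightarrow> j < dim_row M \<Longrightarrow> dim_col M = dim_row M \<Longrightarrow>
   pencil M $$ (i, j) = (if i = j then zvar else 0) - cst (M $$ (i, j))"
  by (auto simp: pencil_def const_mat_def)

lemma smult_one_mult: "dim_row M = n \<Longrightarrow> (c \<cdot>\<^sub>m 1\<^sub>m n) * M = c \<cdot>\<^sub>m (M :: 'a :: comm_ring_1 mat)"
  using mult_smult_assoc_mat[of "1\<^sub>m n" n n M "dim_col M" c] by auto

lemma smult_one_mult_vec:
  assumes v: "v \<in> carrier_vec n"
  shows "(c \<cdot>\<^sub>m 1\<^sub>m n) *\<^sub>v v = c \<cdot>\<^sub>v (v :: 'a :: comm_ring_1 vec)"
proof (rule eq_vecI)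
  fix i assume "i < dim_vec (c \<cdot>\<^sub>v v)"
  then have i: "i < n" using v by simp
  then have "row (c \<cdot>\<^sub>m 1\<^sub>m n) i = c \<cdot>\<^sub>v unit_vec n i" by (intro eq_vecI) auto
  then show "((c \<cdot>\<^sub>m 1\<^sub>m n) *\<^sub>v v) $ i = (c \<cdot>\<^sub>v v) $ i"
    using i v by (simp add: smult_scalar_prod_distrib[of _ n])
qed (use v in auto)

lemma mult_smult_one: "dim_col M = n \<Longrightarrow> M * (c \<cdot>\<^sub>m 1\<^sub>m n) = c \<cdot>\<^sub>m (M :: 'a :: comm_ring_1 mat)"
  using mult_smult_distrib[of M "dim_row M" n "1\<^sub>m n" n c] by auto

lemma pencil_mult:
  "A \<in> carrier_mat n n \<Longrightarrow> dim_row M = n \<Longrightarrow> pencil A * M = zvar \<cdot>\<^sub>m M - const_mat A * M"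
  by (simp add: pencil_def mat_minus_mult smult_one_mult)

lemma mult_pencil:
  "A \<in> carrier_mat n n \<Longrightarrow> dim_col M = n \<Longrightarrow> M * pencil A = zvar \<cdot>\<^sub>m M - M * const_mat A"
  by (simp add: pencil_def mat_mult_minus mult_smult_one)

text \<open>The determinant of the pencil is the characteristic polynomial, which is monic.\<close>

lemma pencil_injective:
  assumes A: "A \<in> carrier_mat n n" and v: "v \<in> carrier_vec n" "pencil A *\<^sub>v v = 0\<^sub>v n"
  shows "v = 0\<^sub>v n"
proof -
  have "pencil A = map_mat to_fract (char_poly_matrix A)"
    using A by (intro eq_matI) (auto simp: pencil_index char_poly_matrix_def cst_hom simp del: add_pCons)
  moreover have "det (map_mat to_fract (char_poly_matrix A)) = to_fract (det (char_poly_matrix A))"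
  proof -
    interpret comm_ring_hom "to_fract :: complex poly \<Rightarrow> _" by unfold_locales auto
    show ?thesis by (rule hom_det)
  qed
  moreover have "char_poly A \<noteq> 0" using degree_monic_char_poly[OF A] by auto
  ultimately have "det (pencil A) \<noteq> 0" by (simp add: char_poly_def)
  then show ?thesis using det_0_iff_vec_prod_zero_field[OF pencil_carrier[OF A]] v by blast
qed

lemma resolvent_pencil:
  assumes A: "A \<in> carrier_mat n n"
  shows "resolvent A \<in> carrier_mat n n" "pencil A * resolvent A = 1\<^sub>m n" "resolvent A * pencil A = 1\<^sub>m n"
  using mat_inv_of_injective[OF pencil_carrier[OF A] pencil_injective[OF A]]
  unfolding pencil_def resolvent_def by auto

lemma resolvent_dims [simp]:
  assumes "A \<in> carrier_mat n n"
  shows "dim_row (resolvent A) = n" "dim_col (resolvent A) = n"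
  using resolvent_pencil(1)[OF assms] by auto

lemma resolvent_unique:
  assumes A: "A \<in> carrier_mat n n" and "N \<in> carrier_mat n n" "N * pencil A = 1\<^sub>m n"
  shows "resolvent A = N"
  using mat_inv_unique(1)[OF pencil_carrier[OF A] assms(2,3)] by (simp add: resolvent_def pencil_def)

lemma resolvent_transpose:
  assumes A: "A \<in> carrier_mat n n"
  shows "resolvent (A\<^sup>T) = (resolvent A)\<^sup>T"
proof (rule resolvent_unique)
  have "pencil (A\<^sup>T) = (pencil A)\<^sup>T"
    using A by (intro eq_matI) (auto simp: pencil_index)
  then have "(resolvent A)\<^sup>T * pencil (A\<^sup>T) = (pencil A * resolvent A)\<^sup>T"
    using A by (simp add: mat_transpose_mult)
  then show "(resolvent A)\<^sup>T * pencil (A\<^sup>T) = 1\<^sub>m n"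
    using resolvent_pencil[OF A] by (simp add: mat_transpose_one)
qed (use A resolvent_pencil(1)[OF A] in auto)

text \<open>Because \<open>const_mat (P * L - A * P) = pencil A * const_mat P - const_mat P * pencil L\<close>.\<close>

lemma resolvent_intertwine:
  assumes A: "A \<in> carrier_mat n n" and L: "L \<in> carrier_mat k k" and P: "P \<in> carrier_mat n k"
  shows "resolvent A * const_mat (P * L - A * P) * resolvent L =
    const_mat P * resolvent L - resolvent A * const_mat P"
proof -
  note rA = resolvent_pencil[OF A] and rL = resolvent_pencil[OF L]
  have c: "dim_row A = n" "dim_col A = n" "dim_row L = k" "dim_col L = k" "dim_row P = n" "dim_col P = k"
    using A L P by auto
  have "const_mat (P * L - A * P) = pencil A * const_mat P - const_mat P * pencil L"
  proof (rule eq_matI)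
    fix i j assume "i < dim_row (pencil A * const_mat P - const_mat P * pencil L)"
      "j < dim_col (pencil A * const_mat P - const_mat P * pencil L)"
    then show "const_mat (P * L - A * P) $$ (i, j) = (pencil A * const_mat P - const_mat P * pencil L) $$ (i, j)"
      using c by (simp add: pencil_mult[OF A] mult_pencil[OF L] const_mat_hom del: index_mult_mat(1))
  qed (use c in auto)
  then have "resolvent A * const_mat (P * L - A * P) * resolvent L =
      (resolvent A * pencil A) * (const_mat P * resolvent L) - resolvent A * const_mat P * (pencil L * resolvent L)"
    using c A L by (simp add: mat_distrib)
  also have "\<dots> = const_mat P * resolvent L - resolvent A * const_mat P"
    unfolding rA rL using c A L by (simp add: mat_distrib)
  finally show ?thesis .
qed

lemma transfer_function_carrier:
  assumes "A \<in> carrier_mat n n" "B \<in> carrier_mat n q" "C \<in> carrier_mat p n" "D \<in> carrier_mat p q"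
  shows "transfer_function A B C D \<in> carrier_mat p q"
  using assms by (auto simp: transfer_function_def)

lemma transfer_function_transpose:
  assumes "A \<in> carrier_mat n n" "B \<in> carrier_mat n q" "C \<in> carrier_mat p n" "D \<in> carrier_mat p q"
  shows "(transfer_function A B C D)\<^sup>T = transfer_function (A\<^sup>T) (C\<^sup>T) (B\<^sup>T) (D\<^sup>T)"
  using assms unfolding transfer_function_def
  by (simp add: mat_transpose resolvent_transpose[OF assms(1)] const_mat_transpose mat_mult_assoc)

text \<open>The second factor has the dynamics of a controlled invariant subspace on which the output vanishes.
  Such a factor is absorbed into the state space of the first one, and only the input matrix changes:
  \<open>B * H = P * L - A * P\<close> allows \<open>resolvent_intertwine\<close> to collapse the product of the two resolvents.\<close>

lemma transfer_function_mult_cascade: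
  assumes c: "A \<in> carrier_mat n n" "B \<in> carrier_mat n q" "C \<in> carrier_mat p n" "D \<in> carrier_mat p q"
    "P \<in> carrier_mat n k" "H \<in> carrier_mat q k" "L \<in> carrier_mat k k" "G \<in> carrier_mat k q"
    and inv: "A * P + B * H = P * L" and out: "C * P + D * H = 0\<^sub>m p k"
  shows "transfer_function A B C D * (1\<^sub>m q - const_mat H * resolvent L * const_mat G) =
    transfer_function A (B + P * G) C D"
proof -
  note d = carrier_matD[OF c(1)] carrier_matD[OF c(2)] carrier_matD[OF c(3)] carrier_matD[OF c(4)]
    carrier_matD[OF c(5)] carrier_matD[OF c(6)] carrier_matD[OF c(7)] carrier_matD[OF c(8)]
    resolvent_dims[OF c(1)] resolvent_dims[OF c(7)]
  let ?A = "resolvent A" and ?L = "resolvent L"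
  have BH: "B * H = P * L - A * P"
  proof (rule eq_matI)
    fix i j assume "i < dim_row (P * L - A * P)" "j < dim_col (P * L - A * P)"
    then show "(B * H) $$ (i, j) = (P * L - A * P) $$ (i, j)"
      unfolding inv[symmetric] using d by (simp del: index_mult_mat(1))
  qed (use d in auto)
  have DH: "D * H = - (C * P)"
  proof (rule eq_matI)
    fix i j assume "i < dim_row (- (C * P))" "j < dim_col (- (C * P))"
    then show "(D * H) $$ (i, j) = (- (C * P)) $$ (i, j)"
      using d arg_cong[OF out, of "\<lambda>M. M $$ (i, j)"]
      by (simp del: index_mult_mat(1) add: eq_neg_iff_add_eq_0 add.commute)
  qed (use d in auto)
  have "?A * (const_mat B * (const_mat H * ?L)) = const_mat P * ?L - ?A * const_mat P"
    using resolvent_intertwine[OF c(1,7,5)] d by (simp add: BH[symmetric] const_mat_hom mat_mult_assoc)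
  moreover have "const_mat D * (const_mat H * ?L) = - (const_mat C * (const_mat P * ?L))"
    using arg_cong[OF DH, of "\<lambda>M. const_mat M * ?L"] d by (simp add: const_mat_hom mat_distrib)
  ultimately have "transfer_function A B C D * (const_mat H * ?L) = - (const_mat C * (?A * const_mat P))"
    using d unfolding transfer_function_def
    by (intro eq_matI) (auto simp: mat_distrib simp del: index_mult_mat(1))
  then have "transfer_function A B C D * (const_mat H * ?L) * const_mat G =
      - (const_mat C * (?A * const_mat P)) * const_mat G" by simp
  moreover have "dim_col (transfer_function A B C D) = q" "dim_row (transfer_function A B C D) = p"
    using d by (auto simp: transfer_function_def)
  ultimately have "transfer_function A B C D * (1\<^sub>m q - const_mat H * ?L * const_mat G) =
      transfer_function A B C D + const_mat C * (?A * const_mat P) * const_mat G"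
    using d by (intro eq_matI) (auto simp: mat_distrib simp del: index_mult_mat(1))
  also have "\<dots> = transfer_function A (B + P * G) C D"
    using d unfolding transfer_function_def
    by (intro eq_matI) (auto simp: mat_distrib const_mat_hom simp del: index_mult_mat(1))
  finally show ?thesis .
qed

lemma transfer_function_mult_const:
  assumes c: "A \<in> carrier_mat n n" "B \<in> carrier_mat n q" "C \<in> carrier_mat p n" "D \<in> carrier_mat p q"
    "M \<in> carrier_mat q l"
  shows "transfer_function A B C D * const_mat M = transfer_function A (B * M) C (D * M)"
  using c resolvent_dims[OF c(1)] unfolding transfer_function_def
  by (simp add: mat_distrib const_mat_hom)


section \<open>Para-hermitian conjugation\<close>

lemma para_conj_poly_hom: "para_conj_poly (p + q) = para_conj_poly p + para_conj_poly q"
  "para_conj_poly (- p) = - para_conj_poly p" "para_conj_poly [:c:] = [:cnj c:]"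
  "para_conj_poly [:0, 1:] = - [:0, 1:]" "para_conj_poly 1 = 1" "para_conj_poly 0 = 0"
  by (simp_all add: poly_eq_poly_eq_iff[symmetric] fun_eq_iff poly_para_conj_poly)

lemma para_conj_to_fract: "para_conj (to_fract p) = to_fract (para_conj_poly p)"
  by (simp add: to_fract_def para_conj_Fract para_conj_poly_hom)

lemma para_conj_add: "para_conj (r + s) = para_conj r + para_conj s"
proof (cases r; cases s)
  fix a b c d assume "r = Fract a b" "b \<noteq> 0" "s = Fract c d" "d \<noteq> 0"
  then show ?thesis
    by (simp add: para_conj_Fract para_conj_poly_hom para_conj_poly_mult para_conj_poly_0_iff)
qed

lemma para_conj_mult: "para_conj (r * s) = para_conj r * para_conj s"
proof (cases r; cases s)
  fix a b c d assume "r = Fract a b" "b \<noteq> 0" "s = Fract c d" "d \<noteq> 0"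
  then show ?thesis
    by (simp add: para_conj_Fract para_conj_poly_mult para_conj_poly_0_iff)
qed

lemma para_conj_cst: "para_conj (cst c) = cst (cnj c)"
  by (simp add: para_conj_to_fract para_conj_poly_hom)

lemma para_conj_0 [simp]: "para_conj 0 = 0" and para_conj_1 [simp]: "para_conj 1 = 1"
  using para_conj_cst[of 0] para_conj_cst[of 1] by (auto simp: cst_1)

lemma para_conj_uminus: "para_conj (- r) = - para_conj r"
  using para_conj_add[of r "- r"] by (simp add: eq_neg_iff_add_eq_0 add.commute)

lemma para_conj_minus: "para_conj (r - s) = para_conj r - para_conj s"
  using para_conj_add[of r "- s"] by (simp add: para_conj_uminus)

lemma para_conj_sum: "para_conj (sum f S) = (\<Sum>x\<in>S. para_conj (f x))"
  by (induction S rule: infinite_finite_induct) (auto simp: para_conj_add)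

lemma para_adjoint_dims [simp]:
  "dim_row (para_adjoint M) = dim_col M" "dim_col (para_adjoint M) = dim_row M"
  by (auto simp: para_adjoint_def)

lemma para_adjoint_index:
  "i < dim_col M \<Longrightarrow> j < dim_row M \<Longrightarrow> para_adjoint M $$ (i, j) = para_conj (M $$ (j, i))"
  by (auto simp: para_adjoint_def)

lemma para_adjoint_mult: "dim_col M = dim_row N \<Longrightarrow> para_adjoint (M * N) = para_adjoint N * para_adjoint M"
  by (rule eq_matI)
    (auto simp: para_adjoint_def scalar_prod_def para_conj_sum para_conj_mult mult.commute intro!: sum.cong)

lemma para_adjoint_minus:
  "dim_row M = dim_row N \<Longrightarrow> dim_col M = dim_col N \<Longrightarrow> para_adjoint (M - N) = para_adjoint M - para_adjoint N"
  by (rule eq_matI) (auto simp: para_adjoint_def para_conj_minus)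

lemma para_adjoint_one: "para_adjoint (1\<^sub>m n) = 1\<^sub>m n"
  by (rule eq_matI) (auto simp: para_adjoint_def)

lemma para_adjoint_const: "para_adjoint (const_mat M) = const_mat (M\<^sup>\<dagger>)"
  by (rule eq_matI) (auto simp: para_adjoint_def const_mat_def para_conj_cst)

lemma para_adjoint_transpose: "para_adjoint (M\<^sup>T) = (para_adjoint M)\<^sup>T"
  by (rule eq_matI) (auto simp: para_adjoint_def)

lemma to_fract_minus_var: "to_fract [:0, - 1:] = - zvar"
  by (simp flip: to_fract_uminus)

lemma para_adjoint_resolvent:
  assumes L: "L \<in> carrier_mat k k"
  shows "para_adjoint (resolvent L) = - resolvent (- L\<^sup>\<dagger>)"
proof -
  note r = resolvent_pencil[OF L]
  have "pencil (- L\<^sup>\<dagger>) = - para_adjoint (pencil L)"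
    using L by (intro eq_matI)
      (auto simp: pencil_index para_adjoint_index para_conj_minus para_conj_cst para_conj_to_fract
        para_conj_poly_hom cst_hom to_fract_minus_var)
  then have "(- para_adjoint (resolvent L)) * pencil (- L\<^sup>\<dagger>) = para_adjoint (pencil L * resolvent L)"
    using L by (simp add: para_adjoint_mult mat_uminus_mult mat_mult_uminus) 
  also have "\<dots> = 1\<^sub>m k" by (simp add: r para_adjoint_one)
  finally have "resolvent (- L\<^sup>\<dagger>) = - para_adjoint (resolvent L)"
    using L by (intro resolvent_unique) auto
  then show ?thesis by simp
qed

text \<open>In \<open>U * para_adjoint U\<close> the resolvents of \<open>L\<close> and \<open>- L\<^sup>\<dagger>\<close> appear on both sides of \<open>S * H\<^sup>\<dagger> * H * S\<close>.
  The Lyapunov equation writes this matrix as \<open>S * (- L\<^sup>\<dagger>) - L * S\<close>, so that the quadratic term splits by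
  \<open>resolvent_intertwine\<close> into two linear ones that cancel the others.\<close>

lemma para_unitary_of_lyapunov:
  assumes H: "H \<in> carrier_mat q k" and L: "L \<in> carrier_mat k k" and S: "S \<in> carrier_mat k k"
    and S_adj: "S\<^sup>\<dagger> = S" and lyap: "L * S + S * L\<^sup>\<dagger> + S * H\<^sup>\<dagger> * H * S = 0\<^sub>m k k"
  defines "U \<equiv> 1\<^sub>m q - const_mat H * resolvent L * const_mat (S * H\<^sup>\<dagger>)"
  shows "U * para_adjoint U = 1\<^sub>m q"
proof -
  define M where "M = - L\<^sup>\<dagger>"
  have M: "M \<in> carrier_mat k k" using L by (auto simp: M_def)
  note d = carrier_matD[OF H] carrier_matD[OF L] carrier_matD[OF S] carrier_matD[OF M]
    resolvent_dims[OF L] resolvent_dims[OF M]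
  let ?h = "const_mat H" and ?h' = "const_mat (H\<^sup>\<dagger>)" and ?s = "const_mat S"
    and ?R = "resolvent L" and ?R' = "resolvent M"
  have U: "U = 1\<^sub>m q - ?h * (?R * (?s * ?h'))"
    using d by (simp add: U_def const_mat_hom mat_mult_assoc)
  have U': "para_adjoint U = 1\<^sub>m q + ?h * (?s * (?R' * ?h'))"
  proof -
    have "para_adjoint U = 1\<^sub>m q - para_adjoint (?h * (?R * (?s * ?h')))"
      unfolding U using d by (subst para_adjoint_minus) (auto simp: para_adjoint_one)
    also have "para_adjoint (?h * (?R * (?s * ?h'))) = - (?h * (?s * (?R' * ?h')))"
      using d by (simp add: para_adjoint_mult para_adjoint_const S_adj para_adjoint_resolvent[OF L]
          M_def[symmetric] mat_distrib)
    finally show ?thesis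
      using d by (intro eq_matI) (auto simp del: index_mult_mat(1))
  qed
  have eq: "S * H\<^sup>\<dagger> * H * S = S * M - L * S"
  proof (rule eq_matI)
    fix i j assume "i < dim_row (S * M - L * S)" "j < dim_col (S * M - L * S)"
    then have ij: "i < k" "j < k" using d by auto
    have "(L * S + S * L\<^sup>\<dagger> + S * H\<^sup>\<dagger> * H * S) $$ (i, j) = 0" using ij by (simp add: lyap)
    then have "(S * H\<^sup>\<dagger> * H * S) $$ (i, j) = - ((L * S) $$ (i, j) + (S * L\<^sup>\<dagger>) $$ (i, j))"
      using ij d by (subst eq_neg_iff_add_eq_0) (simp add: add_ac del: index_mult_mat(1))
    then show "(S * H\<^sup>\<dagger> * H * S) $$ (i, j) = (S * M - L * S) $$ (i, j)"
      using ij d by (simp add: M_def mat_distrib del: index_mult_mat(1))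
  qed (use d in auto)
  have "?R * (?s * (?h' * (?h * (?s * ?R')))) = ?s * ?R' - ?R * ?s"
    using resolvent_intertwine[OF L M S] d by (simp add: eq[symmetric] const_mat_hom mat_mult_assoc)
  then have "?h * (?R * (?s * (?h' * (?h * (?s * ?R'))))) * ?h' = ?h * (?s * ?R' - ?R * ?s) * ?h'"
    by simp
  then have key: "?h * (?R * (?s * (?h' * (?h * (?s * (?R' * ?h')))))) =
      ?h * (?s * (?R' * ?h')) - ?h * (?R * (?s * ?h'))"
    using d by (simp add: mat_distrib)
  show ?thesis
  proof (rule eq_matI)
    fix i j assume ij: "i < dim_row (1\<^sub>m q :: complex poly fract mat)" "j < dim_col (1\<^sub>m q :: complex poly fract mat)"
    show "(U * para_adjoint U) $$ (i, j) = 1\<^sub>m q $$ (i, j)"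
      unfolding U' unfolding U using d ij by (simp add: mat_distrib key del: index_mult_mat(1))
  qed (use d in \<open>auto simp: U\<close>)
qed


section \<open>Polynomial trajectories\<close>

lemma common_denominator:
  fixes R :: "'a :: idom fract set"
  assumes "finite R"
  shows "\<exists>e. e \<noteq> 0 \<and> (\<forall>r\<in>R. \<exists>p. to_fract e * r = to_fract p)"
  using assms
proof (induction R)
  case (insert r R)
  then obtain e where e: "e \<noteq> 0" "\<And>s. s \<in> R \<Longrightarrow> \<exists>p. to_fract e * s = to_fract p" by blast
  obtain a b where r: "r = Fract a b" "b \<noteq> 0" by (cases r)
  have "to_fract (e * b) * r = to_fract (e * a)"
    using r by (simp add: to_fract_def eq_fract)
  moreover have "\<exists>p. to_fract (e * b) * s = to_fract p" if s: "s \<in> R" for s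
  proof -
    obtain p where "to_fract e * s = to_fract p" using e(2)[OF s] by blast
    then have "to_fract (e * b) * s = to_fract (b * p)" by (simp add: mult_ac)
    then show ?thesis by blast
  qed
  ultimately have "\<forall>s\<in>insert r R. \<exists>p. to_fract (e * b) * s = to_fract p" by blast
  moreover have "e * b \<noteq> 0" using e(1) r(2) by simp
  ultimately show ?case by blast
qed (auto intro: exI[of _ 1])

lemma const_mat_mult_poly_vec:
  assumes M: "M \<in> carrier_mat m n" and w: "w \<in> carrier_vec n"
    and P: "\<And>j. j < n \<Longrightarrow> to_fract e * w $ j = to_fract (P j)" and i: "i < m"
  shows "to_fract e * (const_mat M *\<^sub>v w) $ i = to_fract (\<Sum>j<n. smult (M $$ (i, j)) (P j))"
proof -
  have "to_fract e * (const_mat M *\<^sub>v w) $ i = (\<Sum>j<n. cst (M $$ (i, j)) * (to_fract e * w $ j))"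
    using M w i by (simp add: scalar_prod_def const_mat_index sum_distrib_left atLeast0LessThan mult_ac)
  also have "\<dots> = (\<Sum>j<n. to_fract (smult (M $$ (i, j)) (P j)))"
    by (rule sum.cong) (auto simp: P simp flip: to_fract_mult)
  finally show ?thesis by simp
qed

lemma coeff_smult_sum:
  assumes "M \<in> carrier_mat m n" "i < m"
  shows "coeff (\<Sum>j<n. smult (M $$ (i, j)) (P j)) d = (M *\<^sub>v vec n (\<lambda>j. coeff (P j) d)) $ i"
  using assms by (simp add: coeff_sum scalar_prod_def atLeast0LessThan)

text \<open>An element of the kernel of the transfer function, multiplied by a common denominator, is the
  generating function of the inputs of a trajectory with vanishing output that starts and ends in
  the zero state. The powers of \<open>z\<close> count backwards in time, and the states are shifted by one.\<close>

lemma kernel_trajectory: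
  assumes c: "A \<in> carrier_mat n n" "B \<in> carrier_mat n q" "C \<in> carrier_mat p n" "D \<in> carrier_mat p q"
    and v: "v \<in> carrier_vec q" and ker: "transfer_function A B C D *\<^sub>v v = 0\<^sub>v p"
  obtains e and x u :: "nat \<Rightarrow> complex vec" and N P where "e \<noteq> 0"
    "\<And>i. x i \<in> carrier_vec n" "\<And>i. u i \<in> carrier_vec q" "x 0 = 0\<^sub>v n" "\<And>i. i \<ge> N \<Longrightarrow> x i = 0\<^sub>v n"
    "\<And>i. x i = A *\<^sub>v x (Suc i) + B *\<^sub>v u i" "\<And>i. C *\<^sub>v x (Suc i) + D *\<^sub>v u i = 0\<^sub>v p"
    "\<And>i j. j < q \<Longrightarrow> u i $ j = coeff (P j) i" "\<And>j. j < q \<Longrightarrow> to_fract (P j) = to_fract e * v $ j"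
proof -
  note d = carrier_matD[OF c(1)] carrier_matD[OF c(2)] carrier_matD[OF c(3)] carrier_matD[OF c(4)]
    resolvent_dims[OF c(1)]
  define w where "w = resolvent A *\<^sub>v (const_mat B *\<^sub>v v)"
  have w: "w \<in> carrier_vec n" using d by (simp add: w_def)
  have vd: "dim_vec v = q" using v by auto
  have "pencil A *\<^sub>v w = (pencil A * resolvent A) *\<^sub>v (const_mat B *\<^sub>v v)"
    unfolding w_def using d vd by (intro mat_mult_vec[symmetric]) auto
  then have st: "pencil A *\<^sub>v w = const_mat B *\<^sub>v v"
    unfolding resolvent_pencil(2)[OF c(1)] using d by simp
  have out: "const_mat D *\<^sub>v v + const_mat C *\<^sub>v w = 0\<^sub>v p"
    using ker d vd by (simp add: w_def transfer_function_def vec_distrib)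
  obtain e where e: "e \<noteq> 0" "\<And>r. r \<in> set\<^sub>v v \<union> set\<^sub>v w \<Longrightarrow> \<exists>p. to_fract e * r = to_fract p"
    using common_denominator[of "set\<^sub>v v \<union> set\<^sub>v w"] by (auto simp: vec_set_def)
  have "\<exists>p. to_fract e * v $ j = to_fract p" if "j < q" for j
    using that v by (intro e(2)) (auto simp: vec_set_def)
  then obtain P where P: "\<And>j. j < q \<Longrightarrow> to_fract e * v $ j = to_fract (P j)" by metis
  have "\<exists>p. to_fract e * w $ j = to_fract p" if "j < n" for j
    using that w by (intro e(2)) (auto simp: vec_set_def)
  then obtain X where X: "\<And>j. j < n \<Longrightarrow> to_fract e * w $ j = to_fract (X j)" by metis
  have st_poly: "pCons 0 (X i) = (\<Sum>j<n. smult (A $$ (i, j)) (X j)) + (\<Sum>j<q. smult (B $$ (i, j)) (P j))"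
    if i: "i < n" for i
  proof -
    have "(pencil A *\<^sub>v w) $ i = zvar * w $ i - (const_mat A *\<^sub>v w) $ i"
      using i w d by (simp add: pencil_def vec_distrib smult_one_mult_vec del: index_mult_mat_vec)
    then have "zvar * (to_fract e * w $ i) - to_fract e * (const_mat A *\<^sub>v w) $ i =
        to_fract e * (const_mat B *\<^sub>v v) $ i"
      unfolding st by (simp add: right_diff_distrib mult.left_commute del: index_mult_mat_vec)
    then have "to_fract ([:0, 1:] * X i) = to_fract ((\<Sum>j<n. smult (A $$ (i, j)) (X j)) +
        (\<Sum>j<q. smult (B $$ (i, j)) (P j)))"
      using const_mat_mult_poly_vec[OF c(1) w X i] const_mat_mult_poly_vec[OF c(2) v P i] X[OF i]
      by (simp add: diff_eq_eq add.commute del: to_fract_sum index_mult_mat_vec mult_pCons_left)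
    then show ?thesis unfolding to_fract_eq_iff by simp
  qed
  have out_poly: "(\<Sum>j<q. smult (D $$ (i, j)) (P j)) + (\<Sum>j<n. smult (C $$ (i, j)) (X j)) = 0"
    if i: "i < p" for i
  proof -
    have "(const_mat D *\<^sub>v v + const_mat C *\<^sub>v w) $ i = 0" using i by (simp add: out)
    then have "(const_mat D *\<^sub>v v) $ i + (const_mat C *\<^sub>v w) $ i = 0"
      using i d by (simp del: index_mult_mat_vec)
    then have "to_fract e * (const_mat D *\<^sub>v v) $ i + to_fract e * (const_mat C *\<^sub>v w) $ i = 0"
      by (simp flip: distrib_left)
    then have "to_fract ((\<Sum>j<q. smult (D $$ (i, j)) (P j)) + (\<Sum>j<n. smult (C $$ (i, j)) (X j))) = to_fract 0"
      using const_mat_mult_poly_vec[OF c(4) v P i] const_mat_mult_poly_vec[OF c(3) w X i]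
      by (simp del: to_fract_sum index_mult_mat_vec)
    then show ?thesis unfolding to_fract_eq_iff .
  qed
  define u where "u i = vec q (\<lambda>j. coeff (P j) i)" for i
  define x where "x i = vec n (\<lambda>j. coeff (pCons 0 (X j)) i)" for i
  have x_Suc: "x (Suc i) = vec n (\<lambda>j. coeff (X j) i)" for i by (simp add: x_def)
  obtain N where N: "\<And>j. j < n \<Longrightarrow> degree (pCons 0 (X j)) < N"
  proof
    show "degree (pCons 0 (X j)) < Suc (\<Sum>j<n. degree (pCons 0 (X j)))" if "j < n" for j
      using member_le_sum[of j "{..<n}" "\<lambda>j. degree (pCons 0 (X j))"] that by simp
  qed
  show thesis
  proof (rule that[OF e(1), of x u N P])
    show "x i \<in> carrier_vec n" "u i \<in> carrier_vec q" for i by (auto simp: x_def u_def)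
    show "x 0 = 0\<^sub>v n" by (auto simp: x_def)
    show "x i = 0\<^sub>v n" if "i \<ge> N" for i
    proof (rule eq_vecI)
      fix j assume "j < dim_vec (0\<^sub>v n :: complex vec)"
      then show "x i $ j = 0\<^sub>v n $ j" using N[of j] that unfolding x_def by (simp add: coeff_eq_0 del: coeff_pCons)
    qed (simp add: x_def)
    show "x i = A *\<^sub>v x (Suc i) + B *\<^sub>v u i" for i
    proof (rule eq_vecI)
      fix j assume "j < dim_vec (A *\<^sub>v x (Suc i) + B *\<^sub>v u i)"
      then have j: "j < n" using d by simp
      show "x i $ j = (A *\<^sub>v x (Suc i) + B *\<^sub>v u i) $ j"
        using arg_cong[OF st_poly[OF j], of "\<lambda>p. coeff p i"] j d
        by (simp add: x_Suc u_def coeff_smult_sum[OF c(1) j] coeff_smult_sum[OF c(2) j] del: index_mult_mat_vec)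
          (simp add: x_def)
    qed (use d in \<open>simp add: x_def\<close>)
    show "C *\<^sub>v x (Suc i) + D *\<^sub>v u i = 0\<^sub>v p" for i
    proof (rule eq_vecI)
      fix j assume "j < dim_vec (0\<^sub>v p :: complex vec)"
      then have j: "j < p" by simp
      show "(C *\<^sub>v x (Suc i) + D *\<^sub>v u i) $ j = 0\<^sub>v p $ j"
        using arg_cong[OF out_poly[OF j], of "\<lambda>p. coeff p i"] j d
        by (simp add: x_Suc u_def coeff_smult_sum[OF c(3) j] coeff_smult_sum[OF c(4) j] add.commute
            del: index_mult_mat_vec)
    qed (use d in simp)
    show "u i $ j = coeff (P j) i" if "j < q" for i j using that by (simp add: u_def)
    show "to_fract (P j) = to_fract e * v $ j" if "j < q" for j using P that by simp
  qed
qed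

text \<open>The states of the trajectory given by \<open>kernel_trajectory\<close> belong to \<open>Cstar\<close> because it starts at zero, and
  to \<open>Vtraj\<close> because it ends at zero and can be continued there. So they vanish, and then the inputs
  vanish by injectivity.\<close>

lemma (in system) transfer_kernel_trivial:
  assumes CV: "Cstar A B C D \<inter> Vtraj A B C D = {0\<^sub>v n}"
    and inj: "\<And>u. u \<in> carrier_vec q \<Longrightarrow> B *\<^sub>v u = 0\<^sub>v n \<Longrightarrow> D *\<^sub>v u = 0\<^sub>v p \<Longrightarrow> u = 0\<^sub>v q"
    and v: "v \<in> carrier_vec q" and ker: "transfer_function A B C D *\<^sub>v v = 0\<^sub>v p"
  shows "v = 0\<^sub>v q"
proof -
  obtain e and x u :: "nat \<Rightarrow> complex vec" and N P where e: "e \<noteq> 0" and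
    xc: "\<And>i. x i \<in> carrier_vec n" and uc: "\<And>i. u i \<in> carrier_vec q" and x0: "x 0 = 0\<^sub>v n" and
    xN: "\<And>i. i \<ge> N \<Longrightarrow> x i = 0\<^sub>v n" and
    st: "\<And>i. x i = A *\<^sub>v x (Suc i) + B *\<^sub>v u i" and out: "\<And>i. C *\<^sub>v x (Suc i) + D *\<^sub>v u i = 0\<^sub>v p" and
    uP: "\<And>i j. j < q \<Longrightarrow> u i $ j = coeff (P j) i" and
    P: "\<And>j. j < q \<Longrightarrow> to_fract (P j) = to_fract e * v $ j"
    using kernel_trajectory[OF A B C D v ker] by metis
  have step: "step (x (Suc i)) (x i)" for i
    by (rule stepI[OF uc st out])
  have V: "x i \<in> Vtraj A B C D" for i
  proof (induction i)
    case 0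
    then show ?case using x0 vec_subspaceD(2)[OF vec_subspace_Vtraj] by simp
  next
    case (Suc i)
    then show ?case using Vtraj_back[OF step _ xc] by blast
  qed
  have "x (N - i) \<in> Cstar A B C D" for i
  proof (induction i)
    case 0
    then show ?case using xN[of N] zero_Cstar by simp
  next
    case (Suc i)
    show ?case
    proof (cases "i < N")
      case True
      then have "Suc (N - Suc i) = N - i" by simp
      with Suc Cstar_step[OF _ step[of "N - Suc i"]] show ?thesis by simp
    next
      case False
      with Suc show ?thesis by simp
    qed
  qed
  have "x i \<in> Cstar A B C D" for i
  proof (cases "i < N")
    case True
    then have "N - (N - i) = i" by simp
    with \<open>x (N - (N - i)) \<in> Cstar A B C D\<close> show ?thesis by simp
  next
    case False
    then show ?thesis using xN[of i] zero_Cstar by simp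
  qed
  with V CV have x: "x i = 0\<^sub>v n" for i by blast
  have "u i = 0\<^sub>v q" for i
  proof (rule inj[OF uc])
    show "B *\<^sub>v u i = 0\<^sub>v n" "D *\<^sub>v u i = 0\<^sub>v p"
      using st[of i, symmetric] out[of i] by (auto simp: x vec_distrib)
  qed
  then have "coeff (P j) i = 0" if "j < q" for i j using uP[OF that, of i] that by simp
  then have "P j = 0" if "j < q" for j using that by (simp add: poly_eq_iff)
  then have "v $ j = 0" if "j < q" for j using P[OF that] e that by simp
  then show ?thesis using v by (intro eq_vecI) auto
qed

text \<open>Every constant vector \<open>b\<close> is in the kernel, so that a trajectory with inputs \<open>coeff e i \<cdot>\<^sub>v b\<close> has zero
  output. Its first nonzero state is a multiple of \<open>B *\<^sub>v b\<close>, and the equations of the trajectory express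
  \<open>A\<close> applied to a state by the next state and that first one; thus \<open>C\<close> annihilates all powers.\<close>

lemma zero_transfer_function_markov:
  assumes c: "A \<in> carrier_mat n n" "B \<in> carrier_mat n q" "C \<in> carrier_mat p n" "D \<in> carrier_mat p q"
    and zero: "transfer_function A B C D = 0\<^sub>m p q"
    and w: "w \<in> mat_range B"
  shows "C *\<^sub>v (A ^\<^sub>m i *\<^sub>v w) = 0\<^sub>v p"
proof -
  note d = carrier_matD[OF c(1)] carrier_matD[OF c(2)] carrier_matD[OF c(3)] carrier_matD[OF c(4)]
    pow_mat_dims[OF c(1)]
  obtain b where b: "b \<in> carrier_vec q" "w = B *\<^sub>v b" using w mem_mat_range[OF c(2)] by blast
  define v where "v = vec q (\<lambda>j. cst (b $ j))"
  have v: "v \<in> carrier_vec q" by (simp add: v_def)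
  have "transfer_function A B C D *\<^sub>v v = 0\<^sub>v p" unfolding zero using v by (simp add: zero_mat_mult_vec)
  then obtain e and x u :: "nat \<Rightarrow> complex vec" and N P where e: "e \<noteq> 0" and
    xc: "\<And>i. x i \<in> carrier_vec n" and uc: "\<And>i. u i \<in> carrier_vec q" and x0: "x 0 = 0\<^sub>v n" and
    xN: "\<And>i. i \<ge> N \<Longrightarrow> x i = 0\<^sub>v n" and
    st: "\<And>i. x i = A *\<^sub>v x (Suc i) + B *\<^sub>v u i" and out: "\<And>i. C *\<^sub>v x (Suc i) + D *\<^sub>v u i = 0\<^sub>v p" and
    uP: "\<And>i j. j < q \<Longrightarrow> u i $ j = coeff (P j) i" and
    P: "\<And>j. j < q \<Longrightarrow> to_fract (P j) = to_fract e * v $ j"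
    using kernel_trajectory[OF c v] by metis
  have "P j = smult (b $ j) e" if j: "j < q" for j
  proof -
    have "to_fract (P j) = to_fract (e * [:b $ j:])" using P[OF j] j by (simp add: v_def del: mult_pCons_right)
    then show ?thesis unfolding to_fract_eq_iff by simp
  qed
  then have u: "u i = coeff e i \<cdot>\<^sub>v b" for i
    using uP uc[of i] b(1) by (intro eq_vecI) (auto simp: mult.commute)
  define a where "a = degree e"
  define lc where "lc = coeff e a"
  have lc: "lc \<noteq> 0" using e by (simp add: lc_def a_def)
  have x_high: "x i = 0\<^sub>v n" if "i > a" for i
  proof -
    have "i > a \<Longrightarrow> N \<le> i + m \<Longrightarrow> x i = 0\<^sub>v n" for m i
    proof (induction m arbitrary: i)
      case (Suc m)
      have "x (Suc i) = 0\<^sub>v n" using Suc by simp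
      moreover have "u i = 0\<^sub>v q" using Suc(2) b by (auto simp: u coeff_eq_0 a_def)
      ultimately show ?case using st[of i] d by (simp add: vec_distrib)
    qed (simp add: xN)
    from this[of i N] that show ?thesis by simp
  qed
  have xa: "x a = lc \<cdot>\<^sub>v w"
    using st[of a] x_high[of "Suc a"] b d by (simp add: u lc_def vec_distrib)
  have Db: "D *\<^sub>v b = 0\<^sub>v p"
  proof -
    have "lc \<cdot>\<^sub>v (D *\<^sub>v b) = 0\<^sub>v p"
      using out[of a] x_high[of "Suc a"] b d by (simp add: u lc_def vec_distrib)
    then have "(1 / lc) \<cdot>\<^sub>v (lc \<cdot>\<^sub>v (D *\<^sub>v b)) = 0\<^sub>v p" by simp
    then show ?thesis using lc by (simp add: smult_smult_assoc)
  qed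
  have Cx: "C *\<^sub>v x i = 0\<^sub>v p" for i
  proof (cases i)
    case 0
    then show ?thesis using x0 d by (simp add: vec_distrib)
  next
    case (Suc j)
    then show ?thesis using out[of j] b d Db by (simp add: u vec_distrib)
  qed
  have CA: "C *\<^sub>v (A ^\<^sub>m j *\<^sub>v x i) = 0\<^sub>v p" for i j
  proof (induction j arbitrary: i)
    case 0
    then show ?case using Cx xc c(1) by simp
  next
    case (Suc j)
    have xd: "dim_vec (x i) = n" for i using xc[of i] by auto
    have pow: "C *\<^sub>v (A ^\<^sub>m Suc j *\<^sub>v x i) = C *\<^sub>v (A ^\<^sub>m j *\<^sub>v (A *\<^sub>v x i))"
      using d xd[of i] by (simp add: mat_mult_vec)
    show ?case
    proof (cases i)
      case 0
      then show ?thesis unfolding pow using x0 d by (simp add: vec_distrib)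
    next
      case (Suc m)
      have "A *\<^sub>v x (Suc m) = x m - (coeff e m / lc) \<cdot>\<^sub>v x a"
      proof (rule eq_vecI)
        fix r assume "r < dim_vec (x m - (coeff e m / lc) \<cdot>\<^sub>v x a)"
        then have r: "r < n" using xd by simp
        have "x m $ r = (A *\<^sub>v x (Suc m)) $ r + coeff e m * (B *\<^sub>v b) $ r"
          using arg_cong[OF st[of m], of "\<lambda>v. v $ r"] r d b by (simp add: u vec_distrib del: index_mult_mat_vec)
        then show "(A *\<^sub>v x (Suc m)) $ r = (x m - (coeff e m / lc) \<cdot>\<^sub>v x a) $ r"
          using r d b lc xd[of a] unfolding xa by (simp del: index_mult_mat_vec)
      qed (use xd d in simp)
      then have "C *\<^sub>v (A ^\<^sub>m j *\<^sub>v (A *\<^sub>v x i)) =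
          C *\<^sub>v (A ^\<^sub>m j *\<^sub>v x m) - (coeff e m / lc) \<cdot>\<^sub>v (C *\<^sub>v (A ^\<^sub>m j *\<^sub>v x a))"
        using d xd Suc by (simp add: vec_distrib)
      then show ?thesis unfolding pow by (simp add: Suc.IH)
    qed
  qed
  have "lc \<cdot>\<^sub>v (C *\<^sub>v (A ^\<^sub>m i *\<^sub>v w)) = 0\<^sub>v p"
    using CA[of i a] d b unfolding xa by (simp add: vec_distrib)
  then have "(1 / lc) \<cdot>\<^sub>v (lc \<cdot>\<^sub>v (C *\<^sub>v (A ^\<^sub>m i *\<^sub>v w))) = 0\<^sub>v p" by simp
  then show ?thesis using lc by (simp add: smult_smult_assoc)
qed


section \<open>Minimal realizations\<close>

lemma block_diag_mult_vec:
  assumes "A \<in> carrier_mat n n" "A' \<in> carrier_mat m m" "x \<in> carrier_vec n" "y \<in> carrier_vec m"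
  shows "four_block_mat A (0\<^sub>m n m) (0\<^sub>m m n) A' *\<^sub>v (x @\<^sub>v y) = (A *\<^sub>v x) @\<^sub>v (A' *\<^sub>v (y :: 'a :: comm_ring_1 vec))"
  using four_block_mat_mult_vec[OF assms(1) zero_carrier_mat zero_carrier_mat assms(2) assms(3,4)] assms
  by (simp add: zero_mat_mult_vec)

text \<open>The resolvent of a block diagonal matrix is block diagonal.\<close>

lemma transfer_function_difference:
  assumes c: "A \<in> carrier_mat n n" "B \<in> carrier_mat n q" "C \<in> carrier_mat p n" "D \<in> carrier_mat p q"
    and c': "A' \<in> carrier_mat m m" "B' \<in> carrier_mat m q" "C' \<in> carrier_mat p m" "D' \<in> carrier_mat p q"
  shows "transfer_function (four_block_mat A (0\<^sub>m n m) (0\<^sub>m m n) A') (B @\<^sub>r B') (C @\<^sub>c (- C')) (D - D') =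
    transfer_function A B C D - transfer_function A' B' C' D'"
proof -
  let ?A = "four_block_mat A (0\<^sub>m n m) (0\<^sub>m m n) A'"
  note d = carrier_matD[OF c(1)] carrier_matD[OF c(2)] carrier_matD[OF c(3)] carrier_matD[OF c(4)]
    carrier_matD[OF c'(1)] carrier_matD[OF c'(2)] carrier_matD[OF c'(3)] carrier_matD[OF c'(4)]
    resolvent_dims[OF c(1)] resolvent_dims[OF c'(1)]
  note r = resolvent_pencil[OF c(1)] and r' = resolvent_pencil[OF c'(1)]
  have A: "?A \<in> carrier_mat (n + m) (n + m)" using c(1) c'(1) by simp
  have pencil: "pencil ?A = four_block_mat (pencil A) (0\<^sub>m n m) (0\<^sub>m m n) (pencil A')"
    using d by (intro eq_matI) (auto simp: pencil_index)
  have "four_block_mat (resolvent A) (0\<^sub>m n m) (0\<^sub>m m n) (resolvent A') * pencil ?A = 1\<^sub>m (n + m)"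
    unfolding pencil
    using d r r' pencil_carrier[OF c(1)] pencil_carrier[OF c'(1)]
    by (subst mult_four_block_mat[of _ n n _ m _ m _ _ n _ m])
      (auto simp: mat_distrib intro!: eq_matI)
  then have R: "resolvent ?A = four_block_mat (resolvent A) (0\<^sub>m n m) (0\<^sub>m m n) (resolvent A')"
    using A r(1) r'(1) by (intro resolvent_unique) auto
  have B: "const_mat (B @\<^sub>r B') = const_mat B @\<^sub>r const_mat B'"
    using d by (intro eq_matI) (auto simp: append_rows_def const_mat_def)
  have C: "const_mat (C @\<^sub>c (- C')) = const_mat C @\<^sub>c (- const_mat C')"
    using d by (intro eq_matI) (auto simp: append_cols_def const_mat_def cst_hom)
  have "resolvent ?A * const_mat (B @\<^sub>r B') = (resolvent A * const_mat B) @\<^sub>r (resolvent A' * const_mat B')"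
    unfolding R B using c c' r(1) r'(1) d
    by (subst four_block_mult_append_rows[of _ n n _ m _ m _ _ q]) (auto simp: mat_distrib intro!: arg_cong2[of _ _ _ _ append_rows] eq_matI)
  then have "const_mat (C @\<^sub>c (- C')) * (resolvent ?A * const_mat (B @\<^sub>r B')) =
      const_mat C * (resolvent A * const_mat B) + (- const_mat C') * (resolvent A' * const_mat B')"
    unfolding C using c c' d by (simp add: append_cols_mult[of _ p n _ m _ q])
  moreover have "dim_row (resolvent ?A) = n + m" "dim_col (resolvent ?A) = n + m"
    using resolvent_dims[OF A] by auto
  ultimately have "transfer_function ?A (B @\<^sub>r B') (C @\<^sub>c (- C')) (D - D') = const_mat (D - D') +
      (const_mat C * (resolvent A * const_mat B) + (- const_mat C') * (resolvent A' * const_mat B'))"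
    using d by (simp add: transfer_function_def mat_mult_assoc)
  also have "\<dots> = transfer_function A B C D - transfer_function A' B' C' D'"
    unfolding transfer_function_def using d
    by (intro eq_matI) (auto simp: mat_distrib const_mat_hom simp del: index_mult_mat(1))
  finally show ?thesis .
qed

text \<open>Let \<open>S\<close> be the reachable subspace of the block diagonal realization of the difference with another
  realization, which is zero. By \<open>zero_transfer_function_markov\<close> the output is zero along every free
  motion that starts in \<open>S\<close>. Controllability makes the
  projection of \<open>S\<close> to the first component onto; observability makes the projection to the second
  component injective. Hence \<open>n \<le> dim S \<le> m\<close>.\<close>

lemma minimal_realizationI:
  assumes c: "A \<in> carrier_mat n n" "B \<in> carrier_mat n q" "C \<in> carrier_mat p n" "D \<in> carrier_mat p q"
    and G: "F = transfer_function A B C D" and con: "controllable A B" and obs: "observable C A"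
  shows "minimal_realization F A B C D"
  unfolding minimal_realization_def
proof (intro conjI allI impI)
  show "realization F A B C D" using c G by (auto simp: realization_def)
next
  fix A' B' C' D' assume "realization F A' B' C' D'"
  then obtain m q' p' where c': "A' \<in> carrier_mat m m" "B' \<in> carrier_mat m q'" "C' \<in> carrier_mat p' m"
    "D' \<in> carrier_mat p' q'" and G': "F = transfer_function A' B' C' D'"
    by (auto simp: realization_def)
  have "p' = p" "q' = q"
    using transfer_function_carrier[OF c] transfer_function_carrier[OF c'] G G' by auto
  note c' = c'[unfolded this]
  define Ae where "Ae = four_block_mat A (0\<^sub>m n m) (0\<^sub>m m n) A'"
  define Be where "Be = B @\<^sub>r B'"
  define Ce where "Ce = C @\<^sub>c (- C')"
  have e: "Ae \<in> carrier_mat (n + m) (n + m)" "Be \<in> carrier_mat (n + m) q" "Ce \<in> carrier_mat p (n + m)"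
    using c c' by (auto simp: Ae_def Be_def Ce_def intro!: append_cols_carrier append_rows_carrier)
  have D: "D - D' \<in> carrier_mat p q" using c c' by auto
  have "transfer_function Ae Be Ce (D - D') = 0\<^sub>m p q"
    using transfer_function_difference[OF c c'] transfer_function_carrier[OF c]
    by (simp add: Ae_def Be_def Ce_def G[symmetric] G'[symmetric] flip: G')
  note markov = zero_transfer_function_markov[OF e D this]
  define S where "S = reachable_subspace Ae Be"
  have S: "vec_subspace (n + m) S" unfolding S_def by (rule vec_subspace_reachable[OF e(1,2)])
  have Ae: "Ae *\<^sub>v (x @\<^sub>v y) = (A *\<^sub>v x) @\<^sub>v (A' *\<^sub>v y)" if "x \<in> carrier_vec n" "y \<in> carrier_vec m" for x y
    unfolding Ae_def using that c c' by (intro block_diag_mult_vec) auto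
  note ed = carrier_matD[OF e(1)] carrier_matD[OF e(2)] carrier_matD[OF e(3)]
  have unobs: "Ce *\<^sub>v (Ae ^\<^sub>m i *\<^sub>v s) = 0\<^sub>v p" if "s \<in> S" for s i
  proof -
    define V where "V = {x \<in> carrier_vec (n + m). \<forall>i. Ce *\<^sub>v (Ae ^\<^sub>m i *\<^sub>v x) = 0\<^sub>v p}"
    have "S \<subseteq> V"
      unfolding S_def
    proof (rule reachable_least[OF e(1,2)])
      show "vec_subspace (n + m) V"
        by (rule vec_subspaceI) (use ed pow_mat_dims[OF e(1)] in \<open>auto simp: V_def vec_distrib\<close>)
      show "mat_range Be \<subseteq> V" using markov e(2) by (auto simp: V_def mat_range_def)
      show "Ae *\<^sub>v x \<in> V" if "x \<in> V" for x
      proof -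
        have "Ae ^\<^sub>m i *\<^sub>v (Ae *\<^sub>v x) = Ae ^\<^sub>m Suc i *\<^sub>v x" for i
          using that ed pow_mat_dims[OF e(1)] by (simp add: V_def mat_mult_vec)
        then show ?thesis using that ed by (auto simp: V_def simp del: pow_mat.simps)
      qed
    qed
    with that show ?thesis by (auto simp: V_def)
  qed
  have graph: "x = 0\<^sub>v n" if x: "x \<in> carrier_vec n" and S: "x @\<^sub>v 0\<^sub>v m \<in> S" for x
  proof -
    have pow: "Ae ^\<^sub>m i *\<^sub>v (x @\<^sub>v 0\<^sub>v m) = (A ^\<^sub>m i *\<^sub>v x) @\<^sub>v 0\<^sub>v m" for i
    proof (induction i)
      case 0
      have "x @\<^sub>v 0\<^sub>v m \<in> carrier_vec (n + m)" using x by simp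
      then show ?case using x e(1) c(1) by simp
    next
      case (Suc i)
      have xc: "x @\<^sub>v 0\<^sub>v m \<in> carrier_vec (n + m)" using x by simp
      have "Ae ^\<^sub>m Suc i *\<^sub>v (x @\<^sub>v 0\<^sub>v m) = Ae *\<^sub>v (Ae ^\<^sub>m i *\<^sub>v (x @\<^sub>v 0\<^sub>v m))"
        unfolding pow_mat_Suc_left[OF e(1)] using ed pow_mat_dims[OF e(1)] carrier_vecD[OF xc]
        by (intro mat_mult_vec) auto
      also have "\<dots> = (A *\<^sub>v (A ^\<^sub>m i *\<^sub>v x)) @\<^sub>v (A' *\<^sub>v 0\<^sub>v m)"
        unfolding Suc using pow_mat_dims[OF c(1)] by (intro Ae) auto
      also have "A' *\<^sub>v 0\<^sub>v m = 0\<^sub>v m" using c'(1) by (simp add: vec_distrib)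
      also have "A *\<^sub>v (A ^\<^sub>m i *\<^sub>v x) = A ^\<^sub>m Suc i *\<^sub>v x"
        unfolding pow_mat_Suc_left[OF c(1)] using x pow_mat_dims[OF c(1)] c(1) by (simp add: mat_mult_vec)
      finally show ?case .
    qed
    have "C *\<^sub>v (A ^\<^sub>m i *\<^sub>v x) = 0\<^sub>v p" for i
    proof -
      have "Ce *\<^sub>v ((A ^\<^sub>m i *\<^sub>v x) @\<^sub>v 0\<^sub>v m) = C *\<^sub>v (A ^\<^sub>m i *\<^sub>v x) + (- C') *\<^sub>v 0\<^sub>v m"
        unfolding Ce_def using c c' pow_mat_dims[OF c(1)] by (intro append_cols_mult_vec) auto
      moreover have "(- C') *\<^sub>v 0\<^sub>v m = 0\<^sub>v p" using c'(3) by (simp add: vec_distrib)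
      moreover have "C *\<^sub>v (A ^\<^sub>m i *\<^sub>v x) + 0\<^sub>v p = C *\<^sub>v (A ^\<^sub>m i *\<^sub>v x)" using c by (intro right_zero_vec) auto
      ultimately show ?thesis using unobs[OF S, of i] pow[of i] by simp
    qed
    then have "x \<in> (\<Inter>i. mat_kernel (C * A ^\<^sub>m i))"
      using x c pow_mat_dims[OF c(1)] by (auto simp: mat_kernel_def mat_mult_vec)
    then have "x \<in> {0\<^sub>v (dim_row A)}" using obs unfolding observable_def by blast
    then show ?thesis using c(1) by simp
  qed
  have onto: "\<exists>y\<in>carrier_vec m. x @\<^sub>v y \<in> S" if "x \<in> carrier_vec n" for x
  proof -
    note SD = vec_subspaceD[OF S]
    define V where "V = {x \<in> carrier_vec n. \<exists>y\<in>carrier_vec m. x @\<^sub>v y \<in> S}"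
    have "reachable_subspace A B \<subseteq> V"
    proof (rule reachable_least[OF c(1,2)])
      show "vec_subspace n V"
      proof
        have "0\<^sub>v n @\<^sub>v 0\<^sub>v m = (0\<^sub>v (n + m) :: complex vec)"
          using append_vec_zero_iff[of "0\<^sub>v n" n "0\<^sub>v m" m] by simp
        then have "0\<^sub>v n @\<^sub>v 0\<^sub>v m \<in> S" by (metis SD(2))
        then show "0\<^sub>v n \<in> V" by (auto simp: V_def)
      next
        fix x x' assume "x \<in> V" "x' \<in> V"
        then obtain y y' where y: "x \<in> carrier_vec n" "x' \<in> carrier_vec n" "y \<in> carrier_vec m" "x @\<^sub>v y \<in> S" "y' \<in> carrier_vec m" "x' @\<^sub>v y' \<in> S"
          by (auto simp: V_def)
        then have "(x + x') @\<^sub>v (y + y') \<in> S"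
          using SD(3) by (simp add: append_vec_add[symmetric, of _ n _ _ m])
        then show "x + x' \<in> V" using y by (auto simp: V_def)
      next
        fix c x assume "x \<in> V"
        then obtain y where y: "x \<in> carrier_vec n" "y \<in> carrier_vec m" "x @\<^sub>v y \<in> S" by (auto simp: V_def)
        have "(c \<cdot>\<^sub>v x) @\<^sub>v (c \<cdot>\<^sub>v y) = c \<cdot>\<^sub>v (x @\<^sub>v y)" by (rule eq_vecI) (use y in auto)
        then have "(c \<cdot>\<^sub>v x) @\<^sub>v (c \<cdot>\<^sub>v y) \<in> S" using SD(4) y by simp
        then show "c \<cdot>\<^sub>v x \<in> V" using y by (auto simp: V_def)
      qed (auto simp: V_def)
      show "mat_range B \<subseteq> V"
      proof
        fix x assume "x \<in> mat_range B"
        then obtain b where b: "b \<in> carrier_vec q" "x = B *\<^sub>v b" using mem_mat_range[OF c(2)] by blast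
        have "Be *\<^sub>v b = (B *\<^sub>v b) @\<^sub>v (B' *\<^sub>v b)"
          unfolding Be_def using c c' b by (intro append_rows_mult_vec) auto
        moreover have "Be *\<^sub>v b \<in> S"
          using reachable_generator[OF e(1,2), of 0] b e by (auto simp: S_def mat_range_def)
        ultimately show "x \<in> V" using b c c' by (auto simp: V_def intro!: bexI[of _ "B' *\<^sub>v b"])
      qed
      show "A *\<^sub>v x \<in> V" if x: "x \<in> V" for x
      proof -
        obtain y where y: "x \<in> carrier_vec n" "y \<in> carrier_vec m" "x @\<^sub>v y \<in> S" using x by (auto simp: V_def)
        have "Ae *\<^sub>v (x @\<^sub>v y) \<in> S" using reachable_invariant[OF e(1,2)] y by (simp add: S_def)
        then have "(A *\<^sub>v x) @\<^sub>v (A' *\<^sub>v y) \<in> S" using Ae y by simp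
        then show ?thesis using y c c' by (auto simp: V_def intro!: bexI[of _ "A' *\<^sub>v y"])
      qed
    qed
    moreover have "reachable_subspace A B = carrier_vec n" using con c(1) by (simp add: controllable_def)
    ultimately show ?thesis using that by (auto simp: V_def)
  qed
  obtain s M where M: "M \<in> carrier_mat (n + m) s" "mat_range M = S"
    and inj: "\<And>v. v \<in> carrier_vec s \<Longrightarrow> M *\<^sub>v v = 0\<^sub>v (n + m) \<Longrightarrow> v = 0\<^sub>v s"
    by (rule vec_subspace_basis[OF S]) (rule that)
  obtain M1 M2 where M12: "M1 \<in> carrier_mat n s" "M2 \<in> carrier_mat m s" and M1M2: "M = M1 @\<^sub>r M2"
    by (rule append_rows_split[OF M(1)])
  have Mv: "M *\<^sub>v v = (M1 *\<^sub>v v) @\<^sub>v (M2 *\<^sub>v v)" if "v \<in> carrier_vec s" for v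
    unfolding M1M2 by (rule append_rows_mult_vec[OF M12 that])
  have "s \<le> m"
  proof (rule injective_mat_dim_le[OF M12(2)])
    fix v assume v: "v \<in> carrier_vec s" "M2 *\<^sub>v v = 0\<^sub>v m"
    have "M *\<^sub>v v \<in> S" unfolding M(2)[symmetric] using M(1) v by (auto simp: mat_range_def)
    then have "M1 *\<^sub>v v = 0\<^sub>v n" using Mv[OF v(1)] v M12 by (intro graph) auto
    then have "M *\<^sub>v v = 0\<^sub>v (n + m)"
      using Mv[OF v(1)] v append_vec_zero_iff[of "0\<^sub>v n" n "0\<^sub>v m" m] by simp
    then show "v = 0\<^sub>v s" using inj v by blast
  qed
  moreover have "n \<le> s"
  proof (rule injective_mat_dim_le[of "M1\<^sup>T" s n])
    fix y assume y: "y \<in> carrier_vec n" "M1\<^sup>T *\<^sub>v y = 0\<^sub>v s"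
    have "y \<bullet> x = 0" if x: "x \<in> carrier_vec n" for x
    proof -
      obtain z where z: "z \<in> carrier_vec m" "x @\<^sub>v z \<in> S" using onto[OF x] by blast
      then obtain v where v: "v \<in> carrier_vec s" "x @\<^sub>v z = M *\<^sub>v v"
        unfolding M(2)[symmetric] mem_mat_range[OF M(1)] by blast
      then have "x = M1 *\<^sub>v v" using Mv x M12 by (auto simp: append_vec_eq[of _ n])
      then have "y \<bullet> x = (M1\<^sup>T *\<^sub>v y) \<bullet> v" using y v M12 by (subst transpose_scalar_prod) auto
      then show ?thesis using y v by simp
    qed
    then have "y \<in> annihilator n (carrier_vec n)" using y by (simp add: annihilator_def)
    then show "y = 0\<^sub>v n" unfolding annihilator_carrier by simp
  qed (use M12 in auto)
  ultimately show "dim_row A \<le> dim_row A'" using c(1) c'(1) by auto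
qed

text \<open>Restricting a realization to its reachable subspace does not change the transfer function, so that by
  minimality this subspace has full dimension.\<close>

lemma minimal_realization_controllable:
  assumes c: "A \<in> carrier_mat n n" "B \<in> carrier_mat n q" "C \<in> carrier_mat p n" "D \<in> carrier_mat p q"
    and min: "minimal_realization F A B C D"
  shows "controllable A B"
proof -
  let ?W = "reachable_subspace A B"
  have G: "F = transfer_function A B C D"
    using min by (auto simp: minimal_realization_def realization_def)
  obtain s M where M: "M \<in> carrier_mat n s" "mat_range M = ?W"
    and inj: "\<And>v. v \<in> carrier_vec s \<Longrightarrow> M *\<^sub>v v = 0\<^sub>v n \<Longrightarrow> v = 0\<^sub>v s"
    by (rule vec_subspace_basis[OF vec_subspace_reachable[OF c(1,2)]]) (rule that)
  obtain N where N: "N \<in> carrier_mat s n" "N * M = 1\<^sub>m s"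
    by (rule injective_left_inverse[OF M(1) inj])
  have proj: "M *\<^sub>v (N *\<^sub>v x) = x" if x: "x \<in> ?W" for x
  proof -
    obtain v where v: "v \<in> carrier_vec s" "x = M *\<^sub>v v"
      using x unfolding M(2)[symmetric] mem_mat_range[OF M(1)] by blast
    have "(N * M) *\<^sub>v v = v" unfolding N(2) using v by simp
    then have "N *\<^sub>v (M *\<^sub>v v) = v" using assoc_mult_mat_vec[OF N(1) M(1) v(1)] by simp
    then show ?thesis using v by simp
  qed
  define A' where "A' = N * (A * M)"
  define B' where "B' = N * B"
  have c': "A' \<in> carrier_mat s s" "B' \<in> carrier_mat s q" "C * M \<in> carrier_mat p s"
    using c M N by (auto simp: A'_def B'_def)
  have AM: "M * A' = A * M"
  proof (rule mat_eq_vecI[of _ n s])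
    fix v :: "complex vec" assume v: "v \<in> carrier_vec s"
    have "M *\<^sub>v v \<in> ?W" unfolding M(2)[symmetric] using M(1) v by (auto simp: mat_range_def)
    then have "A *\<^sub>v (M *\<^sub>v v) \<in> ?W" by (rule reachable_invariant[OF c(1,2)])
    from proj[OF this] show "(M * A') *\<^sub>v v = (A * M) *\<^sub>v v"
      using c M N v by (simp add: A'_def vec_distrib)
  qed (use c c' M in auto)
  have MB: "M * B' = B"
  proof (rule mat_eq_vecI[of _ n q])
    fix v :: "complex vec" assume v: "v \<in> carrier_vec q"
    have "B *\<^sub>v v \<in> ?W"
      using reachable_generator[OF c(1,2), of 0] c v by (auto simp: mat_range_def)
    from proj[OF this] show "(M * B') *\<^sub>v v = B *\<^sub>v v"
      using c M N v by (simp add: B'_def vec_distrib)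
  qed (use c c' M in auto)
  note d = carrier_matD[OF c(1)] carrier_matD[OF c(2)] carrier_matD[OF c(3)] carrier_matD[OF c(4)]
    carrier_matD[OF c'(1)] carrier_matD[OF c'(2)] carrier_matD[OF M(1)]
    resolvent_dims[OF c(1)] resolvent_dims[OF c'(1)]
  have "M * A' - A * M = 0\<^sub>m n s" unfolding AM using d by (intro eq_matI) (auto simp del: index_mult_mat(1))
  then have zero: "const_mat M * resolvent A' - resolvent A * const_mat M = 0\<^sub>m n s"
    using resolvent_intertwine[OF c(1) c'(1) M(1)] d by (simp add: const_mat_zero mat_distrib)
  have "resolvent A * const_mat M = const_mat M * resolvent A'"
  proof (rule eq_matI)
    fix i j assume "i < dim_row (const_mat M * resolvent A')" "j < dim_col (const_mat M * resolvent A')"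
    then show "(resolvent A * const_mat M) $$ (i, j) = (const_mat M * resolvent A') $$ (i, j)"
      using arg_cong[OF zero, of "\<lambda>X. X $$ (i, j)"] d by (simp del: index_mult_mat(1))
  qed (use d in auto)
  then have "const_mat C * (resolvent A * const_mat M) * const_mat B' =
      const_mat C * (const_mat M * resolvent A') * const_mat B'" by simp
  then have "transfer_function A B C D = transfer_function A' B' (C * M) D"
    unfolding transfer_function_def using d by (simp add: MB[symmetric] const_mat_hom mat_mult_assoc)
  then have "realization F A' B' (C * M) D"
    using c c' by (auto simp: realization_def G)
  then have "n \<le> s" using min d by (auto simp: minimal_realization_def)
  moreover have "s \<le> n" using injective_mat_dim_le[OF M(1) inj] .
  ultimately have s: "s = n" by simp
  have "M * N = 1\<^sub>m n" using mat_inv_unique(2)[of M n N] M N s by auto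
  then have "x \<in> mat_range M" if "x \<in> carrier_vec n" for x
    using that M N s mem_mat_range[OF M(1)]
    by (intro mem_mat_range[OF M(1), THEN iffD2] bexI[of _ "N *\<^sub>v x"]) (auto simp flip: mat_mult_vec)
  then show ?thesis
    using vec_subspaceD(1)[OF vec_subspace_reachable[OF c(1,2)]] d(1) by (auto simp: controllable_def M(2))
qed

lemma realization_transpose:
  "realization F A B C D \<Longrightarrow> realization (F\<^sup>T) (A\<^sup>T) (C\<^sup>T) (B\<^sup>T) (D\<^sup>T)"
  unfolding realization_def using transfer_function_transpose
  by (auto 4 3 intro!: transpose_carrier_mat[THEN iffD2])

lemma minimal_realization_transpose:
  assumes "minimal_realization F A B C D"
  shows "minimal_realization (F\<^sup>T) (A\<^sup>T) (C\<^sup>T) (B\<^sup>T) (D\<^sup>T)"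
  unfolding minimal_realization_def
proof (intro conjI allI impI)
  have "realization F A B C D" using assms by (simp add: minimal_realization_def)
  then show "realization (F\<^sup>T) (A\<^sup>T) (C\<^sup>T) (B\<^sup>T) (D\<^sup>T)" by (rule realization_transpose)
  have sq: "dim_row A = dim_col A"
    using \<open>realization F A B C D\<close> by (auto simp: realization_def)
  fix A' B' C' D' assume r: "realization (F\<^sup>T) A' B' C' D'"
  then have "realization F (A'\<^sup>T) (C'\<^sup>T) (B'\<^sup>T) (D'\<^sup>T)"
    using realization_transpose[OF r] by simp
  then have "dim_row A \<le> dim_row (A'\<^sup>T)" using assms unfolding minimal_realization_def by blast
  moreover have "dim_row A' = dim_col A'" using r by (auto simp: realization_def)
  ultimately show "dim_row (A\<^sup>T) \<le> dim_row A'" using sq by simp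
qed

lemma minimal_realization_observable:
  assumes c: "A \<in> carrier_mat n n" "B \<in> carrier_mat n q" "C \<in> carrier_mat p n" "D \<in> carrier_mat p q"
    and min: "minimal_realization F A B C D"
  shows "observable C A"
proof -
  have "controllable (A\<^sup>T) (C\<^sup>T)"
    by (rule minimal_realization_controllable[OF _ _ _ _ minimal_realization_transpose[OF min]])
      (use c in auto)
  then show ?thesis using controllable_transpose[OF c(1,3)] by simp
qed

section \<open>The para-unitary factor and controllability of the perturbed system\<close>

lemma square_injective_transpose:
  fixes M :: "'a :: field mat"
  assumes M: "M \<in> carrier_mat n n"
  shows "(\<exists>v\<in>carrier_vec n. v \<noteq> 0\<^sub>v n \<and> M\<^sup>T *\<^sub>v v = 0\<^sub>v n) \<longleftrightarrow>
    (\<exists>v\<in>carrier_vec n. v \<noteq> 0\<^sub>v n \<and> M *\<^sub>v v = 0\<^sub>v n)"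
  using det_0_iff_vec_prod_zero_field[OF M] det_0_iff_vec_prod_zero_field[of "M\<^sup>T" n] det_transpose[OF M] M
  by (auto simp: Bex_def)

lemma eigenvalueI:
  assumes "A \<in> carrier_mat n n" "v \<in> carrier_vec n" "v \<noteq> 0\<^sub>v n" "A *\<^sub>v v = \<mu> \<cdot>\<^sub>v v"
  shows "eigenvalue A \<mu>"
  using assms by (auto simp: eigenvalue_def eigenvector_def)

lemma eigenvalue_transpose:
  assumes A: "(A :: complex mat) \<in> carrier_mat n n"
  shows "eigenvalue (A\<^sup>T) \<mu> \<longleftrightarrow> eigenvalue A \<mu>"
proof -
  have AT: "A\<^sup>T \<in> carrier_mat n n" using A by simp
  have "char_matrix (A\<^sup>T) \<mu> = (char_matrix A \<mu>)\<^sup>T"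
    using A by (intro eq_matI) (auto simp: char_matrix_def)
  then show ?thesis
    unfolding eigenvalue_char_matrix[OF A] eigenvalue_char_matrix[OF AT]
    using square_injective_transpose[of "char_matrix A \<mu>" n] A by (auto simp: Bex_def)
qed

lemma conjugate_mult_vec:
  assumes "dim_vec x = dim_col A"
  shows "conjugate ((A :: complex mat) *\<^sub>v x) = (A\<^sup>\<dagger>)\<^sup>T *\<^sub>v conjugate x"
  by (rule eq_vecI) (use assms in \<open>auto simp: scalar_prod_def\<close>)

context right_data
begin

text \<open>The square para-unitary function that the orthonormal columns of \<open>L0\<close> cut down to \<open>Lbeta\<close>.\<close>

definition U :: "complex poly fract mat" where
  "U = 1\<^sub>m q - const_mat Hb * resolvent Lb * const_mat G"

definition Lbeta :: "complex poly fract mat" where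
  "Lbeta = U * const_mat L0"

lemma U_dims [simp]: "dim_row U = q" "dim_col U = q"
  by (auto simp: U_def)

lemma Lbeta_dims [simp]: "dim_row Lbeta = q" "dim_col Lbeta = l"
  by (auto simp: Lbeta_def)

lemma res_Lb [simp]: "dim_row (resolvent Lb) = k" "dim_col (resolvent Lb) = k"
  using resolvent_dims[OF Lb(1)] by auto

lemma Lbeta_eq: "Lbeta = const_mat L0 - const_mat (Hk + R0 * \<beta>k) * resolvent (\<Lambda>k + \<alpha>k * \<beta>k)
    * const_mat (mat_inv \<sigma> * (Hk + R0 * \<beta>k)\<^sup>\<dagger> * L0)"
  unfolding Hb_def[symmetric] Lb_def[symmetric] S_def[symmetric] Lbeta_def U_def G_def
  by (simp add: mat_distrib const_mat_hom)

lemma lyapunov_inverse: "Lb * S + S * Lb\<^sup>\<dagger> + S * Hb\<^sup>\<dagger> * Hb * S = 0\<^sub>m k k"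
proof -
  have "S * (\<sigma> * Lb + Lb\<^sup>\<dagger> * \<sigma> + Hb\<^sup>\<dagger> * Hb) * S = 0\<^sub>m k k"
    unfolding lyapunov by (simp add: mat_distrib)
  moreover have "S * (\<sigma> * Lb + Lb\<^sup>\<dagger> * \<sigma> + Hb\<^sup>\<dagger> * Hb) * S =
      (S * \<sigma>) * (Lb * S) + S * (Lb\<^sup>\<dagger> * (\<sigma> * S)) + S * Hb\<^sup>\<dagger> * Hb * S"
    by (simp add: mat_distrib)
  ultimately show ?thesis unfolding S\<sigma> \<sigma>S by (simp add: mat_distrib)
qed

lemma U_para_unitary: "U * para_adjoint U = 1\<^sub>m q"
  unfolding U_def G_def
  by (rule para_unitary_of_lyapunov[OF Hb(1) Lb(1) S S_adjoint lyapunov_inverse])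

lemma transfer_U:
  "transfer_function A B C D * U = transfer_function A pert.Bp C D"
  unfolding U_def pert.Bp_def
  by (rule transfer_function_mult_cascade[OF A B C D carriers(1) Hb(1) Lb(1) G(1) controlled_invariance])

lemma transfer_Lbeta:
  "transfer_function A B C D * Lbeta = transfer_function A (pert.Bp * L0) C (D * L0)"
proof -
  have T: "transfer_function A B C D \<in> carrier_mat p q" by (rule transfer_function_carrier[OF A B C D])
  have "transfer_function A B C D * Lbeta = transfer_function A B C D * U * const_mat L0"
    unfolding Lbeta_def using carrier_matD[OF T] by (simp add: mat_mult_assoc)
  also have "\<dots> = transfer_function A (pert.Bp * L0) C (D * L0)"
    unfolding transfer_U by (rule transfer_function_mult_const[OF A pert.Bp C D L0])
  finally show ?thesis .
qed

text \<open>Although \<open>Lbeta\<close> is not square, \<open>L0 * L0\<^sup>\<dagger>\<close> can be cancelled in the middle because it fixes \<open>pert.Bp\<close> and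
  \<open>D\<close>, and what remains is \<open>U * para_adjoint U\<close>.\<close>

lemma transfer_Lbeta_para:
  "transfer_function A B C D * Lbeta * para_adjoint Lbeta = transfer_function A B C D"
proof -
  let ?F = "transfer_function A B C D"
  note T = transfer_function_carrier[OF A B C D] transfer_function_carrier[OF A pert.Bp C D]
  note Td = carrier_matD[OF T(1)] carrier_matD[OF T(2)]
  have L: "L0 * L0\<^sup>\<dagger> \<in> carrier_mat q q" by auto
  have proj: "pert.Bp * (L0 * L0\<^sup>\<dagger>) = pert.Bp" "D * (L0 * L0\<^sup>\<dagger>) = D"
    using project_input[OF pert.Bp Bp_R0] project_input[OF D DR0] by (auto simp: mat_mult_assoc)
  have "?F * Lbeta * para_adjoint Lbeta = ?F * U * const_mat (L0 * L0\<^sup>\<dagger>) * para_adjoint U"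
    unfolding Lbeta_def using Td by (simp add: para_adjoint_mult para_adjoint_const const_mat_hom mat_mult_assoc)
  also have "?F * U * const_mat (L0 * L0\<^sup>\<dagger>) = ?F * U"
    unfolding transfer_U transfer_function_mult_const[OF A pert.Bp C D L] proj ..
  also have "?F * U * para_adjoint U = ?F * (U * para_adjoint U)"
    using Td by (intro mat_mult_assoc) auto
  also have "\<dots> = ?F" unfolding U_para_unitary using Td by (simp add: mat_mult_one)
  finally show ?thesis .
qed

text \<open>Such an input \<open>L0 *\<^sub>v u\<close> leads under \<open>B\<close> into the range of \<open>\<Pi>k\<close>, so that it is in the range of
  \<open>R0\<close>, to which the columns of \<open>L0\<close> are orthogonal.\<close>

lemma perturbed_input_injective:
  assumes u: "u \<in> carrier_vec l" and Bu: "pert.Bp *\<^sub>v (L0 *\<^sub>v u) = 0\<^sub>v n" and Du: "D *\<^sub>v (L0 *\<^sub>v u) = 0\<^sub>v p"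
  shows "u = 0\<^sub>v l"
proof -
  have v: "L0 *\<^sub>v u \<in> carrier_vec q" by simp
  have "B *\<^sub>v (L0 *\<^sub>v u) = \<Pi>k *\<^sub>v (- (G *\<^sub>v (L0 *\<^sub>v u)))"
  proof (rule eq_vecI)
    fix i assume "i < dim_vec (\<Pi>k *\<^sub>v (- (G *\<^sub>v (L0 *\<^sub>v u))))"
    then show "(B *\<^sub>v (L0 *\<^sub>v u)) $ i = (\<Pi>k *\<^sub>v (- (G *\<^sub>v (L0 *\<^sub>v u)))) $ i"
      using arg_cong[OF Bu, of "\<lambda>v. v $ i"]
      by (simp add: pert.Bp_def vec_distrib eq_neg_iff_add_eq_0 del: index_mult_mat_vec)
  qed simp
  moreover have "- (G *\<^sub>v (L0 *\<^sub>v u)) \<in> carrier_vec k" by simp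
  ultimately have "B *\<^sub>v (L0 *\<^sub>v u) \<in> Vtraj A B C D"
    using pert.range_Vtraj mem_mat_range[OF carriers(1)] by blast
  then have "L0 *\<^sub>v u \<in> mat_range R0" by (rule range_R0[OF v Du])
  then obtain c where c: "c \<in> carrier_vec r" "L0 *\<^sub>v u = R0 *\<^sub>v c" using mem_mat_range[OF R0] by blast
  have "(L0\<^sup>\<dagger> * L0) *\<^sub>v u = (L0\<^sup>\<dagger> * R0) *\<^sub>v c"
    using u c by (simp add: mat_mult_vec)
  then show ?thesis unfolding unitary_eqs using u c by (simp add: zero_mat_mult_vec)
qed

text \<open>Testing controlled invariance against the conjugate \<open>x\<close> of the eigenvector \<open>y\<close>, and using the
  Lyapunov equation, one finds that \<open>w\<close> is an eigenvector of \<open>Lb\<close> to the reflected eigenvalue. Controllability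
  of \<open>(A, B)\<close> gives \<open>w \<noteq> 0\<close>, observability gives \<open>Hb *\<^sub>v w \<noteq> 0\<close>, and then the Lyapunov equation at \<open>w\<close>
  gives the sign of \<open>Re \<mu>\<close>.\<close>

lemma uncontrollable_mode:
  assumes y: "y \<in> carrier_vec n" "y \<noteq> 0\<^sub>v n" and Ay: "A\<^sup>T *\<^sub>v y = \<mu> \<cdot>\<^sub>v y"
    and By: "(pert.Bp * L0)\<^sup>T *\<^sub>v y = 0\<^sub>v l"
  obtains x w where "x = conjugate y" "w \<in> carrier_vec k" "w \<noteq> 0\<^sub>v k" "A\<^sup>\<dagger> *\<^sub>v x = cnj \<mu> \<cdot>\<^sub>v x"
    "B\<^sup>\<dagger> *\<^sub>v x = - (Hb *\<^sub>v w)" "Lb *\<^sub>v w = (- cnj \<mu>) \<cdot>\<^sub>v w" "w = S *\<^sub>v (\<Pi>k\<^sup>\<dagger> *\<^sub>v x)" "0 < Re \<mu>"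
proof -
  define x where "x = conjugate y"
  define w where "w = S *\<^sub>v (\<Pi>k\<^sup>\<dagger> *\<^sub>v x)"
  have yd: "dim_vec y = n" and xd: "dim_vec x = n" and wd: "dim_vec w = k"
    using y by (auto simp: x_def w_def)
  have wc: "w \<in> carrier_vec k" by (simp add: w_def)
  have conjT: "conjugate (M\<^sup>T *\<^sub>v y) = M\<^sup>\<dagger> *\<^sub>v x" if "dim_row M = n" for M
    using that yd by (subst conjugate_mult_vec) (auto simp: x_def adjoint_transpose)
  have Ax: "A\<^sup>\<dagger> *\<^sub>v x = cnj \<mu> \<cdot>\<^sub>v x"
    using conjT[of A] by (simp add: Ay x_def conjugate_smult_vec)
  have "pert.Bp\<^sup>T *\<^sub>v y = 0\<^sub>v q"
  proof -
    have "pert.Bp\<^sup>T = (pert.Bp * L0 * L0\<^sup>\<dagger>)\<^sup>T" using project_input[OF pert.Bp Bp_R0] by simp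
    also have "\<dots> = (L0\<^sup>\<dagger>)\<^sup>T * (pert.Bp * L0)\<^sup>T" by (rule mat_transpose_mult) simp
    finally have "pert.Bp\<^sup>T *\<^sub>v y = ((L0\<^sup>\<dagger>)\<^sup>T * (pert.Bp * L0)\<^sup>T) *\<^sub>v y" by simp
    also have "\<dots> = (L0\<^sup>\<dagger>)\<^sup>T *\<^sub>v ((pert.Bp * L0)\<^sup>T *\<^sub>v y)" using yd by (intro mat_mult_vec) auto
    finally have "pert.Bp\<^sup>T *\<^sub>v y = (L0\<^sup>\<dagger>)\<^sup>T *\<^sub>v ((pert.Bp * L0)\<^sup>T *\<^sub>v y)" .
    then show ?thesis using By by (simp add: vec_distrib)
  qed
  then have Bpx: "pert.Bp\<^sup>\<dagger> *\<^sub>v x = 0\<^sub>v q"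
    using conjT[of pert.Bp] by (simp add: conjugate_zero_vec)
  have Bx: "B\<^sup>\<dagger> *\<^sub>v x = - (Hb *\<^sub>v w)"
  proof (rule eq_vecI)
    fix i assume "i < dim_vec (- (Hb *\<^sub>v w))"
    then have i: "i < q" by simp
    have "pert.Bp\<^sup>\<dagger> = B\<^sup>\<dagger> + Hb * (S * \<Pi>k\<^sup>\<dagger>)"
      unfolding pert.Bp_def by (simp add: G_def adjoint_simps S_adjoint mat_distrib)
    then have "(B\<^sup>\<dagger> *\<^sub>v x + Hb *\<^sub>v w) $ i = 0"
      using Bpx i xd by (simp add: w_def vec_distrib)
    then show "(B\<^sup>\<dagger> *\<^sub>v x) $ i = (- (Hb *\<^sub>v w)) $ i"
      using i by (simp add: eq_neg_iff_add_eq_0 del: index_mult_mat_vec)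
  qed simp
  have sw: "\<sigma> *\<^sub>v w = \<Pi>k\<^sup>\<dagger> *\<^sub>v x"
  proof -
    have "\<sigma> *\<^sub>v w = (\<sigma> * S) *\<^sub>v (\<Pi>k\<^sup>\<dagger> *\<^sub>v x)" unfolding w_def by (intro mat_mult_vec[symmetric]) auto
    then show ?thesis unfolding \<sigma>S by simp
  qed
  have e1: "cnj \<mu> \<cdot>\<^sub>v (\<sigma> *\<^sub>v w) - Hb\<^sup>\<dagger> *\<^sub>v (Hb *\<^sub>v w) = Lb\<^sup>\<dagger> *\<^sub>v (\<sigma> *\<^sub>v w)"
  proof -
    have "(A * \<Pi>k + B * Hb)\<^sup>\<dagger> *\<^sub>v x = (\<Pi>k * Lb)\<^sup>\<dagger> *\<^sub>v x" by (simp add: controlled_invariance)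
    then have "\<Pi>k\<^sup>\<dagger> *\<^sub>v (A\<^sup>\<dagger> *\<^sub>v x) + Hb\<^sup>\<dagger> *\<^sub>v (B\<^sup>\<dagger> *\<^sub>v x) = Lb\<^sup>\<dagger> *\<^sub>v (\<Pi>k\<^sup>\<dagger> *\<^sub>v x)"
      using xd by (simp add: adjoint_simps vec_distrib)
    then have eq: "\<Pi>k\<^sup>\<dagger> *\<^sub>v (cnj \<mu> \<cdot>\<^sub>v x) + Hb\<^sup>\<dagger> *\<^sub>v (- (Hb *\<^sub>v w)) = Lb\<^sup>\<dagger> *\<^sub>v (\<Pi>k\<^sup>\<dagger> *\<^sub>v x)"
      by (simp only: Ax Bx)
    show ?thesis
    proof (rule eq_vecI)
      fix i assume "i < dim_vec (Lb\<^sup>\<dagger> *\<^sub>v (\<sigma> *\<^sub>v w))"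
      then show "(cnj \<mu> \<cdot>\<^sub>v (\<sigma> *\<^sub>v w) - Hb\<^sup>\<dagger> *\<^sub>v (Hb *\<^sub>v w)) $ i = (Lb\<^sup>\<dagger> *\<^sub>v (\<sigma> *\<^sub>v w)) $ i"
        using arg_cong[OF eq, of "\<lambda>v. v $ i"] xd by (simp add: sw vec_distrib del: index_mult_mat_vec)
    qed simp
  qed
  have e2: "\<sigma> *\<^sub>v (Lb *\<^sub>v w) = (- cnj \<mu>) \<cdot>\<^sub>v (\<sigma> *\<^sub>v w)"
  proof (rule eq_vecI)
    fix i assume "i < dim_vec ((- cnj \<mu>) \<cdot>\<^sub>v (\<sigma> *\<^sub>v w))"
    then have i: "i < k" by simp
    have "(\<sigma> * Lb + Lb\<^sup>\<dagger> * \<sigma> + Hb\<^sup>\<dagger> * Hb) *\<^sub>v w = 0\<^sub>v k"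
      unfolding lyapunov by (rule zero_mat_mult_vec[OF wd])
    then have "(\<sigma> *\<^sub>v (Lb *\<^sub>v w) + Lb\<^sup>\<dagger> *\<^sub>v (\<sigma> *\<^sub>v w) + Hb\<^sup>\<dagger> *\<^sub>v (Hb *\<^sub>v w)) $ i = 0"
      using i wd by (simp add: vec_distrib)
    moreover have "(cnj \<mu> \<cdot>\<^sub>v (\<sigma> *\<^sub>v w) - Hb\<^sup>\<dagger> *\<^sub>v (Hb *\<^sub>v w)) $ i = (Lb\<^sup>\<dagger> *\<^sub>v (\<sigma> *\<^sub>v w)) $ i" by (simp add: e1)
    ultimately have "(\<sigma> *\<^sub>v (Lb *\<^sub>v w)) $ i + (Lb\<^sup>\<dagger> *\<^sub>v (\<sigma> *\<^sub>v w)) $ i + (Hb\<^sup>\<dagger> *\<^sub>v (Hb *\<^sub>v w)) $ i = 0"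
      "cnj \<mu> * (\<sigma> *\<^sub>v w) $ i - (Hb\<^sup>\<dagger> *\<^sub>v (Hb *\<^sub>v w)) $ i = (Lb\<^sup>\<dagger> *\<^sub>v (\<sigma> *\<^sub>v w)) $ i"
      using i by (auto simp: add.assoc simp del: index_mult_mat_vec)
    then have "(\<sigma> *\<^sub>v (Lb *\<^sub>v w)) $ i + cnj \<mu> * (\<sigma> *\<^sub>v w) $ i = 0" by (simp add: algebra_simps)
    then show "(\<sigma> *\<^sub>v (Lb *\<^sub>v w)) $ i = ((- cnj \<mu>) \<cdot>\<^sub>v (\<sigma> *\<^sub>v w)) $ i"
      using i by (simp add: eq_neg_iff_add_eq_0 del: index_mult_mat_vec)
  qed simp
  have Lw: "Lb *\<^sub>v w = (- cnj \<mu>) \<cdot>\<^sub>v w"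
  proof -
    have "(S * \<sigma>) *\<^sub>v (Lb *\<^sub>v w) = S *\<^sub>v (\<sigma> *\<^sub>v (Lb *\<^sub>v w))" by (rule mat_mult_vec) auto
    also have "\<dots> = (- cnj \<mu>) \<cdot>\<^sub>v (S *\<^sub>v (\<sigma> *\<^sub>v w))" unfolding e2 by (simp add: vec_distrib)
    also have "S *\<^sub>v (\<sigma> *\<^sub>v w) = (S * \<sigma>) *\<^sub>v w" using wd by (intro mat_mult_vec[symmetric]) auto
    finally show ?thesis unfolding S\<sigma> using wc by simp
  qed
  have w0: "w \<noteq> 0\<^sub>v k"
  proof
    assume "w = 0\<^sub>v k"
    then have "B\<^sup>\<dagger> *\<^sub>v x = 0\<^sub>v q" using Bx by (simp add: vec_distrib)
    then have "conjugate (B\<^sup>T *\<^sub>v y) = 0\<^sub>v q" using conjT[of B] by simp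
    then have "B\<^sup>T *\<^sub>v y = 0\<^sub>v q" by simp
    from controllable_hautus[OF A B reach y(1) Ay this] y(2) show False by simp
  qed
  define s where "s = (\<sigma> *\<^sub>v w) \<bullet>c w"
  define h where "h = (Hb *\<^sub>v w) \<bullet>c (Hb *\<^sub>v w)"
  have s_pos: "0 < Re s" using \<sigma>_pos[OF wc w0] by (simp add: s_def)
  have Hw0: "Hb *\<^sub>v w \<noteq> 0\<^sub>v q"
  proof
    assume Hw: "Hb *\<^sub>v w = 0\<^sub>v q"
    have "A *\<^sub>v (\<Pi>k *\<^sub>v w) = (- cnj \<mu>) \<cdot>\<^sub>v (\<Pi>k *\<^sub>v w)"
      using pert.invD[OF wc] wd by (simp add: Hw Lw vec_distrib)
    moreover have "C *\<^sub>v (\<Pi>k *\<^sub>v w) = 0\<^sub>v p"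
      using pert.outD[OF wc] by (simp add: Hw vec_distrib)
    moreover have "\<Pi>k *\<^sub>v w \<in> carrier_vec n" by simp
    ultimately have "\<Pi>k *\<^sub>v w = 0\<^sub>v n" using observable_hautus[OF A C obs] by blast
    then have "\<Pi>k *\<^sub>v w + \<Pi>f *\<^sub>v 0\<^sub>v f = 0\<^sub>v n" by (simp add: vec_distrib)
    from \<Pi>z_injective(1)[OF wc _ this] w0 show False by simp
  qed
  have h_pos: "0 < Re h"
  proof -
    have "0 \<le> h" unfolding h_def using conjugate_square_positive by blast
    moreover have "h \<noteq> 0" using Hw0 vec_norm_zero[of "Hb *\<^sub>v w"] by (auto simp: h_def)
    ultimately show ?thesis by (auto simp: less_eq_complex_def complex_eq_iff)
  qed
  have "cnj \<mu> * s - h = - (\<mu> * s)"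
  proof -
    have "(cnj \<mu> \<cdot>\<^sub>v (\<sigma> *\<^sub>v w) - Hb\<^sup>\<dagger> *\<^sub>v (Hb *\<^sub>v w)) \<bullet>c w = cnj \<mu> * s - (Hb\<^sup>\<dagger> *\<^sub>v (Hb *\<^sub>v w)) \<bullet>c w"
      using wc by (subst minus_scalar_prod_distrib[of _ k]) (auto simp: s_def)
    also have "(Hb\<^sup>\<dagger> *\<^sub>v (Hb *\<^sub>v w)) \<bullet>c w = h"
      using wd by (subst adjoint_scalar_prod) (auto simp: h_def)
    finally have "cnj \<mu> * s - h = (Lb\<^sup>\<dagger> *\<^sub>v (\<sigma> *\<^sub>v w)) \<bullet>c w" by (simp add: e1)
    also have "\<dots> = (\<sigma> *\<^sub>v w) \<bullet>c (Lb *\<^sub>v w)"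
      using wd by (subst adjoint_scalar_prod) auto
    also have "\<dots> = - (\<mu> * s)" unfolding Lw s_def using wc by (simp add: conjugate_smult_vec)
    finally show ?thesis .
  qed
  then have "Re (cnj \<mu> * s + \<mu> * s) = Re h" by (simp add: algebra_simps) 
  then have "2 * Re \<mu> * Re s = Re h" by (simp add: algebra_simps)
  then have "0 < Re \<mu> * Re s" using h_pos by simp
  then have "0 < Re \<mu>" using s_pos by (simp add: zero_less_mult_iff)
  with that x_def wc w0 Ax Bx Lw w_def show thesis by blast
qed

lemma controllable_perturbed_of_stable:
  assumes "\<And>\<mu>. eigenvalue A \<mu> \<Longrightarrow> Re \<mu> \<le> 0"
  shows "controllable A (pert.Bp * L0)"
proof (rule hautus_controllable[OF A])
  fix y \<mu> assume y: "y \<in> carrier_vec n" "A\<^sup>T *\<^sub>v y = \<mu> \<cdot>\<^sub>v y" "(pert.Bp * L0)\<^sup>T *\<^sub>v y = 0\<^sub>v l"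
  show "y = 0\<^sub>v n"
  proof (rule ccontr)
    assume y0: "y \<noteq> 0\<^sub>v n"
    have "0 < Re \<mu>" by (rule uncontrollable_mode[OF y(1) y0 y(2,3)])
    moreover have "eigenvalue (A\<^sup>T) \<mu>" by (rule eigenvalueI[OF _ y(1) y0 y(2)]) simp
    then have "eigenvalue A \<mu>" by (simp add: eigenvalue_transpose[OF A])
    ultimately show False using assms by force
  qed
qed simp

text \<open>With \<open>x\<close> and \<open>w\<close> as in \<open>uncontrollable_mode\<close>, the vector \<open>P *\<^sub>v x + \<Pi>k *\<^sub>v w\<close> satisfies the equation of an
  eigenvector of \<open>A\<close> for \<open>- cnj \<mu>\<close>, which is an eigenvalue of \<open>- A\<^sup>\<dagger>\<close>; so it is zero. It follows that
  \<open>C * P + D * B\<^sup>\<dagger>\<close> annihilates \<open>x\<close>, and no feedback through its adjoint can move the unstable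
  eigenvalue \<open>\<mu>\<close>.\<close>

lemma controllable_perturbed_of_stabilizable:
  assumes no_common: "\<And>\<mu>. eigenvalue A \<mu> \<Longrightarrow> \<not> eigenvalue (- A\<^sup>\<dagger>) \<mu>"
    and P: "P \<in> carrier_mat n n" and lyap: "A * P + P * A\<^sup>\<dagger> + B * B\<^sup>\<dagger> = 0\<^sub>m n n"
    and stab: "stabilizable A ((C * P + D * B\<^sup>\<dagger>)\<^sup>\<dagger>)"
  shows "controllable A (pert.Bp * L0)"
proof (rule hautus_controllable[OF A])
  fix y \<mu> assume y: "y \<in> carrier_vec n" "A\<^sup>T *\<^sub>v y = \<mu> \<cdot>\<^sub>v y" "(pert.Bp * L0)\<^sup>T *\<^sub>v y = 0\<^sub>v l"
  show "y = 0\<^sub>v n"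
  proof (rule ccontr)
    assume y0: "y \<noteq> 0\<^sub>v n"
    obtain x w where x: "x = conjugate y" and w: "w \<in> carrier_vec k" "w \<noteq> 0\<^sub>v k"
      and Ax: "A\<^sup>\<dagger> *\<^sub>v x = cnj \<mu> \<cdot>\<^sub>v x" and Bx: "B\<^sup>\<dagger> *\<^sub>v x = - (Hb *\<^sub>v w)"
      and Lw: "Lb *\<^sub>v w = (- cnj \<mu>) \<cdot>\<^sub>v w" and \<mu>: "0 < Re \<mu>"
      by (rule uncontrollable_mode[OF y(1) y0 y(2,3)]) (rule that)
    have xc: "x \<in> carrier_vec n" using y by (simp add: x)
    have xd: "dim_vec x = n" "dim_vec w = k" using xc w by auto
    have x0: "x \<noteq> 0\<^sub>v n" using y0 by (simp add: x)
    note Pd = carrier_matD[OF P]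
    define z where "z = P *\<^sub>v x + \<Pi>k *\<^sub>v w"
    have zc: "z \<in> carrier_vec n" using Pd by (auto simp: z_def intro!: carrier_vecI)
    have Az: "A *\<^sub>v z = (- cnj \<mu>) \<cdot>\<^sub>v z"
    proof (rule eq_vecI)
      fix i assume "i < dim_vec ((- cnj \<mu>) \<cdot>\<^sub>v z)"
      then have i: "i < n" using zc by simp
      have "(A * P + P * A\<^sup>\<dagger> + B * B\<^sup>\<dagger>) *\<^sub>v x = 0\<^sub>v n" unfolding lyap using xd by (simp add: zero_mat_mult_vec)
      then have "(A *\<^sub>v (P *\<^sub>v x) + P *\<^sub>v (A\<^sup>\<dagger> *\<^sub>v x) + B *\<^sub>v (B\<^sup>\<dagger> *\<^sub>v x)) $ i = 0"
        using Pd xd i by (simp add: vec_distrib)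
      then have 1: "(A *\<^sub>v (P *\<^sub>v x)) $ i + (cnj \<mu> * (P *\<^sub>v x) $ i - (B *\<^sub>v (Hb *\<^sub>v w)) $ i) = 0"
        unfolding Ax Bx using Pd xd i by (simp add: vec_distrib del: index_mult_mat_vec)
      have "(A *\<^sub>v (\<Pi>k *\<^sub>v w) + B *\<^sub>v (Hb *\<^sub>v w)) $ i = ((- cnj \<mu>) \<cdot>\<^sub>v (\<Pi>k *\<^sub>v w)) $ i"
        using pert.invD[OF w(1)] xd by (simp add: Lw vec_distrib)
      then have 2: "(A *\<^sub>v (\<Pi>k *\<^sub>v w)) $ i + (B *\<^sub>v (Hb *\<^sub>v w)) $ i = - (cnj \<mu> * (\<Pi>k *\<^sub>v w) $ i)"
        using i by (simp del: index_mult_mat_vec)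
      have "(A *\<^sub>v (P *\<^sub>v x)) $ i + (A *\<^sub>v (\<Pi>k *\<^sub>v w)) $ i =
          (A *\<^sub>v (P *\<^sub>v x)) $ i - (B *\<^sub>v (Hb *\<^sub>v w)) $ i + - (cnj \<mu> * (\<Pi>k *\<^sub>v w) $ i)"
        unfolding 2[symmetric] by simp
      also have "(A *\<^sub>v (P *\<^sub>v x)) $ i - (B *\<^sub>v (Hb *\<^sub>v w)) $ i = - (cnj \<mu> * (P *\<^sub>v x) $ i)"
        unfolding 1[folded eq_neg_iff_add_eq_0] by simp
      finally show "(A *\<^sub>v z) $ i = ((- cnj \<mu>) \<cdot>\<^sub>v z) $ i"
        using i Pd xd by (simp add: z_def vec_distrib algebra_simps del: index_mult_mat_vec)
    qed (use zc in simp)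
    have z0: "z = 0\<^sub>v n"
    proof (rule ccontr)
      assume "z \<noteq> 0\<^sub>v n"
      then have "eigenvalue A (- cnj \<mu>)" by (rule eigenvalueI[OF A zc _ Az])
      moreover have "(- A\<^sup>\<dagger>) *\<^sub>v x = (- cnj \<mu>) \<cdot>\<^sub>v x"
        using xd by (intro eq_vecI) (auto simp: vec_distrib Ax)
      then have "eigenvalue (- A\<^sup>\<dagger>) (- cnj \<mu>)" by (intro eigenvalueI[OF _ xc x0]) auto
      ultimately show False using no_common by blast
    qed
    define Cb where "Cb = C * P + D * B\<^sup>\<dagger>"
    have Cb: "dim_row Cb = p" "dim_col Cb = n" using Pd by (auto simp: Cb_def)
    have "Cb *\<^sub>v x = C *\<^sub>v z"
    proof (rule eq_vecI)
      fix i assume "i < dim_vec (C *\<^sub>v z)"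
      then have i: "i < p" by simp
      have "(C *\<^sub>v (\<Pi>k *\<^sub>v w) + D *\<^sub>v (Hb *\<^sub>v w)) $ i = 0" using pert.outD[OF w(1)] i by simp
      then have "(C *\<^sub>v (\<Pi>k *\<^sub>v w)) $ i = - (D *\<^sub>v (Hb *\<^sub>v w)) $ i"
        using i by (simp add: eq_neg_iff_add_eq_0 del: index_mult_mat_vec)
      then show "(Cb *\<^sub>v x) $ i = (C *\<^sub>v z) $ i"
        using i Pd xd by (simp add: Cb_def z_def Bx vec_distrib del: index_mult_mat_vec)
    qed (use Cb in simp)
    then have Cbx: "Cb *\<^sub>v x = 0\<^sub>v p" by (simp add: z0 vec_distrib)
    have "conjugate (Cb *\<^sub>v x) = (Cb\<^sup>\<dagger>)\<^sup>T *\<^sub>v y"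
      using Cb xd by (subst conjugate_mult_vec) (auto simp: x)
    then have Cby: "(Cb\<^sup>\<dagger>)\<^sup>T *\<^sub>v y = 0\<^sub>v p" by (simp add: Cbx conjugate_zero_vec)
    obtain K where K: "K \<in> carrier_mat p n" and hur: "hurwitz (A + Cb\<^sup>\<dagger> * K)"
      using stab Cb unfolding stabilizable_def Cb_def[symmetric] by auto
    have M: "A + Cb\<^sup>\<dagger> * K \<in> carrier_mat n n" using K Cb by (intro carrier_matI) auto
    have "(A + Cb\<^sup>\<dagger> * K)\<^sup>T *\<^sub>v y = A\<^sup>T *\<^sub>v y + K\<^sup>T *\<^sub>v ((Cb\<^sup>\<dagger>)\<^sup>T *\<^sub>v y)"
      using K Cb y(1) by (simp add: mat_transpose vec_distrib)
    also have "\<dots> = \<mu> \<cdot>\<^sub>v y" unfolding y(2) Cby using K y(1) by (simp add: vec_distrib)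
    finally have "eigenvalue ((A + Cb\<^sup>\<dagger> * K)\<^sup>T) \<mu>"
      using M by (intro eigenvalueI[OF _ y(1) y0]) auto
    then have "eigenvalue (A + Cb\<^sup>\<dagger> * K) \<mu>" by (simp add: eigenvalue_transpose[OF M])
    with hur \<mu> show False unfolding hurwitz_def by force
  qed
qed simp

end


section \<open>A Sylvester equation\<close>

text \<open>The set of solvable right hand sides is closed under multiplication by \<open>L\<close> from the left: if
  \<open>(W, X)\<close> solves the equation for \<open>E\<close>, then \<open>(L * W + a * X, X * N)\<close> solves it for \<open>L * E\<close>.\<close>

lemma sylvester_solvable:
  assumes L: "L \<in> carrier_mat k k" and a: "a \<in> carrier_mat k r" and con: "controllable L a"
    and N: "N \<in> carrier_mat m m" and E: "E \<in> carrier_mat k m"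
  obtains W X where "W \<in> carrier_mat k m" "X \<in> carrier_mat r m"
    "L * W - W * N + a * X = (E :: complex mat)"
proof -
  define ok where "ok E \<longleftrightarrow> (\<exists>W\<in>carrier_mat k m. \<exists>X\<in>carrier_mat r m. L * W - W * N + a * X = E)" for E
  note d = carrier_matD[OF L] carrier_matD[OF a] carrier_matD[OF N]
  have ok_zero: "ok (0\<^sub>m k m)"
    unfolding ok_def
    by (rule bexI[of _ "0\<^sub>m k m"], rule bexI[of _ "0\<^sub>m r m"]) (use d in \<open>auto simp: mat_distrib intro!: eq_matI\<close>)
  have ok_add: "ok (E + E')" if EE: "ok E" "ok E'" for E E'
  proof -
    obtain W X where W: "W \<in> carrier_mat k m" "X \<in> carrier_mat r m" "L * W - W * N + a * X = E"
      using EE(1) by (auto simp: ok_def)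
    obtain W' X' where W': "W' \<in> carrier_mat k m" "X' \<in> carrier_mat r m" "L * W' - W' * N + a * X' = E'"
      using EE(2) by (auto simp: ok_def)
    have "L * (W + W') - (W + W') * N + a * (X + X') = E + E'"
      unfolding W(3)[symmetric] W'(3)[symmetric]
      by (rule eq_matI) (use d W(1,2) W'(1,2) in \<open>auto simp: mat_distrib simp del: index_mult_mat(1)\<close>)
    then show ?thesis using W W' unfolding ok_def by (meson add_carrier_mat)
  qed
  have ok_smult: "ok (c \<cdot>\<^sub>m E)" if EE: "ok E" for c E
  proof -
    obtain W X where W: "W \<in> carrier_mat k m" "X \<in> carrier_mat r m" "L * W - W * N + a * X = E"
      using EE by (auto simp: ok_def)
    have "L * (c \<cdot>\<^sub>m W) - (c \<cdot>\<^sub>m W) * N + a * (c \<cdot>\<^sub>m X) = c \<cdot>\<^sub>m E"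
      unfolding W(3)[symmetric] mult_smult_distrib[OF L W(1)] mult_smult_assoc_mat[OF W(1) N] mult_smult_distrib[OF a W(2)]
      by (rule eq_matI) (use d W(1,2) in \<open>auto simp: algebra_simps simp del: index_mult_mat(1)\<close>)
    then show ?thesis using W unfolding ok_def by (meson smult_carrier_mat)
  qed
  have ok_left: "ok (L * E)" if EE: "ok E" for E
  proof -
    obtain W X where W: "W \<in> carrier_mat k m" "X \<in> carrier_mat r m" "L * W - W * N + a * X = E"
      using EE by (auto simp: ok_def)
    have "L * (L * W + a * X) - (L * W + a * X) * N + a * (X * N) = L * E"
      unfolding W(3)[symmetric]
      by (rule eq_matI) (use d W(1,2) in \<open>auto simp: mat_distrib simp del: index_mult_mat(1)\<close>)
    moreover have "L * W + a * X \<in> carrier_mat k m" "X * N \<in> carrier_mat r m" using W d by auto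
    ultimately show ?thesis unfolding ok_def by blast
  qed
  \<comment> \<open>By linearity it suffices to treat right hand sides of rank one; for these the left factors
    that are admissible form a subspace that is invariant under \<open>L\<close> and contains the range of \<open>a\<close>.\<close>
  define outer where "outer v w = mat k m (\<lambda>(i, j). v $ i * w $ j)" for v w :: "complex vec"
  have outer_ok: "ok (outer v w)" if v: "v \<in> carrier_vec k" for v w
  proof -
    define V where "V = {v \<in> carrier_vec k. \<forall>w. ok (outer v w)}"
    have "reachable_subspace L a \<subseteq> V"
    proof (rule reachable_least[OF L a])
      show "vec_subspace k V"
      proof
        have "outer (0\<^sub>v k) w = 0\<^sub>m k m" for w by (rule eq_matI) (auto simp: outer_def)
        then show "0\<^sub>v k \<in> V" using ok_zero by (simp add: V_def)
      next
        fix x y assume xy: "x \<in> V" "y \<in> V"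
        then have "outer (x + y) w = outer x w + outer y w" for w
          by (intro eq_matI) (auto simp: outer_def V_def algebra_simps)
        then show "x + y \<in> V" using xy ok_add by (simp add: V_def)
      next
        fix c x assume x: "x \<in> V"
        then have "outer (c \<cdot>\<^sub>v x) w = c \<cdot>\<^sub>m outer x w" for w
          by (intro eq_matI) (auto simp: outer_def V_def algebra_simps)
        then show "c \<cdot>\<^sub>v x \<in> V" using x ok_smult by (simp add: V_def)
      qed (auto simp: V_def)
      show "mat_range a \<subseteq> V"
      proof
        fix x assume "x \<in> mat_range a"
        then obtain c where c: "c \<in> carrier_vec r" "x = a *\<^sub>v c" using mem_mat_range[OF a] by blast
        have "ok (outer x w)" for w
        proof -
          define Y where "Y = mat r m (\<lambda>(i, j). c $ i * w $ j)"
          have "L * 0\<^sub>m k m - 0\<^sub>m k m * N + a * Y = outer x w"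
            by (rule eq_matI)
              (use d c in \<open>auto simp: mat_distrib Y_def outer_def scalar_prod_def sum_distrib_right sum_distrib_left mult_ac
                  intro!: sum.cong\<close>)
          moreover have "Y \<in> carrier_mat r m" by (simp add: Y_def)
          ultimately show ?thesis
            unfolding ok_def by (intro bexI[of _ "0\<^sub>m k m"] bexI[of _ Y]) auto
        qed
        then show "x \<in> V" using c d by (auto simp: V_def)
      qed
      show "L *\<^sub>v x \<in> V" if x: "x \<in> V" for x
      proof -
        have xd: "dim_vec x = k" using x by (auto simp: V_def)
        have "outer (L *\<^sub>v x) w = L * outer x w" for w
          by (rule eq_matI) (use d xd in \<open>auto simp: outer_def scalar_prod_def sum_distrib_right sum_distrib_left mult_ac
                  intro!: sum.cong\<close>)
        then show ?thesis using x ok_left d by (auto simp: V_def)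
      qed
    qed
    moreover have "reachable_subspace L a = carrier_vec k" using con L by (simp add: controllable_def)
    ultimately show ?thesis using v by (auto simp: V_def)
  qed
  have "ok (mat k m (\<lambda>(i, j). if j < b then E $$ (i, j) else 0))" if "b \<le> m" for b
    using that
  proof (induction b)
    case 0
    have "mat k m (\<lambda>(i, j). if j < 0 then E $$ (i, j) else 0) = 0\<^sub>m k m" by (rule eq_matI) auto
    with ok_zero show ?case by (simp only:)
  next
    case (Suc b)
    have "mat k m (\<lambda>(i, j). if j < Suc b then E $$ (i, j) else 0) =
        mat k m (\<lambda>(i, j). if j < b then E $$ (i, j) else 0) + outer (col E b) (unit_vec m b)"
      by (rule eq_matI) (use Suc.prems E in \<open>auto simp: outer_def less_Suc_eq\<close>)
    moreover have "ok (outer (col E b) (unit_vec m b))" using E by (intro outer_ok) auto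
    ultimately show ?case using Suc ok_add by simp
  qed
  from this[of m] have "ok (mat k m (\<lambda>(i, j). if j < m then E $$ (i, j) else 0))" by simp
  moreover have "mat k m (\<lambda>(i, j). if j < m then E $$ (i, j) else 0) = E" by (rule eq_matI) (use E in auto)
  ultimately show thesis using that unfolding ok_def by auto
qed

section \<open>The spaces \<open>W_space\<close> of an invertible function\<close>

lemma strictly_proper_zero: "strictly_proper 0"
  unfolding strictly_proper_def by (intro exI[of _ 0] exI[of _ 1]) (auto simp: Zero_fract_def)

lemma strictly_proper_uminus: "strictly_proper r \<Longrightarrow> strictly_proper (- r)"
  unfolding strictly_proper_def by (metis degree_minus minus_fract neg_equal_0_iff_equal)

lemma strictly_proper_add:
  assumes "strictly_proper r" "strictly_proper s"
  shows "strictly_proper (r + s)"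
proof -
  from assms obtain a b c d where ab: "b \<noteq> 0" "r = Fract a b" "a = 0 \<or> degree a < degree b"
    and cd: "d \<noteq> 0" "s = Fract c d" "c = 0 \<or> degree c < degree d"
    by (auto simp: strictly_proper_def)
  have "r + s = Fract (a * d + c * b) (b * d)" using ab cd by simp
  moreover have "a * d + c * b = 0 \<or> degree (a * d + c * b) < degree (b * d)"
  proof (cases "a = 0 \<or> c = 0")
    case True
    then show ?thesis using ab cd by (auto simp: degree_mult_eq)
  next
    case False
    then have "degree (a * d) < degree (b * d)" "degree (c * b) < degree (b * d)"
      using ab cd by (auto simp: degree_mult_eq)
    then show ?thesis using degree_add_less by blast
  qed
  ultimately show ?thesis using ab(1) cd(1) unfolding strictly_proper_def by (metis mult_eq_0_iff)
qed

lemma strictly_proper_to_fract: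
  assumes "strictly_proper (to_fract p)"
  shows "p = 0"
proof (rule ccontr)
  assume p: "p \<noteq> 0"
  from assms obtain a b where ab: "b \<noteq> 0" "to_fract p = Fract a b" "a = 0 \<or> degree a < degree b"
    by (auto simp: strictly_proper_def)
  then have "a = p * b" by (simp add: to_fract_def eq_fract)
  with ab p show False by (auto simp: degree_mult_eq)
qed

text \<open>Division with remainder of numerator by denominator gives existence; a polynomial that is strictly
  proper vanishes, which gives uniqueness.\<close>

lemma strictly_proper_part: "strictly_proper (strictly_proper_part r)"
proof -
  obtain a b where ab: "r = Fract a b" "b \<noteq> 0" by (cases r)
  have "strictly_proper (Fract (a mod b) b)"
    unfolding strictly_proper_def
    by (rule exI[of _ "a mod b"], rule exI[of _ b]) (use degree_mod_less[OF ab(2), of a] ab(2) in auto)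
  moreover have "r = to_fract (a div b) + Fract (a mod b) b"
    using ab by (simp add: to_fract_def eq_fract)
  moreover have "s = s'" if s: "strictly_proper s" "strictly_proper s'" "r = to_fract p + s" "r = to_fract p' + s'"
    for s s' p p'
  proof -
    have "to_fract (p - p') = s' + (- s)" using s(3,4) by (simp add: algebra_simps)
    then have "p - p' = 0"
      using strictly_proper_add[OF s(2) strictly_proper_uminus[OF s(1)]] strictly_proper_to_fract by metis
    then show ?thesis using s(3,4) by simp
  qed
  ultimately have "\<exists>!s. strictly_proper s \<and> (\<exists>p. r = to_fract p + s)" by blast
  from theI'[OF this] show ?thesis by (simp add: strictly_proper_part_def)
qed

text \<open>If \<open>U\<close> contains the strictly proper part of each of its elements, then every coset is that of zero.\<close>

lemma W_space_trivial:
  assumes U: "U \<subseteq> carrier_vec m" "U \<noteq> {}" and part: "\<And>v. v \<in> U \<Longrightarrow> map_vec strictly_proper_part v \<in> U"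
    and closed: "\<And>v w. v \<in> U \<Longrightarrow> w \<in> U \<Longrightarrow> v + w \<in> U" "\<And>v w. v \<in> U \<Longrightarrow> w \<in> U \<Longrightarrow> v - w \<in> U"
  shows "W_space U = {strictly_proper_elems U}"
proof -
  have "{x + s | s. s \<in> strictly_proper_elems U} = strictly_proper_elems U"
    if x: "x \<in> map_vec strictly_proper_part ` U" for x
  proof -
    have xU: "x \<in> U" and xs: "\<And>i. i < m \<Longrightarrow> strictly_proper (x $ i)"
      using x part U(1) by (auto simp: strictly_proper_part)
    have xc: "x \<in> carrier_vec m" using xU U(1) by blast
    show ?thesis
    proof (intro equalityI subsetI)
      fix t assume "t \<in> {x + s | s. s \<in> strictly_proper_elems U}"
      then obtain s where s: "t = x + s" "s \<in> U" "\<forall>i<dim_vec s. strictly_proper (s $ i)"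
        by (auto simp: strictly_proper_elems_def)
      have "s \<in> carrier_vec m" using s(2) U(1) by blast
      with s xs xU xc closed(1) show "t \<in> strictly_proper_elems U"
        by (auto simp: strictly_proper_elems_def intro: strictly_proper_add)
    next
      fix t assume t: "t \<in> strictly_proper_elems U"
      then have tc: "t \<in> carrier_vec m" using U(1) by (auto simp: strictly_proper_elems_def)
      have "t = x + (t - x)" using tc xc by (intro eq_vecI) auto
      moreover have "t - x \<in> strictly_proper_elems U"
      proof -
        have "strictly_proper (t $ i - x $ i)" if "i < m" for i
          using strictly_proper_add[of "t $ i" "- (x $ i)"] strictly_proper_uminus[OF xs[OF that]] t tc that
          by (simp add: strictly_proper_elems_def)
        then show ?thesis using t tc xc xU closed(2) by (auto simp: strictly_proper_elems_def)
      qed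
      ultimately show "t \<in> {x + s | s. s \<in> strictly_proper_elems U}" by blast
    qed
  qed
  then show ?thesis using U(2) unfolding W_space_def by (auto simp: image_iff)
qed

lemma W_space_carrier: "W_space (carrier_vec m) = {strictly_proper_elems (carrier_vec m)}"
proof (rule W_space_trivial)
  show "carrier_vec m \<noteq> ({} :: complex poly fract vec set)" using zero_carrier_vec by blast
qed auto

lemma W_space_zero: "W_space {0\<^sub>v m} = {strictly_proper_elems {0\<^sub>v m}}"
proof (rule W_space_trivial[of _ m])
  have "strictly_proper_part 0 = 0"
  proof -
    have "strictly_proper_part 0 = (THE s. strictly_proper s \<and> (\<exists>p. 0 = to_fract p + s))"
      by (simp add: strictly_proper_part_def)
    also have "\<dots> = 0"
    proof (rule the_equality)
      fix s assume "strictly_proper s \<and> (\<exists>p. 0 = to_fract p + s)"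
      then obtain p where p: "strictly_proper s" "s = to_fract (- p)" by (auto simp: add_eq_0_iff)
      then have "- p = 0" using strictly_proper_to_fract by metis
      with p show "s = 0" by simp
    qed (auto simp: strictly_proper_zero intro: exI[of _ 0])
    finally show ?thesis .
  qed
  then show "map_vec strictly_proper_part v \<in> {0\<^sub>v m}" if "v \<in> {0\<^sub>v m}" for v
    using that by (auto intro!: eq_vecI)
qed auto


section \<open>Systems with the same steps\<close>

lemma Cstar_mono:
  assumes "system A B C D n q p" "system A' B' C' D' n q' p'"
    and step: "\<And>x y. x \<in> carrier_vec n \<Longrightarrow> null_step A B C D x y \<Longrightarrow> null_step A' B' C' D' x y"
  shows "Cstar A B C D \<subseteq> Cstar A' B' C' D'"
proof
  interpret S: system A B C D n q p by fact
  interpret S': system A' B' C' D' n q' p' by fact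
  fix x assume "x \<in> Cstar A B C D"
  then show "x \<in> Cstar A' B' C' D'"
  proof (induction rule: S.Cstar_induct)
    case zero
    show ?case by (rule S'.zero_Cstar)
  next
    case (step x y)
    then show ?case using S'.Cstar_step assms(3) by blast
  qed
qed

lemma Vtraj_mono:
  assumes "system A B C D n q p" "system A' B' C' D' n q' p'"
    and step: "\<And>x y. x \<in> carrier_vec n \<Longrightarrow> null_step A B C D x y \<Longrightarrow> null_step A' B' C' D' x y"
  shows "Vtraj A B C D \<subseteq> Vtraj A' B' C' D'"
proof
  interpret S: system A B C D n q p by fact
  interpret S': system A' B' C' D' n q' p' by fact
  fix x assume x: "x \<in> Vtraj A B C D"
  show "x \<in> Vtraj A' B' C' D'"
  proof (rule S'.Vtraj_coinduct[OF x S.Vtraj_carrier])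
    fix x assume x: "x \<in> Vtraj A B C D"
    obtain y where y: "y \<in> Vtraj A B C D" "null_step A B C D x y" using x by (rule S.Vtraj_step)
    have "x \<in> carrier_vec n" using x S.Vtraj_carrier by blast
    then show "\<exists>y\<in>Vtraj A B C D. null_step A' B' C' D' x y" using y step by blast
  qed
qed

lemma Cstar_Vtraj_cong:
  assumes "system A B C D n q p" "system A' B' C' D' n q' p'"
    and step: "\<And>x y. x \<in> carrier_vec n \<Longrightarrow> null_step A B C D x y \<longleftrightarrow> null_step A' B' C' D' x y"
  shows "Cstar A B C D = Cstar A' B' C' D'" "Vtraj A B C D = Vtraj A' B' C' D'"
proof -
  show "Cstar A B C D = Cstar A' B' C' D'"
    using Cstar_mono[OF assms(1,2)] Cstar_mono[OF assms(2,1)] step by (intro equalityI) blast+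
  show "Vtraj A B C D = Vtraj A' B' C' D'"
    using Vtraj_mono[OF assms(1,2)] Vtraj_mono[OF assms(2,1)] step by (intro equalityI) blast+
qed

lemma null_step_compress_input:
  assumes M: "M \<in> carrier_mat n q" and D: "D \<in> carrier_mat p q" and L: "L \<in> carrier_mat q l"
    and proj: "M * L * L\<^sup>\<dagger> = M" "D * L * L\<^sup>\<dagger> = D"
  shows "null_step A (M * L) C (D * L) x y \<longleftrightarrow> null_step A M C D x y"
proof
  assume "null_step A (M * L) C (D * L) x y"
  then obtain u where u: "u \<in> carrier_vec l" "y = A *\<^sub>v x + (M * L) *\<^sub>v u" "C *\<^sub>v x + (D * L) *\<^sub>v u = 0\<^sub>v (dim_row C)"
    using L by (auto simp: null_step_def)
  have "(M * L) *\<^sub>v u = M *\<^sub>v (L *\<^sub>v u)" "(D * L) *\<^sub>v u = D *\<^sub>v (L *\<^sub>v u)"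
    using M L D u(1) by (auto intro!: mat_mult_vec)
  with u show "null_step A M C D x y"
    unfolding null_step_def using M L by (intro bexI[of _ "L *\<^sub>v u"]) auto
next
  assume "null_step A M C D x y"
  then obtain u where u: "u \<in> carrier_vec q" "y = A *\<^sub>v x + M *\<^sub>v u" "C *\<^sub>v x + D *\<^sub>v u = 0\<^sub>v (dim_row C)"
    using M by (auto simp: null_step_def)
  have "(M * L) *\<^sub>v (L\<^sup>\<dagger> *\<^sub>v u) = (M * L * L\<^sup>\<dagger>) *\<^sub>v u" "(D * L) *\<^sub>v (L\<^sup>\<dagger> *\<^sub>v u) = (D * L * L\<^sup>\<dagger>) *\<^sub>v u"
    using M L D u(1) by (subst mat_mult_vec[of "_ * L"]; simp)+
  with u show "null_step A (M * L) C (D * L) x y"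
    unfolding null_step_def proj using L by (intro bexI[of _ "L\<^sup>\<dagger> *\<^sub>v u"]) auto
qed

lemma null_step_compress_output:
  assumes c: "B \<in> carrier_mat n q" "C \<in> carrier_mat p n" "D \<in> carrier_mat p q" "N \<in> carrier_mat l p" "N' \<in> carrier_mat p l"
    and proj: "N' * (N * C) = C" "N' * (N * D) = D" and x: "x \<in> carrier_vec n"
  shows "null_step A B (N * C) (N * D) x y \<longleftrightarrow> null_step A B C D x y"
proof -
  have "(N * C) *\<^sub>v x + (N * D) *\<^sub>v u = 0\<^sub>v l \<longleftrightarrow> C *\<^sub>v x + D *\<^sub>v u = 0\<^sub>v p" if u: "u \<in> carrier_vec q" for u
  proof
    assume eq: "(N * C) *\<^sub>v x + (N * D) *\<^sub>v u = 0\<^sub>v l"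
    have "N' *\<^sub>v ((N * C) *\<^sub>v x + (N * D) *\<^sub>v u) = (N' * (N * C)) *\<^sub>v x + (N' * (N * D)) *\<^sub>v u"
      using c x u by (subst (1 2) mat_mult_vec) (auto simp: vec_distrib)
    then show "C *\<^sub>v x + D *\<^sub>v u = 0\<^sub>v p" unfolding proj eq using c by (simp add: vec_distrib)
  next
    assume eq: "C *\<^sub>v x + D *\<^sub>v u = 0\<^sub>v p"
    have "(N * C) *\<^sub>v x + (N * D) *\<^sub>v u = N *\<^sub>v (C *\<^sub>v x + D *\<^sub>v u)"
      using c x u by (simp add: vec_distrib)
    then show "(N * C) *\<^sub>v x + (N * D) *\<^sub>v u = 0\<^sub>v l" unfolding eq using c by (simp add: vec_distrib)
  qed
  then show ?thesis using c by (auto simp: null_step_def)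
qed

section \<open>Both constructions together\<close>

text \<open>The left data enter as right data of the transposed system; in particular the rows of the left
  construction appear here as columns.\<close>

locale two_sided = right_data A B C D n q p k f r l \<Pi>k \<Pi>f Hk Hf \<Lambda>k \<Lambda>kf \<Lambda>f \<alpha>k R0 \<sigma> \<beta>k L0 +
    left: right_data "A\<^sup>T" "C\<^sup>T" "B\<^sup>T" "D\<^sup>T" n p q k' f' r' l' \<Pi>k' \<Pi>f' Hk' Hf' \<Lambda>k' \<Lambda>kf' \<Lambda>f' \<alpha>k' R0' \<sigma>' \<beta>k' L0'
  for A B C D n q p k f r l \<Pi>k \<Pi>f Hk Hf \<Lambda>k \<Lambda>kf \<Lambda>f \<alpha>k R0 \<sigma> \<beta>k L0
    k' f' r' l' \<Pi>k' \<Pi>f' Hk' Hf' \<Lambda>k' \<Lambda>kf' \<Lambda>f' \<alpha>k' R0' \<sigma>' \<beta>k' L0'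
begin

abbreviation Bh :: "complex mat" where "Bh \<equiv> pert.Bp"
abbreviation Ch :: "complex mat" where "Ch \<equiv> left.pert.Bp\<^sup>T"

lemma Ch [simp]: "Ch \<in> carrier_mat p n"
  using left.pert.Bp by simp

text \<open>The columns of \<open>\<Pi>k'\<close> span the intersection of \<open>Cstar\<close> and \<open>Vtraj\<close> of the transposed system, and by
  duality they annihilate both \<open>Vtraj\<close> and \<open>Cstar\<close> of the given one.\<close>

lemma left_annihilates: "y \<in> mat_range \<Pi>k' \<Longrightarrow> x \<in> Vtraj A B C D \<Longrightarrow> y \<bullet> x = 0"
  using left.range_\<Pi>k_Cstar unfolding Cstar_transpose by (auto simp: annihilator_def)

lemma left_annihilates_Cstar: "y \<in> mat_range \<Pi>k' \<Longrightarrow> x \<in> Cstar A B C D \<Longrightarrow> y \<bullet> x = 0"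
  using left.pert.range_Vtraj unfolding Vtraj_transpose by (auto simp: annihilator_def)

lemma annihilated_iff:
  assumes x: "x \<in> carrier_vec n"
  shows "\<Pi>k'\<^sup>T *\<^sub>v x = 0\<^sub>v k' \<longleftrightarrow> (\<forall>y\<in>mat_range \<Pi>k'. y \<bullet> x = 0)"
proof -
  have eq: "(\<Pi>k' *\<^sub>v v) \<bullet> x = v \<bullet> (\<Pi>k'\<^sup>T *\<^sub>v x)" if "v \<in> carrier_vec k'" for v
    using transpose_scalar_prod[of x "\<Pi>k'\<^sup>T" v] that x by simp
  show ?thesis
  proof
    assume "\<Pi>k'\<^sup>T *\<^sub>v x = 0\<^sub>v k'"
    then show "\<forall>y\<in>mat_range \<Pi>k'. y \<bullet> x = 0" using eq by (auto simp: mat_range_def)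
  next
    assume *: "\<forall>y\<in>mat_range \<Pi>k'. y \<bullet> x = 0"
    have "unit_vec k' i \<bullet> (\<Pi>k'\<^sup>T *\<^sub>v x) = 0" for i
      using * eq[of "unit_vec k' i"] by (auto simp: mat_range_def)
    then show "\<Pi>k'\<^sup>T *\<^sub>v x = 0\<^sub>v k'"
      by (intro eq_vecI) (auto simp del: index_mult_mat_vec simp flip: scalar_prod_left_unit[of _ k'])
  qed
qed

lemma \<Pi>k'_Vtraj: "x \<in> Vtraj A B C D \<Longrightarrow> \<Pi>k'\<^sup>T *\<^sub>v x = 0\<^sub>v k'"
  using annihilated_iff left_annihilates Vtraj_carrier by blast

lemma \<Pi>k'_Cstar: "x \<in> Cstar A B C D \<Longrightarrow> \<Pi>k'\<^sup>T *\<^sub>v x = 0\<^sub>v k'"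
  using annihilated_iff left_annihilates_Cstar Cstar_subset by blast

lemma \<Pi>k'_\<Pi>: "\<Pi>k'\<^sup>T * \<Pi>k = 0\<^sub>m k' k" "\<Pi>k'\<^sup>T * \<Pi>f = 0\<^sub>m k' f"
proof -
  show "\<Pi>k'\<^sup>T * \<Pi>k = 0\<^sub>m k' k"
  proof (rule mat_eq_vecI[of _ k' k])
    fix v :: "complex vec" assume v: "v \<in> carrier_vec k"
    have "\<Pi>k *\<^sub>v v = \<Pi>k *\<^sub>v v + \<Pi>f *\<^sub>v 0\<^sub>v f" by (simp add: vec_distrib)
    then have "\<Pi>k *\<^sub>v v \<in> Vtraj A B C D" unfolding range_Vtraj_iff using v zero_carrier_vec by blast
    from \<Pi>k'_Vtraj[OF this] v show "(\<Pi>k'\<^sup>T * \<Pi>k) *\<^sub>v v = 0\<^sub>m k' k *\<^sub>v v"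
      by (simp add: vec_distrib)
  qed auto
  show "\<Pi>k'\<^sup>T * \<Pi>f = 0\<^sub>m k' f"
  proof (rule mat_eq_vecI[of _ k' f])
    fix v :: "complex vec" assume v: "v \<in> carrier_vec f"
    have "\<Pi>f *\<^sub>v v = \<Pi>k *\<^sub>v 0\<^sub>v k + \<Pi>f *\<^sub>v v" by (simp add: vec_distrib)
    then have "\<Pi>f *\<^sub>v v \<in> Vtraj A B C D" unfolding range_Vtraj_iff using v zero_carrier_vec by blast
    from \<Pi>k'_Vtraj[OF this] v show "(\<Pi>k'\<^sup>T * \<Pi>f) *\<^sub>v v = 0\<^sub>m k' f *\<^sub>v v"
      by (simp add: vec_distrib)
  qed auto
qed

lemma pert_out: "Bh\<^sup>T * \<Pi>k' + D\<^sup>T * left.Hb = 0\<^sub>m q k'"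
proof -
  have "\<Pi>k\<^sup>T * \<Pi>k' = (\<Pi>k'\<^sup>T * \<Pi>k)\<^sup>T" by (simp add: mat_transpose_mult)
  then have z: "\<Pi>k\<^sup>T * \<Pi>k' = 0\<^sub>m k k'" by (simp add: \<Pi>k'_\<Pi> mat_transpose_zero)
  have "Bh\<^sup>T * \<Pi>k' + D\<^sup>T * left.Hb = (B\<^sup>T * \<Pi>k' + D\<^sup>T * left.Hb) + G\<^sup>T * (\<Pi>k\<^sup>T * \<Pi>k')"
    unfolding pert.Bp_def by (rule eq_matI) (auto simp: mat_transpose mat_distrib simp del: index_mult_mat(1))
  then show ?thesis unfolding left.controlled_invariance(2) z by (simp add: mat_distrib)
qed

text \<open>Since \<open>\<Pi>k'\<close> annihilates \<open>\<Pi>k\<close>, the perturbation of the input matrix is invisible in the left equations,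
  and the left factor can be applied after the right one.\<close>

sublocale lf: input_factor "A\<^sup>T" "C\<^sup>T" "Bh\<^sup>T" "D\<^sup>T" n p q k' \<Pi>k' left.Hb left.Lb left.G
proof unfold_locales
  show "A\<^sup>T * \<Pi>k' + C\<^sup>T * left.Hb = \<Pi>k' * left.Lb" by (rule left.controlled_invariance)
  show "Bh\<^sup>T * \<Pi>k' + D\<^sup>T * left.Hb = 0\<^sub>m q k'" by (rule pert_out)
  have C: "Cstar (A\<^sup>T) (C\<^sup>T) (Bh\<^sup>T) (D\<^sup>T) = Cstar (A\<^sup>T) (C\<^sup>T) (B\<^sup>T) (D\<^sup>T)"
    unfolding Cstar_transpose pert.pert.Cstar_transpose pert.Vtraj_pert ..
  have V: "Vtraj (A\<^sup>T) (C\<^sup>T) (Bh\<^sup>T) (D\<^sup>T) = annihilator n (Cstar A Bh C D)"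
    by (rule pert.pert.Vtraj_transpose)
  have Pi: "\<Pi>k *\<^sub>v w \<in> Vtraj A B C D" if "w \<in> carrier_vec k" for w
    using pert.range_Vtraj that mem_mat_range[OF carriers(1)] by blast
  show "mat_range \<Pi>k' \<subseteq> Cstar (A\<^sup>T) (C\<^sup>T) (Bh\<^sup>T) (D\<^sup>T)"
    unfolding C by (rule left.range_\<Pi>k_Cstar)
  show "Cstar (A\<^sup>T) (C\<^sup>T) (Bh\<^sup>T) (D\<^sup>T) \<inter> Vtraj (A\<^sup>T) (C\<^sup>T) (Bh\<^sup>T) (D\<^sup>T) \<subseteq> mat_range \<Pi>k'"
  proof
    fix y assume y: "y \<in> Cstar (A\<^sup>T) (C\<^sup>T) (Bh\<^sup>T) (D\<^sup>T) \<inter> Vtraj (A\<^sup>T) (C\<^sup>T) (Bh\<^sup>T) (D\<^sup>T)"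
    then have yc: "y \<in> carrier_vec n" and yV: "\<And>x. x \<in> Vtraj A B C D \<Longrightarrow> y \<bullet> x = 0"
      and yC: "\<And>x. x \<in> Cstar A Bh C D \<Longrightarrow> y \<bullet> x = 0"
      unfolding C V Cstar_transpose by (auto simp: annihilator_def)
    have "y \<bullet> x = 0" if x: "x \<in> Cstar A B C D" for x
    proof -
      obtain z w where z: "z \<in> Cstar A Bh C D" "w \<in> carrier_vec k" "x = z + \<Pi>k *\<^sub>v w"
        using x unfolding factor.Cstar_eq by blast
      have "z \<in> carrier_vec n" using z(1) pert.pert.Cstar_subset by blast
      then have "y \<bullet> x = y \<bullet> z + y \<bullet> (\<Pi>k *\<^sub>v w)"
        unfolding z(3) using yc by (intro scalar_prod_add_distrib[of _ n]) auto
      then show ?thesis using yC[OF z(1)] yV[OF Pi[OF z(2)]] by simp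
    qed
    then have "y \<in> Cstar (A\<^sup>T) (C\<^sup>T) (B\<^sup>T) (D\<^sup>T) \<inter> Vtraj (A\<^sup>T) (C\<^sup>T) (B\<^sup>T) (D\<^sup>T)"
      unfolding Cstar_transpose Vtraj_transpose using yc yV by (auto simp: annihilator_def)
    then show "y \<in> mat_range \<Pi>k'" using left.factor.Cstar_Vtraj_eq by simp
  qed
  fix u assume u: "u \<in> carrier_vec p" "D\<^sup>T *\<^sub>v u = 0\<^sub>v q" and Cu: "C\<^sup>T *\<^sub>v u \<in> Vtraj (A\<^sup>T) (C\<^sup>T) (Bh\<^sup>T) (D\<^sup>T)"
  have "C\<^sup>T *\<^sub>v u \<in> Vtraj (A\<^sup>T) (C\<^sup>T) (B\<^sup>T) (D\<^sup>T)"
  proof -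
    have "(C\<^sup>T *\<^sub>v u) \<bullet> x = 0" if x: "x \<in> Cstar A B C D" for x
    proof -
      obtain z w where z: "z \<in> Cstar A Bh C D" "w \<in> carrier_vec k" "x = z + \<Pi>k *\<^sub>v w"
        using x unfolding factor.Cstar_eq by blast
      have zc: "z \<in> carrier_vec n" using z(1) pert.pert.Cstar_subset by blast
      have "(C\<^sup>T *\<^sub>v u) \<bullet> x = (C\<^sup>T *\<^sub>v u) \<bullet> z + (C\<^sup>T *\<^sub>v u) \<bullet> (\<Pi>k *\<^sub>v w)"
        unfolding z(3) using u zc by (intro scalar_prod_add_distrib[of _ n]) auto
      also have "(C\<^sup>T *\<^sub>v u) \<bullet> z = 0" using Cu z(1) unfolding V by (auto simp: annihilator_def)
      also have "(C\<^sup>T *\<^sub>v u) \<bullet> (\<Pi>k *\<^sub>v w) = u \<bullet> (C *\<^sub>v (\<Pi>k *\<^sub>v w))"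
        using u z by (intro transpose_scalar_prod) auto
      also have "\<dots> = - (u \<bullet> (D *\<^sub>v (Hb *\<^sub>v w)))"
      proof -
        have "u \<bullet> (C *\<^sub>v (\<Pi>k *\<^sub>v w)) + u \<bullet> (D *\<^sub>v (Hb *\<^sub>v w)) = u \<bullet> (C *\<^sub>v (\<Pi>k *\<^sub>v w) + D *\<^sub>v (Hb *\<^sub>v w))"
          using u by (intro scalar_prod_add_distrib[symmetric, of _ p]) auto
        also have "\<dots> = 0" using u by (simp add: pert.outD[OF z(2)])
        finally show ?thesis by (simp add: eq_neg_iff_add_eq_0)
      qed
      also have "u \<bullet> (D *\<^sub>v (Hb *\<^sub>v w)) = (D\<^sup>T *\<^sub>v u) \<bullet> (Hb *\<^sub>v w)"
        using u by (intro transpose_scalar_prod[symmetric]) auto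
      also have "\<dots> = 0" unfolding u(2) by simp
      finally show ?thesis by simp
    qed
    then show ?thesis unfolding Vtraj_transpose by (auto simp: annihilator_def)
  qed
  then show "(C\<^sup>T + \<Pi>k' * left.G) *\<^sub>v u = 0\<^sub>v n"
    by (rule left.factor.blocked[OF u])
qed auto

sublocale rl: system A Bh Ch D n q p
  by unfold_locales auto

lemmas rl_transpose = rl.Cstar_transpose[unfolded transpose_transpose]
  rl.Vtraj_transpose[unfolded transpose_transpose]

text \<open>By duality this is the invariance of \<open>Vtraj\<close> under an input perturbation of the transposed system.\<close>

lemma Cstar_rl: "Cstar A Bh Ch D = Cstar A Bh C D"
proof -
  have "annihilator n (Cstar A Bh Ch D) = annihilator n (Cstar A Bh C D)"
    using rl.Vtraj_transpose lf.Vtraj_pert pert.pert.Vtraj_transpose by simp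
  then show ?thesis
    using annihilator_annihilator[OF rl.vec_subspace_Cstar] annihilator_annihilator[OF pert.pert.vec_subspace_Cstar]
    by metis
qed

text \<open>The dual of \<open>Cstar_eq\<close>, which says that \<open>Cstar\<close> of the transposed system grows by the range of \<open>\<Pi>k'\<close>
  when the perturbation is removed.\<close>

lemma Vtraj_iff: "x \<in> Vtraj A B C D \<longleftrightarrow> x \<in> Vtraj A Bh Ch D \<and> \<Pi>k'\<^sup>T *\<^sub>v x = 0\<^sub>v k'"
proof -
  have ann: "annihilator n (Vtraj A B C D) =
      {y + \<Pi>k' *\<^sub>v w | y w. y \<in> annihilator n (Vtraj A Bh Ch D) \<and> w \<in> carrier_vec k'}"
    using lf.Cstar_eq unfolding pert.pert.Cstar_transpose pert.Vtraj_pert rl_transpose .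
  have A1: "x \<in> Vtraj A B C D \<longleftrightarrow> x \<in> annihilator n (annihilator n (Vtraj A B C D))"
    by (simp add: annihilator_annihilator[OF vec_subspace_Vtraj])
  have A2: "x \<in> Vtraj A Bh Ch D \<longleftrightarrow> x \<in> annihilator n (annihilator n (Vtraj A Bh Ch D))"
    by (simp add: annihilator_annihilator[OF rl.vec_subspace_Vtraj])
  have ann_sub: "annihilator n (Vtraj A Bh Ch D) \<subseteq> annihilator n (Vtraj A B C D)"
  proof
    fix y assume y: "y \<in> annihilator n (Vtraj A Bh Ch D)"
    then have "y = y + \<Pi>k' *\<^sub>v 0\<^sub>v k'" by (auto simp: annihilator_def vec_distrib)
    then show "y \<in> annihilator n (Vtraj A B C D)" unfolding ann using y zero_carrier_vec by blast
  qed
  show ?thesis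
  proof
    assume x: "x \<in> Vtraj A B C D"
    then have "x \<in> Vtraj A Bh Ch D"
      unfolding A1 A2 using ann_sub by (auto simp: annihilator_def)
    then show "x \<in> Vtraj A Bh Ch D \<and> \<Pi>k'\<^sup>T *\<^sub>v x = 0\<^sub>v k'" using \<Pi>k'_Vtraj[OF x] by simp
  next
    assume x: "x \<in> Vtraj A Bh Ch D \<and> \<Pi>k'\<^sup>T *\<^sub>v x = 0\<^sub>v k'"
    then have xc: "x \<in> carrier_vec n" using rl.Vtraj_carrier by blast
    have "x \<bullet> z = 0" if z: "z \<in> annihilator n (Vtraj A B C D)" for z
    proof -
      obtain y w where y: "y \<in> annihilator n (Vtraj A Bh Ch D)" "w \<in> carrier_vec k'" "z = y + \<Pi>k' *\<^sub>v w"
        using z unfolding ann by blast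
      have yc: "y \<in> carrier_vec n" using y by (simp add: annihilator_def)
      have "z \<bullet> x = y \<bullet> x + (\<Pi>k' *\<^sub>v w) \<bullet> x"
        unfolding y(3) using xc yc by (intro add_scalar_prod_distrib[of _ n]) auto
      moreover have "y \<bullet> x = 0" using y x by (auto simp: annihilator_def)
      moreover have "\<Pi>k' *\<^sub>v w \<in> mat_range \<Pi>k'" using y by (auto simp: mat_range_def)
      then have "(\<Pi>k' *\<^sub>v w) \<bullet> x = 0" using annihilated_iff[OF xc] x by blast
      ultimately have "z \<bullet> x = 0" by simp
      moreover have "z \<in> carrier_vec n" using z by (simp add: annihilator_def)
      ultimately show ?thesis using xc comm_scalar_prod by metis
    qed
    then show "x \<in> Vtraj A B C D" unfolding A1 using xc by (auto simp: annihilator_def)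
  qed
qed

text \<open>An element of the intersection is in \<open>Cstar\<close> of the given system, hence annihilated by \<open>\<Pi>k'\<close>; so it lies
  in the smaller \<open>Vtraj\<close>, which meets the perturbed \<open>Cstar\<close> only in zero.\<close>

lemma Cstar_Vtraj_rl: "Cstar A Bh Ch D \<inter> Vtraj A Bh Ch D = {0\<^sub>v n}"
proof -
  have "x = 0\<^sub>v n" if x: "x \<in> Cstar A Bh Ch D" "x \<in> Vtraj A Bh Ch D" for x
  proof -
    have xC: "x \<in> Cstar A Bh C D" using x(1) by (simp add: Cstar_rl)
    have "x \<in> Cstar A B C D"
    proof -
      have "x = x + \<Pi>k *\<^sub>v 0\<^sub>v k" using xC pert.pert.Cstar_subset by (auto simp: vec_distrib)
      then show ?thesis unfolding factor.Cstar_eq using xC zero_carrier_vec by blast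
    qed
    then have "\<Pi>k'\<^sup>T *\<^sub>v x = 0\<^sub>v k'" by (rule \<Pi>k'_Cstar)
    then have "x \<in> Vtraj A Bh C D" using Vtraj_iff x(2) by (simp add: pert.Vtraj_pert)
    then show ?thesis using xC factor.Cstar_Vtraj_pert by blast
  qed
  then show ?thesis using rl.zero_Cstar vec_subspaceD(2)[OF rl.vec_subspace_Vtraj] by blast
qed

text \<open>The annihilator of the sum is the intersection of the corresponding subspaces of the transposed system,
  which is zero by \<open>Cstar_Vtraj_pert\<close> for the left factor.\<close>

lemma Cstar_join_Vtraj_rl:
  assumes x: "x \<in> carrier_vec n"
  shows "\<exists>c\<in>Cstar A Bh Ch D. \<exists>v\<in>Vtraj A Bh Ch D. x = c + v"
proof -
  note C = vec_subspaceD[OF rl.vec_subspace_Cstar] and V = vec_subspaceD[OF rl.vec_subspace_Vtraj]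
  define J where "J = {c + v | c v. c \<in> Cstar A Bh Ch D \<and> v \<in> Vtraj A Bh Ch D}"
  have J: "vec_subspace n J"
  proof
    show "J \<subseteq> carrier_vec n" using C(1) V(1) by (auto simp: J_def intro!: add_carrier_vec)
    have "0\<^sub>v n = 0\<^sub>v n + (0\<^sub>v n :: complex vec)" by simp
    then show "0\<^sub>v n \<in> J" unfolding J_def using C(2) V(2) by blast
  next
    fix x y assume "x \<in> J" "y \<in> J"
    then obtain c v c' v' where cv: "x = c + v" "c \<in> Cstar A Bh Ch D" "v \<in> Vtraj A Bh Ch D"
      "y = c' + v'" "c' \<in> Cstar A Bh Ch D" "v' \<in> Vtraj A Bh Ch D" by (auto simp: J_def)
    note cc = C(5)[OF cv(2)] C(5)[OF cv(5)] V(5)[OF cv(3)] V(5)[OF cv(6)]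
    have "x + y = (c + c') + (v + v')" unfolding cv(1,4) by (rule eq_vecI) (use cc in auto)
    then show "x + y \<in> J" unfolding J_def using C(3) V(3) cv by blast
  next
    fix a x assume "x \<in> J"
    then obtain c v where cv: "x = c + v" "c \<in> Cstar A Bh Ch D" "v \<in> Vtraj A Bh Ch D" by (auto simp: J_def)
    have "a \<cdot>\<^sub>v x = a \<cdot>\<^sub>v c + a \<cdot>\<^sub>v v"
      unfolding cv(1) by (rule smult_add_distrib_vec[OF C(5)[OF cv(2)] V(5)[OF cv(3)]])
    then show "a \<cdot>\<^sub>v x \<in> J" unfolding J_def using C(4) V(4) cv by blast
  qed
  have sub: "Cstar A Bh Ch D \<subseteq> J" "Vtraj A Bh Ch D \<subseteq> J"
  proof -
    show "Cstar A Bh Ch D \<subseteq> J"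
    proof
      fix c assume c: "c \<in> Cstar A Bh Ch D"
      then have "c = c + 0\<^sub>v n" using C(5) by simp
      then show "c \<in> J" unfolding J_def using c V(2) by blast
    qed
    show "Vtraj A Bh Ch D \<subseteq> J"
    proof
      fix v assume v: "v \<in> Vtraj A Bh Ch D"
      then have "v = 0\<^sub>v n + v" using V(5) by simp
      then show "v \<in> J" unfolding J_def using v C(2) by blast
    qed
  qed
  have "annihilator n J \<subseteq> annihilator n (Cstar A Bh Ch D) \<inter> annihilator n (Vtraj A Bh Ch D)"
    using sub by (auto simp: annihilator_def)
  also have "\<dots> = {0\<^sub>v n}"
    using lf.Cstar_Vtraj_pert unfolding rl_transpose by blast
  finally have "annihilator n J \<subseteq> {0\<^sub>v n}" .
  then have "carrier_vec n \<subseteq> annihilator n (annihilator n J)"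
    by (auto simp: annihilator_def)
  then have "carrier_vec n \<subseteq> J" unfolding annihilator_annihilator[OF J] .
  then have "x \<in> J" using x by blast
  then show ?thesis unfolding J_def by blast
qed


text \<open>Compressing by \<open>L0\<close> and \<open>L0'\<close> does not change the steps, because these matrices act as identities on what
  matters: \<open>Bh\<close> and \<open>D\<close> vanish on \<open>R0\<close>, and dually for the outputs.\<close>

abbreviation Brl :: "complex mat" where "Brl \<equiv> Bh * L0"
abbreviation Crl :: "complex mat" where "Crl \<equiv> L0'\<^sup>T * Ch"
abbreviation Drl :: "complex mat" where "Drl \<equiv> L0'\<^sup>T * D * L0"

sublocale comp: system A Brl Crl Drl n l l'
  by unfold_locales auto

lemma proj_input: "Bh * L0 * L0\<^sup>\<dagger> = Bh" "D * L0 * L0\<^sup>\<dagger> = D"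
  using project_input[OF pert.Bp Bp_R0] project_input[OF D DR0] by auto

lemma proj_output: "(L0'\<^sup>\<dagger>)\<^sup>T * (L0'\<^sup>T * Ch) = Ch" "(L0'\<^sup>\<dagger>)\<^sup>T * (L0'\<^sup>T * D) = D"
proof -
  have "(left.pert.Bp * L0' * L0'\<^sup>\<dagger>)\<^sup>T = Ch" "(D\<^sup>T * L0' * L0'\<^sup>\<dagger>)\<^sup>T = D\<^sup>T\<^sup>T"
    using left.project_input[OF left.pert.Bp left.Bp_R0] left.project_input[OF left.D left.DR0] by auto
  then show "(L0'\<^sup>\<dagger>)\<^sup>T * (L0'\<^sup>T * Ch) = Ch" "(L0'\<^sup>\<dagger>)\<^sup>T * (L0'\<^sup>T * D) = D"
    by (auto simp: mat_transpose_mult)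
qed

lemma comp_step: "null_step A Brl Crl Drl x y \<longleftrightarrow> null_step A Bh Ch D x y" if x: "x \<in> carrier_vec n"
proof -
  have "null_step A Brl Crl Drl x y \<longleftrightarrow> null_step A Bh Crl (L0'\<^sup>T * D) x y"
  proof (rule null_step_compress_input[of _ n q _ l'])
    show "L0'\<^sup>T * D * L0 * L0\<^sup>\<dagger> = L0'\<^sup>T * D"
      using proj_input(2) by (simp add: mat_mult_assoc)
  qed (use proj_input in auto)
  also have "\<dots> \<longleftrightarrow> null_step A Bh Ch D x y"
    by (rule null_step_compress_output[OF pert.Bp Ch D _ _ proj_output x, of l']) auto
  finally show ?thesis .
qed

lemma comp_spaces: "Cstar A Brl Crl Drl = Cstar A Bh Ch D" "Vtraj A Brl Crl Drl = Vtraj A Bh Ch D"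
  using Cstar_Vtraj_cong[OF comp.system_axioms rl.system_axioms comp_step] by auto

lemma right_spaces: "Cstar A Brl C (D * L0) = Cstar A Bh C D"
proof (rule Cstar_Vtraj_cong(1))
  show "system A Brl C (D * L0) n l p" by unfold_locales auto
  show "system A Bh C D n q p" by unfold_locales auto
  show "null_step A Brl C (D * L0) x y \<longleftrightarrow> null_step A Bh C D x y" for x y
    by (rule null_step_compress_input[OF pert.Bp D L0 proj_input])
qed

abbreviation F :: "complex poly fract mat" where "F \<equiv> transfer_function A B C D"

lemma F_dims [simp]: "dim_row F = p" "dim_col F = q"
  using transfer_function_carrier[OF A B C D] by auto

lemma FT: "transfer_function (A\<^sup>T) (C\<^sup>T) (B\<^sup>T) (D\<^sup>T) = F\<^sup>T"
  using transfer_function_transpose[OF A B C D] by simp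

text \<open>The right factor is absorbed first, by \<open>transfer_Lbeta\<close>. For the left factor the same cascade
  argument applies to the transposed system with the perturbed input matrix, for which the output
  equation is \<open>pert_out\<close>.\<close>

lemma realization_comp: "left.Lbeta\<^sup>T * F * Lbeta = transfer_function A Brl Crl Drl"
proof -
  have c: "Bh * L0 \<in> carrier_mat n l" "D * L0 \<in> carrier_mat p l" by auto
  have T: "dim_row (transfer_function A Brl C (D * L0)) = p"
    using transfer_function_carrier[OF A c(1) C c(2)] by auto
  have out: "(Bh * L0)\<^sup>T * \<Pi>k' + (D * L0)\<^sup>T * left.Hb = 0\<^sub>m l k'"
  proof -
    have "(Bh * L0)\<^sup>T * \<Pi>k' + (D * L0)\<^sup>T * left.Hb = L0\<^sup>T * (Bh\<^sup>T * \<Pi>k' + D\<^sup>T * left.Hb)"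
      by (simp add: mat_transpose_mult mat_distrib)
    then show ?thesis unfolding pert_out by (simp add: mat_distrib)
  qed
  have cT: "(Bh * L0)\<^sup>T \<in> carrier_mat l n" "(D * L0)\<^sup>T \<in> carrier_mat l p" by auto
  have "(transfer_function A Brl C (D * L0))\<^sup>T * left.U =
      transfer_function (A\<^sup>T) (C\<^sup>T) ((Bh * L0)\<^sup>T) ((D * L0)\<^sup>T) * left.U"
    using transfer_function_transpose[OF A c(1) C c(2)] by simp
  also have "\<dots> = transfer_function (A\<^sup>T) left.pert.Bp ((Bh * L0)\<^sup>T) ((D * L0)\<^sup>T)"
    unfolding left.U_def left.pert.Bp_def
    by (rule transfer_function_mult_cascade[OF left.A left.B cT left.carriers(1) left.Hb(1) left.Lb(1) left.G(1)
          left.controlled_invariance(1) out])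
  finally have 1: "(transfer_function A Brl C (D * L0))\<^sup>T * left.U =
      transfer_function (A\<^sup>T) left.pert.Bp ((Bh * L0)\<^sup>T) ((D * L0)\<^sup>T)" .
  have "(transfer_function A Brl C (D * L0))\<^sup>T * left.Lbeta =
      (transfer_function A Brl C (D * L0))\<^sup>T * left.U * const_mat L0'"
    unfolding left.Lbeta_def using T by (intro mat_mult_assoc[symmetric]) auto
  also have "\<dots> = transfer_function (A\<^sup>T) (left.pert.Bp * L0') ((Bh * L0)\<^sup>T) ((D * L0)\<^sup>T * L0')"
    unfolding 1 by (rule transfer_function_mult_const[OF left.A left.pert.Bp cT left.L0])
  finally have 2: "(transfer_function A Brl C (D * L0))\<^sup>T * left.Lbeta =
      transfer_function (A\<^sup>T) (left.pert.Bp * L0') ((Bh * L0)\<^sup>T) ((D * L0)\<^sup>T * L0')" .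
  have "left.Lbeta\<^sup>T * F * Lbeta = left.Lbeta\<^sup>T * (F * Lbeta)" by (rule mat_mult_assoc) auto
  also have "\<dots> = ((transfer_function A Brl C (D * L0))\<^sup>T * left.Lbeta)\<^sup>T"
    unfolding transfer_Lbeta using T by (simp add: mat_transpose_mult)
  also have "\<dots> = transfer_function A Brl ((left.pert.Bp * L0')\<^sup>T) (((D * L0)\<^sup>T * L0')\<^sup>T)"
    unfolding 2 by (subst transfer_function_transpose[of _ n _ l' _ l]) auto
  also have "(left.pert.Bp * L0')\<^sup>T = Crl" by (simp add: mat_transpose_mult)
  also have "((D * L0)\<^sup>T * L0')\<^sup>T = Drl" by (simp add: mat_transpose_mult mat_mult_assoc)
  finally show ?thesis .
qed

lemma recover: "F = para_adjoint (left.Lbeta\<^sup>T) * (left.Lbeta\<^sup>T * F * Lbeta) * para_adjoint Lbeta"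
proof -
  have "(F\<^sup>T * left.Lbeta * para_adjoint left.Lbeta)\<^sup>T = F\<^sup>T\<^sup>T"
    using left.transfer_Lbeta_para unfolding FT by simp
  then have l: "para_adjoint (left.Lbeta\<^sup>T) * (left.Lbeta\<^sup>T * F) = F"
    by (simp add: mat_transpose_mult para_adjoint_transpose)
  have "para_adjoint (left.Lbeta\<^sup>T) * (left.Lbeta\<^sup>T * F * Lbeta) * para_adjoint Lbeta =
      (para_adjoint (left.Lbeta\<^sup>T) * (left.Lbeta\<^sup>T * F)) * Lbeta * para_adjoint Lbeta"
    by (simp add: mat_mult_assoc)
  then show ?thesis unfolding l using transfer_Lbeta_para by simp
qed

lemma Drl_zero: "D *\<^sub>v (L0 *\<^sub>v u) = 0\<^sub>v p" if "u \<in> carrier_vec l" "Drl *\<^sub>v u = 0\<^sub>v l'"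
proof -
  have d: "dim_vec u = l" using that by auto
  have "(L0'\<^sup>\<dagger>)\<^sup>T *\<^sub>v (Drl *\<^sub>v u) = ((L0'\<^sup>\<dagger>)\<^sup>T * (L0'\<^sup>T * D)) *\<^sub>v (L0 *\<^sub>v u)"
    using d by (subst mat_mult_vec) (auto simp: vec_distrib)
  then show ?thesis unfolding proj_output that(2) by (simp add: vec_distrib)
qed

lemma DrlT_zero: "D\<^sup>T *\<^sub>v (L0' *\<^sub>v u) = 0\<^sub>v q" if "u \<in> carrier_vec l'" "Drl\<^sup>T *\<^sub>v u = 0\<^sub>v l"
proof -
  have d: "dim_vec u = l'" using that by auto
  have "(D * L0 * L0\<^sup>\<dagger>)\<^sup>T = D\<^sup>T" by (simp only: proj_input)
  then have DT: "(L0\<^sup>\<dagger>)\<^sup>T * (L0\<^sup>T * D\<^sup>T) = D\<^sup>T" by (simp add: mat_transpose_mult)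
  have "(L0\<^sup>\<dagger>)\<^sup>T *\<^sub>v (Drl\<^sup>T *\<^sub>v u) = ((L0\<^sup>\<dagger>)\<^sup>T * (L0\<^sup>T * D\<^sup>T)) *\<^sub>v (L0' *\<^sub>v u)"
    using d by (subst mat_mult_vec) (auto simp: mat_transpose_mult vec_distrib)
  then show ?thesis unfolding DT that(2) by (simp add: vec_distrib)
qed

lemma comp_kernels:
  "v \<in> carrier_vec l \<Longrightarrow> transfer_function A Brl Crl Drl *\<^sub>v v = 0\<^sub>v l' \<Longrightarrow> v = 0\<^sub>v l"
  "v \<in> carrier_vec l' \<Longrightarrow> (transfer_function A Brl Crl Drl)\<^sup>T *\<^sub>v v = 0\<^sub>v l \<Longrightarrow> v = 0\<^sub>v l'"
proof -
  show "v \<in> carrier_vec l \<Longrightarrow> transfer_function A Brl Crl Drl *\<^sub>v v = 0\<^sub>v l' \<Longrightarrow> v = 0\<^sub>v l"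
  proof (rule comp.transfer_kernel_trivial)
    show "Cstar A Brl Crl Drl \<inter> Vtraj A Brl Crl Drl = {0\<^sub>v n}"
      unfolding comp_spaces by (rule Cstar_Vtraj_rl)
    fix u assume u: "u \<in> carrier_vec l" "Brl *\<^sub>v u = 0\<^sub>v n" "Drl *\<^sub>v u = 0\<^sub>v l'"
    have "Bh *\<^sub>v (L0 *\<^sub>v u) = 0\<^sub>v n" using u(1,2) by (simp add: mat_mult_vec)
    from perturbed_input_injective[OF u(1) this Drl_zero[OF u(1,3)]] show "u = 0\<^sub>v l" .
  qed
  interpret cT: system "A\<^sup>T" "Crl\<^sup>T" "Brl\<^sup>T" "Drl\<^sup>T" n l' l by (rule comp.system_transpose)
  have tr: "(transfer_function A Brl Crl Drl)\<^sup>T = transfer_function (A\<^sup>T) (Crl\<^sup>T) (Brl\<^sup>T) (Drl\<^sup>T)"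
    by (rule transfer_function_transpose[OF comp.A comp.B comp.C comp.D])
  show "v \<in> carrier_vec l' \<Longrightarrow> (transfer_function A Brl Crl Drl)\<^sup>T *\<^sub>v v = 0\<^sub>v l \<Longrightarrow> v = 0\<^sub>v l'"
    unfolding tr
  proof (rule cT.transfer_kernel_trivial)
    show "Cstar (A\<^sup>T) (Crl\<^sup>T) (Brl\<^sup>T) (Drl\<^sup>T) \<inter> Vtraj (A\<^sup>T) (Crl\<^sup>T) (Brl\<^sup>T) (Drl\<^sup>T) = {0\<^sub>v n}"
      unfolding comp.Cstar_transpose comp.Vtraj_transpose comp_spaces
      using lf.Cstar_Vtraj_pert unfolding rl_transpose .
    fix u assume u: "u \<in> carrier_vec l'" "Crl\<^sup>T *\<^sub>v u = 0\<^sub>v n" "Drl\<^sup>T *\<^sub>v u = 0\<^sub>v l"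
    have "left.pert.Bp *\<^sub>v (L0' *\<^sub>v u) = 0\<^sub>v n" using u(1,2) by (simp add: mat_transpose_mult mat_mult_vec)
    from left.perturbed_input_injective[OF u(1) this DrlT_zero[OF u(1,3)]] show "u = 0\<^sub>v l'" .
  qed
qed

lemma comp_invertible:
  "invertible_mat (transfer_function A Brl Crl Drl)"
  "mat_range (transfer_function A Brl Crl Drl) = carrier_vec l'"
  "mat_kernel (transfer_function A Brl Crl Drl) = {0\<^sub>v l}"
proof -
  have G: "transfer_function A Brl Crl Drl \<in> carrier_mat l' l"
    by (rule transfer_function_carrier[OF comp.A comp.B comp.C comp.D])
  show "invertible_mat (transfer_function A Brl Crl Drl)"
    by (rule invertible_of_injective(1)[OF G comp_kernels])
  show "mat_range (transfer_function A Brl Crl Drl) = carrier_vec l'"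
    by (rule invertible_of_injective(2)[OF G comp_kernels])
  show "mat_kernel (transfer_function A Brl Crl Drl) = {0\<^sub>v l}"
    by (rule invertible_of_injective(3)[OF G comp_kernels])
qed

lemma minimal_comp_of_stable:
  assumes "\<And>\<mu>. eigenvalue A \<mu> \<Longrightarrow> Re \<mu> \<le> 0"
  shows "controllable A Brl" "observable Crl A"
proof -
  show "controllable A Brl" by (rule controllable_perturbed_of_stable) (rule assms)
  have "controllable (A\<^sup>T) (left.pert.Bp * L0')"
    by (rule left.controllable_perturbed_of_stable) (use assms eigenvalue_transpose[OF A] in blast)
  then have "controllable (A\<^sup>T) (Crl\<^sup>T)" by (simp add: mat_transpose_mult)
  then show "observable Crl A" using controllable_transpose[OF A comp.C] by simp
qed

lemma minimal_comp_of_stabilizable: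
  assumes no_common: "\<And>\<mu>. eigenvalue A \<mu> \<Longrightarrow> \<not> eigenvalue (- A\<^sup>\<dagger>) \<mu>"
    and P: "P \<in> carrier_mat n n" "A * P + P * A\<^sup>\<dagger> + B * B\<^sup>\<dagger> = 0\<^sub>m n n"
    and Q: "Q \<in> carrier_mat n n" "Q * A + A\<^sup>\<dagger> * Q + C\<^sup>\<dagger> * C = 0\<^sub>m n n"
    and stab: "stabilizable A ((C * P + D * B\<^sup>\<dagger>)\<^sup>\<dagger>)" and det: "detectable ((Q * B + C\<^sup>\<dagger> * D)\<^sup>\<dagger>) A"
  shows "controllable A Brl" "observable Crl A"
proof -
  show "controllable A Brl" by (rule controllable_perturbed_of_stabilizable[OF no_common P stab])
  note Qd = carrier_matD[OF Q(1)]
  have "controllable (A\<^sup>T) (left.pert.Bp * L0')"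
  proof (rule left.controllable_perturbed_of_stabilizable)
    fix \<mu> assume "eigenvalue (A\<^sup>T) \<mu>"
    then have "\<not> eigenvalue (- A\<^sup>\<dagger>) \<mu>" using no_common eigenvalue_transpose[OF A] by blast
    moreover have "- (A\<^sup>T)\<^sup>\<dagger> = (- A\<^sup>\<dagger>)\<^sup>T" by (simp add: adjoint_transpose mat_transpose_uminus)
    ultimately show "\<not> eigenvalue (- (A\<^sup>T)\<^sup>\<dagger>) \<mu>" using eigenvalue_transpose[of "- A\<^sup>\<dagger>" n \<mu>] by simp
  next
    show "Q\<^sup>T \<in> carrier_mat n n" using Q by simp
    have "A\<^sup>T * Q\<^sup>T + Q\<^sup>T * (A\<^sup>T)\<^sup>\<dagger> + C\<^sup>T * (C\<^sup>T)\<^sup>\<dagger> = (Q * A + A\<^sup>\<dagger> * Q + C\<^sup>\<dagger> * C)\<^sup>T"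
      using Qd by (simp add: mat_transpose adjoint_transpose)
    then show "A\<^sup>T * Q\<^sup>T + Q\<^sup>T * (A\<^sup>T)\<^sup>\<dagger> + C\<^sup>T * (C\<^sup>T)\<^sup>\<dagger> = 0\<^sub>m n n" by (simp add: Q mat_transpose_zero)
    define E where "E = (Q * B + C\<^sup>\<dagger> * D)\<^sup>\<dagger>"
    have E: "dim_row E = q" "dim_col E = n" using Qd by (auto simp: E_def)
    have ET: "(B\<^sup>T * Q\<^sup>T + D\<^sup>T * (C\<^sup>T)\<^sup>\<dagger>)\<^sup>\<dagger> = E\<^sup>T"
    proof -
      have "B\<^sup>T * Q\<^sup>T + D\<^sup>T * (C\<^sup>T)\<^sup>\<dagger> = (Q * B + C\<^sup>\<dagger> * D)\<^sup>T"
        using Qd by (simp add: mat_transpose adjoint_transpose)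
      then show ?thesis by (simp add: E_def adjoint_transpose)
    qed
    obtain K where K: "K \<in> carrier_mat n q" and hur: "hurwitz (A + K * E)"
      using det E unfolding detectable_def E_def[symmetric] by auto
    have M: "A + K * E \<in> carrier_mat n n" using K E by (intro carrier_matI) auto
    have "A\<^sup>T + E\<^sup>T * K\<^sup>T = (A + K * E)\<^sup>T" using K E by (simp add: mat_transpose)
    then have "hurwitz (A\<^sup>T + E\<^sup>T * K\<^sup>T)"
      using hur eigenvalue_transpose[OF M] by (simp add: hurwitz_def)
    then show "stabilizable (A\<^sup>T) ((B\<^sup>T * Q\<^sup>T + D\<^sup>T * (C\<^sup>T)\<^sup>\<dagger>)\<^sup>\<dagger>)"
      unfolding ET stabilizable_def using K E by (intro bexI[of _ "K\<^sup>T"]) auto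
  qed
  then have "controllable (A\<^sup>T) (Crl\<^sup>T)" by (simp add: mat_transpose_mult)
  then show "observable Crl A" using controllable_transpose[OF A comp.C] by simp
qed


section \<open>The finite zero matrix\<close>

text \<open>Split a preimage along \<open>Cstar\<close> and \<open>Vtraj\<close>; the first part is annihilated by \<open>\<Pi>k'\<^sup>T\<close>.\<close>

lemma \<Pi>k'_onto:
  assumes e: "e \<in> carrier_vec k'"
  shows "\<exists>v\<in>Vtraj A Bh Ch D. \<Pi>k'\<^sup>T *\<^sub>v v = e"
proof -
  have inj: "v = 0\<^sub>v k'" if "v \<in> carrier_vec k'" "\<Pi>k' *\<^sub>v v = 0\<^sub>v n" for v
    by (rule left.\<Pi>z_injective(1)[of v "0\<^sub>v f'"]) (use that in \<open>auto simp: vec_distrib\<close>)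
  obtain N where N: "N \<in> carrier_mat k' n" "N * \<Pi>k' = 1\<^sub>m k'"
    by (rule injective_left_inverse[OF left.carriers(1) inj])
  have "(N * \<Pi>k')\<^sup>T = 1\<^sub>m k'" by (simp add: N mat_transpose_one)
  then have NT: "\<Pi>k'\<^sup>T * N\<^sup>T = 1\<^sub>m k'" using N(1) by (simp add: mat_transpose_mult)
  define x where "x = N\<^sup>T *\<^sub>v e"
  have x: "x \<in> carrier_vec n" using N by (simp add: x_def)
  have "(\<Pi>k'\<^sup>T * N\<^sup>T) *\<^sub>v e = \<Pi>k'\<^sup>T *\<^sub>v x" unfolding x_def using N(1) e by (intro mat_mult_vec) auto
  then have Px: "\<Pi>k'\<^sup>T *\<^sub>v x = e" unfolding NT using e by simp
  obtain c v where cv: "c \<in> Cstar A Bh Ch D" "v \<in> Vtraj A Bh Ch D" "x = c + v"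
    using Cstar_join_Vtraj_rl[OF x] by blast
  have cC: "c \<in> carrier_vec n" and vC: "v \<in> carrier_vec n"
    using cv rl.Cstar_subset rl.Vtraj_carrier by auto
  have "c = c + \<Pi>k *\<^sub>v 0\<^sub>v k" using cC by (simp add: vec_distrib)
  then have "c \<in> Cstar A B C D"
    unfolding factor.Cstar_eq using cv(1) zero_carrier_vec unfolding Cstar_rl by blast
  then have "\<Pi>k'\<^sup>T *\<^sub>v c = 0\<^sub>v k'" by (rule \<Pi>k'_Cstar)
  moreover have "\<Pi>k'\<^sup>T *\<^sub>v x = \<Pi>k'\<^sup>T *\<^sub>v c + \<Pi>k'\<^sup>T *\<^sub>v v" using cv(3) cC vC by (simp add: vec_distrib)
  ultimately have "\<Pi>k'\<^sup>T *\<^sub>v v = e" using Px by simp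
  with cv show ?thesis by blast
qed

lemma \<sigma>T_inverse: "left.S\<^sup>T * \<sigma>'\<^sup>T = 1\<^sub>m k'" "\<sigma>'\<^sup>T * left.S\<^sup>T = 1\<^sub>m k'"
proof -
  have "(\<sigma>' * left.S)\<^sup>T = 1\<^sub>m k'" "(left.S * \<sigma>')\<^sup>T = 1\<^sub>m k'"
    by (simp_all only: left.\<sigma>S left.S\<sigma> mat_transpose_one)
  then show "left.S\<^sup>T * \<sigma>'\<^sup>T = 1\<^sub>m k'" "\<sigma>'\<^sup>T * left.S\<^sup>T = 1\<^sub>m k'"
    by (auto simp: mat_transpose_mult)
qed

text \<open>A block that completes \<open>\<Pi>k\<close> and \<open>\<Pi>f\<close> to a basis of the enlarged \<open>Vtraj\<close>. The normalization by
  \<open>\<sigma>'\<^sup>T\<close> makes its diagonal block exactly the negative of \<open>(left.Lb\<^sup>\<dagger>)\<^sup>T\<close> instead of a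
  matrix similar to it.\<close>

lemma complement_exists:
  obtains X where "X \<in> carrier_mat n k'" "mat_range X \<subseteq> Vtraj A Bh Ch D" "\<Pi>k'\<^sup>T * X = \<sigma>'\<^sup>T"
proof -
  obtain s M where M: "M \<in> carrier_mat n s" "mat_range M = Vtraj A Bh Ch D"
    and "\<And>v. v \<in> carrier_vec s \<Longrightarrow> M *\<^sub>v v = 0\<^sub>v n \<Longrightarrow> v = 0\<^sub>v s"
    by (rule vec_subspace_basis[OF rl.vec_subspace_Vtraj]) (rule that)
  define T where "T = \<Pi>k'\<^sup>T * M"
  have T: "T \<in> carrier_mat k' s" using M by (auto simp: T_def)
  have inj: "y = 0\<^sub>v k'" if y: "y \<in> carrier_vec k'" "T\<^sup>T *\<^sub>v y = 0\<^sub>v s" for y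
  proof (rule eq_vecI)
    fix i assume "i < dim_vec (0\<^sub>v k' :: complex vec)"
    then have i: "i < k'" by simp
    obtain v where v: "v \<in> mat_range M" "\<Pi>k'\<^sup>T *\<^sub>v v = unit_vec k' i"
      using \<Pi>k'_onto[of "unit_vec k' i"] unfolding M(2) by auto
    then obtain c where c: "c \<in> carrier_vec s" "v = M *\<^sub>v c" using mem_mat_range[OF M(1)] by blast
    have "T *\<^sub>v c = unit_vec k' i" using v c M by (simp add: T_def mat_mult_vec)
    then have "y \<bullet> unit_vec k' i = (T\<^sup>T *\<^sub>v y) \<bullet> c"
      using transpose_scalar_prod[of c T y] T c(1) y(1) by simp
    moreover have "y \<bullet> unit_vec k' i = y $ i" by (rule scalar_prod_right_unit) (use y(1) i in auto)
    moreover have "(T\<^sup>T *\<^sub>v y) \<bullet> c = 0" unfolding y(2) using c(1) by simp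
    moreover have "0\<^sub>v k' $ i = (0 :: complex)" using i by simp
    ultimately show "y $ i = 0\<^sub>v k' $ i" by (simp only:)
  qed (use y in auto)
  have TT: "T\<^sup>T \<in> carrier_mat s k'" using T by simp
  obtain N where N: "N \<in> carrier_mat k' s" "N * T\<^sup>T = 1\<^sub>m k'"
    by (rule injective_left_inverse[OF TT inj])
  have "(N * T\<^sup>T)\<^sup>T = 1\<^sub>m k'" by (simp add: N mat_transpose_one)
  then have NT: "T * N\<^sup>T = 1\<^sub>m k'" using N(1) T by (simp add: mat_transpose_mult)
  define W where "W = N\<^sup>T * \<sigma>'\<^sup>T"
  have W: "W \<in> carrier_mat s k'" using N by (auto simp: W_def)
  have TW: "T * W = \<sigma>'\<^sup>T"
  proof -
    have "T * W = (T * N\<^sup>T) * \<sigma>'\<^sup>T" unfolding W_def using N(1) T by (simp add: mat_mult_assoc)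
    then show ?thesis unfolding NT by simp
  qed
  show thesis
  proof (rule that)
    show "M * W \<in> carrier_mat n k'" using M W by auto
    show "\<Pi>k'\<^sup>T * (M * W) = \<sigma>'\<^sup>T" using TW M W by (simp add: T_def mat_mult_assoc)
    have "M *\<^sub>v (W *\<^sub>v v) \<in> Vtraj A Bh Ch D" if "v \<in> carrier_vec k'" for v
      unfolding M(2)[symmetric] using W that by (intro mem_mat_range[OF M(1), THEN iffD2] bexI[of _ "W *\<^sub>v v"]) auto
    then show "mat_range (M * W) \<subseteq> Vtraj A Bh Ch D"
      using M W by (auto simp: mat_range_def mat_mult_vec)
  qed
qed

end

context system
begin

text \<open>If no nonzero input leads from zero into \<open>Vtraj\<close> with zero output, the block with index \<open>k\<close> and the matrix \<open>R0\<close> are empty,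
  and the whole multiplier is the finite zero matrix.\<close>

lemma finite_zero_matrixI:
  assumes P: "P \<in> carrier_mat n m" and H: "H \<in> carrier_mat q m" and L: "L \<in> carrier_mat m m"
    and eqs: "A * P + B * H = P * L" "C * P + D * H = 0\<^sub>m p m"
    and inj: "mat_kernel P = {0\<^sub>v m}" and range: "mat_range P = Vtraj A B C D"
    and blocked: "\<And>u. u \<in> carrier_vec q \<Longrightarrow> D *\<^sub>v u = 0\<^sub>v p \<Longrightarrow> B *\<^sub>v u \<in> Vtraj A B C D \<Longrightarrow> u = 0\<^sub>v q"
    and con: "controllable A B" and obs: "observable C A"
  shows "finite_zero_matrix A B C D L"
proof -
  have P0: "0\<^sub>m n 0 @\<^sub>c P = P"
    by (rule eq_matI) (use P in \<open>auto simp: append_cols_index[of _ n 0 _ m]\<close>)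
  have H0: "0\<^sub>m q 0 @\<^sub>c H = H"
    by (rule eq_matI) (use H in \<open>auto simp: append_cols_index[of _ q 0 _ m]\<close>)
  have L0: "four_block_mat (0\<^sub>m 0 0) (0\<^sub>m 0 m) (0\<^sub>m m 0) L = L"
    by (rule eq_matI) (use L in auto)
  have a0: "0\<^sub>m 0 0 @\<^sub>r 0\<^sub>m m 0 = (0\<^sub>m m 0 :: complex mat)"
    by (rule eq_matI) auto
  have range0: "mat_range (0\<^sub>m q 0 :: complex mat) = {0\<^sub>v q}"
    using image_constant[OF zero_carrier_vec[of 0]] by (simp add: mat_range_def vec_distrib)
  have reach: "reachable_subspace A B = carrier_vec n" using con by (simp add: controllable_def)
  have "right_construction A B C D 0 m 0 (0\<^sub>m n 0) P (0\<^sub>m q 0) H (0\<^sub>m 0 0) (0\<^sub>m 0 m) L (0\<^sub>m 0 0) (0\<^sub>m q 0)"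
    unfolding right_construction_def Let_def sys_dims P0 H0 L0 a0 add_0
  proof (intro conjI allI impI)
    show "four_block_mat A B C D * (P @\<^sub>r H) = P * L @\<^sub>r 0\<^sub>m p m"
      unfolding four_block_mult_append_rows[OF A B C D P H] eqs ..
    show "mat_range P = Vstar A B C D \<inter> reachable_subspace A B"
      unfolding range reach Vstar_eq_Vtraj using Vtraj_carrier by blast
    show "R_solution B D P m 0 (0\<^sub>m q 0) (0\<^sub>m m 0)"
      unfolding R_solution_def using P by (auto intro!: eq_matI)
    show "controllable (0\<^sub>m 0 0) (0\<^sub>m 0 0)"
    proof -
      have "vec_subspace 0 (reachable_subspace (0\<^sub>m 0 0) (0\<^sub>m 0 0))"
        by (rule vec_subspace_reachable) (rule zero_carrier_mat)+
      moreover have "carrier_vec 0 = {0\<^sub>v 0 :: complex vec}" by auto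
      ultimately show ?thesis using vec_subspaceD(2,5) unfolding controllable_def by fastforce
    qed
    fix r' R \<alpha> assume R: "R_solution B D P m r' R \<alpha> \<and> mat_range (0\<^sub>m q 0) \<subseteq> mat_range R"
    then have c: "R \<in> carrier_mat q r'" "\<alpha> \<in> carrier_mat m r'" "B * R = P * \<alpha>" "D * R = 0\<^sub>m p r'"
      by (auto simp: R_solution_def)
    have "R *\<^sub>v v = 0\<^sub>v q" if v: "v \<in> carrier_vec r'" for v
    proof (rule blocked)
      have "D *\<^sub>v (R *\<^sub>v v) = (D * R) *\<^sub>v v" using c(1) v by (intro mat_mult_vec[symmetric]) auto
      then show "D *\<^sub>v (R *\<^sub>v v) = 0\<^sub>v p" unfolding c(4) using v by (simp add: vec_distrib)
      have "B *\<^sub>v (R *\<^sub>v v) = (B * R) *\<^sub>v v" using c(1) v by (intro mat_mult_vec[symmetric]) auto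
      also have "\<dots> = P *\<^sub>v (\<alpha> *\<^sub>v v)" unfolding c(3) using c(2) P v by (intro mat_mult_vec) auto
      finally have "B *\<^sub>v (R *\<^sub>v v) = P *\<^sub>v (\<alpha> *\<^sub>v v)" .
      moreover have "\<alpha> *\<^sub>v v \<in> carrier_vec m" using c v by simp
      ultimately show "B *\<^sub>v (R *\<^sub>v v) \<in> Vtraj A B C D"
        unfolding range[symmetric] using mem_mat_range[OF P] by blast
    qed (use c v in auto)
    then have "mat_range R \<subseteq> {0\<^sub>v q}" using c(1) by (auto simp: mat_range_def)
    with R show "mat_range R = mat_range (0\<^sub>m q 0)" unfolding range0 by blast
  qed (use assms in \<open>auto intro!: eq_matI\<close>)
  then show ?thesis unfolding finite_zero_matrix_def using obs by blast
qed

end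

context two_sided
begin

text \<open>By \<open>Vtraj_iff\<close> the kernel of \<open>\<Pi>k'\<^sup>T\<close> in the enlarged \<open>Vtraj\<close> is the original one, spanned by \<open>\<Pi>k\<close> and
  \<open>\<Pi>f\<close>, while \<open>\<Pi>k'\<^sup>T\<close> maps the columns of \<open>X\<close> to a basis.\<close>

lemma complement_basis:
  assumes X: "X \<in> carrier_mat n k'" "mat_range X \<subseteq> Vtraj A Bh Ch D" "\<Pi>k'\<^sup>T * X = \<sigma>'\<^sup>T"
  shows "mat_range (\<Pi>k @\<^sub>c (\<Pi>f @\<^sub>c X)) = Vtraj A Bh Ch D" (is ?range)
    "mat_kernel (\<Pi>k @\<^sub>c (\<Pi>f @\<^sub>c X)) = {0\<^sub>v (k + (f + k'))}" (is ?kernel)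
proof -
  have c: "\<Pi>f @\<^sub>c X \<in> carrier_mat n (f + k')" "\<Pi>k @\<^sub>c (\<Pi>f @\<^sub>c X) \<in> carrier_mat n (k + (f + k'))"
    using X(1) by auto
  note V = vec_subspaceD[OF rl.vec_subspace_Vtraj]
  have mult: "(\<Pi>k @\<^sub>c (\<Pi>f @\<^sub>c X)) *\<^sub>v (x @\<^sub>v (y @\<^sub>v z)) = (\<Pi>k *\<^sub>v x + \<Pi>f *\<^sub>v y) + X *\<^sub>v z"
    if "x \<in> carrier_vec k" "y \<in> carrier_vec f" "z \<in> carrier_vec k'" for x y z
  proof -
    have "(\<Pi>k @\<^sub>c (\<Pi>f @\<^sub>c X)) *\<^sub>v (x @\<^sub>v (y @\<^sub>v z)) = \<Pi>k *\<^sub>v x + (\<Pi>f @\<^sub>c X) *\<^sub>v (y @\<^sub>v z)"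
      by (rule append_cols_mult_vec[OF carriers(1) c(1)]) (use that in auto)
    also have "(\<Pi>f @\<^sub>c X) *\<^sub>v (y @\<^sub>v z) = \<Pi>f *\<^sub>v y + X *\<^sub>v z"
      by (rule append_cols_mult_vec[OF carriers(2) X(1)]) (use that in auto)
    finally show ?thesis using X(1) by (simp add: vec_distrib)
  qed
  have split: "\<exists>x y z. x \<in> carrier_vec k \<and> y \<in> carrier_vec f \<and> z \<in> carrier_vec k' \<and> v = x @\<^sub>v (y @\<^sub>v z)"
    if v: "v \<in> carrier_vec (k + (f + k'))" for v :: "complex vec"
  proof -
    obtain x w where w: "x \<in> carrier_vec k" "w \<in> carrier_vec (f + k')" "v = x @\<^sub>v w"
      using v by (rule vec_split)
    obtain y z where z: "y \<in> carrier_vec f" "z \<in> carrier_vec k'" "w = y @\<^sub>v z"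
      using w(2) by (rule vec_split)
    show ?thesis using w z by blast
  qed
  have XV: "X *\<^sub>v z \<in> Vtraj A Bh Ch D" if "z \<in> carrier_vec k'" for z
    using X(2) mem_mat_range[OF X(1)] that by blast
  have proj: "\<Pi>k'\<^sup>T *\<^sub>v (X *\<^sub>v z) = \<sigma>'\<^sup>T *\<^sub>v z" if "z \<in> carrier_vec k'" for z
  proof -
    have "(\<Pi>k'\<^sup>T * X) *\<^sub>v z = \<Pi>k'\<^sup>T *\<^sub>v (X *\<^sub>v z)" using X(1) that by (intro mat_mult_vec) auto
    then show ?thesis unfolding X(3) by simp
  qed
  have kill: "\<Pi>k'\<^sup>T *\<^sub>v (\<Pi>k *\<^sub>v x + \<Pi>f *\<^sub>v y) = 0\<^sub>v k'" if "x \<in> carrier_vec k" "y \<in> carrier_vec f" for x y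
    using \<Pi>k'_Vtraj range_Vtraj_iff that by blast
  show ?range
  proof
    show "mat_range (\<Pi>k @\<^sub>c (\<Pi>f @\<^sub>c X)) \<subseteq> Vtraj A Bh Ch D"
    proof
      fix v assume "v \<in> mat_range (\<Pi>k @\<^sub>c (\<Pi>f @\<^sub>c X))"
      then obtain w where w: "w \<in> carrier_vec (k + (f + k'))" "v = (\<Pi>k @\<^sub>c (\<Pi>f @\<^sub>c X)) *\<^sub>v w"
        unfolding mem_mat_range[OF c(2)] by (rule bexE)
      obtain x y z where s: "x \<in> carrier_vec k" "y \<in> carrier_vec f" "z \<in> carrier_vec k'" "w = x @\<^sub>v (y @\<^sub>v z)"
        using split[OF w(1)] by (elim exE conjE) (rule that)
      have "\<Pi>k *\<^sub>v x + \<Pi>f *\<^sub>v y \<in> Vtraj A B C D" using s range_Vtraj_iff by blast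
      then have "\<Pi>k *\<^sub>v x + \<Pi>f *\<^sub>v y \<in> Vtraj A Bh Ch D" using Vtraj_iff by blast
      then show "v \<in> Vtraj A Bh Ch D"
        unfolding w(2) s(4) mult[OF s(1-3)] using XV[OF s(3)] by (rule V(3))
    qed
    show "Vtraj A Bh Ch D \<subseteq> mat_range (\<Pi>k @\<^sub>c (\<Pi>f @\<^sub>c X))"
    proof
      fix v assume v: "v \<in> Vtraj A Bh Ch D"
      then have vc: "v \<in> carrier_vec n" using V(5) by blast
      define z where "z = left.S\<^sup>T *\<^sub>v (\<Pi>k'\<^sup>T *\<^sub>v v)"
      have z: "z \<in> carrier_vec k'" by (simp add: z_def)
      have "(\<sigma>'\<^sup>T * left.S\<^sup>T) *\<^sub>v (\<Pi>k'\<^sup>T *\<^sub>v v) = \<sigma>'\<^sup>T *\<^sub>v z"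
        unfolding z_def by (intro mat_mult_vec) auto
      then have sz: "\<sigma>'\<^sup>T *\<^sub>v z = \<Pi>k'\<^sup>T *\<^sub>v v" unfolding \<sigma>T_inverse by simp
      define w where "w = v - X *\<^sub>v z"
      have "w \<in> Vtraj A Bh Ch D"
        unfolding w_def using v XV[OF z] by (rule vec_subspace_minus[OF rl.vec_subspace_Vtraj])
      moreover have "\<Pi>k'\<^sup>T *\<^sub>v w = 0\<^sub>v k'"
        unfolding w_def using vc z X(1) by (simp add: vec_distrib proj sz)
      ultimately have "w \<in> Vtraj A B C D" using Vtraj_iff by blast
      then obtain x y where xy: "x \<in> carrier_vec k" "y \<in> carrier_vec f" "w = \<Pi>k *\<^sub>v x + \<Pi>f *\<^sub>v y"
        unfolding range_Vtraj_iff by blast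
      have "v = w + X *\<^sub>v z" unfolding w_def by (rule eq_vecI) (use vc X(1) in auto)
      also have "\<dots> = (\<Pi>k @\<^sub>c (\<Pi>f @\<^sub>c X)) *\<^sub>v (x @\<^sub>v (y @\<^sub>v z))"
        unfolding mult[OF xy(1,2) z] xy(3) ..
      finally have "v = (\<Pi>k @\<^sub>c (\<Pi>f @\<^sub>c X)) *\<^sub>v (x @\<^sub>v (y @\<^sub>v z))" .
      moreover have "x @\<^sub>v (y @\<^sub>v z) \<in> carrier_vec (k + (f + k'))" using xy z by auto
      ultimately show "v \<in> mat_range (\<Pi>k @\<^sub>c (\<Pi>f @\<^sub>c X))"
        unfolding mem_mat_range[OF c(2)] by (rule bexI)
    qed
  qed
  show ?kernel
  proof (intro equalityI subsetI)
    fix v assume "v \<in> mat_kernel (\<Pi>k @\<^sub>c (\<Pi>f @\<^sub>c X))"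
    then have v: "v \<in> carrier_vec (k + (f + k'))" "(\<Pi>k @\<^sub>c (\<Pi>f @\<^sub>c X)) *\<^sub>v v = 0\<^sub>v n"
      using mat_kernelD[OF c(2)] by auto
    obtain x y z where s: "x \<in> carrier_vec k" "y \<in> carrier_vec f" "z \<in> carrier_vec k'" "v = x @\<^sub>v (y @\<^sub>v z)"
      using split[OF v(1)] by (elim exE conjE) (rule that)
    have eq: "(\<Pi>k *\<^sub>v x + \<Pi>f *\<^sub>v y) + X *\<^sub>v z = 0\<^sub>v n" using v(2) unfolding s(4) mult[OF s(1-3)] .
    have "\<Pi>k'\<^sup>T *\<^sub>v ((\<Pi>k *\<^sub>v x + \<Pi>f *\<^sub>v y) + X *\<^sub>v z) = \<Pi>k'\<^sup>T *\<^sub>v (\<Pi>k *\<^sub>v x + \<Pi>f *\<^sub>v y) + \<Pi>k'\<^sup>T *\<^sub>v (X *\<^sub>v z)"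
      by (rule mult_add_distrib_mat_vec[of _ k' n]) (use X(1) in auto)
    then have "\<sigma>'\<^sup>T *\<^sub>v z = 0\<^sub>v k'"
      unfolding eq kill[OF s(1,2)] proj[OF s(3)] by (simp add: vec_distrib)
    then have "left.S\<^sup>T *\<^sub>v (\<sigma>'\<^sup>T *\<^sub>v z) = 0\<^sub>v k'" by (simp add: vec_distrib)
    moreover have "(left.S\<^sup>T * \<sigma>'\<^sup>T) *\<^sub>v z = left.S\<^sup>T *\<^sub>v (\<sigma>'\<^sup>T *\<^sub>v z)"
      using s by (intro mat_mult_vec) auto
    ultimately have z0: "z = 0\<^sub>v k'" unfolding \<sigma>T_inverse using s by simp
    have "\<Pi>k *\<^sub>v x + \<Pi>f *\<^sub>v y = 0\<^sub>v n"
      using eq X(1) unfolding z0 by (simp add: vec_distrib)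
    from \<Pi>z_injective[OF s(1,2) this] show "v \<in> {0\<^sub>v (k + (f + k'))}"
      unfolding s(4) z0 by (auto intro!: eq_vecI)
  next
    fix v :: "complex vec" assume "v \<in> {0\<^sub>v (k + (f + k'))}"
    then show "v \<in> mat_kernel (\<Pi>k @\<^sub>c (\<Pi>f @\<^sub>c X))"
      using c(2) by (auto intro!: mat_kernelI[OF c(2)] simp: vec_distrib)
  qed
qed

lemma Ch_\<Pi>: "Ch * \<Pi>k = C * \<Pi>k" "Ch * \<Pi>f = C * \<Pi>f"
proof -
  have Ch: "Ch = C + left.G\<^sup>T * \<Pi>k'\<^sup>T" by (simp add: left.pert.Bp_def mat_transpose)
  have "Ch * \<Pi>k = C * \<Pi>k + left.G\<^sup>T * (\<Pi>k'\<^sup>T * \<Pi>k)" "Ch * \<Pi>f = C * \<Pi>f + left.G\<^sup>T * (\<Pi>k'\<^sup>T * \<Pi>f)"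
    unfolding Ch by (simp_all add: mat_distrib)
  then show "Ch * \<Pi>k = C * \<Pi>k" "Ch * \<Pi>f = C * \<Pi>f"
    unfolding \<Pi>k'_\<Pi> by (simp_all add: mat_distrib)
qed

text \<open>Multiplication of the first equation by \<open>\<Pi>k'\<^sup>T\<close> removes \<open>\<Pi>k\<close> and \<open>\<Pi>f\<close>, and the equations of the left
  construction together with its Lyapunov equation evaluate the left hand side.\<close>

lemma complement_multiplier:
  assumes X: "X \<in> carrier_mat n k'" "mat_range X \<subseteq> Vtraj A Bh Ch D" "\<Pi>k'\<^sup>T * X = \<sigma>'\<^sup>T"
  obtains H L1 L2 where "H \<in> carrier_mat q k'" "L1 \<in> carrier_mat k k'" "L2 \<in> carrier_mat f k'"
    "A * X + Bh * H = \<Pi>k * L1 + \<Pi>f * L2 + X * (- (left.Lb\<^sup>\<dagger>)\<^sup>T)" "Ch * X + D * H = 0\<^sub>m p k'"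
proof -
  define J where "J = \<Pi>k @\<^sub>c (\<Pi>f @\<^sub>c X)"
  have c: "\<Pi>f @\<^sub>c X \<in> carrier_mat n (f + k')" "J \<in> carrier_mat n (k + (f + k'))"
    using X(1) by (auto simp: J_def)
  have st: "\<exists>y\<in>mat_range J. rl.step x y" if "x \<in> mat_range X" for x
    unfolding J_def complement_basis(1)[OF X] using X(2) that rl.Vtraj_step by blast
  obtain H L where HL: "H \<in> carrier_mat q k'" "L \<in> carrier_mat (k + (f + k')) k'"
    "A * X + Bh * H = J * L" "Ch * X + D * H = 0\<^sub>m p k'"
    by (rule rl.steps_matrix[OF X(1) c(2) st])
  obtain L1 L' where L': "L1 \<in> carrier_mat k k'" "L' \<in> carrier_mat (f + k') k'" "L = L1 @\<^sub>r L'"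
    by (rule append_rows_split[OF HL(2)])
  obtain L2 L3 where L3: "L2 \<in> carrier_mat f k'" "L3 \<in> carrier_mat k' k'" "L' = L2 @\<^sub>r L3"
    by (rule append_rows_split[OF L'(2)])
  have "J * L = \<Pi>k * L1 + (\<Pi>f @\<^sub>c X) * L'"
    unfolding J_def L'(3) by (rule append_cols_mult[OF carriers(1) c(1) L'(1,2)])
  also have "(\<Pi>f @\<^sub>c X) * L' = \<Pi>f * L2 + X * L3"
    unfolding L3(3) by (rule append_cols_mult[OF carriers(2) X(1) L3(1,2)])
  finally have JL: "J * L = \<Pi>k * L1 + \<Pi>f * L2 + X * L3"
    using L' L3 X(1) by (simp add: mat_distrib)
  note d = carrier_matD[OF X(1)] carrier_matD[OF HL(1)] carrier_matD[OF L'(1)] carrier_matD[OF L3(1)] carrier_matD[OF L3(2)]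
  have "\<sigma>'\<^sup>T * L3 = (\<Pi>k'\<^sup>T * \<Pi>k) * L1 + (\<Pi>k'\<^sup>T * \<Pi>f) * L2 + (\<Pi>k'\<^sup>T * X) * L3"
    unfolding \<Pi>k'_\<Pi> X(3) using d by (simp add: mat_distrib)
  also have "\<dots> = \<Pi>k'\<^sup>T * (A * X + Bh * H)"
    unfolding HL(3) JL using d by (simp add: mat_distrib)
  also have "\<dots> = (left.Lb\<^sup>T + left.Hb\<^sup>T * left.G\<^sup>T) * \<sigma>'\<^sup>T"
  proof -
    have "(\<Pi>k' * left.Lb)\<^sup>T = (A\<^sup>T * \<Pi>k' + C\<^sup>T * left.Hb)\<^sup>T" by (simp only: left.controlled_invariance)
    then have 1: "left.Lb\<^sup>T * \<Pi>k'\<^sup>T = \<Pi>k'\<^sup>T * A + left.Hb\<^sup>T * C" by (simp add: mat_transpose)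
    have "(Bh\<^sup>T * \<Pi>k' + D\<^sup>T * left.Hb)\<^sup>T = (0\<^sub>m q k')\<^sup>T" by (simp only: pert_out)
    then have 2: "\<Pi>k'\<^sup>T * Bh + left.Hb\<^sup>T * D = 0\<^sub>m k' q" by (simp add: mat_transpose)
    have Ch: "Ch = C + left.G\<^sup>T * \<Pi>k'\<^sup>T" by (simp add: left.pert.Bp_def mat_transpose)
    have 3: "C * X + left.G\<^sup>T * \<sigma>'\<^sup>T + D * H = 0\<^sub>m p k'"
      using HL(4) unfolding Ch X(3)[symmetric] using d by (simp add: mat_distrib)
    have "(\<Pi>k'\<^sup>T * (A * X + Bh * H)) = (\<Pi>k'\<^sup>T * A + left.Hb\<^sup>T * C) * X + (\<Pi>k'\<^sup>T * Bh + left.Hb\<^sup>T * D) * H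
        + left.Hb\<^sup>T * left.G\<^sup>T * \<sigma>'\<^sup>T - left.Hb\<^sup>T * (C * X + left.G\<^sup>T * \<sigma>'\<^sup>T + D * H)"
      by (rule eq_matI) (use d in \<open>auto simp: mat_distrib simp del: index_mult_mat(1)\<close>)
    also have "\<dots> = left.Lb\<^sup>T * (\<Pi>k'\<^sup>T * X) + left.Hb\<^sup>T * left.G\<^sup>T * \<sigma>'\<^sup>T"
      unfolding 1[symmetric] 2 3
      by (rule eq_matI) (use d in \<open>auto simp: mat_distrib simp del: index_mult_mat(1)\<close>)
    finally show ?thesis unfolding X(3) by (simp add: mat_distrib)
  qed
  also have "left.Lb\<^sup>T + left.Hb\<^sup>T * left.G\<^sup>T = (left.Lb + left.G * left.Hb)\<^sup>T" by (simp add: mat_transpose)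
  also have "left.Lb + left.G * left.Hb = - (left.S * left.Lb\<^sup>\<dagger> * \<sigma>')"
    unfolding left.G_Hb by (rule eq_matI) auto
  also have "(- (left.S * left.Lb\<^sup>\<dagger> * \<sigma>'))\<^sup>T * \<sigma>'\<^sup>T = \<sigma>'\<^sup>T * (- (left.Lb\<^sup>\<dagger>)\<^sup>T * (left.S\<^sup>T * \<sigma>'\<^sup>T))"
    by (simp add: mat_transpose mat_distrib)
  finally have "\<sigma>'\<^sup>T * L3 = \<sigma>'\<^sup>T * (- (left.Lb\<^sup>\<dagger>)\<^sup>T)" unfolding \<sigma>T_inverse by simp
  then have "(left.S\<^sup>T * \<sigma>'\<^sup>T) * L3 = (left.S\<^sup>T * \<sigma>'\<^sup>T) * (- (left.Lb\<^sup>\<dagger>)\<^sup>T)" using d by (simp add: mat_mult_assoc)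
  then have "L3 = - (left.Lb\<^sup>\<dagger>)\<^sup>T" unfolding \<sigma>T_inverse using d by simp
  then show thesis using that HL L' L3 unfolding JL by blast
qed

text \<open>Replacing \<open>X\<close> by \<open>X + \<Pi>k * W\<close> and the inputs \<open>H\<close> by \<open>H + Hk * W + R0 * Y\<close> preserves all properties and
  changes the coefficient of \<open>\<Pi>k\<close>. It takes the form \<open>G * Z\<close> if and only if \<open>W\<close> and \<open>Y\<close> solve a Sylvester
  equation for \<open>(\<Lambda>k, \<alpha>k)\<close>.\<close>

lemma decoupled_complement:
  obtains X Z \<Delta> where "X \<in> carrier_mat n k'" "mat_range X \<subseteq> Vtraj A Bh Ch D" "\<Pi>k'\<^sup>T * X = \<sigma>'\<^sup>T"
    "Z \<in> carrier_mat q k'" "\<Delta> \<in> carrier_mat f k'"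
    "A * X + Bh * Z = \<Pi>k * (G * Z) + \<Pi>f * \<Delta> + X * (- (left.Lb\<^sup>\<dagger>)\<^sup>T)" "Ch * X + D * Z = 0\<^sub>m p k'"
proof -
  obtain X where X: "X \<in> carrier_mat n k'" "mat_range X \<subseteq> Vtraj A Bh Ch D" "\<Pi>k'\<^sup>T * X = \<sigma>'\<^sup>T"
    by (rule complement_exists)
  define N where "N = - (left.Lb\<^sup>\<dagger>)\<^sup>T"
  have N: "N \<in> carrier_mat k' k'" by (auto simp: N_def)
  obtain H L1 L2 where H: "H \<in> carrier_mat q k'" "L1 \<in> carrier_mat k k'" "L2 \<in> carrier_mat f k'"
    "A * X + Bh * H = \<Pi>k * L1 + \<Pi>f * L2 + X * N" "Ch * X + D * H = 0\<^sub>m p k'"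
    by (rule complement_multiplier[OF X, folded N_def]) (rule that)
  have con: "controllable \<Lambda>k \<alpha>k" using right_unfolded by (elim conjE)
  have E: "G * H - L1 \<in> carrier_mat k k'" using H by auto
  obtain W Y where W: "W \<in> carrier_mat k k'" "Y \<in> carrier_mat r k'"
    "\<Lambda>k * W - W * N + \<alpha>k * Y = G * H - L1"
    by (rule sylvester_solvable[OF carriers(5,8) con N E]) (rule that)
  note d = carrier_matD[OF X(1)] carrier_matD[OF H(1)] carrier_matD[OF H(2)] carrier_matD[OF H(3)]
    carrier_matD[OF N] carrier_matD[OF W(1)] carrier_matD[OF W(2)]
  define Z where "Z = H + Hk * W + R0 * Y"
  define X' where "X' = X + \<Pi>k * W"
  have Z: "Z \<in> carrier_mat q k'" and X': "X' \<in> carrier_mat n k'" using d by (auto simp: Z_def X'_def)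
  have 1: "A * \<Pi>k + Bh * Hk = \<Pi>k * \<Lambda>k + \<Pi>k * (G * Hk)"
  proof -
    have "A * \<Pi>k + Bh * Hk = (A * \<Pi>k + B * Hk) + \<Pi>k * (G * Hk)"
      by (rule eq_matI) (auto simp: pert.Bp_def mat_distrib simp del: index_mult_mat(1))
    then show ?thesis unfolding zero_equations(1) .
  qed
  have GZ: "L1 + \<Lambda>k * W + G * Hk * W - W * N = G * Z"
  proof (rule eq_matI)
    fix i j assume "i < dim_row (G * Z)" "j < dim_col (G * Z)"
    then have ij: "i < k" "j < k'" using d by (auto simp: Z_def)
    have "(\<Lambda>k * W - W * N + \<alpha>k * Y) $$ (i, j) = (G * H - L1) $$ (i, j)" by (simp only: W(3))
    moreover have "G * Z = G * H + G * Hk * W + (G * R0) * Y" using d by (simp add: Z_def mat_distrib)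
    ultimately show "(L1 + \<Lambda>k * W + G * Hk * W - W * N) $$ (i, j) = (G * Z) $$ (i, j)"
      unfolding G_R0 using ij d by (simp add: mat_distrib algebra_simps del: index_mult_mat(1))
  qed (use d in \<open>auto simp: Z_def\<close>)
  show thesis
  proof (rule that[OF X' _ _ Z H(3)])
    show "mat_range X' \<subseteq> Vtraj A Bh Ch D"
    proof
      fix v assume "v \<in> mat_range X'"
      then obtain c where c: "c \<in> carrier_vec k'" "v = X' *\<^sub>v c" using mem_mat_range[OF X'] by blast
      have "\<Pi>k *\<^sub>v (W *\<^sub>v c) \<in> Vtraj A B C D"
        using pert.range_Vtraj mem_mat_range[OF carriers(1)] W(1) c(1) mult_mat_vec_carrier by blast
      then have "\<Pi>k *\<^sub>v (W *\<^sub>v c) \<in> Vtraj A Bh Ch D" using Vtraj_iff by blast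
      moreover have "X *\<^sub>v c \<in> Vtraj A Bh Ch D" using X(1,2) c(1) mem_mat_range[OF X(1)] by blast
      ultimately have "X *\<^sub>v c + \<Pi>k *\<^sub>v (W *\<^sub>v c) \<in> Vtraj A Bh Ch D"
        using vec_subspaceD(3)[OF rl.vec_subspace_Vtraj] by blast
      then show "v \<in> Vtraj A Bh Ch D" unfolding c(2) X'_def using d c(1) by (simp add: vec_distrib)
    qed
    have "\<Pi>k'\<^sup>T * X' = \<Pi>k'\<^sup>T * X + (\<Pi>k'\<^sup>T * \<Pi>k) * W" unfolding X'_def using d by (simp add: mat_distrib)
    then show "\<Pi>k'\<^sup>T * X' = \<sigma>'\<^sup>T" unfolding X(3) \<Pi>k'_\<Pi> using d by (simp add: mat_distrib)
    have "A * X' + Bh * Z = (A * X + Bh * H) + (A * \<Pi>k + Bh * Hk) * W + (Bh * R0) * Y"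
      by (rule eq_matI) (use d in \<open>auto simp: Z_def X'_def mat_distrib simp del: index_mult_mat(1)\<close>)
    also have "\<dots> = \<Pi>k * (L1 + \<Lambda>k * W + G * Hk * W - W * N) + \<Pi>f * L2 + X' * N"
      unfolding H(4) 1 Bp_R0
      by (rule eq_matI) (use d in \<open>auto simp: X'_def mat_distrib simp del: index_mult_mat(1)\<close>)
    finally show "A * X' + Bh * Z = \<Pi>k * (G * Z) + \<Pi>f * L2 + X' * (- (left.Lb\<^sup>\<dagger>)\<^sup>T)"
      unfolding GZ unfolding N_def .
    have "Ch * X' + D * Z = (Ch * X + D * H) + (Ch * \<Pi>k + D * Hk) * W + (D * R0) * Y"
      by (rule eq_matI) (use d in \<open>auto simp: Z_def X'_def mat_distrib simp del: index_mult_mat(1)\<close>)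
    then show "Ch * X' + D * Z = 0\<^sub>m p k'"
      unfolding H(5) Ch_\<Pi> zero_equations(2) DR0 using d by (simp add: mat_distrib)
  qed
qed

lemma finite_zero_matrix_comp:
  assumes con: "controllable A Brl" and obs: "observable Crl A"
  shows "\<exists>Z\<in>carrier_mat q k'. \<exists>\<Delta>\<in>carrier_mat f k'. finite_zero_matrix A Brl Crl Drl
    (four_block_mat (- (S * Lb\<^sup>\<dagger> * \<sigma>)) ((\<Lambda>kf + G * Hf) @\<^sub>c (G * Z)) (0\<^sub>m (f + k') k)
      (four_block_mat \<Lambda>f \<Delta> (0\<^sub>m k' f) (- (left.Lb\<^sup>\<dagger>)\<^sup>T)))"
proof -
  obtain X Z \<Delta> where X: "X \<in> carrier_mat n k'" "mat_range X \<subseteq> Vtraj A Bh Ch D" "\<Pi>k'\<^sup>T * X = \<sigma>'\<^sup>T"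
    and Z: "Z \<in> carrier_mat q k'" and \<Delta>: "\<Delta> \<in> carrier_mat f k'"
    and eqs: "A * X + Bh * Z = \<Pi>k * (G * Z) + \<Pi>f * \<Delta> + X * (- (left.Lb\<^sup>\<dagger>)\<^sup>T)" "Ch * X + D * Z = 0\<^sub>m p k'"
    by (rule decoupled_complement) (rule that)
  note d = carrier_matD[OF X(1)] carrier_matD[OF Z] carrier_matD[OF \<Delta>]
  define N where "N = - (left.Lb\<^sup>\<dagger>)\<^sup>T"
  have N: "N \<in> carrier_mat k' k'" by (auto simp: N_def)
  define M1 where "M1 = four_block_mat \<Lambda>f \<Delta> (0\<^sub>m k' f) N"
  define M where "M = four_block_mat (- (S * Lb\<^sup>\<dagger> * \<sigma>)) ((\<Lambda>kf + G * Hf) @\<^sub>c (G * Z)) (0\<^sub>m (f + k') k) M1"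
  define J1 where "J1 = \<Pi>f @\<^sub>c X"
  define J where "J = \<Pi>k @\<^sub>c J1"
  define H1 where "H1 = Hf @\<^sub>c Z"
  define H where "H = Hb @\<^sub>c H1"
  have M1: "M1 \<in> carrier_mat (f + k') (f + k')" unfolding M1_def using \<Delta> N by auto
  have c3: "- (S * Lb\<^sup>\<dagger> * \<sigma>) \<in> carrier_mat k k" "\<Lambda>kf + G * Hf \<in> carrier_mat k f" "G * Z \<in> carrier_mat k k'"
    using Z by auto
  have c4: "(\<Lambda>kf + G * Hf) @\<^sub>c (G * Z) \<in> carrier_mat k (f + k')" by (rule append_cols_carrier[OF c3(2,3)])
  have M: "M \<in> carrier_mat (k + (f + k')) (k + (f + k'))"
    unfolding M_def using c3 c4 M1 by auto
  have J1: "J1 \<in> carrier_mat n (f + k')" unfolding J1_def using X by auto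
  have J: "J \<in> carrier_mat n (k + (f + k'))" unfolding J_def using J1 by auto
  have H1: "H1 \<in> carrier_mat q (f + k')" unfolding H1_def by (rule append_cols_carrier[OF carriers(4) Z])
  have H: "H \<in> carrier_mat q (k + (f + k'))" unfolding H_def by (rule append_cols_carrier[OF Hb(1) H1])
  have z: "0\<^sub>m (f + k') k \<in> carrier_mat (f + k') k" "0\<^sub>m k' f \<in> carrier_mat k' f" by auto
  have cM: "E * F1 \<in> carrier_mat a b" if "E \<in> carrier_mat a c" "F1 \<in> carrier_mat c b" for E F1 :: "complex mat" and a b c
    using that by auto
  have J1M: "J1 * M1 = (\<Pi>f * \<Lambda>f) @\<^sub>c (\<Pi>f * \<Delta> + X * N)"
    unfolding J1_def M1_def append_cols_four_block[OF carriers(2) X(1) carriers(7) \<Delta> z(2) N]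
    using d by (simp add: mat_distrib)
  have JM: "J * M = (\<Pi>k * (- (S * Lb\<^sup>\<dagger> * \<sigma>))) @\<^sub>c
      ((\<Pi>k * (\<Lambda>kf + G * Hf) + \<Pi>f * \<Lambda>f) @\<^sub>c (\<Pi>k * (G * Z) + (\<Pi>f * \<Delta> + X * N)))"
  proof -
    have "J * M = (\<Pi>k * (- (S * Lb\<^sup>\<dagger> * \<sigma>)) + J1 * 0\<^sub>m (f + k') k) @\<^sub>c
        (\<Pi>k * ((\<Lambda>kf + G * Hf) @\<^sub>c (G * Z)) + J1 * M1)"
      unfolding J_def M_def by (rule append_cols_four_block[OF carriers(1) J1 c3(1) c4 z(1) M1])
    also have "\<Pi>k * (- (S * Lb\<^sup>\<dagger> * \<sigma>)) + J1 * 0\<^sub>m (f + k') k = \<Pi>k * (- (S * Lb\<^sup>\<dagger> * \<sigma>))"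
      using J1 by simp
    also have "\<Pi>k * ((\<Lambda>kf + G * Hf) @\<^sub>c (G * Z)) + J1 * M1 =
        (\<Pi>k * (\<Lambda>kf + G * Hf) + \<Pi>f * \<Lambda>f) @\<^sub>c (\<Pi>k * (G * Z) + (\<Pi>f * \<Delta> + X * N))"
      unfolding J1M mult_append_cols[OF carriers(1) c3(2,3)]
      by (rule append_cols_add[of _ n f _ k']) (use d N in auto)
    finally show ?thesis .
  qed
  have blockwise: "Q * J + R * H = (Q * \<Pi>k + R * Hb) @\<^sub>c ((Q * \<Pi>f + R * Hf) @\<^sub>c (Q * X + R * Z))"
    if Q: "Q \<in> carrier_mat m n" and R: "R \<in> carrier_mat m q" for Q R m
  proof -
    have "Q * J = (Q * \<Pi>k) @\<^sub>c ((Q * \<Pi>f) @\<^sub>c (Q * X))"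
      unfolding J_def J1_def mult_append_cols[OF Q carriers(1) J1[unfolded J1_def]]
        mult_append_cols[OF Q carriers(2) X(1)] ..
    moreover have "R * H = (R * Hb) @\<^sub>c ((R * Hf) @\<^sub>c (R * Z))"
      unfolding H_def H1_def mult_append_cols[OF R Hb(1) H1[unfolded H1_def]]
        mult_append_cols[OF R carriers(4) Z] ..
    ultimately have "Q * J + R * H =
        (Q * \<Pi>k + R * Hb) @\<^sub>c (((Q * \<Pi>f) @\<^sub>c (Q * X)) + ((R * Hf) @\<^sub>c (R * Z)))"
      using append_cols_add[of "Q * \<Pi>k" m k "(Q * \<Pi>f) @\<^sub>c (Q * X)" "f + k'" "R * Hb" "(R * Hf) @\<^sub>c (R * Z)"] Q R d
      by (simp add: append_cols_carrier)
    also have "((Q * \<Pi>f) @\<^sub>c (Q * X)) + ((R * Hf) @\<^sub>c (R * Z)) = (Q * \<Pi>f + R * Hf) @\<^sub>c (Q * X + R * Z)"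
      by (rule append_cols_add[of _ m f _ k']) (use Q R d in auto)
    finally show ?thesis .
  qed
  have zf: "Ch * \<Pi>f + D * Hf = 0\<^sub>m p f" unfolding Ch_\<Pi> by (rule zero_equations)
  have zk: "Ch * \<Pi>k + D * Hb = 0\<^sub>m p k" unfolding Ch_\<Pi> by (rule controlled_invariance)
  have state: "A * J + Bh * H = J * M"
    unfolding blockwise[OF A pert.Bp] JM zero_equations_pert eqs(1) N_def[symmetric]
    using d N by (simp add: mat_distrib)
  have out: "Ch * J + D * H = 0\<^sub>m p (k + (f + k'))"
    unfolding blockwise[OF Ch D] zk zf eqs(2) zero_append_cols ..
  have HL: "L0\<^sup>\<dagger> * H \<in> carrier_mat l (k + (f + k'))" using H by auto
  have lift: "Brl * (L0\<^sup>\<dagger> * H) = Bh * H" "Drl * (L0\<^sup>\<dagger> * H) = L0'\<^sup>T * (D * H)"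
  proof -
    have "Brl * (L0\<^sup>\<dagger> * H) = (Bh * L0 * L0\<^sup>\<dagger>) * H" using H by (simp add: mat_mult_assoc)
    then show "Brl * (L0\<^sup>\<dagger> * H) = Bh * H" unfolding proj_input .
    have "Drl * (L0\<^sup>\<dagger> * H) = L0'\<^sup>T * ((D * L0 * L0\<^sup>\<dagger>) * H)" using H by (simp add: mat_mult_assoc)
    then show "Drl * (L0\<^sup>\<dagger> * H) = L0'\<^sup>T * (D * H)" unfolding proj_input .
  qed
  have "finite_zero_matrix A Brl Crl Drl M"
  proof (rule comp.finite_zero_matrixI[OF J HL M])
    show "A * J + Brl * (L0\<^sup>\<dagger> * H) = J * M" unfolding lift by (rule state)
    have "Crl * J + Drl * (L0\<^sup>\<dagger> * H) = L0'\<^sup>T * (Ch * J + D * H)"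
      unfolding lift using H J by (simp add: mat_distrib)
    then show "Crl * J + Drl * (L0\<^sup>\<dagger> * H) = 0\<^sub>m l' (k + (f + k'))" unfolding out by (simp add: mat_distrib)
    show "mat_kernel J = {0\<^sub>v (k + (f + k'))}" unfolding J_def J1_def by (rule complement_basis[OF X])
    show "mat_range J = Vtraj A Brl Crl Drl" unfolding comp_spaces J_def J1_def by (rule complement_basis[OF X])
    fix u assume u: "u \<in> carrier_vec l" "Drl *\<^sub>v u = 0\<^sub>v l'" "Brl *\<^sub>v u \<in> Vtraj A Brl Crl Drl"
    have "comp.step (0\<^sub>v n) (Brl *\<^sub>v u)"
      by (rule comp.stepI[OF u(1)]) (use u in \<open>auto simp: vec_distrib\<close>)
    then have "Brl *\<^sub>v u \<in> Cstar A Brl Crl Drl" using comp.Cstar_step[OF comp.zero_Cstar] by blast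
    then have "Brl *\<^sub>v u = 0\<^sub>v n" using u(3) Cstar_Vtraj_rl unfolding comp_spaces by blast
    then have "Bh *\<^sub>v (L0 *\<^sub>v u) = 0\<^sub>v n" using u(1) by (simp add: mat_mult_vec)
    from perturbed_input_injective[OF u(1) this Drl_zero[OF u(1,2)]] show "u = 0\<^sub>v l" .
  qed (rule con, rule obs)
  then show ?thesis unfolding M_def M1_def N_def using Z \<Delta> by blast
qed

end

section \<open>The left construction by transposition\<close>

lemma mat_inv_transpose:
  fixes M :: "'a :: field mat"
  assumes "M \<in> carrier_mat n n" "N \<in> carrier_mat n n" "M * N = 1\<^sub>m n"
  shows "mat_inv (M\<^sup>T) = N\<^sup>T"
proof (rule mat_inv_unique(1))
  have "N\<^sup>T * M\<^sup>T = (M * N)\<^sup>T" using assms(1,2) by (intro mat_transpose_mult[symmetric]) auto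
  then show "N\<^sup>T * M\<^sup>T = 1\<^sub>m n" unfolding assms(3) mat_transpose_one .
qed (use assms in auto)

lemma pos_def_mat_transpose:
  assumes "pos_def_mat m M"
  shows "pos_def_mat m (M\<^sup>T)"
  unfolding pos_def_mat_def
proof (intro conjI ballI impI)
  have M: "M \<in> carrier_mat m m" and adj: "M\<^sup>\<dagger> = M"
    and pos: "\<And>v. v \<in> carrier_vec m \<Longrightarrow> v \<noteq> 0\<^sub>v m \<Longrightarrow> 0 < Re ((M *\<^sub>v v) \<bullet>c v)"
    using assms by (auto simp: pos_def_mat_def)
  show "M\<^sup>T \<in> carrier_mat m m" using M by simp
  show "(M\<^sup>T)\<^sup>\<dagger> = M\<^sup>T" by (simp add: adjoint_transpose adj)
  fix v :: "complex vec" assume v: "v \<in> carrier_vec m" "v \<noteq> 0\<^sub>v m"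
  define w where "w = conjugate v"
  have w: "w \<in> carrier_vec m" using v by (simp add: w_def)
  have "w \<noteq> 0\<^sub>v m"
  proof
    assume "w = 0\<^sub>v m"
    then have "v = conjugate (0\<^sub>v m)" unfolding w_def by (metis conjugate_id)
    then show False using v by simp
  qed
  have "(M\<^sup>T *\<^sub>v v) \<bullet>c v = (M\<^sup>T *\<^sub>v v) \<bullet> w" by (simp add: w_def)
  also have "\<dots> = v \<bullet> (M *\<^sub>v w)" using M v w by (intro transpose_scalar_prod) auto
  also have "\<dots> = (M *\<^sub>v w) \<bullet> v" using M v w by (intro comm_scalar_prod[of _ m]) auto
  also have "\<dots> = (M *\<^sub>v w) \<bullet>c w" by (simp add: w_def)
  finally show "0 < Re ((M\<^sup>T *\<^sub>v v) \<bullet>c v)" using pos[OF w \<open>w \<noteq> 0\<^sub>v m\<close>] by simp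
qed

lemma unitary_mat_transpose:
  assumes "unitary_mat U"
  shows "unitary_mat (U\<^sup>T)"
proof -
  have U: "dim_col U = dim_row U" "U\<^sup>\<dagger> * U = 1\<^sub>m (dim_row U)" "U * U\<^sup>\<dagger> = 1\<^sub>m (dim_row U)"
    using assms by (auto simp: unitary_mat_def)
  have "(U\<^sup>T)\<^sup>\<dagger> * U\<^sup>T = (U * U\<^sup>\<dagger>)\<^sup>T" "U\<^sup>T * (U\<^sup>T)\<^sup>\<dagger> = (U\<^sup>\<dagger> * U)\<^sup>T"
    using U(1) by (simp_all add: mat_transpose_mult adjoint_transpose)
  then show ?thesis unfolding unitary_mat_def U(2,3) using U(1) by (simp add: mat_transpose_one)
qed

context system
begin

lemma left_zero_solution_iff:
  "left_zero_solution A B C D m P H L \<longleftrightarrow>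
    P \<in> carrier_mat m n \<and> H \<in> carrier_mat m p \<and> L \<in> carrier_mat m m \<and>
    A\<^sup>T * P\<^sup>T + C\<^sup>T * H\<^sup>T = P\<^sup>T * L\<^sup>T \<and> B\<^sup>T * P\<^sup>T + D\<^sup>T * H\<^sup>T = 0\<^sub>m q m"
proof (cases "P \<in> carrier_mat m n \<and> H \<in> carrier_mat m p \<and> L \<in> carrier_mat m m")
  case True
  then have c: "P \<in> carrier_mat m n" "H \<in> carrier_mat m p" "L \<in> carrier_mat m m" by auto
  note d = carrier_matD[OF c(1)] carrier_matD[OF c(2)] carrier_matD[OF c(3)]
  have "(P @\<^sub>c H) * four_block_mat A B C D = (P * A + H * C) @\<^sub>c (P * B + H * D)"
    by (rule append_cols_four_block[OF c(1,2) A B C D])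
  then have "left_zero_solution A B C D m P H L \<longleftrightarrow> P * A + H * C = L * P \<and> P * B + H * D = 0\<^sub>m m q"
    unfolding left_zero_solution_def sys_dims using c
    by (simp add: append_cols_eq_iff[of _ m n _ _ q] d)
  also have "P * A + H * C = L * P \<longleftrightarrow> (P * A + H * C)\<^sup>T = (L * P)\<^sup>T" by simp
  also have "(P * A + H * C)\<^sup>T = A\<^sup>T * P\<^sup>T + C\<^sup>T * H\<^sup>T" using d by (simp add: mat_transpose)
  also have "(L * P)\<^sup>T = P\<^sup>T * L\<^sup>T" using d by (simp add: mat_transpose)
  also have "P * B + H * D = 0\<^sub>m m q \<longleftrightarrow> (P * B + H * D)\<^sup>T = (0\<^sub>m m q)\<^sup>T" by (simp only: transpose_mat_eq)
  also have "(P * B + H * D)\<^sup>T = B\<^sup>T * P\<^sup>T + D\<^sup>T * H\<^sup>T" using d by (simp add: mat_transpose)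
  also have "(0\<^sub>m m q)\<^sup>T = (0\<^sub>m q m :: complex mat)" by (rule mat_transpose_zero)
  finally show ?thesis using c by simp
qed (auto simp: left_zero_solution_def)

lemma left_R_solution_iff:
  assumes P: "P \<in> carrier_mat m n"
  shows "left_R_solution C D P m r R \<alpha> \<longleftrightarrow> R_solution (C\<^sup>T) (D\<^sup>T) (P\<^sup>T) m r (R\<^sup>T) (\<alpha>\<^sup>T)"
proof (cases "R \<in> carrier_mat r p \<and> \<alpha> \<in> carrier_mat r m")
  case True
  then have d: "dim_row R = r" "dim_col R = p" "dim_row \<alpha> = r" "dim_col \<alpha> = m" by auto
  have "R * C = \<alpha> * P \<longleftrightarrow> (R * C)\<^sup>T = (\<alpha> * P)\<^sup>T" by (simp only: transpose_mat_eq)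
  moreover have "(R * C)\<^sup>T = C\<^sup>T * R\<^sup>T" "(\<alpha> * P)\<^sup>T = P\<^sup>T * \<alpha>\<^sup>T" using d P by (simp_all add: mat_transpose_mult)
  moreover have "R * D = 0\<^sub>m r q \<longleftrightarrow> (R * D)\<^sup>T = (0\<^sub>m r q)\<^sup>T" by (simp only: transpose_mat_eq)
  moreover have "(R * D)\<^sup>T = D\<^sup>T * R\<^sup>T" using d by (simp add: mat_transpose_mult)
  ultimately show ?thesis
    unfolding left_R_solution_def R_solution_def using True by (simp add: mat_transpose_zero)
qed (auto simp: left_R_solution_def R_solution_def)

text \<open>The equations are transposed termwise. Maximality of the row space of the left solution gives the range
  of the right one: a basis matrix of \<open>Vtraj\<close> of the transposed system is a competing solution.
  Observability makes the reachable subspace of the transposed system the whole space.\<close>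

lemma right_construction_of_left:
  assumes left: "left_construction A B C D k f r \<Pi>k \<Pi>f Hk Hf \<Lambda>k \<Lambda>kf \<Lambda>f \<alpha>k R0"
    and obs: "observable C A"
  shows "right_construction (A\<^sup>T) (C\<^sup>T) (B\<^sup>T) (D\<^sup>T) k f r (\<Pi>k\<^sup>T) (\<Pi>f\<^sup>T) (Hk\<^sup>T) (Hf\<^sup>T)
    (\<Lambda>k\<^sup>T) (\<Lambda>kf\<^sup>T) (\<Lambda>f\<^sup>T) (\<alpha>k\<^sup>T) (R0\<^sup>T)"
proof -
  interpret T: system "A\<^sup>T" "C\<^sup>T" "B\<^sup>T" "D\<^sup>T" n p q by (rule system_transpose)
  note l = left[unfolded left_construction_def Let_def sys_dims]
  have c: "\<Pi>k \<in> carrier_mat k n" "\<Pi>f \<in> carrier_mat f n" "Hk \<in> carrier_mat k p" "Hf \<in> carrier_mat f p"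
    "\<Lambda>k \<in> carrier_mat k k" "\<Lambda>kf \<in> carrier_mat f k" "\<Lambda>f \<in> carrier_mat f f" "\<alpha>k \<in> carrier_mat r k"
    using l by auto
  let ?P = "\<Pi>k @\<^sub>r \<Pi>f" and ?H = "Hk @\<^sub>r Hf"
    and ?L = "four_block_mat \<Lambda>k (0\<^sub>m k f) \<Lambda>kf \<Lambda>f" and ?a = "\<alpha>k @\<^sub>c 0\<^sub>m r f"
  have P: "?P \<in> carrier_mat (k + f) n" by (rule append_rows_carrier[OF c(1,2)])
  have tr: "\<Pi>k\<^sup>T @\<^sub>c \<Pi>f\<^sup>T = ?P\<^sup>T" "Hk\<^sup>T @\<^sub>c Hf\<^sup>T = ?H\<^sup>T"
    "four_block_mat (\<Lambda>k\<^sup>T) (\<Lambda>kf\<^sup>T) (0\<^sub>m f k) (\<Lambda>f\<^sup>T) = ?L\<^sup>T" "\<alpha>k\<^sup>T @\<^sub>r 0\<^sub>m f r = ?a\<^sup>T"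
    using c by (simp_all add: append_rows_transpose[of _ k n] append_rows_transpose[of _ k p]
        transpose_four_block_mat[of _ k k _ f _ f] append_cols_transpose[of _ r k _ f] mat_transpose_zero)
  have sol: "left_zero_solution A B C D (k + f) ?P ?H ?L" using l by (elim conjE)
  then have eqs: "?H \<in> carrier_mat (k + f) p" "?L \<in> carrier_mat (k + f) (k + f)"
    "A\<^sup>T * ?P\<^sup>T + C\<^sup>T * ?H\<^sup>T = ?P\<^sup>T * ?L\<^sup>T" "B\<^sup>T * ?P\<^sup>T + D\<^sup>T * ?H\<^sup>T = 0\<^sub>m q (k + f)"
    unfolding left_zero_solution_iff by auto
  have PT: "?P\<^sup>T \<in> carrier_mat n (k + f)" "?H\<^sup>T \<in> carrier_mat p (k + f)" "?L\<^sup>T \<in> carrier_mat (k + f) (k + f)"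
    using P eqs by auto
  have Rsol: "left_R_solution C D ?P (k + f) r R0 ?a" using l by (elim conjE)
  have R0c: "R0 \<in> carrier_mat r p" using Rsol by (auto simp: left_R_solution_def)
  have max: "mat_range (P'\<^sup>T) = mat_range (?P\<^sup>T)"
    if "left_zero_solution A B C D m' P' H' L'" "mat_range (?P\<^sup>T) \<subseteq> mat_range (P'\<^sup>T)" for m' P' H' L'
    using l that by blast
  have Rmax: "mat_range (R\<^sup>T) = mat_range (R0\<^sup>T)"
    if "left_R_solution C D ?P (k + f) r' R \<alpha>" "mat_range (R0\<^sup>T) \<subseteq> mat_range (R\<^sup>T)" for r' R \<alpha>
    using l that by blast
  have sub: "mat_range (?P\<^sup>T) \<subseteq> Vtraj (A\<^sup>T) (C\<^sup>T) (B\<^sup>T) (D\<^sup>T)"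
    by (rule T.Vtraj_of_matrix[OF PT eqs(3,4)])
  have range: "mat_range (?P\<^sup>T) = Vtraj (A\<^sup>T) (C\<^sup>T) (B\<^sup>T) (D\<^sup>T)"
  proof -
    obtain m M where M: "M \<in> carrier_mat n m" "mat_range M = Vtraj (A\<^sup>T) (C\<^sup>T) (B\<^sup>T) (D\<^sup>T)"
      "\<And>v. v \<in> carrier_vec m \<Longrightarrow> M *\<^sub>v v = 0\<^sub>v n \<Longrightarrow> v = 0\<^sub>v m"
      by (rule vec_subspace_basis[OF T.vec_subspace_Vtraj]) (rule that)
    have st: "\<exists>y\<in>mat_range M. T.step x y" if "x \<in> mat_range M" for x
      using T.Vtraj_step that unfolding M(2) by blast
    obtain H L where HL: "H \<in> carrier_mat p m" "L \<in> carrier_mat m m"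
      "A\<^sup>T * M + C\<^sup>T * H = M * L" "B\<^sup>T * M + D\<^sup>T * H = 0\<^sub>m q m"
      by (rule T.steps_matrix[OF M(1,1) st])
    have "left_zero_solution A B C D m (M\<^sup>T) (H\<^sup>T) (L\<^sup>T)"
      unfolding left_zero_solution_iff using HL M(1) by simp
    from max[OF this] show ?thesis using sub M(2) by simp
  qed
  have con: "controllable (A\<^sup>T) (C\<^sup>T)" using obs controllable_transpose[OF A C] by simp
  then have reach: "reachable_subspace (A\<^sup>T) (C\<^sup>T) = carrier_vec n" by (simp add: controllable_def)
  show ?thesis
    unfolding right_construction_def Let_def T.sys_dims tr
  proof (intro conjI allI impI)
    show "four_block_mat (A\<^sup>T) (C\<^sup>T) (B\<^sup>T) (D\<^sup>T) * (?P\<^sup>T @\<^sub>r ?H\<^sup>T) = ?P\<^sup>T * ?L\<^sup>T @\<^sub>r 0\<^sub>m q (k + f)"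
      unfolding four_block_mult_append_rows[OF T.A T.B T.C T.D PT(1,2)] eqs(3,4) ..
    show "mat_kernel (?P\<^sup>T) = {0\<^sub>v (k + f)}" using l by (elim conjE)
    show "mat_range (?P\<^sup>T) = Vstar (A\<^sup>T) (C\<^sup>T) (B\<^sup>T) (D\<^sup>T) \<inter> reachable_subspace (A\<^sup>T) (C\<^sup>T)"
      unfolding range reach T.Vstar_eq_Vtraj using T.Vtraj_carrier by blast
    show "R_solution (C\<^sup>T) (D\<^sup>T) (?P\<^sup>T) (k + f) r (R0\<^sup>T) (?a\<^sup>T)"
      using Rsol unfolding left_R_solution_iff[OF P] .
    show "(R0\<^sup>T)\<^sup>\<dagger> * R0\<^sup>T = 1\<^sub>m r"
    proof -
      have "R0 * R0\<^sup>\<dagger> = 1\<^sub>m r" using l by (elim conjE)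
      then have "(R0 * R0\<^sup>\<dagger>)\<^sup>T = 1\<^sub>m r" by (simp add: mat_transpose_one)
      then show ?thesis by (simp add: mat_transpose_mult adjoint_transpose)
    qed
    show "controllable (\<Lambda>k\<^sup>T) (\<alpha>k\<^sup>T)"
    proof -
      have "observable \<alpha>k \<Lambda>k" using l by (elim conjE)
      then show ?thesis using controllable_transpose[OF c(5,8)] by simp
    qed
    fix r' R \<alpha>
    assume R: "R_solution (C\<^sup>T) (D\<^sup>T) (?P\<^sup>T) (k + f) r' R \<alpha> \<and> mat_range (R0\<^sup>T) \<subseteq> mat_range R"
    then have "left_R_solution C D ?P (k + f) r' (R\<^sup>T) (\<alpha>\<^sup>T)" unfolding left_R_solution_iff[OF P] by simp
    from Rmax[OF this] R show "mat_range R = mat_range (R0\<^sup>T)" by simp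
  qed (use c in auto)
qed

end

section \<open>The factorization theorem\<close>

lemma join_subspaces_eq: "join_subspaces n U V = {x + y | x y. x \<in> U \<and> y \<in> V}"
proof -
  interpret vec_space "TYPE(complex)" n .
  show ?thesis unfolding submodule_sum_def by (auto simp: module_vec_simps)
qed

context two_sided
begin

lemma join_Cstar_comp:
  "join_subspaces n (Cstar A B C D \<inter> Vstar A B C D) (Cstar A Brl Crl Drl) = Cstar A B C D"
proof -
  have "{x + y | x y. x \<in> mat_range \<Pi>k \<and> y \<in> Cstar A Bh C D} = Cstar A B C D"
  proof (intro equalityI subsetI)
    fix z assume "z \<in> {x + y | x y. x \<in> mat_range \<Pi>k \<and> y \<in> Cstar A Bh C D}"
    then obtain w y where w: "w \<in> carrier_vec k" "y \<in> Cstar A Bh C D" "z = \<Pi>k *\<^sub>v w + y"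
      unfolding mem_mat_range[OF carriers(1)] by blast
    have "z = y + \<Pi>k *\<^sub>v w"
      unfolding w(3) using w(1,2) pert.pert.Cstar_subset by (intro comm_add_vec[of _ n]) auto
    then show "z \<in> Cstar A B C D" unfolding factor.Cstar_eq using w by blast
  next
    fix z assume "z \<in> Cstar A B C D"
    then obtain w y where w: "w \<in> carrier_vec k" "y \<in> Cstar A Bh C D" "z = y + \<Pi>k *\<^sub>v w"
      unfolding factor.Cstar_eq by blast
    have "z = \<Pi>k *\<^sub>v w + y"
      unfolding w(3) using w(1,2) pert.pert.Cstar_subset by (intro comm_add_vec[of _ n]) auto
    moreover have "\<Pi>k *\<^sub>v w \<in> mat_range \<Pi>k" using w(1) mem_mat_range[OF carriers(1)] by blast
    ultimately show "z \<in> {x + y | x y. x \<in> mat_range \<Pi>k \<and> y \<in> Cstar A Bh C D}" using w(2) by blast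
  qed
  then show ?thesis
    unfolding join_subspaces_eq Vstar_eq_Vtraj factor.Cstar_Vtraj_eq comp_spaces Cstar_rl .
qed

lemma Vstar_comp_inter_join:
  "Vstar A Brl Crl Drl \<inter> join_subspaces n (Cstar A B C D) (Vstar A B C D) = Vstar A B C D"
proof -
  have "x \<in> Vtraj A B C D" if x: "x \<in> Vtraj A Bh Ch D" "x = c + v" "c \<in> Cstar A B C D" "v \<in> Vtraj A B C D" for x c v
  proof -
    have "c \<in> carrier_vec n" "v \<in> carrier_vec n" using x Cstar_subset Vtraj_carrier by auto
    then have "\<Pi>k'\<^sup>T *\<^sub>v x = \<Pi>k'\<^sup>T *\<^sub>v c + \<Pi>k'\<^sup>T *\<^sub>v v" unfolding x(2) by (simp add: vec_distrib)
    then have "\<Pi>k'\<^sup>T *\<^sub>v x = 0\<^sub>v k'" unfolding \<Pi>k'_Cstar[OF x(3)] \<Pi>k'_Vtraj[OF x(4)] by simp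
    then show ?thesis using x(1) Vtraj_iff by blast
  qed
  moreover have "x \<in> Vtraj A Bh Ch D \<and> (\<exists>c v. x = c + v \<and> c \<in> Cstar A B C D \<and> v \<in> Vtraj A B C D)"
    if x: "x \<in> Vtraj A B C D" for x
  proof -
    have "x = 0\<^sub>v n + x" using x Vtraj_carrier by auto
    then show ?thesis using x zero_Cstar Vtraj_iff by blast
  qed
  ultimately show ?thesis
    unfolding join_subspaces_eq Vstar_eq_Vtraj comp.Vstar_eq_Vtraj comp_spaces by blast
qed

lemma Cstar_Vstar_comp:
  "Cstar A Brl Crl Drl \<inter> Vstar A Brl Crl Drl = {0\<^sub>v n}"
  "join_subspaces n (Cstar A Brl Crl Drl) (Vstar A Brl Crl Drl) = carrier_vec n"
proof -
  show "Cstar A Brl Crl Drl \<inter> Vstar A Brl Crl Drl = {0\<^sub>v n}"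
    unfolding comp.Vstar_eq_Vtraj comp_spaces by (rule Cstar_Vtraj_rl)
  have "x + y \<in> carrier_vec n" if "x \<in> Cstar A Bh Ch D" "y \<in> Vtraj A Bh Ch D" for x y
    using that rl.Cstar_subset rl.Vtraj_carrier by (intro add_carrier_vec) auto
  then show "join_subspaces n (Cstar A Brl Crl Drl) (Vstar A Brl Crl Drl) = carrier_vec n"
    unfolding join_subspaces_eq comp.Vstar_eq_Vtraj comp_spaces using Cstar_join_Vtraj_rl by blast
qed

lemma comp_W_space:
  "W_space (mat_kernel (transfer_function A Brl Crl Drl)) =
    {strictly_proper_elems (mat_kernel (transfer_function A Brl Crl Drl))}"
  "W_space (mat_range (transfer_function A Brl Crl Drl)) =
    {strictly_proper_elems (mat_range (transfer_function A Brl Crl Drl))}"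
  unfolding comp_invertible by (rule W_space_zero, rule W_space_carrier)

end

theorem theorem4p5:
  fixes n q p k f r l k' f' r' l' :: nat
    and A B C D :: "complex mat"
    and \<Pi>k \<Pi>f Hk Hf \<Lambda>k \<Lambda>kf \<Lambda>f \<alpha>k R0 \<sigma> \<beta>k L0 :: "complex mat"
    and \<Pi>k' \<Pi>f' Hk' Hf' \<Lambda>k' \<Lambda>kf' \<Lambda>f' \<alpha>k' R0' \<sigma>' \<beta>k' L0' :: "complex mat"
    and Brl Crl Drl :: "complex mat"
    and F L\<beta> L\<beta>' Fr Frl :: "complex poly fract mat"
  assumes A: "A \<in> carrier_mat n n" and B: "B \<in> carrier_mat n q"
    and C: "C \<in> carrier_mat p n" and D: "D \<in> carrier_mat p q"
    and F: "minimal_realization F A B C D"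
    and right: "right_construction A B C D k f r \<Pi>k \<Pi>f Hk Hf \<Lambda>k \<Lambda>kf \<Lambda>f \<alpha>k R0"
    and \<sigma>: "pos_def_mat k \<sigma>"
    and riccati: "\<sigma> * (\<Lambda>k - \<alpha>k * R0\<^sup>\<dagger> * Hk) + (\<Lambda>k - \<alpha>k * R0\<^sup>\<dagger> * Hk)\<^sup>\<dagger> * \<sigma>
          - \<sigma> * \<alpha>k * \<alpha>k\<^sup>\<dagger> * \<sigma> + Hk\<^sup>\<dagger> * (1\<^sub>m q - R0 * R0\<^sup>\<dagger>) * Hk = 0\<^sub>m k k"
    and \<beta>k: "\<beta>k = - (\<alpha>k\<^sup>\<dagger> * \<sigma>) - R0\<^sup>\<dagger> * Hk"
    and L0: "L0 \<in> carrier_mat q l" "unitary_mat (R0 @\<^sub>c L0)"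
    and L\<beta>: "L\<beta> = const_mat L0 - const_mat (Hk + R0 * \<beta>k) * resolvent (\<Lambda>k + \<alpha>k * \<beta>k)
          * const_mat (mat_inv \<sigma> * (Hk + R0 * \<beta>k)\<^sup>\<dagger> * L0)"
    and left: "left_construction A B C D k' f' r' \<Pi>k' \<Pi>f' Hk' Hf' \<Lambda>k' \<Lambda>kf' \<Lambda>f' \<alpha>k' R0'"
    and \<sigma>': "pos_def_mat k' \<sigma>'"
    and riccati': "(\<Lambda>k' - Hk' * R0'\<^sup>\<dagger> * \<alpha>k') * \<sigma>' + \<sigma>' * (\<Lambda>k' - Hk' * R0'\<^sup>\<dagger> * \<alpha>k')\<^sup>\<dagger>
          - \<sigma>' * \<alpha>k'\<^sup>\<dagger> * \<alpha>k' * \<sigma>' + Hk' * (1\<^sub>m p - R0'\<^sup>\<dagger> * R0') * Hk'\<^sup>\<dagger> = 0\<^sub>m k' k'"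
    and \<beta>k': "\<beta>k' = - (\<sigma>' * \<alpha>k'\<^sup>\<dagger>) - Hk' * R0'\<^sup>\<dagger>"
    and L0': "L0' \<in> carrier_mat l' p" "unitary_mat (R0' @\<^sub>r L0')"
    and L\<beta>': "L\<beta>' = const_mat L0' - const_mat (L0' * (Hk' + \<beta>k' * R0')\<^sup>\<dagger> * mat_inv \<sigma>')
          * resolvent (\<Lambda>k' + \<beta>k' * \<alpha>k') * const_mat (Hk' + \<beta>k' * R0')"
    and Fr: "Fr = F * L\<beta>"
    and Frl: "Frl = L\<beta>' * F * L\<beta>"
    and Brl: "Brl = (B + \<Pi>k * mat_inv \<sigma> * Hk\<^sup>\<dagger>) * L0"
    and Crl: "Crl = L0' * (C + Hk'\<^sup>\<dagger> * mat_inv \<sigma>' * \<Pi>k')"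
    and Drl: "Drl = L0' * D * L0"
  shows
    "(F = para_adjoint L\<beta>' * Frl * para_adjoint L\<beta> \<and> realization Frl A Brl Crl Drl) \<and>
    ((\<forall>\<mu>. eigenvalue A \<mu> \<longrightarrow> Re \<mu> \<le> 0) \<or>
     ((\<nexists>\<mu>. eigenvalue A \<mu> \<and> eigenvalue (- A\<^sup>\<dagger>) \<mu>) \<and>
      (\<exists>P \<in> carrier_mat n n. \<exists>Q \<in> carrier_mat n n.
         A * P + P * A\<^sup>\<dagger> + B * B\<^sup>\<dagger> = 0\<^sub>m n n \<and>
         Q * A + A\<^sup>\<dagger> * Q + C\<^sup>\<dagger> * C = 0\<^sub>m n n \<and>
         stabilizable A ((C * P + D * B\<^sup>\<dagger>)\<^sup>\<dagger>) \<and>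
         detectable ((Q * B + C\<^sup>\<dagger> * D)\<^sup>\<dagger>) A))
     \<longrightarrow> minimal_realization Frl A Brl Crl Drl) \<and>
    (minimal_realization Frl A Brl Crl Drl \<longrightarrow>
     Cstar A Brl Crl Drl \<inter> Vstar A Brl Crl Drl = {0\<^sub>v n} \<and>
     join_subspaces n (Cstar A Brl Crl Drl) (Vstar A Brl Crl Drl) = carrier_vec n \<and>
     realization Fr A Brl C (D * L0) \<and>
     Cstar A Brl Crl Drl = Cstar A Brl C (D * L0) \<and>
     join_subspaces n (Cstar A B C D \<inter> Vstar A B C D) (Cstar A Brl Crl Drl) = Cstar A B C D \<and>
     Vstar A Brl Crl Drl \<inter> join_subspaces n (Cstar A B C D) (Vstar A B C D) = Vstar A B C D \<and>
     W_space (mat_kernel Frl) = {strictly_proper_elems (mat_kernel Frl)} \<and>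
     W_space (mat_range Frl) = {strictly_proper_elems (mat_range Frl)} \<and>
     invertible_mat Frl) \<and>
    (minimal_realization Frl A Brl Crl Drl \<longrightarrow>
     (\<exists>Zk' \<in> carrier_mat q k'. \<exists>\<Delta> \<in> carrier_mat f k'.
       finite_zero_matrix A Brl Crl Drl
         (four_block_mat
            (- (mat_inv \<sigma> * (\<Lambda>k + \<alpha>k * \<beta>k)\<^sup>\<dagger> * \<sigma>))
            ((\<Lambda>kf + mat_inv \<sigma> * (Hk + R0 * \<beta>k)\<^sup>\<dagger> * Hf) @\<^sub>c
             (mat_inv \<sigma> * (Hk + R0 * \<beta>k)\<^sup>\<dagger> * Zk'))
            (0\<^sub>m (f + k') k)
            (four_block_mat \<Lambda>f \<Delta> (0\<^sub>m k' f) (- (\<Lambda>k' + \<beta>k' * \<alpha>k')\<^sup>\<dagger>)))))"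
proof -
  have con: "controllable A B" by (rule minimal_realization_controllable[OF A B C D F])
  have obs: "observable C A" by (rule minimal_realization_observable[OF A B C D F])
  interpret \<Sigma>: system A B C D n q p by unfold_locales (rule A B C D)+
  interpret \<Sigma>T: system "A\<^sup>T" "C\<^sup>T" "B\<^sup>T" "D\<^sup>T" n p q by (rule \<Sigma>.system_transpose)
  note l = left[unfolded left_construction_def Let_def \<Sigma>.sys_dims left_R_solution_def]
  have c: "\<Pi>k' \<in> carrier_mat k' n" "Hk' \<in> carrier_mat k' p" "\<Lambda>k' \<in> carrier_mat k' k'" "\<alpha>k' \<in> carrier_mat r' k'"
    "R0' \<in> carrier_mat r' p" "\<sigma>' \<in> carrier_mat k' k'"
    using l \<sigma>' by (auto simp: pos_def_mat_def)
  note d = carrier_matD[OF c(1)] carrier_matD[OF c(2)] carrier_matD[OF c(3)] carrier_matD[OF c(4)]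
    carrier_matD[OF c(5)] carrier_matD[OF c(6)] carrier_matD[OF L0'(1)]
  have \<beta>d: "dim_row \<beta>k' = k'" "dim_col \<beta>k' = r'" using d by (auto simp: \<beta>k')
  interpret L: right_data "A\<^sup>T" "C\<^sup>T" "B\<^sup>T" "D\<^sup>T" n p q k' f' r' l' "\<Pi>k'\<^sup>T" "\<Pi>f'\<^sup>T" "Hk'\<^sup>T" "Hf'\<^sup>T"
      "\<Lambda>k'\<^sup>T" "\<Lambda>kf'\<^sup>T" "\<Lambda>f'\<^sup>T" "\<alpha>k'\<^sup>T" "R0'\<^sup>T" "\<sigma>'\<^sup>T" "\<beta>k'\<^sup>T" "L0'\<^sup>T"
  proof
    show "right_construction (A\<^sup>T) (C\<^sup>T) (B\<^sup>T) (D\<^sup>T) k' f' r' (\<Pi>k'\<^sup>T) (\<Pi>f'\<^sup>T) (Hk'\<^sup>T) (Hf'\<^sup>T)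
      (\<Lambda>k'\<^sup>T) (\<Lambda>kf'\<^sup>T) (\<Lambda>f'\<^sup>T) (\<alpha>k'\<^sup>T) (R0'\<^sup>T)"
      by (rule \<Sigma>.right_construction_of_left[OF left obs])
    show "controllable (A\<^sup>T) (C\<^sup>T)" using obs controllable_transpose[OF A C] by simp
    show "observable (B\<^sup>T) (A\<^sup>T)" using con observable_transpose[OF A B] by simp
    show "pos_def_mat k' (\<sigma>'\<^sup>T)" by (rule pos_def_mat_transpose[OF \<sigma>'])
    have "((\<Lambda>k' - Hk' * R0'\<^sup>\<dagger> * \<alpha>k') * \<sigma>' + \<sigma>' * (\<Lambda>k' - Hk' * R0'\<^sup>\<dagger> * \<alpha>k')\<^sup>\<dagger>
        - \<sigma>' * \<alpha>k'\<^sup>\<dagger> * \<alpha>k' * \<sigma>' + Hk' * (1\<^sub>m p - R0'\<^sup>\<dagger> * R0') * Hk'\<^sup>\<dagger>)\<^sup>T = (0\<^sub>m k' k')\<^sup>T"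
      by (simp only: riccati')
    moreover have "((\<Lambda>k' - Hk' * R0'\<^sup>\<dagger> * \<alpha>k') * \<sigma>' + \<sigma>' * (\<Lambda>k' - Hk' * R0'\<^sup>\<dagger> * \<alpha>k')\<^sup>\<dagger>
        - \<sigma>' * \<alpha>k'\<^sup>\<dagger> * \<alpha>k' * \<sigma>' + Hk' * (1\<^sub>m p - R0'\<^sup>\<dagger> * R0') * Hk'\<^sup>\<dagger>)\<^sup>T =
        \<sigma>'\<^sup>T * (\<Lambda>k'\<^sup>T - \<alpha>k'\<^sup>T * (R0'\<^sup>T)\<^sup>\<dagger> * Hk'\<^sup>T) + (\<Lambda>k'\<^sup>T - \<alpha>k'\<^sup>T * (R0'\<^sup>T)\<^sup>\<dagger> * Hk'\<^sup>T)\<^sup>\<dagger> * \<sigma>'\<^sup>T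
        - \<sigma>'\<^sup>T * \<alpha>k'\<^sup>T * (\<alpha>k'\<^sup>T)\<^sup>\<dagger> * \<sigma>'\<^sup>T + (Hk'\<^sup>T)\<^sup>\<dagger> * (1\<^sub>m p - R0'\<^sup>T * (R0'\<^sup>T)\<^sup>\<dagger>) * Hk'\<^sup>T"
    proof -
      have "(\<Lambda>k'\<^sup>T - \<alpha>k'\<^sup>T * (R0'\<^sup>T)\<^sup>\<dagger> * Hk'\<^sup>T) = (\<Lambda>k' - Hk' * R0'\<^sup>\<dagger> * \<alpha>k')\<^sup>T"
        "(1\<^sub>m p - R0'\<^sup>T * (R0'\<^sup>T)\<^sup>\<dagger>) = (1\<^sub>m p - R0'\<^sup>\<dagger> * R0')\<^sup>T"
        using d by (simp_all add: mat_transpose adjoint_transpose mat_mult_assoc)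
      then show ?thesis
        using d by (simp add: mat_transpose adjoint_transpose mat_mult_assoc del: mat_transpose_minus
            add: mat_transpose_minus[of "_ + _"])
    qed
    ultimately show "\<sigma>'\<^sup>T * (\<Lambda>k'\<^sup>T - \<alpha>k'\<^sup>T * (R0'\<^sup>T)\<^sup>\<dagger> * Hk'\<^sup>T) + (\<Lambda>k'\<^sup>T - \<alpha>k'\<^sup>T * (R0'\<^sup>T)\<^sup>\<dagger> * Hk'\<^sup>T)\<^sup>\<dagger> * \<sigma>'\<^sup>T
        - \<sigma>'\<^sup>T * \<alpha>k'\<^sup>T * (\<alpha>k'\<^sup>T)\<^sup>\<dagger> * \<sigma>'\<^sup>T + (Hk'\<^sup>T)\<^sup>\<dagger> * (1\<^sub>m p - R0'\<^sup>T * (R0'\<^sup>T)\<^sup>\<dagger>) * Hk'\<^sup>T = 0\<^sub>m k' k'"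
      by (simp only: mat_transpose_zero)
    show "\<beta>k'\<^sup>T = - ((\<alpha>k'\<^sup>T)\<^sup>\<dagger> * \<sigma>'\<^sup>T) - (R0'\<^sup>T)\<^sup>\<dagger> * Hk'\<^sup>T"
      unfolding \<beta>k' using d by (simp add: mat_transpose adjoint_transpose)
    show "L0'\<^sup>T \<in> carrier_mat p l'" using L0' by simp
    show "unitary_mat (R0'\<^sup>T @\<^sub>c L0'\<^sup>T)"
      using unitary_mat_transpose[OF L0'(2)] append_rows_transpose[OF c(5) L0'(1)] by simp
  qed
  interpret T: two_sided A B C D n q p k f r l \<Pi>k \<Pi>f Hk Hf \<Lambda>k \<Lambda>kf \<Lambda>f \<alpha>k R0 \<sigma> \<beta>k L0
      k' f' r' l' "\<Pi>k'\<^sup>T" "\<Pi>f'\<^sup>T" "Hk'\<^sup>T" "Hf'\<^sup>T" "\<Lambda>k'\<^sup>T" "\<Lambda>kf'\<^sup>T" "\<Lambda>f'\<^sup>T" "\<alpha>k'\<^sup>T" "R0'\<^sup>T" "\<sigma>'\<^sup>T" "\<beta>k'\<^sup>T" "L0'\<^sup>T"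
    by unfold_locales (rule right con obs \<sigma> riccati \<beta>k L0)+
  have ST: "L.S\<^sup>T = mat_inv \<sigma>'"
    using mat_inv_transpose[OF L.\<sigma>_carrier L.S L.\<sigma>S] by simp
  have Sd: "dim_row (mat_inv \<sigma>') = k'" "dim_col (mat_inv \<sigma>') = k'"
    unfolding ST[symmetric] by simp_all
  have Ftf: "F = T.F" using F by (auto simp: minimal_realization_def realization_def)
  have L\<beta>_eq: "L\<beta> = T.Lbeta" unfolding L\<beta> T.Lbeta_eq ..
  have HT: "Hk'\<^sup>T + R0'\<^sup>T * \<beta>k'\<^sup>T = (Hk' + \<beta>k' * R0')\<^sup>T" "\<Lambda>k'\<^sup>T + \<alpha>k'\<^sup>T * \<beta>k'\<^sup>T = (\<Lambda>k' + \<beta>k' * \<alpha>k')\<^sup>T"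
    using d \<beta>d by (simp_all add: mat_transpose)
  have L\<beta>'_eq: "L\<beta>' = L.Lbeta\<^sup>T"
  proof -
    define H where "H = Hk' + \<beta>k' * R0'"
    define M where "M = \<Lambda>k' + \<beta>k' * \<alpha>k'"
    have H: "dim_row H = k'" "dim_col H = p" and M: "M \<in> carrier_mat k' k'"
      using d \<beta>d by (auto simp: H_def M_def)
    have S: "mat_inv (\<sigma>'\<^sup>T) = (mat_inv \<sigma>')\<^sup>T" unfolding ST[symmetric] transpose_transpose L.S_def ..
    define K where "K = L0' * H\<^sup>\<dagger> * mat_inv \<sigma>'"
    have "L.Lbeta = const_mat (L0'\<^sup>T) - const_mat (H\<^sup>T) * resolvent (M\<^sup>T)
        * const_mat ((mat_inv \<sigma>')\<^sup>T * (H\<^sup>T)\<^sup>\<dagger> * L0'\<^sup>T)"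
      unfolding L.Lbeta_eq HT S H_def M_def ..
    also have "(mat_inv \<sigma>')\<^sup>T * (H\<^sup>T)\<^sup>\<dagger> * L0'\<^sup>T = K\<^sup>T"
      unfolding K_def using H d Sd by (simp add: mat_transpose_mult adjoint_transpose mat_mult_assoc)
    finally have eq: "L.Lbeta = const_mat (L0'\<^sup>T) - const_mat (H\<^sup>T) * resolvent (M\<^sup>T) * const_mat (K\<^sup>T)" .
    have "dim_row K = l'" "dim_col K = k'" using d Sd by (auto simp: K_def)
    then show ?thesis
      unfolding L\<beta>' eq H_def[symmetric] M_def[symmetric] K_def[symmetric]
      using H d M resolvent_dims[of M]
      by (simp add: const_mat_transpose resolvent_transpose[OF M] mat_transpose mat_mult_assoc)
  qed
  have Brl_eq: "Brl = T.Brl" unfolding Brl T.Bp_L0 T.S_def ..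
  have Crl_eq: "Crl = T.Crl"
  proof -
    have "T.Crl = (L.pert.Bp * L0'\<^sup>T)\<^sup>T" using d by (simp add: mat_transpose_mult)
    also have "\<dots> = ((C\<^sup>T + \<Pi>k'\<^sup>T * L.S * (Hk'\<^sup>T)\<^sup>\<dagger>) * L0'\<^sup>T)\<^sup>T" unfolding L.Bp_L0 ..
    also have "\<dots> = L0' * (C + Hk'\<^sup>\<dagger> * L.S\<^sup>T * \<Pi>k')"
      using d by (simp add: mat_transpose adjoint_transpose mat_mult_assoc)
    finally show ?thesis unfolding Crl ST by simp
  qed
  have Drl_eq: "Drl = T.Drl" unfolding Drl by simp
  have Frl_eq: "Frl = transfer_function A T.Brl T.Crl T.Drl"
    unfolding Frl L\<beta>'_eq Ftf L\<beta>_eq by (rule T.realization_comp)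
  have part1: "F = para_adjoint L\<beta>' * Frl * para_adjoint L\<beta> \<and> realization Frl A Brl Crl Drl"
  proof
    show "F = para_adjoint L\<beta>' * Frl * para_adjoint L\<beta>"
      unfolding Frl L\<beta>'_eq Ftf L\<beta>_eq by (rule T.recover)
    show "realization Frl A Brl Crl Drl"
      unfolding Frl_eq Brl_eq Crl_eq Drl_eq realization_def using T.comp.A T.comp.B T.comp.C T.comp.D by blast
  qed
  have part2: "minimal_realization Frl A Brl Crl Drl"
    if "(\<forall>\<mu>. eigenvalue A \<mu> \<longrightarrow> Re \<mu> \<le> 0) \<or>
     ((\<nexists>\<mu>. eigenvalue A \<mu> \<and> eigenvalue (- A\<^sup>\<dagger>) \<mu>) \<and>
      (\<exists>P \<in> carrier_mat n n. \<exists>Q \<in> carrier_mat n n.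
         A * P + P * A\<^sup>\<dagger> + B * B\<^sup>\<dagger> = 0\<^sub>m n n \<and>
         Q * A + A\<^sup>\<dagger> * Q + C\<^sup>\<dagger> * C = 0\<^sub>m n n \<and>
         stabilizable A ((C * P + D * B\<^sup>\<dagger>)\<^sup>\<dagger>) \<and>
         detectable ((Q * B + C\<^sup>\<dagger> * D)\<^sup>\<dagger>) A))"
  proof -
    have "controllable A T.Brl \<and> observable T.Crl A"
      using that
    proof (elim disjE conjE bexE)
      assume "\<forall>\<mu>. eigenvalue A \<mu> \<longrightarrow> Re \<mu> \<le> 0"
      then have *: "\<And>\<mu>. eigenvalue A \<mu> \<Longrightarrow> Re \<mu> \<le> 0" by blast
      show ?thesis by (intro conjI T.minimal_comp_of_stable[OF *])
    next
      fix P Q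
      assume "\<nexists>\<mu>. eigenvalue A \<mu> \<and> eigenvalue (- A\<^sup>\<dagger>) \<mu>"
      then have *: "\<And>\<mu>. eigenvalue A \<mu> \<Longrightarrow> \<not> eigenvalue (- A\<^sup>\<dagger>) \<mu>" by blast
      assume PQ: "P \<in> carrier_mat n n" "Q \<in> carrier_mat n n"
        "A * P + P * A\<^sup>\<dagger> + B * B\<^sup>\<dagger> = 0\<^sub>m n n" "Q * A + A\<^sup>\<dagger> * Q + C\<^sup>\<dagger> * C = 0\<^sub>m n n"
        "stabilizable A ((C * P + D * B\<^sup>\<dagger>)\<^sup>\<dagger>)" "detectable ((Q * B + C\<^sup>\<dagger> * D)\<^sup>\<dagger>) A"
      show ?thesis
        by (intro conjI T.minimal_comp_of_stabilizable[OF * PQ(1,3,2,4,5,6)])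
    qed
    then show ?thesis
      unfolding Brl_eq Crl_eq Drl_eq
      using minimal_realizationI[OF T.comp.A T.comp.B T.comp.C T.comp.D Frl_eq] by blast
  qed
  have part3: "Cstar A Brl Crl Drl \<inter> Vstar A Brl Crl Drl = {0\<^sub>v n} \<and>
     join_subspaces n (Cstar A Brl Crl Drl) (Vstar A Brl Crl Drl) = carrier_vec n \<and>
     realization Fr A Brl C (D * L0) \<and>
     Cstar A Brl Crl Drl = Cstar A Brl C (D * L0) \<and>
     join_subspaces n (Cstar A B C D \<inter> Vstar A B C D) (Cstar A Brl Crl Drl) = Cstar A B C D \<and>
     Vstar A Brl Crl Drl \<inter> join_subspaces n (Cstar A B C D) (Vstar A B C D) = Vstar A B C D \<and>
     W_space (mat_kernel Frl) = {strictly_proper_elems (mat_kernel Frl)} \<and>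
     W_space (mat_range Frl) = {strictly_proper_elems (mat_range Frl)} \<and>
     invertible_mat Frl"
    unfolding Brl_eq Crl_eq Drl_eq Frl_eq
  proof (intro conjI)
    show "realization Fr A T.Brl C (D * L0)"
      unfolding Fr Ftf L\<beta>_eq T.transfer_Lbeta realization_def
      using A T.comp.B C mult_carrier_mat[OF D L0(1)] by blast
    show "Cstar A T.Brl T.Crl T.Drl = Cstar A T.Brl C (D * L0)"
      unfolding T.comp_spaces T.right_spaces by (rule T.Cstar_rl)
  qed (rule T.Cstar_Vstar_comp T.join_Cstar_comp T.Vstar_comp_inter_join T.comp_W_space T.comp_invertible)+
  have part4: "\<exists>Zk' \<in> carrier_mat q k'. \<exists>\<Delta> \<in> carrier_mat f k'.
       finite_zero_matrix A Brl Crl Drl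
         (four_block_mat
            (- (mat_inv \<sigma> * (\<Lambda>k + \<alpha>k * \<beta>k)\<^sup>\<dagger> * \<sigma>))
            ((\<Lambda>kf + mat_inv \<sigma> * (Hk + R0 * \<beta>k)\<^sup>\<dagger> * Hf) @\<^sub>c
             (mat_inv \<sigma> * (Hk + R0 * \<beta>k)\<^sup>\<dagger> * Zk'))
            (0\<^sub>m (f + k') k)
            (four_block_mat \<Lambda>f \<Delta> (0\<^sub>m k' f) (- (\<Lambda>k' + \<beta>k' * \<alpha>k')\<^sup>\<dagger>)))"
    if min: "minimal_realization Frl A Brl Crl Drl"
  proof -
    have m: "minimal_realization Frl A T.Brl T.Crl T.Drl" using min unfolding Brl_eq Crl_eq Drl_eq .
    have con': "controllable A T.Brl"
      by (rule minimal_realization_controllable[OF T.comp.A T.comp.B T.comp.C T.comp.D m])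
    have obs': "observable T.Crl A"
      by (rule minimal_realization_observable[OF T.comp.A T.comp.B T.comp.C T.comp.D m])
    have "(L.Lb\<^sup>\<dagger>)\<^sup>T = (\<Lambda>k' + \<beta>k' * \<alpha>k')\<^sup>\<dagger>"
      unfolding L.Lb_def HT by (simp add: adjoint_transpose)
    from T.finite_zero_matrix_comp[OF con' obs', unfolded this]
    show ?thesis unfolding Brl_eq Crl_eq Drl_eq T.S_def T.Lb_def T.G_def T.Hb_def .
  qed
  show ?thesis
    by (rule conjI[OF part1], rule conjI, rule impI, erule part2, rule conjI, rule impI, rule part3,
        rule impI, erule part4)
qed

end
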